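(* Let $m\geq 3$ be an integer and let $q(4m)$ be the number of isomorphism classes of braces $(B,+,\circ)$ whose multiplicative group $(B,\circ)$ is isomorphic to $Q_{4m}$. Then $$q(4m)=\begin{cases} 2 & \text{if } m \text{ is odd;}\\ 6 & \text{if } m\equiv 2 \pmod 4;\\ 9 & \text{if } m\equiv 4\pmod 8;\\ 7 & \text{if } m\equiv 0 \pmod 8.\end{cases}$$
   Context: A (left) brace $(B,+,\circ)$ is a set $B$ with two binary operations such that $(B,+)$ is an abelian group (the additive group), $(B,\circ)$ is a group (the multiplicative group), and $a\circ(b+c)=a\circ b-a+a\circ c$ for all $a,b,c\in B$. An isomorphism of braces is a bijection respecting both operations. $Q_{4m}=\langle x,y : x^{2m}=1,\ yx=x^{-1}y,\ y^2=x^{m}\rangle$ is the generalised quaternion group of order $4m$. *)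

theory Defs
  imports "HOL-Algebra.Ring" "HOL-Library.Countable_Set"
begin

section \<open>Braces\<close>

text \<open>
  A brace is carried by the \<open>ring\<close> record of HOL-Algebra: \<open>\<oplus>\<close> is the addition, and \<open>\<otimes>\<close> is the circle
  operation of the brace. The structure is not a ring: the two operations have the same neutral
  element, and distributivity is replaced by the brace law.
\<close>

locale brace = abelian_group B + group B for B (structure) +
  assumes brace_law:
    "\<lbrakk>a \<in> carrier B; b \<in> carrier B; c \<in> carrier B\<rbrakk>
      \<Longrightarrow> a \<otimes> (b \<oplus> c) = (a \<otimes> b \<ominus> a) \<oplus> a \<otimes> c"

definition brace_iso :: "('a, 'c) ring_scheme \<Rightarrow> ('b, 'd) ring_scheme \<Rightarrow> ('a \<Rightarrow> 'b) set" where
  "brace_iso B C = iso B C \<inter> iso (add_monoid B) (add_monoid C)"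

definition brace_isomorphic :: "('a, 'c) ring_scheme \<Rightarrow> ('b, 'd) ring_scheme \<Rightarrow> bool" where
  "brace_isomorphic B C \<longleftrightarrow> brace_iso B C \<noteq> {}"

text \<open>
  Isomorphism classes are counted among braces with carrier a set of natural numbers. For a
  countable group \<open>G\<close> this loses nothing, see \<open>brace_isomorphic_nat\<close> below.
\<close>

definition braces_over :: "('g, 'c) monoid_scheme \<Rightarrow> nat ring set" where
  "braces_over G = {B. brace B \<and> B \<cong> G}"

definition brace_iso_rel :: "('g, 'c) monoid_scheme \<Rightarrow> (nat ring \<times> nat ring) set" where
  "brace_iso_rel G = {(B, C). B \<in> braces_over G \<and> C \<in> braces_over G \<and> brace_isomorphic B C}"

definition num_braces :: "('g, 'c) monoid_scheme \<Rightarrow> nat" where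
  "num_braces G = card (braces_over G // brace_iso_rel G)"

lemma brace_iso_inv_into:
  assumes "brace B" "h \<in> brace_iso B C"
  shows "inv_into (carrier B) h \<in> brace_iso C B"
proof -
  interpret brace B by fact
  have "inv_into (carrier B) h \<in> iso C B"
    using assms(2) iso_set_sym by (auto simp: brace_iso_def)
  moreover have "inv_into (carrier B) h \<in> iso (add_monoid C) (add_monoid B)"
    using assms(2) add.iso_set_sym[of h "add_monoid C"] by (auto simp: brace_iso_def)
  ultimately show ?thesis by (simp add: brace_iso_def)
qed

lemma brace_isomorphic_refl: "brace_isomorphic B B"
  unfolding brace_isomorphic_def brace_iso_def
  using iso_set_refl[of B] iso_set_refl[of "add_monoid B"] by blast

lemma brace_isomorphic_sym: "brace B \<Longrightarrow> brace_isomorphic B C \<Longrightarrow> brace_isomorphic C B"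
  unfolding brace_isomorphic_def using brace_iso_inv_into by blast

lemma brace_isomorphic_trans:
  assumes "brace_isomorphic B C" "brace_isomorphic C D"
  shows "brace_isomorphic B D"
proof -
  obtain h k where "h \<in> brace_iso B C" "k \<in> brace_iso C D"
    using assms by (auto simp: brace_isomorphic_def)
  then have "k \<circ> h \<in> brace_iso B D"
    using iso_set_trans[of h B C k D]
      iso_set_trans[of h "add_monoid B" "add_monoid C" k "add_monoid D"]
    by (simp add: brace_iso_def)
  then show ?thesis by (auto simp: brace_isomorphic_def)
qed

lemma equiv_brace_iso_rel: "equiv (braces_over G) (brace_iso_rel G)"
proof (rule equivI)
  show "brace_iso_rel G \<subseteq> braces_over G \<times> braces_over G"
    by (auto simp: brace_iso_rel_def)
  show "refl_on (braces_over G) (brace_iso_rel G)"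
    by (auto simp: refl_on_def brace_iso_rel_def brace_isomorphic_refl)
  show "sym (brace_iso_rel G)"
    using brace_isomorphic_sym by (fastforce simp: sym_def brace_iso_rel_def braces_over_def)
  show "trans (brace_iso_rel G)"
    using brace_isomorphic_trans by (fastforce simp: trans_def brace_iso_rel_def)
qed

lemma brace_isomorphic_nat:
  fixes B :: "('a, 'c) ring_scheme" (structure)
  assumes "brace B" "B \<cong> G" "countable (carrier B)"
  shows "\<exists>C \<in> braces_over G. brace_isomorphic B C"
proof -
  interpret brace B by fact
  obtain f :: "'a \<Rightarrow> nat" where f: "inj_on f (carrier B)"
    using assms(3) by (auto simp: countable_def)
  define g where "g = inv_into (carrier B) f"
  have gf: "g (f a) = a" if "a \<in> carrier B" for a
    using that f by (simp add: g_def)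
  define C :: "nat ring" where
    "C = \<lparr>carrier = f ` carrier B, mult = \<lambda>u v. f (g u \<otimes> g v), one = f \<one>,
          zero = f \<zero>, add = \<lambda>u v. f (g u \<oplus> g v)\<rparr>"
  have car: "carrier C = f ` carrier B" by (simp add: C_def)
  have mult: "f a \<otimes>\<^bsub>C\<^esub> f b = f (a \<otimes> b)" if "a \<in> carrier B" "b \<in> carrier B" for a b
    using that by (simp add: C_def gf)
  have add: "f a \<oplus>\<^bsub>C\<^esub> f b = f (a \<oplus> b)" if "a \<in> carrier B" "b \<in> carrier B" for a b
    using that by (simp add: C_def gf)
  have one: "\<one>\<^bsub>C\<^esub> = f \<one>" and zero: "\<zero>\<^bsub>C\<^esub> = f \<zero>" by (simp_all add: C_def)
  have agC: "abelian_group C"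
  proof (rule abelian_groupI, unfold car zero, goal_cases)
    case (6 x)
    then obtain a where a: "x = f a" "a \<in> carrier B" by auto
    show ?case
      by (rule bexI[of _ "f (\<ominus> a)"]) (use a in \<open>auto simp: add l_neg\<close>)
  qed (auto simp: add a_ac)
  have gC: "group C"
  proof (rule groupI, unfold car one, goal_cases)
    case (5 x)
    then obtain a where a: "x = f a" "a \<in> carrier B" by auto
    show ?case
      by (rule bexI[of _ "f (inv a)"]) (use a in \<open>auto simp: mult\<close>)
  qed (auto simp: mult m_assoc)
  have minus: "f a \<ominus>\<^bsub>C\<^esub> f b = f (a \<ominus> b)" if "a \<in> carrier B" "b \<in> carrier B" for a b
  proof -
    have "\<ominus>\<^bsub>C\<^esub> f b = f (\<ominus> b)"
      using that
      by (intro abelian_group.minus_equality[OF agC]) (auto simp: add car zero l_neg)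
    then show ?thesis using that by (simp add: a_minus_def add)
  qed
  have "brace C"
    by (intro brace.intro agC gC brace_axioms.intro)
       (auto simp: car add mult minus brace_law)
  moreover have iso: "f \<in> brace_iso B C"
    using f by (auto simp: brace_iso_def iso_def hom_def bij_betw_def car mult add)
  moreover have "C \<cong> G"
  proof -
    have "C \<cong> B"
      using iso iso_sym by (auto simp: brace_iso_def is_iso_def)
    then show ?thesis using assms(2) by (rule iso_trans)
  qed
  ultimately show ?thesis
    by (auto simp: braces_over_def brace_isomorphic_def)
qed


section \<open>Groups given by generators and relations\<close>

datatype 'g letter = Gen 'g | Inv 'g

fun inv_letter :: "'g letter \<Rightarrow> 'g letter" where
  "inv_letter (Gen g) = Inv g"
| "inv_letter (Inv g) = Gen g"

text \<open>
  \<open>word_eq R u v\<close>: the words \<open>u\<close> and \<open>v\<close> represent the same element of the group generated by the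
  type \<open>'g\<close> subject to the relations \<open>r = s\<close> for \<open>(r, s) \<in> R\<close>.
\<close>

inductive word_eq :: "('g letter list \<times> 'g letter list) set \<Rightarrow> 'g letter list \<Rightarrow> 'g letter list \<Rightarrow> bool"
  for R where
  word_rel: "(r, s) \<in> R \<Longrightarrow> word_eq R r s"
| word_cancel: "word_eq R [l, inv_letter l] []"
| word_refl: "word_eq R u u"
| word_sym: "word_eq R u v \<Longrightarrow> word_eq R v u"
| word_trans: "word_eq R u v \<Longrightarrow> word_eq R v w \<Longrightarrow> word_eq R u w"
| word_append: "word_eq R u u' \<Longrightarrow> word_eq R v v' \<Longrightarrow> word_eq R (u @ v) (u' @ v')"

definition word_class ::
  "('g letter list \<times> 'g letter list) set \<Rightarrow> 'g letter list \<Rightarrow> 'g letter list set" where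
  "word_class R u = {v. word_eq R u v}"

definition presented_group ::
  "('g letter list \<times> 'g letter list) set \<Rightarrow> 'g letter list set monoid" where
  "presented_group R =
    \<lparr>carrier = range (word_class R),
     mult = \<lambda>U V. \<Union>u\<in>U. \<Union>v\<in>V. word_class R (u @ v),
     one = word_class R []\<rparr>"

lemma word_class_eq_iff: "word_class R u = word_class R v \<longleftrightarrow> word_eq R u v"
  unfolding word_class_def set_eq_iff mem_Collect_eq
  by (meson word_refl word_sym word_trans)

lemma mult_presented_group:
  "word_class R u \<otimes>\<^bsub>presented_group R\<^esub> word_class R v = word_class R (u @ v)"
proof -
  have "word_class R (u' @ v') = word_class R (u @ v)"
    if "u' \<in> word_class R u" "v' \<in> word_class R v" for u' v'
    using that word_sym[OF word_append] unfolding word_class_eq_iff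
    by (simp add: word_class_def)
  then have "(\<Union>u'\<in>word_class R u. \<Union>v'\<in>word_class R v. word_class R (u' @ v')) =
      (\<Union>u'\<in>word_class R u. \<Union>v'\<in>word_class R v. word_class R (u @ v))"
    by simp
  moreover have "word_class R u \<noteq> {}" "word_class R v \<noteq> {}"
    using word_refl by (force simp: word_class_def)+
  ultimately show ?thesis
    by (simp add: presented_group_def)
qed

lemma group_presented_group: "group (presented_group R)"
proof (rule groupI)
  have car: "carrier (presented_group R) = range (word_class R)"
    and one: "\<one>\<^bsub>presented_group R\<^esub> = word_class R []"
    by (simp_all add: presented_group_def)
  have inv: "word_eq R (rev (map inv_letter u) @ u) []" for u
  proof (induction u)
    case (Cons l u)
    have "word_eq R [inv_letter l, l] []"
      using word_cancel[of R "inv_letter l"] by (cases l) auto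
    then have "word_eq R ((rev (map inv_letter u) @ [inv_letter l, l]) @ u)
        ((rev (map inv_letter u) @ []) @ u)"
      by (intro word_append word_refl)
    then show ?case using word_trans[OF _ Cons] by simp
  qed (simp add: word_refl)
  show "\<one>\<^bsub>presented_group R\<^esub> \<in> carrier (presented_group R)"
    by (simp add: car one)
  fix x y z
  assume x: "x \<in> carrier (presented_group R)"
  then show "\<one>\<^bsub>presented_group R\<^esub> \<otimes>\<^bsub>presented_group R\<^esub> x = x"
    by (auto simp: car one mult_presented_group)
  show "\<exists>y\<in>carrier (presented_group R). y \<otimes>\<^bsub>presented_group R\<^esub> x = \<one>\<^bsub>presented_group R\<^esub>"
  proof -
    obtain u where u: "x = word_class R u" using x by (auto simp: car)
    show ?thesis
      by (rule bexI[of _ "word_class R (rev (map inv_letter u))"])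
         (auto simp: u car one mult_presented_group word_class_eq_iff inv)
  qed
  assume "y \<in> carrier (presented_group R)"
  with x show "x \<otimes>\<^bsub>presented_group R\<^esub> y \<in> carrier (presented_group R)"
    by (auto simp: car mult_presented_group)
  assume "z \<in> carrier (presented_group R)"
  with x \<open>y \<in> _\<close> show "x \<otimes>\<^bsub>presented_group R\<^esub> y \<otimes>\<^bsub>presented_group R\<^esub> z =
      x \<otimes>\<^bsub>presented_group R\<^esub> (y \<otimes>\<^bsub>presented_group R\<^esub> z)"
    by (auto simp: car mult_presented_group)
qed


section \<open>Generalised quaternion groups\<close>

datatype quaternion_gen = qx | qy

text \<open>\<open>gen_quaternion m\<close> is the group \<open>Q\<^sub>4\<^sub>m = \<langle>x, y : x\<^sup>2\<^sup>m = 1, yx = x\<^sup>-\<^sup>1y, y\<^sup>2 = x\<^sup>m\<rangle>\<close>.\<close>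

definition gen_quaternion :: "nat \<Rightarrow> quaternion_gen letter list set monoid" where
  "gen_quaternion m = presented_group
    {(replicate (2 * m) (Gen qx), []),
     ([Gen qy, Gen qx], [Inv qx, Gen qy]),
     ([Gen qy, Gen qy], replicate m (Gen qx))}"

text \<open>Indexed by \<open>m\<close>, not by the group order: this is the number written \<open>q(4m)\<close>.\<close>

definition quaternion_brace_count :: "nat \<Rightarrow> nat" where
  "quaternion_brace_count m = num_braces (gen_quaternion m)"

end

theory Submission
  imports Complex_Main Defs "HOL-Library.Function_Algebras" "HOL-Algebra.Multiplicative_Group" "HOL-Library.Product_Plus"
begin

text \<open>
  In a brace the map \<open>\<lambda>\<^sub>g b = g \<circ> b - g\<close> is an additive automorphism and \<open>\<lambda>\<close> is an action of the
  multiplicative group, so a brace with multiplicative group \<open>Q\<^sub>4\<^sub>m = \<langle>x, y\<rangle>\<close> is a regular affine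
  action of \<open>Q\<^sub>4\<^sub>m\<close> on an abelian group. Powers of \<open>x\<close> generating ideals form a chain: in a quotient
  of \<open>2\<close>-power order there is a nonzero vector fixed by the group, and it forces the middle
  rotation to be fixed. Climbing back up this chain, \<open>\<lambda>\<^sub>x\<close> to the power \<open>4\<close> is trivial at every stage.
  The vector \<open>\<lambda>\<^sub>x x - x\<close> is then one of the points \<open>x\<^sup>i\<close> or \<open>x\<^sup>i y\<close> of the brace, and each possibility
  determines the brace up to a few parameters. The surviving types are realised on quotients of
  \<open>\<int>\<^sup>4\<close>, where the relations can be checked by congruences, and are separated by isomorphism
  invariants.
\<close>

text \<open>The fixed vector argument needs quotients of \<open>2\<close>-power order, while
  \<open>m = 2^k n\<close> may have an odd factor \<open>n\<close>. The \<open>n\<close>-torsion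
  turns out to be the ideal generated by \<open>x^(2^(k+1))\<close>, and \<open>x\<close> acts
  trivially on it, so the action of \<open>x\<close> is governed by the quotient of order
  \<open>2^(k+2)\<close>; the chain of ideals starts there. The exponent \<open>4\<close> matters
  because it makes \<open>x^(4 i)\<close> equal to \<open>i c\<close> for the single vector
  \<open>c = x^4\<close>: every rotation is then a multiple of \<open>c\<close> plus one of four
  vectors. Since quotients are not types, each is embedded in a ring of functions on characters, and
  every relation becomes an integral linear identity checked with explicit multipliers. The
  generator \<open>y\<close> is unique only up to powers of \<open>x\<close>, so whenever some
  \<open>x^i y\<close> appears it may be renamed \<open>y\<close>; lemmas are stated for one such
  generator and instantiated for another. The congruences of \<open>m\<close> modulo
  \<open>4\<close> and \<open>8\<close> record when \<open>t = x^m\<close> is a multiple of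
  \<open>c\<close>, and when the order \<open>m / 2\<close> of \<open>c\<close> is twice an odd
  number.\<close>

lemma additive_of_nat:
  fixes f :: "'a::comm_ring_1 \<Rightarrow> 'a"
  assumes "additive f"
  shows "f (of_nat k * v) = of_nat k * f v"
  by (induction k)
     (simp_all add: additive.zero[OF assms] additive.add[OF assms] distrib_right)

lemma additive_of_int:
  fixes f :: "'a::comm_ring_1 \<Rightarrow> 'a"
  assumes "additive f"
  shows "f (of_int k * v) = of_int k * f v"
  by (cases k) (simp_all only: of_int_of_nat_eq of_int_minus mult_minus_left
      additive.minus[OF assms] additive_of_nat[OF assms])

lemma additive_numeral:
  fixes f :: "'a::comm_ring_1 \<Rightarrow> 'a"
  assumes "additive f"
  shows "f (numeral k * v) = numeral k * f v"
  using additive_of_nat[OF assms, of "numeral k"] by simp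

lemma additive_numeral':
  fixes f :: "'a::comm_ring_1 \<Rightarrow> 'a"
  assumes "additive f"
  shows "f (v * numeral k) = f v * numeral k"
  using additive_numeral[OF assms, of k v] by (simp add: mult.commute)

lemma additive_of_nat':
  fixes f :: "'a::comm_ring_1 \<Rightarrow> 'a"
  assumes "additive f"
  shows "f (v * of_nat k) = f v * of_nat k"
  using additive_of_nat[OF assms, of k v] by (simp add: mult.commute)

lemma additive_of_int':
  fixes f :: "'a::comm_ring_1 \<Rightarrow> 'a"
  assumes "additive f"
  shows "f (v * of_int k) = f v * of_int k"
  using additive_of_int[OF assms, of k v] by (simp add: mult.commute)

lemma additive_funpow:
  fixes f :: "'a::ab_group_add \<Rightarrow> 'a"
  assumes "additive f"
  shows "additive (f ^^ k)"
  by (induction k) (auto simp: additive_def additive.add[OF assms])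

text \<open>Certificate rules: an equation follows from hypotheses once the difference of its sides
  is exhibited as a linear combination of theirs. Each use supplies the multipliers and leaves a
  ring identity to \<open>algebra_simps\<close>.\<close>

lemma ring_cert_1:
  fixes A B :: "'a::comm_ring_1"
  shows "a = b \<Longrightarrow> A - B = k * (a - b) \<Longrightarrow> A = B"
  by simp

lemma ring_cert_2:
  fixes A B :: "'a::comm_ring_1"
  shows "a = b \<Longrightarrow> a' = b' \<Longrightarrow> A - B = k * (a - b) + k' * (a' - b') \<Longrightarrow> A = B"
  by simp

lemma ring_cert_3:
  fixes A B :: "'a::comm_ring_1"
  shows "a = b \<Longrightarrow> a' = b' \<Longrightarrow> a'' = b'' \<Longrightarrow>
    A - B = k * (a - b) + k' * (a' - b') + k'' * (a'' - b'') \<Longrightarrow> A = B"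
  by simp

section \<open>Linear algebra of a dicyclic affine action\<close>

text \<open>The actions \<open>l\<close>, \<open>l'\<close>, \<open>u\<close> of \<open>x\<close>, \<open>x\<^sup>-\<^sup>1\<close>, \<open>y\<close> by \<open>\<lambda>\<close>, extended from a quotient \<open>S\<close> of the
  brace to an ambient ring of which only the addition matters. The sum over \<open>j < i\<close> is the point
  \<open>x\<^sup>i\<close>, which has period \<open>N\<close> in \<open>S\<close>.\<close>

locale dicyclic_module =
  fixes l l' u :: "'a::comm_ring_1 \<Rightarrow> 'a" and x y :: 'a and S :: "'a set" and N m :: nat
  assumes l_additive: "additive l" and u_additive: "additive u"
    and l_l' [simp]: "l (l' v) = v" and l'_l [simp]: "l' (l v) = v"
    and u_l: "u (l v) = l' (u v)"
    and u_u: "u (u v) = (l ^^ m) v"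
    and u_x: "u x = l' y - l' x - y"
    and u_y: "u y = (\<Sum>j<m. (l ^^ j) x) - y"
    and S_add: "v \<in> S \<Longrightarrow> w \<in> S \<Longrightarrow> v + w \<in> S"
    and S_minus: "v \<in> S \<Longrightarrow> - v \<in> S"
    and l_S: "v \<in> S \<Longrightarrow> l v \<in> S" and u_S: "v \<in> S \<Longrightarrow> u v \<in> S"
    and x_S: "x \<in> S" and y_S: "y \<in> S"
    and S_cases': "v \<in> S \<Longrightarrow> \<exists>i. v = (\<Sum>j<i. (l ^^ j) x) \<or> v = (\<Sum>j<i. (l ^^ j) x) + (l ^^ i) y"
    and sum_eq_0_iff: "(\<Sum>j<i. (l ^^ j) x) = 0 \<longleftrightarrow> N dvd i"
    and sum_neq: "(\<Sum>j<i. (l ^^ j) x) \<noteq> (\<Sum>j<k. (l ^^ j) x) + (l ^^ k) y"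
    and l_N: "v \<in> S \<Longrightarrow> (l ^^ N) v = v"
    and N_dvd: "N dvd 2 * m" and m_pos: "m > 0"
begin

definition f :: "nat \<Rightarrow> 'a" where "f i = (\<Sum>j<i. (l ^^ j) x)"

lemma l'_additive: "additive l'"
proof
  fix v w
  have "l (l' (v + w)) = l (l' v + l' w)"
    by (simp add: additive.add[OF l_additive])
  then show "l' (v + w) = l' v + l' w" by (metis l'_l)
qed

lemmas linear [simp] =
  additive.add[OF l_additive] additive.zero[OF l_additive] additive.minus[OF l_additive]
  additive.diff[OF l_additive] additive_of_nat[OF l_additive] additive_numeral[OF l_additive] additive_numeral'[OF l_additive] additive_of_nat'[OF l_additive] additive_of_int'[OF l_additive]
  additive_of_int[OF l_additive]
  additive.add[OF l'_additive] additive.zero[OF l'_additive] additive.minus[OF l'_additive]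
  additive.diff[OF l'_additive] additive_of_nat[OF l'_additive] additive_numeral[OF l'_additive] additive_numeral'[OF l'_additive] additive_of_nat'[OF l'_additive] additive_of_int'[OF l'_additive]
  additive_of_int[OF l'_additive]
  additive.add[OF u_additive] additive.zero[OF u_additive] additive.minus[OF u_additive]
  additive.diff[OF u_additive] additive_of_nat[OF u_additive] additive_numeral[OF u_additive] additive_numeral'[OF u_additive] additive_of_nat'[OF u_additive] additive_of_int'[OF u_additive]
  additive_of_int[OF u_additive]

lemmas lpow_additive = additive_funpow[OF l_additive]

lemmas lpow_linear [simp] =
  additive.add[OF lpow_additive] additive.zero[OF lpow_additive] additive.minus[OF lpow_additive]
  additive.diff[OF lpow_additive] additive_of_nat[OF lpow_additive]
  additive_numeral[OF lpow_additive] additive_numeral'[OF lpow_additive] additive_of_nat'[OF lpow_additive] additive_of_int'[OF lpow_additive] additive_of_int[OF lpow_additive]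

lemma N_pos: "N > 0"
  using N_dvd m_pos by (cases N) auto

lemma f_0 [simp]: "f 0 = 0" and f_1 [simp]: "f (Suc 0) = x"
  by (simp_all add: f_def)

lemma f_Suc: "f (Suc i) = f i + (l ^^ i) x"
  by (simp add: f_def)

text \<open>The cocycle rule: left multiplication by \<open>x^i\<close> is the affine map
  \<open>v \<mapsto> f i + (l ^^ i) v\<close>.\<close>

lemma f_add: "f (i + j) = f i + (l ^^ i) (f j)"
  by (induction j) (simp_all add: f_Suc funpow_add add.assoc)

lemma f_Suc': "f (Suc i) = x + l (f i)"
  using f_add[of 1 i] by simp

lemma f_eq_0_iff: "f i = 0 \<longleftrightarrow> N dvd i"
  using sum_eq_0_iff by (simp add: f_def)

lemma f_neq: "f i \<noteq> f k + (l ^^ k) y"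
  using sum_neq by (simp add: f_def)

text \<open>The two cosets of the cyclic group generated by \<open>x\<close>: rotations
  \<open>x^i\<close> and points \<open>x^i y\<close>, called reflections although their square is
  \<open>x^m\<close>.\<close>

lemma S_cases [consumes 1]:
  assumes "v \<in> S"
  obtains (rot) i where "v = f i" | (refl) i where "v = f i + (l ^^ i) y"
  using S_cases'[OF assms] by (auto simp: f_def)

lemma u_y': "u y = f m - y"
  by (simp add: u_y f_def)

lemma S_0: "0 \<in> S"
  using S_add[OF x_S S_minus[OF x_S]] by simp

lemma S_diff: "v \<in> S \<Longrightarrow> w \<in> S \<Longrightarrow> v - w \<in> S"
  using S_add[of v "- w"] S_minus by simp

lemma lpow_S: "v \<in> S \<Longrightarrow> (l ^^ i) v \<in> S"
  by (induction i) (auto simp: l_S)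

lemma f_S: "f i \<in> S"
  by (induction i) (auto simp: f_Suc' S_0 S_add x_S l_S)

lemma l'_eq: "v \<in> S \<Longrightarrow> l' v = (l ^^ (N - 1)) v"
  using l_N[of v] N_pos l'_l[of "(l ^^ (N - 1)) v"] by (cases N) simp_all

lemma l'_S: "v \<in> S \<Longrightarrow> l' v \<in> S"
  by (simp add: l'_eq lpow_S)

lemma S_of_nat: "v \<in> S \<Longrightarrow> of_nat k * v \<in> S"
  by (induction k) (auto simp: S_0 S_add distrib_right)

lemma S_numeral: "v \<in> S \<Longrightarrow> numeral k * v \<in> S"
  using S_of_nat[of v "numeral k"] by simp

lemma S_of_int: "v \<in> S \<Longrightarrow> of_int k * v \<in> S"
  using S_of_nat S_minus by (cases k) (auto simp del: of_nat_Suc)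

lemmas S_closed = S_add S_minus S_diff l_S l'_S u_S x_S y_S S_0 lpow_S f_S S_of_nat S_numeral S_of_int

lemma lpow_eq_0_iff [simp]: "(l ^^ i) v = 0 \<longleftrightarrow> v = 0"
proof (induction i)
  case (Suc i)
  have "l w = 0 \<longleftrightarrow> w = 0" for w
    by (metis l'_l additive.zero[OF l'_additive] additive.zero[OF l_additive])
  then show ?case using Suc by simp
qed simp

lemma f_eq_iff: "f i = f j \<longleftrightarrow> i mod N = j mod N" if "i \<le> j"
proof -
  have "f j = f i + (l ^^ i) (f (j - i))"
    using f_add[of i "j - i"] that by simp
  then have "f i = f j \<longleftrightarrow> f (j - i) = 0" by auto
  then show ?thesis
    using that mod_eq_dvd_iff_nat[of i j N] by (simp add: f_eq_0_iff eq_commute[of "i mod N"])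
qed
end

lemma nat_mod_4_cases:
  fixes i :: nat
  obtains (0) a where "i = 4 * a" | (1) a where "i = 4 * a + 1"
    | (2) a where "i = 4 * a + 2" | (3) a where "i = 4 * a + 3"
proof -
  have "i = 4 * (i div 4) + i mod 4" "i mod 4 < 4" by simp_all
  then show ?thesis
    using 0[of "i div 4"] 1[of "i div 4"] 2[of "i div 4"] 3[of "i div 4"] by linarith
qed

section \<open>The set of rotations and its index\<close>

context dicyclic_module
begin

definition X :: "'a set" where "X = range f"

lemma y_X: "y \<notin> X"
  using f_neq[of _ 0] by (auto simp: X_def)

lemma X_S: "X \<subseteq> S"
  by (auto simp: X_def f_S)

lemma f_mod: "f (i mod N) = f i"
  using f_eq_iff[of "i mod N" i] by simp

lemma X_eq: "X = f ` {..<N}"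
proof
  show "X \<subseteq> f ` {..<N}"
    using f_mod N_pos by (auto simp: X_def intro!: image_eqI[of _ f "_ mod N"])
qed (auto simp: X_def)

lemma f_inj: "inj_on f {..<N}"
proof (rule inj_onI)
  fix i j assume "i \<in> {..<N}" "j \<in> {..<N}" "f i = f j"
  then show "i = j"
    using f_eq_iff[of i j] f_eq_iff[of j i] by (cases "i \<le> j") auto
qed

lemma card_X: "card X = N"
  by (simp add: X_eq card_image f_inj)

lemma lpow_mod: "v \<in> S \<Longrightarrow> (l ^^ (i mod N)) v = (l ^^ i) v"
proof -
  assume v: "v \<in> S"
  have N: "(l ^^ (N * k)) v = v" for k
    by (induction k) (simp_all add: funpow_add l_N v)
  have "(l ^^ i) v = (l ^^ (i mod N + N * (i div N))) v"
    by simp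
  also have "\<dots> = (l ^^ (i mod N)) v"
    by (subst funpow_add) (simp add: N)
  finally show ?thesis by simp
qed

lemma S_minus_X: "S - X \<subseteq> (\<lambda>i. f i + (l ^^ i) y) ` {..<N}"
proof
  fix v assume v: "v \<in> S - X"
  then obtain i where "v = f i + (l ^^ i) y"
    by (metis DiffD1 DiffD2 S_cases X_def rangeI)
  then have "v = f (i mod N) + (l ^^ (i mod N)) y"
    by (simp add: f_mod lpow_mod y_S)
  then show "v \<in> (\<lambda>i. f i + (l ^^ i) y) ` {..<N}"
    using N_pos by auto
qed

text \<open>Counting replaces a quotient group: the coset \<open>w + X\<close> has \<open>N\<close>
  elements and avoids \<open>X\<close>, while \<open>S - X\<close> has at most \<open>N\<close>, so
  the two sets coincide and \<open>v\<close> lies in the coset.\<close>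

lemma X_index_2:
  assumes X: "\<And>v w. v \<in> X \<Longrightarrow> w \<in> X \<Longrightarrow> v - w \<in> X"
    and "v \<in> S" "v \<notin> X" "w \<in> S" "w \<notin> X"
  shows "v - w \<in> X"
proof -
  have sub: "(\<lambda>a. w + a) ` X \<subseteq> S - X"
  proof
    fix b assume "b \<in> (\<lambda>a. w + a) ` X"
    then obtain a where a: "a \<in> X" "b = w + a" by auto
    then have "b \<notin> X"
      using X[of b a] assms by auto
    then show "b \<in> S - X"
      using a assms X_S S_add by auto
  qed
  have fin: "finite (S - X)" "card (S - X) \<le> N"
    using S_minus_X finite_subset card_mono[OF _ S_minus_X] card_image_le[of "{..<N}" "\<lambda>i. f i + (l ^^ i) y"]
    by (auto intro: le_trans)
  have "card ((\<lambda>a. w + a) ` X) = N"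
    by (simp add: card_image card_X)
  then have "(\<lambda>a. w + a) ` X = S - X"
    using card_subset_eq[OF fin(1) sub] card_mono[OF fin(1) sub] fin(2) by simp
  then have "v \<in> (\<lambda>a. w + a) ` X"
    using assms by auto
  then show ?thesis by auto
qed

end

section \<open>Excluding a nontrivial fourth power of the action\<close>

text \<open>One step up the chain of ideals: \<open>l\<^sup>4\<close> is trivial modulo the middle rotation.\<close>

locale quartic_step = dicyclic_module +
  fixes h K :: nat
  assumes N_eq: "N = 16 * h" and h_pos: "h > 0" and h_cases: "h = 1 \<or> even h"
    and quartic: "v \<in> S \<Longrightarrow> l (l (l (l v))) = v \<or> l (l (l (l v))) = v + f (8 * h)"
    and l_mid: "l (f (8 * h)) = f (8 * h)" and u_mid: "u (f (8 * h)) = f (8 * h)"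
    and f_m: "f m = 0 \<or> f m = f (8 * h)"
    and uu: "v \<in> S \<Longrightarrow> u (u v) = v"
    and two_power: "v \<in> S \<Longrightarrow> 2 ^ K * v = 0"
begin

text \<open>\<open>t\<close> is the middle rotation, \<open>c\<close> the image of \<open>x\<close>
  under the norm \<open>1 + l + l^2 + l^3\<close>, \<open>\<tau>\<close> the common square of all
  reflections, and \<open>p\<close> the point \<open>x^2\<close>.\<close>

definition "t = f (8 * h)"
definition "c = f 4"
definition "\<tau> = f m"
definition "p = f 2"

lemma l_t [simp]: "l t = t" and u_t [simp]: "u t = t"
  by (simp_all add: t_def l_mid u_mid)

lemma l'_t [simp]: "l' t = t"
  by (metis l_t l'_l)

lemma t_neq_0: "t \<noteq> 0"
  using h_pos by (simp add: t_def f_eq_0_iff N_eq)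

lemma lpow_t [simp]: "(l ^^ i) t = t"
  by (induction i) auto

lemma two_t: "2 * t = 0"
proof -
  have "f (8 * h + 8 * h) = 0"
    by (simp add: f_eq_0_iff N_eq)
  then show ?thesis
    by (simp only: f_add flip: t_def) simp
qed

lemma two_t': "t + t = 0" and minus_t: "- t = t"
  using two_t by (simp_all add: eq_neg_iff_add_eq_0 minus_equation_iff)

lemma tau: "\<tau> = 0 \<or> \<tau> = t"
  using f_m by (simp add: \<tau>_def t_def)

lemma two_tau: "2 * \<tau> = 0"
  using tau two_t by auto

lemma u_y'': "u y = \<tau> - y"
  by (simp add: u_y' \<tau>_def)

text \<open>\<open>S\<close> has exponent dividing \<open>2 ^ K\<close>, so odd factors are inverted
  by Bezout.\<close>

lemma odd_cancel:
  assumes "v \<in> S" "of_int k * v = 0" "odd k"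
  shows "v = 0"
proof -
  have "coprime k (2 ^ K)"
    using assms(3) by simp
  then obtain a b where "a * k + b * 2 ^ K = 1"
    using bezout_int[of k "2 ^ K"] by (metis coprime_imp_gcd_eq_1)
  then have "v = of_int (a * k + b * 2 ^ K) * v" by simp
  also have "\<dots> = of_int a * (of_int k * v) + of_int b * (2 ^ K * v)"
    by (simp add: algebra_simps)
  finally show ?thesis using assms two_power by simp
qed

lemma cancel_3: "v \<in> S \<Longrightarrow> 3 * v = 0 \<Longrightarrow> v = 0"
  using odd_cancel[of v 3] by simp

text \<open>The defect of \<open>l^4\<close>. On \<open>S\<close> it is additive with values
  \<open>0\<close> and \<open>t\<close>, so it is determined by its values at \<open>x\<close> and
  \<open>y\<close>; the aim is to show that both vanish.\<close>

definition "ph v = l (l (l (l v))) - v"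

lemma ph_additive: "additive ph"
  by (simp add: additive_def ph_def)

lemmas ph_linear [simp] =
  additive.add[OF ph_additive] additive.zero[OF ph_additive] additive.minus[OF ph_additive]
  additive.diff[OF ph_additive] additive_of_nat[OF ph_additive]
  additive_numeral[OF ph_additive] additive_of_int[OF ph_additive]

lemma l4: "l (l (l (l v))) = v + ph v"
  by (simp add: ph_def)

lemma ph_cases: "v \<in> S \<Longrightarrow> ph v = 0 \<or> ph v = t"
  using quartic[of v] by (auto simp: t_def ph_def)

lemma c_eq: "c = x + l x + l (l x) + l (l (l x))"
  by (simp add: c_def numeral_eq_Suc f_Suc add.assoc)

lemma p_eq: "p = x + l x"
  by (simp add: p_def numeral_eq_Suc f_Suc)

lemma l_c: "l c = c + ph x"
  by (simp add: c_eq ph_def)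

lemma ph_l: "ph (l v) = l (ph v)"
  by (simp add: ph_def)

lemma l_ph: "v \<in> S \<Longrightarrow> l (ph v) = ph v"
  using ph_cases[of v] by auto

lemma ph_c: "ph c = 0"
proof -
  have "ph c = 4 * ph x"
    by (simp add: c_eq ph_l l_ph[OF x_S])
  then show ?thesis using ph_cases[OF x_S] arg_cong[OF two_t, of "\<lambda>v. 2 * v"] by auto
qed

lemma funpow_4: "(l ^^ 4) v = l (l (l (l v)))"
  by (simp add: numeral_eq_Suc)

text \<open>Although \<open>l c = c + ph x\<close> may differ from \<open>c\<close>, the defect of
  \<open>c\<close> itself is \<open>4 ph x = 0\<close>; so \<open>l^4\<close> fixes
  \<open>c\<close>, and that is all that powers of \<open>x^4\<close> use.\<close>

lemma f_4: "f (4 * i) = of_nat i * c"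
proof (induction i)
  case (Suc i)
  have "(l ^^ (4 * i)) c = c"
    by (induction i) (simp_all add: funpow_add funpow_4 l4 ph_c)
  then show ?case
    using Suc f_add[of "4 * i" 4] by (simp add: c_def algebra_simps)
qed simp

lemma c_S: "c \<in> S" and t_S: "t \<in> S" and p_S: "p \<in> S" and tau_S: "\<tau> \<in> S"
  by (simp_all add: c_def t_def p_def \<tau>_def f_S)

lemma c_of_nat: "of_nat i * c = 0 \<longleftrightarrow> 4 * h dvd i"
proof -
  have "of_nat i * c = 0 \<longleftrightarrow> 16 * h dvd 4 * i"
    by (simp add: f_4[symmetric] f_eq_0_iff N_eq)
  also have "\<dots> \<longleftrightarrow> 4 * (4 * h) dvd 4 * i" by simp
  finally show ?thesis
    using dvd_mult_cancel_left[of 4 "4 * h" i] by simp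
qed

lemma c_of_int: "of_int k * c = 0 \<longleftrightarrow> 4 * int h dvd k"
  using c_of_nat[of "nat k"] c_of_nat[of "nat (- k)"]
proof (cases k)
  case (nonneg n)
  then show ?thesis
    using c_of_nat[of n] by (simp flip: int_dvd_int_iff)
next
  case (neg n)
  then show ?thesis
    using c_of_nat[of "Suc n"] dvd_minus_iff[of "4 * int h" "int (Suc n)"]
    by (simp del: of_nat_Suc dvd_minus_iff flip: int_dvd_int_iff)
qed

lemma t_c: "t = of_int (2 * int h) * c"
  using f_4[of "2 * h"] by (simp add: t_def)

text \<open>A parity obstruction: \<open>t = 2 h c\<close> is an even multiple of \<open>c\<close>,
  and the order \<open>4 h\<close> of \<open>c\<close> is even. Several contradictions below end
  here.\<close>

lemma odd_c: "odd k \<Longrightarrow> of_int k * c \<noteq> of_int j * t"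
proof
  assume "odd k" "of_int k * c = of_int j * t"
  then have "of_int (k - 2 * int h * j) * c = 0"
    by (simp add: t_c algebra_simps)
  then have "2 dvd k - 2 * int h * j"
    unfolding c_of_int by (rule dvd_trans[rotated]) simp
  then show False using \<open>odd k\<close> by simp
qed

lemma l'_ph: "v \<in> S \<Longrightarrow> l' (ph v) = ph v"
  using ph_cases[of v] by auto

lemma l'4: "v \<in> S \<Longrightarrow> l' (l' (l' (l' v))) = v - ph v"
proof -
  assume v: "v \<in> S"
  have "l' (l' (l' (l' (l (l (l (l v))))))) = l' (l' (l' (l' (v + ph v))))"
    by (simp only: l4)
  then show ?thesis by (simp add: l'_ph v eq_diff_eq)
qed

text \<open>The formula for \<open>u x\<close>, summed over \<open>x\<close>, \<open>l x\<close>,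
  \<open>l^2 x\<close>, \<open>l^3 x\<close>, telescopes in \<open>y\<close>.\<close>

lemma u_c: "u c = - c + ph y"
proof -
  have "u c = l' (l' (l' (l' y))) - y - l' (l' (l' (l' c)))"
    by (simp add: c_eq u_l u_x)
  also have "\<dots> = - ph y - c"
    unfolding l'4[OF y_S] l'4[OF c_S] ph_c by simp
  also have "- ph y = ph y"
    using ph_cases[OF y_S] minus_t by (metis minus_zero)
  finally show ?thesis by simp
qed

lemma f_4_add: "f (4 * i + j) = of_nat i * c + (l ^^ (4 * i)) (f j)"
  by (simp add: f_add f_4)

lemma lpow_4: "ph v = 0 \<Longrightarrow> (l ^^ (4 * i)) v = v"
  by (induction i) (simp_all add: funpow_add funpow_4 l4)

lemma ph_l': "v \<in> S \<Longrightarrow> ph (l v) = ph v"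
  by (simp add: ph_l l_ph)

lemma ph_lpow: "v \<in> S \<Longrightarrow> ph ((l ^^ i) v) = ph v"
  by (induction i) (simp_all add: ph_l' lpow_S)

lemma ph_f: "ph (f i) = of_nat i * ph x"
  by (induction i) (simp_all add: f_Suc ph_lpow x_S distrib_right)

lemma of_nat_t: "of_nat i * t = (if even i then 0 else t)"
proof (induction i)
  case (Suc i)
  then show ?case using two_t' by (auto simp: distrib_right)
qed simp

lemma ph_f_y: "ph (f i + (l ^^ i) y) = of_nat i * ph x + ph y"
  by (simp add: ph_f ph_lpow y_S)

lemma l_tau [simp]: "l \<tau> = \<tau>" and l'_tau [simp]: "l' \<tau> = \<tau>" and u_tau [simp]: "u \<tau> = \<tau>"
  using tau by auto

text \<open>The norm turns each summand of \<open>f k\<close> into a translate of \<open>c\<close>,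
  and \<open>l\<close> fixes \<open>c\<close> when \<open>ph x = 0\<close>.\<close>

lemma sum_4_f:
  assumes "ph x = 0"
  shows "f k + l (f k) + l (l (f k)) + l (l (l (f k))) = of_nat k * c"
proof (induction k)
  case (Suc k)
  have lc: "l c = c" using l_c assms by simp
  have lpc: "(l ^^ i) c = c" for i by (induction i) (auto simp: lc)
  have "f (Suc k) + l (f (Suc k)) + l (l (f (Suc k))) + l (l (l (f (Suc k)))) =
      (f k + l (f k) + l (l (f k)) + l (l (l (f k)))) + (l ^^ k) c"
    by (simp add: f_Suc c_eq flip: funpow_swap1)
  then show ?case using Suc lpc by (simp add: algebra_simps)
qed simp

text \<open>With \<open>ph x = 0\<close> every reflection has defect \<open>t\<close>, so
  \<open>l y - y\<close>, of defect \<open>0\<close>, is a rotation \<open>f k\<close>. Its norm is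
  \<open>l^4 y - y = t\<close> on one side and \<open>k c\<close> on the other.\<close>

lemma caseA_k:
  assumes "ph x = 0" "ph y = t"
  obtains k where "l y - y = f k" "even k" "of_nat k * c = t"
proof -
  define e where "e = l y - y"
  have ph: "ph e = 0" by (simp add: e_def ph_l' y_S)
  have "e \<in> S" by (simp add: e_def S_closed)
  then obtain k where k: "e = f k"
  proof (cases rule: S_cases)
    case (refl i)
    then show ?thesis using ph_f_y[of i] assms ph t_neq_0 by simp
  qed
  have kc: "of_nat k * c = t"
    using sum_4_f[OF assms(1), of k] assms(2) unfolding k[symmetric] by (simp add: e_def ph_def)
  then have "of_int (int k - 2 * int h) * c = 0"
    using t_c by (simp add: left_diff_distrib)
  then have "2 dvd int k - 2 * int h"
    unfolding c_of_int by (rule dvd_trans[rotated]) simp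
  then have "even k" by simp
  with k kc show ?thesis unfolding e_def by (intro that[of k])
qed

text \<open>For \<open>e = l y - y\<close> the relation \<open>u e = l' e\<close> excludes
  \<open>4 dvd k\<close>. As \<open>k\<close> and \<open>2 h\<close> agree modulo
  \<open>4 h\<close>, this excludes even \<open>h\<close>. What is left is \<open>h = 1\<close>, a
  quotient with \<open>16\<close> rotations, where explicit computation expresses \<open>4 x\<close>
  through \<open>c\<close> and \<open>t\<close> and contradicts the action of
  \<open>u\<close>.\<close>

lemma caseA:
  assumes phx: "ph x = 0" and phy: "ph y = t"
  shows False
proof -
  obtain k where k: "l y - y = f k" "even k" and kc: "of_nat k * c = t"
    using caseA_k[OF assms] .
  define e where "e = l y - y"
  have lc: "l c = c" using l_c phx by simp
  then have l'c: "l' c = c" by (metis l'_l)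
  have uc: "u c = t - c" using u_c phy by simp
  have ue: "u e = l' e"
    by (simp add: e_def u_l u_y'' algebra_simps)
  have le: "l y = y + e" by (simp add: e_def)
  have t4c: "t \<noteq> 0" by (rule t_neq_0)
  have "\<not> 4 dvd k"
  proof
    assume "4 dvd k"
    then obtain q where q: "k = 4 * q" by auto
    then have e: "e = of_nat q * c" using k f_4 e_def by simp
    then have "of_nat q * (t - c) = of_nat q * c"
      using ue by (simp add: uc l'c)
    then have "2 * (of_nat q * t) = of_nat k * c"
      by (simp add: q algebra_simps)
    then show False using kc t_neq_0 by (simp add: of_nat_t two_t split: if_splits)
  qed
  then obtain q where q: "k = 4 * q + 2"
    using \<open>even k\<close> by (cases k rule: nat_mod_4_cases) auto
  have "of_int (int k - 2 * int h) * c = 0"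
    using t_c kc by (simp add: left_diff_distrib)
  then have "4 * int h dvd int k - 2 * int h" by (simp only: c_of_int)
  have h1: "h = 1"
  proof (rule ccontr)
    assume "h \<noteq> 1"
    then obtain h' where h': "h = 2 * h'" using h_cases by auto
    have "4 dvd int k - 2 * int h"
      by (rule dvd_trans[OF _ \<open>4 * int h dvd int k - 2 * int h\<close>]) simp
    then show False using \<open>\<not> 4 dvd k\<close> unfolding h' by presburger
  qed
  have t2c: "t = 2 * c" using t_c by (simp add: h1)
  have c4: "4 * c = 0" using two_t by (simp add: t2c)
  have qt: "of_nat i * t = (if even i then 0 else t)" for i by (rule of_nat_t)
  have ph_p: "ph p = 0"
    by (simp add: p_eq ph_l' x_S phx)
  have e_p: "e = of_nat q * c + p"
    using k(1) f_4_add[of q 2] lpow_4[OF ph_p, of q] by (simp add: e_def q p_def)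
  have c_p: "c = p + l (l p)" by (simp add: c_eq p_eq)
  have l'l'p: "l' (l' p) = c - p"
    using arg_cong[OF c_p, of "\<lambda>v. l' (l' v)"] by (simp add: l'c eq_diff_eq)
  have l'y: "l' y = y - l' e"
    using arg_cong[OF le, of l'] by (simp add: eq_diff_eq)
  have up: "u p = 2 * p - 2 * c - 2 * (of_nat q * c) - l' p"
  proof -
    have "u p = l' (l' y) - y - l' (l' p)"
      by (simp add: p_eq u_l u_x)
    then show ?thesis
      by (simp add: l'y l'l'p e_p l'c algebra_simps)
  qed
  have q4: "4 * (of_nat q * c) = 0" using c4 by (simp add: mult.left_commute[of 4])
  have E1: "2 * p - 2 * l' p = 2 * c - of_nat q * t"
  proof -
    have "of_nat q * (t - c) + u p = of_nat q * c + l' p"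
      using ue by (simp add: e_p uc l'c)
    then have "2 * p - 2 * l' p = 2 * c + 4 * (of_nat q * c) - of_nat q * t"
      by (simp add: up algebra_simps)
    then show ?thesis using q4 by simp
  qed
  have lp: "l p = c - l' p"
    using arg_cong[OF l'l'p, of l] by (simp add: lc algebra_simps)
  have E2: "2 * l p - 2 * p = 2 * c - of_nat q * t"
    using arg_cong[OF E1, of l] by (simp add: lc)
  have p4: "4 * p = t"
  proof -
    have "2 * c - 4 * l' p = 2 * (2 * c - of_nat q * t)"
      using E1 E2 by (simp add: lp algebra_simps)
    also have "\<dots> = 0" using c4 two_t by (simp add: qt algebra_simps)
    finally have "l (2 * c - 4 * l' p) = 0" by simp
    then show ?thesis by (simp add: lc t2c)
  qed
  have l0: "2 * l v = 0" if "2 * v = 0" for v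
    using arg_cong[OF that, of l] by simp
  \<comment> \<open>Twice the norm of \<open>f i\<close> is \<open>2 i c = 0\<close>, so
    \<open>i\<close> is even because \<open>c\<close> has order \<open>4\<close>. The two even
    residues modulo \<open>4\<close> are then settled by the order of \<open>c\<close> and by
    \<open>4 p = t\<close>.\<close>
  have two_torsion: "f i = 0 \<or> f i = t" if "2 * f i = 0" for i
  proof -
    have "2 * (of_nat i * c) = 0"
      unfolding sum_4_f[OF phx, of i, symmetric]
      using that l0[OF that] l0[OF l0[OF that]] l0[OF l0[OF l0[OF that]]]
      by (simp add: distrib_left)
    then have "of_nat (2 * i) * c = 0" by (simp add: algebra_simps)
    then have "4 dvd 2 * i" unfolding c_of_nat h1 by simp
    then have "even i" by presburger
    then consider a where "i = 4 * a" | a where "i = 4 * a + 2"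
      by (cases i rule: nat_mod_4_cases) auto
    then show ?thesis
    proof cases
      case 1
      then have fi: "f i = of_nat a * c" by (simp add: f_4)
      then have "of_nat (2 * a) * c = 0" using that by (simp add: algebra_simps)
      then have "4 dvd 2 * a" unfolding c_of_nat h1 by simp
      then have "even a" by presburger
      then obtain b where "a = 2 * b" by auto
      then have "f i = of_nat b * t" using fi t2c by (simp add: algebra_simps)
      then show ?thesis by (simp add: qt)
    next
      case 2
      then have "f i = of_nat a * c + p"
        using f_4_add[of a 2] lpow_4[OF ph_p, of a] by (simp add: p_def)
      then have "2 * (2 * f i) = of_nat a * (4 * c) + 4 * p" by (simp add: algebra_simps)
      then show ?thesis using that p4 c4 t_neq_0 by simp
    qed
  qed
  have not_refl: "\<exists>i. v = f i" if "v \<in> S" "ph v = 0" for v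
    using \<open>v \<in> S\<close>
  proof (cases rule: S_cases)
    case (refl i)
    then show ?thesis using ph_f_y[of i] phx phy t_neq_0 that by simp
  qed auto
  obtain \<alpha> where \<alpha>: "2 * p = c + \<alpha>" "\<alpha> = 0 \<or> \<alpha> = t"
  proof -
    have "2 * p - c \<in> S" by (intro S_closed p_S c_S)
    moreover have "ph (2 * p - c) = 0" using ph_p ph_c by simp
    ultimately obtain i where i: "2 * p - c = f i" using not_refl by blast
    have "2 * (2 * p - c) = 0" using p4 t2c by (simp add: algebra_simps)
    then have "f i = 0 \<or> f i = t" unfolding i by (rule two_torsion)
    then show ?thesis using that[of "f i"] i by (simp add: algebra_simps)
  qed
  have l\<alpha> [simp]: "l \<alpha> = \<alpha>" "u \<alpha> = \<alpha>" and \<alpha>2: "2 * \<alpha> = 0" using \<alpha>(2) two_t by auto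
  have q_odd: "odd q"
  proof
    assume "even q"
    moreover have "2 * l p = l (2 * p)" by simp
    then have "2 * l p = 2 * p" unfolding \<alpha>(1) by (simp add: lc)
    ultimately show False using E2 t2c qt t_neq_0 by simp
  qed
  \<comment> \<open>\<open>w\<close> will be \<open>2 e\<close>, fixed by \<open>l\<close> with
    \<open>2 w = t\<close>. Once \<open>2 y\<close> is written as a rotation \<open>f j\<close>, it
    measures how \<open>l^j\<close> moves \<open>x\<close>.\<close>
  define w where "w = t + c + \<alpha>"
  have w: "l w = w" "2 * w = t"
    using two_t \<alpha>2 lc by (simp_all add: w_def distrib_left flip: t2c)
  then have "l' w = w" by (metis l'_l)
  have e2: "2 * e = w"
  proof -
    have "2 * e = of_nat q * (2 * c) + 2 * p" by (simp add: e_p algebra_simps)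
    then show ?thesis using q_odd qt by (simp add: \<alpha>(1) w_def flip: t2c)
  qed
  obtain j where j: "2 * y = f j"
  proof -
    have "ph (2 * y) = 0" using phy two_t by simp
    then show ?thesis using not_refl[of "2 * y"] that y_S by (auto simp: S_closed)
  qed
  have ljx: "(l ^^ j) x = x + w"
  proof -
    have "l (f j) = f j + (l ^^ j) x - x"
      using f_Suc[of j] f_Suc'[of j] by (simp add: algebra_simps)
    moreover have "l (2 * y) = 2 * y + 2 * e" by (simp add: le distrib_left)
    ultimately show ?thesis
      unfolding j[symmetric] e2 by (simp add: algebra_simps)
  qed
  \<comment> \<open>For even \<open>j\<close> the map \<open>l^(2 j)\<close> fixes \<open>x\<close>,
    whereas two shifts by \<open>w\<close> add \<open>2 w = t\<close>.\<close>
  have "odd j"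
  proof
    assume "even j"
    then obtain b where "j = 2 * b" by auto
    then have "(l ^^ (j + j)) x = x" using lpow_4[OF phx, of b] by simp
    moreover have "(l ^^ (j + j)) x = (l ^^ j) ((l ^^ j) x)"
      by (simp only: funpow_add o_apply)
    moreover have "(l ^^ j) w = w" by (induction j) (auto simp: w)
    ultimately have "x + (w + w) = x + 0" by (simp add: ljx add.assoc)
    then have "w + w = 0" by (rule add_left_imp_eq)
    then show False using w(2) t_neq_0 mult_2[of w] by metis
  qed
  have l3: "l' x = l (l (l x))"
  proof -
    have "l' x = l' (l (l (l (l x))))" by (simp only: l4 phx add_0_right)
    then show ?thesis by (simp only: l'_l)
  qed
  obtain w' where w': "l x = x + w'" "w' = w \<or> w' = - w" and fj: "4 * f j = 4 * x \<or> 4 * f j = 12 * x"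
  proof -
    consider b where "j = 4 * b + 1" | b where "j = 4 * b + 3"
      using \<open>odd j\<close> by (cases j rule: nat_mod_4_cases) auto
    then show ?thesis
    proof cases
      case 1
      then have "l x = x + w" using ljx lpow_4[OF phx] by simp
      moreover have "f j = of_nat b * c + x"
        using f_4_add[of b 1] lpow_4[OF phx] 1 by simp
      then have "4 * f j = of_nat b * (4 * c) + 4 * x" by (simp add: algebra_simps)
      ultimately show ?thesis using that[of w] c4 by simp
    next
      case 2
      then have "(l ^^ (3 + 4 * b)) x = x + w" using ljx by (simp only: add.commute)
      then have "(l ^^ 3) x = x + w" by (simp only: funpow_add o_apply lpow_4[OF phx])
      then have "l' x = x + w" by (simp only: l3) (simp add: numeral_eq_Suc)
      then have "l (l' x) = l (x + w)" by (simp only:)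
      then have "x = l x + w" using w by simp
      then have lx: "l x = x - w" by (simp add: eq_diff_eq)
      have "f j = of_nat b * c + (l ^^ (4 * b)) (f 3)"
        using f_4_add[of b 3] 2 by simp
      also have "f 3 = 3 * x - 3 * w" by (simp add: numeral_eq_Suc f_Suc lx w algebra_simps)
      also have "(l ^^ (4 * b)) (3 * x - 3 * w) = 3 * x - 3 * w"
      proof -
        have "(l ^^ i) w = w" for i by (induction i) (auto simp: w)
        then show ?thesis using lpow_4[OF phx] by simp
      qed
      finally have fj: "f j = of_nat b * c + (3 * x - 3 * w)" .
      have "4 * f j = of_nat b * (4 * c) + 12 * x - 3 * (2 * t)"
        by (rule ring_cert_2[OF fj w(2), of _ _ 4 "- 6"]) (simp add: algebra_simps)
      then have "4 * f j = 12 * x" by (simp only: c4 two_t mult_zero_right add_0_left diff_0_right)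
      then show ?thesis using that[of "- w"] lx by simp
    qed
  qed
  have x4: "4 * x = c + \<alpha> + t"
  proof -
    have "2 * w' = t" using w' w minus_t by auto
    moreover have "2 * p = 4 * x + 2 * w'" by (simp add: p_eq w' algebra_simps)
    ultimately show ?thesis using \<alpha>(1) minus_t by (simp add: algebra_simps)
  qed
  have "u (4 * x) = (t - c) + \<alpha> + t" by (simp only: x4 linear uc l\<alpha> u_t)
  then have ux4: "u (4 * x) = \<alpha> - c"
    by (rule ring_cert_2[OF _ two_t, of _ _ _ _ 1 1]) (simp add: algebra_simps)
  \<comment> \<open>\<open>4 f j\<close> is \<open>8 y\<close>, which \<open>u\<close> negates; but
    it is also \<open>4 x\<close> or \<open>12 x\<close>, where \<open>u\<close> has just been
    computed.\<close>
  have "u (4 * f j) = - (4 * f j)"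
    unfolding j[symmetric]
  proof -
    have "u (4 * (2 * y)) = 4 * (2 * (\<tau> - y))" by (simp only: linear u_y'')
    then show "u (4 * (2 * y)) = - (4 * (2 * y))"
      by (rule ring_cert_2[OF _ two_tau, of _ _ _ _ 1 4]) (simp add: algebra_simps)
  qed
  from fj show False
  proof
    assume *: "4 * f j = 4 * x"
    have "\<alpha> - c = u (4 * x)" by (simp only: ux4)
    also have "\<dots> = - (4 * x)" using \<open>u (4 * f j) = _\<close> by (simp only: *)
    also have "\<dots> = - (c + \<alpha> + t)" by (simp only: x4)
    finally have E: "\<alpha> - c = - (c + \<alpha> + t)" .
    have "t = 0"
      by (rule ring_cert_2[OF E \<alpha>2, of _ _ 1 "- 1"]) (simp add: algebra_simps)
    then show False using t_neq_0 by simp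
  next
    assume *: "4 * f j = 12 * x"
    have "3 * (\<alpha> - c) = 3 * u (4 * x)" by (simp only: ux4)
    also have "\<dots> = u (12 * x)" by simp
    also have "\<dots> = - (12 * x)" using \<open>u (4 * f j) = _\<close> by (simp only: *)
    also have "\<dots> = - (3 * (4 * x))" by simp
    also have "\<dots> = - (3 * (c + \<alpha> + t))" by (simp only: x4)
    finally have E: "- (3 * (c + \<alpha> + t)) = 3 * (\<alpha> - c)" by (rule sym)
    have "t = 0"
      by (rule ring_cert_3[OF E \<alpha>2 two_t, of _ _ "- 1" "- 3" "- 1"]) (simp add: algebra_simps)
    then show False using t_neq_0 by simp
  qed
qed

lemma caseB_basic:
  assumes phx: "ph x = t" and phy: "ph y = 0"
  shows "l c = c + t" "l' c = c - t" "u c = - c" "l (l p) = c - p" "l' (l' p) = c - p"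
    "u p = p - c + l' (l' y) - y" "ph p = 0"
proof -
  show lc: "l c = c + t" and uc: "u c = - c" using l_c u_c phx phy by simp_all
  show l'c: "l' c = c - t"
    using arg_cong[OF lc, of l'] by (simp add: eq_diff_eq)
  have c_p: "c = p + l (l p)" by (simp add: c_eq p_eq)
  then show "l (l p) = c - p" by (simp add: eq_diff_eq)
  have "l' (l' c) = c" using two_t by (simp add: l'c)
  then show l'l'p: "l' (l' p) = c - p"
    using arg_cong[OF c_p, of "\<lambda>v. l' (l' v)"] by (simp add: eq_diff_eq)
  have "u p = l' (l' y) - y - l' (l' p)"
    by (simp add: p_eq u_l u_x)
  then show "u p = p - c + l' (l' y) - y"
    by (simp add: l'l'p)
  show "ph p = 0"
    using two_t' by (simp add: p_eq ph_l' x_S phx)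
qed

lemma f_even:
  assumes "ph p = 0" "even i"
  obtains a where "f i = of_nat a * c" | a where "f i = of_nat a * c + p"
proof (cases i rule: nat_mod_4_cases)
  case (0 a)
  then show ?thesis using that(1)[of a] f_4 by simp
next
  case (2 a)
  then show ?thesis
    using that(2)[of a] f_4_add[of a 2] lpow_4[OF assms(1), of a] by (simp add: p_def)
qed (use assms in auto)

text \<open>Here \<open>ph\<close> detects the parity of the exponent on rotations and reflections
  alike, so defect \<open>0\<close> means even exponent.\<close>

lemma caseB_ph_0:
  assumes phx: "ph x = t" and phy: "ph y = 0" and v: "v \<in> S" "ph v = 0"
  obtains a where "v = of_nat a * c" | a where "v = of_nat a * c + p"
    | i where "v = f i + (l ^^ i) y" "even i"
  using v(1)
proof (cases rule: S_cases)
  case (rot i)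
  then have "even i" using v(2) ph_f[of i] phx t_neq_0 of_nat_t[of i] by (auto split: if_splits)
  then show ?thesis using that(1,2) rot f_even[OF caseB_basic(7)[OF assms(1,2)]] by metis
next
  case (refl i)
  then have "even i" using v(2) ph_f_y[of i] phx phy t_neq_0 of_nat_t[of i] by (auto split: if_splits)
  then show ?thesis using that(3) refl by metis
qed

lemma tau_c: obtains k where "\<tau> = of_int (2 * k) * c"
proof -
  have "\<tau> = of_int (2 * 0) * c \<or> \<tau> = of_int (2 * int h) * c"
    using tau by (metis t_c mult_zero_left of_int_0 mult_zero_right)
  then show ?thesis using that by blast
qed

text \<open>With the reflection \<open>l p - p\<close> as \<open>y\<close>, the relation
  \<open>u l = l' u\<close> at \<open>p\<close> yields \<open>3 (2 p - c - \<tau>) = 0\<close>, and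
  the factor \<open>3\<close> cancels. Then \<open>2 x\<close>, having defect \<open>0\<close>, is
  compared with \<open>l (2 x) = 2 p - 2 x\<close>: its coefficient at \<open>p\<close> is
  \<open>0\<close>, against the parity of \<open>c\<close>, or \<open>1\<close>, which makes
  \<open>y\<close> a rotation.\<close>

lemma caseB1:
  assumes phx: "ph x = t" and phy: "ph y = 0" and y: "l p - p = y"
  shows False
proof -
  note basic = caseB_basic[OF phx phy]
  have lp: "l p = p + y" using y by (simp add: diff_eq_eq)
  have "l (l p) = l p + l y" using arg_cong[OF lp, of l] by simp
  then have "c - p = p + y + l y" by (simp only: basic(4) lp[symmetric])
  then have ly: "l y = c - 2 * p - y" by (simp add: algebra_simps)
  have "l (l y) = l c - 2 * l p - l y"
    using arg_cong[OF ly, of l] by simp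
  then have "l (l y) = t - y" by (simp add: basic lp ly algebra_simps)
  from arg_cong[OF this, of "\<lambda>v. l' (l' v)"] have "l' (l' y) = t - y"
    by (simp add: eq_diff_eq add.commute)
  then have up: "u p = p - c + t - 2 * y" by (simp add: basic algebra_simps)
  have l'p: "l' p + l' y = p" using arg_cong[OF lp, of l'] by simp
  have l'y: "y = (c - t) - 2 * l' p - l' y" using arg_cong[OF ly, of l'] by (simp add: basic algebra_simps)
  have l'p': "l' p = c - t - y - p"
    by (rule ring_cert_2[OF l'p l'y, of _ _ "- 1" 1]) (simp add: algebra_simps)
  have l'y': "l' y = 2 * p + y - c + t"
    by (rule ring_cert_2[OF l'p l'y, of _ _ 2 "- 1"]) (simp add: algebra_simps)
  have "u (l p) = l' (u p)" by (rule u_l)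
  then have "p - c + t - 2 * y + (\<tau> - y) = l' p - (c - t) + t - 2 * l' y"
    by (simp add: lp up u_y'' basic)
  then have "6 * p + \<tau> = 3 * c - 2 * t"
    unfolding l'p' l'y' by (simp add: algebra_simps)
  then have "3 * (2 * p - c - \<tau>) = 0"
    by (rule ring_cert_3[OF _ two_tau two_t, of _ _ _ _ 1 "- 2" "- 1"]) (simp add: algebra_simps)
  then have "2 * p - c - \<tau> = 0"
    by (rule cancel_3[rotated]) (intro S_closed p_S c_S tau_S)
  then have p2: "2 * p = c + \<tau>" by (simp add: algebra_simps)
  have "2 * p + 2 * y = c + t + \<tau>"
    using arg_cong[OF p2, of l] by (simp add: lp basic distrib_left del: p2)
  then have y2: "2 * y = t" by (simp add: p2)
  have ly': "l y = - \<tau> - y" by (simp add: ly p2)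
  have x2S: "2 * x \<in> S" and ph_x2: "ph (2 * x) = 0"
    using two_t by (simp_all add: phx S_closed)
  consider a where "2 * x = of_nat a * c" | a where "2 * x = of_nat a * c + p"
    | i where "2 * x = f i + (l ^^ i) y" "even i"
    by (metis caseB_ph_0[OF phx phy x2S ph_x2])
  then obtain a where X2: "2 * x = of_nat a * c \<or> 2 * x = of_nat a * c + p \<or>
      (\<exists>w. (w = y \<or> w = t - y) \<and> (2 * x = of_nat a * c + w \<or> 2 * x = of_nat a * c + p + w))"
  proof cases
    case (3 i)
    have "(l ^^ i) y = y \<or> (l ^^ i) y = t - y"
    proof (cases i rule: nat_mod_4_cases)
      case (0 a)
      then show ?thesis using lpow_4[OF phy] by simp
    next
      case (2 a)
      have "(l ^^ (2 + 4 * a)) y = (l ^^ 2) y"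
        by (simp only: funpow_add o_apply lpow_4[OF phy])
      then show ?thesis using \<open>l (l y) = t - y\<close> 2 by (simp add: numeral_2_eq_2 add.commute)
    qed (use \<open>even i\<close> in auto)
    moreover obtain a where "f i = of_nat a * c \<or> f i = of_nat a * c + p"
      using f_even[OF basic(7) \<open>even i\<close>] by metis
    ultimately show ?thesis
      using 3(1) that[of a] by metis
  qed (use that in blast)+
  \<comment> \<open>All shapes of \<open>2 x\<close> are collected in one linear form;
    \<open>\<delta>\<close> is there for the shape \<open>t - y\<close>.\<close>
  have "\<exists>\<beta> \<gamma> :: int. \<exists>\<delta>. 2 * x = of_nat a * c + of_int \<beta> * p + of_int \<gamma> * y + of_int \<delta> * t \<and> (\<beta> = 0 \<or> \<beta> = 1)"
    using X2 apply (elim disjE exE conjE)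
         apply (intro exI[of _ 0]; simp)
        apply (rule exI[of _ 1], rule exI[of _ 0], rule exI[of _ 0], simp)
       apply (rule exI[of _ 0], rule exI[of _ 1], rule exI[of _ 0], simp)
      apply (rule exI[of _ 1], rule exI[of _ 1], rule exI[of _ 0], simp)
     apply (rule exI[of _ 0], rule exI[of _ "- 1"], rule exI[of _ 1], simp)
    apply (rule exI[of _ 1], rule exI[of _ "- 1"], rule exI[of _ 1], simp)
    done
  then obtain \<beta> \<gamma> \<delta> :: int where x2:
      "2 * x = of_nat a * c + of_int \<beta> * p + of_int \<gamma> * y + of_int \<delta> * t" and \<beta>: "\<beta> = 0 \<or> \<beta> = 1"
    by blast
  have "l (2 * x) = 2 * p - 2 * x" by (simp add: p_eq algebra_simps)
  then have "of_nat a * (c + t) + of_int \<beta> * (p + y) + of_int \<gamma> * (- \<tau> - y) + of_int \<delta> * t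
      = c + \<tau> - (of_nat a * c + of_int \<beta> * p + of_int \<gamma> * y + of_int \<delta> * t)"
    unfolding x2 p2 by (simp add: basic lp ly')
  then have E: "of_int \<beta> * (2 * p) + of_int \<beta> * y =
      c + \<tau> - of_nat (2 * a) * c - of_nat a * t + of_int \<gamma> * \<tau> - of_int \<delta> * (2 * t)"
    by (simp add: algebra_simps)
  obtain k where k: "\<tau> = of_int (2 * k) * c" by (rule tau_c)
  from \<beta> show False
  proof
    assume "\<beta> = 0"
    then have "of_int (1 - 2 * int a + 2 * k + 2 * k * \<gamma>) * c = of_int (int a) * t"
      using E two_t by (simp add: k algebra_simps)
    moreover have "odd (1 - 2 * int a + 2 * k + 2 * k * \<gamma>)" by simp
    ultimately show False using odd_c by blast
  next
    assume "\<beta> = 1"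
    then have "y = of_int (- 2 * int a + 2 * k * \<gamma> - 2 * int h * int a) * c"
      using E two_t p2 by (simp add: k t_c algebra_simps)
    \<comment> \<open>Reducing the coefficient modulo the order of \<open>c\<close> makes it a
      natural number, so the multiple of \<open>c\<close> becomes a rotation.\<close>
    also have "\<dots> = of_nat (nat ((- 2 * int a + 2 * k * \<gamma> - 2 * int h * int a) mod (4 * int h))) * c"
    proof -
      have "of_int (n mod (4 * int h)) * c = of_int n * c" for n
      proof -
        have "of_int (n - n mod (4 * int h)) * c = 0"
          unfolding c_of_int by (simp add: minus_mod_eq_mult_div)
        then show ?thesis by (simp add: left_diff_distrib)
      qed
      then show ?thesis using h_pos by (metis of_int_of_nat_eq pos_mod_sign nat_0_le mult_pos_pos zero_less_numeral of_nat_0_less_iff)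
    qed
    also have "\<dots> = f (4 * nat ((- 2 * int a + 2 * k * \<gamma> - 2 * int h * int a) mod (4 * int h)))"
      by (simp only: f_4)
    finally show False using y_X by (auto simp: X_def)
  qed
qed

lemma d_eq: "l p - p = l (l x) - x"
  by (simp add: p_eq)

text \<open>As \<open>d = l^2 x - x\<close>, applying \<open>l^2\<close> twice to \<open>x\<close>
  gives \<open>ph x = 2 d + 2 (j t) = 2 d\<close>. So \<open>2 d = t\<close>, and
  \<open>d = 0\<close> would be a contradiction.\<close>

lemma caseB2_basic:
  assumes phx: "ph x = t" and phy: "ph y = 0" and d: "l p - p = d" "d = of_nat j * c"
  shows "2 * d = t" "l d = d + of_nat j * t" "2 * p = c - t - of_nat j * t" "l (l x) = x + d"
proof -
  note basic = caseB_basic[OF phx phy]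
  show ld: "l d = d + of_nat j * t"
    by (simp add: d(2) basic distrib_left)
  have jt: "2 * (of_nat j * t) = 0" using two_t by (simp add: of_nat_t)
  show llx: "l (l x) = x + d" using d(1) d_eq by (simp add: algebra_simps)
  have "l (l (l (l x))) = l (l (x + d))" by (simp only: llx)
  also have "\<dots> = x + d + (d + of_nat j * t + of_nat j * t)" by (simp add: llx ld)
  finally have E: "x + t = x + d + (d + of_nat j * t + of_nat j * t)" by (simp only: l4 phx)
  show d2: "2 * d = t"
    by (rule ring_cert_2[OF E jt, of _ _ "- 1" "- 1"]) (simp add: algebra_simps)
  have lp: "l p = p + d" using d(1) by (simp add: diff_eq_eq add.commute)
  have "l (l p) = p + d + (d + of_nat j * t)" using arg_cong[OF lp, of l] by (simp add: lp ld)
  then have E: "c - p = p + d + (d + of_nat j * t)" by (simp only: basic)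
  show "2 * p = c - t - of_nat j * t"
    by (rule ring_cert_2[OF E d2, of _ _ "- 1" "- 1"]) (simp add: algebra_simps)
qed

text \<open>Written out, \<open>u (u x) = x\<close> reads \<open>3 (2 y - \<tau>) = 0\<close>. With
  \<open>2 y = \<tau>\<close> the vector \<open>c\<close> becomes fixed by \<open>l\<close>, against
  \<open>l c = c + t\<close>.\<close>

lemma caseB2c:
  assumes phx: "ph x = t" and phy: "ph y = 0" and d: "l p - p = of_nat j * c" and y: "l x - x = y"
  shows False
proof -
  note basic = caseB_basic[OF phx phy]
  define d where "d = of_nat j * c"
  define \<eta> where "\<eta> = of_nat j * t"
  note B2 = caseB2_basic[OF phx phy d[folded d_def] d_def, folded \<eta>_def]
  have \<eta>: "l' \<eta> = \<eta>" "l \<eta> = \<eta>" by (simp_all add: \<eta>_def)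
  have \<eta>2: "2 * \<eta> = 0" using two_t by (simp add: \<eta>_def of_nat_t)
  have lx: "l x = x + y" using y by (simp add: diff_eq_eq add.commute)
  have "l (l x) = x + y + l y" using arg_cong[OF lx, of l] by (simp add: lx)
  then have "x + d = x + y + l y" by (simp only: B2)
  then have ly: "l y = d - y" by (simp add: algebra_simps)
  have l'd: "l' d = d - \<eta>" using arg_cong[OF B2(2), of l'] by (simp add: \<eta> eq_diff_eq)
  have l'y: "l' y = d - \<eta> - y" using arg_cong[OF ly, of l'] by (simp add: l'd algebra_simps)
  have l'x: "l' x = x - d + \<eta> + y" using arg_cong[OF lx, of l'] by (simp add: l'y algebra_simps)
  have ux: "u x = t - x - 3 * y"
    by (rule ring_cert_3[OF u_x B2(1) \<eta>2, of _ _ 1 1 "- 1"]) (simp add: l'y l'x algebra_simps)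
  have "u (u x) = t - (t - x - 3 * y) - 3 * (\<tau> - y)"
    using arg_cong[OF ux, of u] by (simp add: ux u_y'')
  then have E: "x = t - (t - x - 3 * y) - 3 * (\<tau> - y)" using uu[OF x_S] by simp
  have "3 * (2 * y - \<tau>) = 0"
    by (rule ring_cert_1[OF E, of _ _ "- 1"]) (simp add: algebra_simps)
  then have "2 * y - \<tau> = 0"
    by (rule cancel_3[rotated]) (intro S_closed tau_S)
  then have y2: "2 * y = \<tau>" by simp
  have p_x: "2 * p = 4 * x + 2 * y" by (simp add: p_eq lx algebra_simps)
  have c: "c = 4 * x + \<tau> + t + \<eta>"
    by (rule ring_cert_3[OF B2(3) p_x y2, of _ _ "- 1" 1 1]) (simp add: algebra_simps)
  have "l c = l (4 * x + \<tau> + t + \<eta>)" by (rule arg_cong[OF c])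
  also have "\<dots> = c + 2 * (2 * y)" unfolding c by (simp add: lx \<eta> algebra_simps)
  finally have "c + t = c" using two_tau by (simp add: basic y2)
  then show False using t_neq_0 by simp
qed

text \<open>Substituting \<open>l x - x\<close> into \<open>l^2 x = x + d\<close> makes an odd
  multiple of \<open>c\<close> equal to a multiple of \<open>t\<close>.\<close>

lemma caseB2b:
  assumes phx: "ph x = t" and phy: "ph y = 0" and d: "l p - p = of_nat j * c"
    and v: "l x - x = of_nat a * c + p"
  shows False
proof -
  note basic = caseB_basic[OF phx phy]
  define d where "d = of_nat j * c"
  note B2 = caseB2_basic[OF phx phy d[folded d_def] d_def]
  have lp: "l p = p + d" using d by (simp add: diff_eq_eq d_def add.commute)
  have "l (l x - x) = x + d - x - (l x - x)" using B2(4) by (simp add: algebra_simps)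
  then have E: "of_nat a * (c + t) + p + d = d - (of_nat a * c + p)"
    unfolding v by (simp add: basic lp algebra_simps)
  have "of_int (2 * int a + 1) * c = of_int (1 + int j - int a) * t"
    by (rule ring_cert_2[OF E B2(3), of _ _ 1 "- 1"]) (simp add: algebra_simps)
  moreover have "odd (2 * int a + 1)" by simp
  ultimately show False using odd_c by blast
qed

text \<open>An odd multiple of \<open>c\<close>, hence \<open>c\<close>, is a multiple of
  \<open>x\<close>, so \<open>l\<close> is multiplication by some \<open>\<delta>\<close> on the
  cyclic group generated by \<open>x\<close>. Counting identifies this group with \<open>X\<close>,
  and index two of \<open>X\<close> shows that \<open>u\<close> acts on it by a scalar
  \<open>\<kappa>\<close> too. Scalars commute, so \<open>l u l = u\<close> and
  \<open>u^2 = 1\<close> give \<open>l^2 x = x\<close>, that is \<open>d = 0\<close>.\<close>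

lemma caseB2a:
  assumes phx: "ph x = t" and phy: "ph y = 0" and d: "l p - p = of_nat j * c"
    and v: "l x - x = of_nat a * c"
  shows False
proof -
  note basic = caseB_basic[OF phx phy]
  define d where "d = of_nat j * c"
  note B2 = caseB2_basic[OF phx phy d[folded d_def] d_def]
  have lx: "l x = x + of_nat a * c" using v by (simp add: diff_eq_eq add.commute)
  have p2: "2 * p = 4 * x + 2 * (of_nat a * c)" by (simp add: p_eq lx algebra_simps)
  have E: "of_int (1 - 2 * int a) * c = 4 * x + t + of_nat j * t"
    by (rule ring_cert_2[OF p2 B2(3), of _ _ 1 "- 1"]) (simp add: algebra_simps)
  have c0: "of_int (4 * int h) * c = 0" unfolding c_of_int by simp
  \<comment> \<open>Multiplication by \<open>2 h\<close> kills the terms in \<open>t\<close> on the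
    right and turns the left side into \<open>t\<close>, because \<open>c\<close> has order
    \<open>4 h\<close>.\<close>
  have t_x: "t = of_int (8 * int h) * x"
    by (rule ring_cert_3[OF E c0 two_t, of _ _ "of_int (2 * int h)" "of_int (int a)" "of_int (int h * (1 + int j))"])
       (simp add: t_c algebra_simps)
  have "coprime (1 - 2 * int a) (2 ^ K)" by simp
  then obtain \<alpha> \<beta> where \<alpha>: "\<alpha> * (1 - 2 * int a) + \<beta> * 2 ^ K = 1"
    using bezout_int[of "1 - 2 * int a" "2 ^ K"] by (metis coprime_imp_gcd_eq_1)
  define \<gamma> where "\<gamma> = \<alpha> * (4 + 8 * int h * (1 + int j))"
  have "c = of_int (\<alpha> * (1 - 2 * int a) + \<beta> * 2 ^ K) * c" by (simp add: \<alpha>)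
  also have "\<dots> = of_int \<alpha> * (of_int (1 - 2 * int a) * c) + of_int \<beta> * (2 ^ K * c)"
    by (simp add: algebra_simps)
  also have "\<dots> = of_int \<gamma> * x"
    unfolding E two_power[OF c_S] \<gamma>_def by (simp add: t_x algebra_simps)
  finally have c_x: "c = of_int \<gamma> * x" .
  define \<delta> where "\<delta> = 1 + int a * \<gamma>"
  have lx': "l x = of_int \<delta> * x" by (simp add: lx c_x \<delta>_def algebra_simps)
  define H where "H = range (\<lambda>k. of_int k * x)"
  have HI: "of_int k * x \<in> H" for k by (auto simp: H_def)
  have lH: "l w \<in> H" if "w \<in> H" for w
    using that HI by (auto simp: H_def lx' simp flip: mult.assoc of_int_mult)
  have Hadd: "v + w \<in> H" and Hdiff: "v - w \<in> H" if "v \<in> H" "w \<in> H" for v w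
    using that HI by (auto simp: H_def simp flip: distrib_right left_diff_distrib of_int_add of_int_diff)
  have "f i \<in> H" for i
  proof (induction i)
    case 0 then show ?case using HI[of 0] by simp
  next
    case (Suc i) then show ?case using Hadd[OF HI[of 1] lH[OF Suc]] by (simp add: f_Suc')
  qed
  then have XH: "X \<subseteq> H" by (auto simp: X_def)
  have Nx: "of_int (int N) * x = 0"
    using two_t by (simp add: t_x N_eq algebra_simps)
  have Hsub: "H \<subseteq> (\<lambda>k. of_int (int k) * x) ` {..<N}"
  proof
    fix w assume "w \<in> H"
    then obtain k where "w = of_int k * x" by (auto simp: H_def)
    also have "of_int k * x = of_int (k mod int N + int N * (k div int N)) * x" by simp
    also have "\<dots> = of_int (k mod int N) * x + of_int (k div int N) * (of_int (int N) * x)"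
      by (simp only: of_int_add of_int_mult algebra_simps)
    finally have "w = of_int (int (nat (k mod int N))) * x" using Nx N_pos by simp
    moreover have "nat (k mod int N) < N" using N_pos by (simp add: nat_less_iff)
    ultimately show "w \<in> (\<lambda>k. of_int (int k) * x) ` {..<N}" by blast
  qed
  then have "finite H" "card H \<le> N"
    using finite_subset card_mono[OF _ Hsub] card_image_le[of "{..<N}" "\<lambda>k. of_int (int k) * x"]
    by (auto intro: le_trans)
  then have HX: "H = X"
    using card_subset_eq[OF _ XH] card_mono[OF _ XH] card_X by simp
  have lpH: "(l ^^ i) w \<in> H" if "w \<in> H" for w i
    using that by (induction i) (auto simp: lH)
  have l'H: "l' w \<in> H" if "w \<in> H" for w
    using lpH[OF that] l'_eq[of w] that HX X_S by auto
  have "l' y \<notin> X"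
    using lH[of "l' y"] y_X HX by auto
  then have "l' y - y \<in> X"
    using Hdiff unfolding HX by (intro X_index_2[OF _ l'_S[OF y_S] _ y_S y_X])
  then have "(l' y - y) - l' x \<in> H"
    using Hdiff[OF _ l'H[OF HI[of 1]]] HX by simp
  moreover have "u x = (l' y - y) - l' x" by (simp add: u_x)
  ultimately have "u x \<in> H" by simp
  then obtain \<kappa> where \<kappa>: "u x = of_int \<kappa> * x" by (auto simp: H_def)
  have "l (u (l x)) = u x" by (simp only: u_l l_l')
  then have E1: "of_int (\<delta> * \<kappa> * \<delta>) * x = of_int \<kappa> * x"
    by (simp only: lx' linear \<kappa> of_int_mult mult.assoc)
  have "u (u x) = of_int (\<kappa> * \<kappa>) * x" by (simp only: \<kappa> linear of_int_mult mult.assoc)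
  then have E2: "x = of_int (\<kappa> * \<kappa>) * x" by (simp only: uu[OF x_S])
  have "of_int (\<delta> * \<delta>) * x = x"
    by (rule ring_cert_2[OF E1 E2, of _ _ "of_int \<kappa>" "of_int (\<delta> * \<delta>) - 1"]) (simp add: algebra_simps)
  moreover have "l (l x) = of_int (\<delta> * \<delta>) * x" by (simp only: lx' linear of_int_mult mult.assoc)
  ultimately have "d = 0" using B2(4) by simp
  then show False using B2(1) t_neq_0 by simp
qed

text \<open>The possibilities for \<open>l p - p\<close> and \<open>l x - x\<close> that involve
  only \<open>c\<close> and \<open>p\<close> are refuted here. In each remaining outcome a
  reflection appears; it has to be renamed \<open>y\<close> before \<open>caseB1\<close> or
  \<open>caseB2c\<close> applies.\<close>

theorem caseB:
  assumes phx: "ph x = t" and phy: "ph y = 0"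
  obtains i where "even i" "l p - p = f i + (l ^^ i) y"
  | i j where "even i" "l p - p = of_nat j * c" "l x - x = f i + (l ^^ i) y"
proof -
  note basic = caseB_basic[OF phx phy]
  have "l p - p \<in> S" by (intro S_closed p_S)
  moreover have "ph (l p - p) = 0" by (simp add: basic ph_l' p_S)
  ultimately consider j where "l p - p = of_nat j * c" | a where "l p - p = of_nat a * c + p"
    | i where "l p - p = f i + (l ^^ i) y" "even i"
    by (metis caseB_ph_0[OF phx phy])
  then show ?thesis
  proof cases
    case (1 j)
    have "l x - x \<in> S" by (intro S_closed)
    moreover have "ph (l x - x) = 0" by (simp add: ph_l' x_S)
    ultimately consider a where "l x - x = of_nat a * c" | a where "l x - x = of_nat a * c + p"
      | i where "l x - x = f i + (l ^^ i) y" "even i"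
      by (metis caseB_ph_0[OF phx phy])
    then show ?thesis
      using caseB2a[OF phx phy 1] caseB2b[OF phx phy 1] that(2) 1 by cases blast+
  next
    case (2 a)
    have "l (l (l (l x) - x)) = t - (l (l x) - x)"
      using l4[of x] by (simp add: phx)
    then have "l (l (of_nat a * c + p)) = t - (of_nat a * c + p)"
      by (simp only: d_eq[symmetric] 2)
    then have E: "of_nat a * (c + t + t) + (c - p) = t - (of_nat a * c + p)"
      by (simp add: basic)
    have "of_int (2 * int a + 1) * c = of_int 1 * t"
      by (rule ring_cert_2[OF E two_t, of _ _ 1 "- of_nat a"]) (simp add: algebra_simps)
    moreover have "odd (2 * int a + 1)" by simp
    ultimately show ?thesis using odd_c by blast
  next
    case (3 i)
    then show ?thesis using that(1) by blast
  qed
qed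

end

section \<open>Fixed vectors and the middle rotation in quotients of 2-power order\<close>

lemma power_2_decompose:
  fixes i :: nat
  assumes "i \<noteq> 0"
  obtains a b where "i = 2 ^ a * b" "odd b"
  using assms
proof (induction i arbitrary: thesis rule: less_induct)
  case (less i)
  show ?case
  proof (cases "odd i")
    case True
    then show ?thesis using less.prems(1)[of 0 i] by simp
  next
    case False
    then obtain j where "i = 2 * j" by auto
    then show ?thesis
      using less.IH[of j] less.prems(1)[of "Suc _"] less.prems(2) by auto
  qed
qed

context dicyclic_module
begin

definition \<delta> :: "'a \<Rightarrow> 'a" where "\<delta> v = l v - v"

lemma delta_additive: "additive \<delta>"
  by (simp add: additive_def \<delta>_def)

lemmas delta_linear [simp] =
  additive.add[OF delta_additive] additive.zero[OF delta_additive]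
  additive.minus[OF delta_additive] additive.diff[OF delta_additive]
lemmas deltapow_additive = additive_funpow[OF delta_additive]
lemmas deltapow_linear [simp] =
  additive.add[OF deltapow_additive] additive.zero[OF deltapow_additive]
  additive.minus[OF deltapow_additive] additive.diff[OF deltapow_additive]

lemma delta_S: "v \<in> S \<Longrightarrow> \<delta> v \<in> S"
  unfolding \<delta>_def by (intro S_diff l_S)

lemma deltapow_S: "v \<in> S \<Longrightarrow> (\<delta> ^^ i) v \<in> S"
  by (induction i) (auto simp: delta_S)

lemma deltapow_two: "2 * v = 0 \<Longrightarrow> 2 * (\<delta> ^^ i) v = 0"
proof (induction i)
  case (Suc i)
  have "2 * \<delta> w = \<delta> (2 * w)" for w by (simp add: \<delta>_def right_diff_distrib)
  then show ?case using Suc by simp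
qed simp

text \<open>On \<open>2\<close>-torsion the mixed term of \<open>(l - 1)^2\<close> vanishes, so
  taking \<open>2^a\<close>-th powers is additive. For \<open>N = 2^n\<close> and
  \<open>l^N = 1\<close> this makes \<open>\<delta>\<close> nilpotent there.\<close>

lemma deltapow_pow2: "2 * v = 0 \<Longrightarrow> (\<delta> ^^ (2 ^ a)) v = (l ^^ (2 ^ a)) v - v"
proof (induction a arbitrary: v)
  case (Suc a)
  have "(\<delta> ^^ (2 ^ Suc a)) v = (\<delta> ^^ (2 ^ a)) ((\<delta> ^^ (2 ^ a)) v)"
    by (simp only: power_Suc mult_2 funpow_add o_apply)
  also have "\<dots> = (l ^^ (2 ^ a)) ((\<delta> ^^ (2 ^ a)) v) - (\<delta> ^^ (2 ^ a)) v"
    using deltapow_two[OF Suc.prems] by (rule Suc.IH)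
  also have "\<dots> = (l ^^ (2 ^ a)) ((l ^^ (2 ^ a)) v - v) - ((l ^^ (2 ^ a)) v - v)"
    by (simp only: Suc.IH[OF Suc.prems])
  also have "\<dots> = (l ^^ (2 ^ Suc a)) v - v - (l ^^ (2 ^ a)) (2 * v) + 2 * v"
  proof -
    have "(l ^^ (2 ^ Suc a)) v = (l ^^ (2 ^ a)) ((l ^^ (2 ^ a)) v)"
      by (simp only: power_Suc mult_2 funpow_add o_apply)
    then show ?thesis by (simp add: algebra_simps)
  qed
  finally show ?case using Suc.prems by simp
qed (simp add: \<delta>_def)

lemma u_l': "u (l' v) = l (u v)"
  using u_l[of "l' v"] by (metis l_l')

text \<open>This is the group identity \<open>x^i y x^i = y\<close>, read additively.\<close>

lemma lpow_u_f: "(l ^^ i) (u (f i)) = y - (l ^^ i) y - f i"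
proof (induction i)
  case (Suc i)
  have "(l ^^ Suc i) (u (f (Suc i))) = (l ^^ i) (l (u x)) + (l ^^ i) (u (f i))"
    by (simp add: f_Suc' u_l funpow_swap1)
  also have "l (u x) = y - x - l y" by (simp add: u_x)
  finally show ?case
    unfolding Suc by (simp add: f_Suc funpow_swap1)
qed simp

lemma lpow_u_lpow: "(l ^^ i) (u ((l ^^ i) v)) = u v"
proof (induction i arbitrary: v)
  case (Suc i)
  have "(l ^^ Suc i) (u ((l ^^ Suc i) v)) = l ((l ^^ i) (u ((l ^^ i) (l v))))"
    by (simp add: funpow_swap1)
  then show ?case by (simp add: Suc u_l)
qed simp

text \<open>The left side is the square of the point \<open>x^i y\<close> in the brace.\<close>

lemma refl_square: "f i + (l ^^ i) y + (l ^^ i) (u (f i + (l ^^ i) y)) = f m"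
  by (simp add: lpow_u_f lpow_u_lpow u_y')

lemma f_mult_fixed: "l (f i) = f i \<Longrightarrow> f (k * i) = of_nat k * f i"
proof (induction k)
  case (Suc k)
  have "(l ^^ j) (f i) = f i" for j
    by (induction j) (simp_all add: Suc.prems)
  then show ?case using f_add[of "k * i" i] Suc by (simp add: algebra_simps)
qed simp

text \<open>For a rotation fixed by \<open>l\<close>, multiples and powers agree, so a suitable
  \<open>2\<close>-power multiple of \<open>f i\<close> is the element of order two in the cyclic
  \<open>2\<close>-group of rotations.\<close>

lemma mid_multiple:
  assumes "N = 2 ^ n" "\<not> N dvd i" "l (f i) = f i"
  obtains k where "f (N div 2) = of_nat k * f i"
proof -
  have i0: "i \<noteq> 0" using assms(2) by (metis dvd_0_right)
  obtain a b where ab: "i = 2 ^ a * b" "odd b"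
    using power_2_decompose[OF i0] .
  have "a < n"
  proof (rule ccontr)
    assume "\<not> a < n"
    then have "2 ^ n dvd (2::nat) ^ a" by (simp add: le_imp_power_dvd)
    then show False using assms(1,2) ab by simp
  qed
  then obtain r where r: "n = Suc (a + r)"
    by (metis less_imp_Suc_add)
  obtain q where q: "b = Suc (2 * q)" using ab(2) by (metis oddE Suc_eq_plus1)
  have N2: "N div 2 = 2 ^ (a + r)" "N = 2 * 2 ^ (a + r)" using assms(1) r by simp_all
  have "2 ^ r * i = 2 ^ (a + r) + N * q"
    by (simp add: ab q N2 power_add algebra_simps)
  then have "f (2 ^ r * i) = f (N div 2)"
    using f_eq_iff[of "N div 2" "2 ^ r * i"] by (simp add: N2)
  then show ?thesis using f_mult_fixed[OF assms(3), of "2 ^ r"] that by metis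
qed

lemma mid_fixed_rot:
  assumes "N = 2 ^ n" "\<not> N dvd i" "l (f i) = f i" "u (f i) = f i"
  shows "l (f (N div 2)) = f (N div 2) \<and> u (f (N div 2)) = f (N div 2)"
proof -
  obtain k where "f (N div 2) = of_nat k * f i"
    using mid_multiple[OF assms(1-3)] .
  then show ?thesis using assms by simp
qed

text \<open>The fixed point of a \<open>2\<close>-group acting on a nonzero \<open>2\<close>-group,
  made explicit: the last nonzero \<open>2\<close>-power multiple of \<open>x\<close>, then its last
  nonzero image under powers of the nilpotent \<open>\<delta>\<close>, then symmetrisation under
  \<open>u\<close>.\<close>

lemma fixed_vector:
  assumes N: "N = 2 ^ n" "n > 0" and two: "\<And>v. v \<in> S \<Longrightarrow> 2 ^ K * v = 0"
  obtains w where "w \<in> S" "w \<noteq> 0" "l w = w" "u w = w"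
proof -
  have x0: "x \<noteq> 0" using f_eq_0_iff[of 1] N by simp
  define k where "k = (LEAST k. 2 ^ k * x = 0)"
  have k: "2 ^ k * x = 0" unfolding k_def by (rule LeastI[of _ K]) (rule two[OF x_S])
  then have "k \<noteq> 0" using x0 by (intro notI) simp
  then obtain k' where k': "k = Suc k'" by (cases k) auto
  define w0 where "w0 = 2 ^ k' * x"
  have "w0 \<noteq> 0" using not_less_Least[of k' "\<lambda>k. 2 ^ k * x = 0"] k' by (simp add: w0_def k_def)
  have w0: "2 * w0 = 0" "w0 \<in> S"
    using k k' S_of_nat[OF x_S, of "2 ^ k'"] by (simp_all add: w0_def mult.assoc)
  have "(\<delta> ^^ N) w0 = 0"
    using deltapow_pow2[OF w0(1), of n] l_N[OF w0(2)] by (simp add: N)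
  define r where "r = (LEAST r. (\<delta> ^^ r) w0 = 0)"
  have r: "(\<delta> ^^ r) w0 = 0" unfolding r_def by (rule LeastI) fact
  then have "r \<noteq> 0" using \<open>w0 \<noteq> 0\<close> by (intro notI) simp
  then obtain r' where r': "r = Suc r'" by (cases r) auto
  define w1 where "w1 = (\<delta> ^^ r') w0"
  have w1: "w1 \<noteq> 0" "w1 \<in> S" "2 * w1 = 0"
    using not_less_Least[of r' "\<lambda>r. (\<delta> ^^ r) w0 = 0"] r' deltapow_S w0 deltapow_two
    by (simp_all add: w1_def r_def)
  have "\<delta> w1 = 0" using r by (simp add: r' w1_def)
  then have lw1: "l w1 = w1" by (simp add: \<delta>_def)
  then have "l' w1 = w1" by (metis l'_l)
  then have luw1: "l (u w1) = u w1" using u_l'[of w1] by simp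
  have "(l ^^ m) w1 = w1" by (induction m) (simp_all add: lw1)
  then have uuw1: "u (u w1) = w1" by (simp add: u_u)
  show ?thesis
  proof (cases "w1 + u w1 = 0")
    case False
    show ?thesis
      by (rule that[of "w1 + u w1"])
        (use w1 False lw1 luw1 uuw1 in \<open>simp_all add: S_add u_S add.commute\<close>)
  next
    case True
    have "w1 + w1 = 0" using w1(3) by (simp only: mult_2)
    then have "u w1 = w1" using True by (metis add_left_imp_eq)
    then show ?thesis using that w1 lw1 by blast
  qed
qed

text \<open>A fixed reflection yields a fixed rotation directly only if its square
  \<open>f m = 2 y\<close> is nonzero. Otherwise \<open>2 y = 0\<close>, and for the middle rotation
  \<open>t\<close> the vector \<open>d = l t - t\<close> satisfies
  \<open>d = P (l (l d) - d)\<close> with \<open>P\<close> commuting with \<open>l\<close>; as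
  \<open>l - 1\<close> is nilpotent on \<open>2\<close>-torsion, \<open>d = 0\<close>.\<close>

lemma mid_fixed_refl:
  assumes N: "N = 2 ^ n" and N8: "8 dvd N \<or> f m \<noteq> 0" and ly: "l y = y" and uy: "u y = y"
  shows "l (f (N div 2)) = f (N div 2) \<and> u (f (N div 2)) = f (N div 2)"
proof (cases "f m = 0")
  case False
  have "f m = 2 * y" using u_y' uy by (simp add: eq_diff_eq)
  then have "l (f m) = f m" "u (f m) = f m" using ly uy by simp_all
  then show ?thesis
    using mid_fixed_rot[OF N] False f_eq_0_iff by blast
next
  case True
  then have y2: "2 * y = 0" using u_y' uy by (simp add: eq_diff_eq)
  obtain h where h: "N = 8 * h" using N8 True by auto
  then have h0: "h > 0" using N_pos by simp
  define t where "t = f (4 * h)"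
  have Nt: "N div 2 = 4 * h" using h by simp
  have lpy [simp]: "(l ^^ i) y = y" for i by (induction i) (simp_all add: ly)
  have l'y: "l' y = y" using ly by (metis l'_l)
  have t0: "t \<noteq> 0" using h0 by (simp add: t_def f_eq_0_iff h)
  have fy: "f i \<noteq> y" for i using f_neq[of i 0] by simp
  have f_mid: "f i = 0 \<or> f i = t" if "N dvd 2 * i" for i
  proof -
    have "4 * h dvd i" using that dvd_mult_cancel_left[of 2 "4 * h" i] by (simp add: h)
    then obtain q where q: "i = 4 * h * q" by auto
    have "i mod N = 0 \<or> i mod N = 4 * h"
    proof (cases "even q")
      case True
      then show ?thesis by (auto simp: q h)
    next
      case False
      then obtain r where "q = 2 * r + 1" by (rule oddE)
      then have "i = 4 * h + N * r" by (simp add: q h algebra_simps)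
      then show ?thesis using h0 by (simp add: h)
    qed
    then show ?thesis using f_mod[of i] by (auto simp: t_def)
  qed
  have f_u: "N dvd 2 * i" if "u (f i) = f i" for i
  proof -
    have "(l ^^ i) (f i) = - f i" using lpow_u_f[of i] by (simp add: that)
    then have "f (i + i) = 0" unfolding f_add by simp
    then show ?thesis by (simp add: f_eq_0_iff mult_2)
  qed
  have fix_u: "w = 0 \<or> w = y \<or> w = t \<or> w = t + y" if "w \<in> S" "u w = w" for w
    using that(1)
  proof (cases rule: S_cases)
    case (rot i)
    then show ?thesis using f_mid f_u that by auto
  next
    case (refl i)
    then have "u (f i) = f i" using that(2) by (simp add: uy)
    then show ?thesis using f_mid f_u refl by auto
  qed
  have lt: "l t = t"
  proof (rule ccontr)
    assume ne: "l t \<noteq> t"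
    \<comment> \<open>\<open>b\<close> is fixed by \<open>u\<close>, hence one of the four points
      above; this confines \<open>l x - x = l b\<close>.\<close>
    define b where "b = x - l' x"
    have ux: "u x = - l' x" by (simp add: u_x l'y)
    have "u b = b" by (simp add: b_def ux u_l')
    have bS: "b \<in> S" unfolding b_def by (intro S_closed)
    then consider "b = 0 \<or> b = y" | "b = t \<or> b = t + y"
      using fix_u \<open>u b = b\<close> by blast
    then have b2: "2 * b = 0 \<or> 2 * b = y"
    proof cases
      case 1 then show ?thesis using y2 by auto
    next
      case 2
      have "2 * b = 2 * t" using 2 y2 by (auto simp: distrib_left)
      have "2 * b \<in> S" "u (2 * b) = 2 * b" using bS \<open>u b = b\<close> by (simp_all add: S_numeral)
      then have "2 * b = 0 \<or> 2 * b = y \<or> 2 * b = t \<or> 2 * b = t + y" by (rule fix_u)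
      moreover have "2 * t = t + t" by simp
      ultimately show ?thesis
        using \<open>2 * b = 2 * t\<close> t0 fy[of "4 * h"] by (auto simp: t_def)
    qed
    define z where "z = 2 * b"
    have z3: "z = 0 \<or> z = y" using b2 by (simp add: z_def)
    have z: "l z = z" "2 * z = 0" "z = 0 \<or> z = y"
      using z3 ly y2 by auto
    define v where "v = l b"
    have v: "l x = x + v" by (simp add: v_def b_def)
    have v2: "2 * v = z"
    proof -
      have "2 * v = l (2 * b)" by (simp add: v_def)
      then show ?thesis using z by (simp add: z_def)
    qed
    define q where "q = l v - v"
    have q2: "2 * q = 0"
    proof -
      have "2 * q = l (2 * v) - 2 * v" by (simp add: q_def right_diff_distrib)
      then show ?thesis using z by (simp add: v2)
    qed
    have lv: "l v = v + q" by (simp add: q_def)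
    have f4: "f 4 = 4 * x + z + (q + l q)"
    proof -
      have "f 4 = 4 * x + 6 * v + (q + l q) + 2 * q"
        by (simp add: numeral_eq_Suc f_Suc v lv algebra_simps)
      then have E: "f 4 = 4 * x + 6 * v + (q + l q)" by (simp only: q2 add_0_right)
      show ?thesis
        by (rule ring_cert_3[OF E v2 z(2), of _ _ 1 3 1]) (simp add: algebra_simps)
    qed
    have x4: "4 * x = 0 \<or> 4 * x = y"
    proof -
      have "l (4 * x) = 4 * x + 2 * (2 * v)" by (simp add: v distrib_left)
      then have lx4: "l (4 * x) = 4 * x" using z by (simp only: v2) simp
      \<comment> \<open>A nonzero rotation fixed by \<open>l\<close> has \<open>t\<close> among its
        multiples, against \<open>l t \<noteq> t\<close>.\<close>
      have rot: "f i = 0" if li: "l (f i) = f i" for i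
      proof (rule ccontr)
        assume "f i \<noteq> 0"
        then obtain k where "f (N div 2) = of_nat k * f i"
          using mid_multiple[OF N _ li] by (metis f_eq_0_iff)
        then show False using li ne by (simp add: Nt t_def)
      qed
      have "4 * x \<in> S" by (intro S_closed)
      then show ?thesis
      proof (cases rule: S_cases)
        case (rot i)
        then show ?thesis using \<open>\<And>i. l (f i) = f i \<Longrightarrow> f i = 0\<close>[of i] lx4 by simp
      next
        case (refl i)
        then have "l (f i + y) = f i + y" using lx4 by simp
        then have "l (f i) = f i" by (simp add: ly)
        then show ?thesis using \<open>\<And>i. l (f i) = f i \<Longrightarrow> f i = 0\<close>[of i] refl by simp
      qed
    qed
    define \<epsilon> where "\<epsilon> = 4 * x + z"
    have eps: "\<epsilon> = 0 \<or> \<epsilon> = y" "l \<epsilon> = \<epsilon>"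
    proof -
      have "y + y = 0" using y2 by (simp only: mult_2)
      then show "\<epsilon> = 0 \<or> \<epsilon> = y" using x4 z(3) by (elim disjE) (simp_all add: \<epsilon>_def)
      then show "l \<epsilon> = \<epsilon>" using ly by auto
    qed
    have f4': "f 4 = \<epsilon> + (q + l q)" by (simp add: f4 \<epsilon>_def)
    have f4_neq: "f 4 \<noteq> 0" "f 4 \<noteq> y"
    proof -
      have "\<not> 8 * h dvd 4" using h0 by (auto dest!: dvd_imp_le)
      then show "f 4 \<noteq> 0" by (simp add: f_eq_0_iff h)
    qed (rule fy)
    define d where "d = l t - t"
    have q_d: "q = l d"
    proof -
      consider "b = 0 \<or> b = y" | "b = t \<or> b = t + y"
        using fix_u bS \<open>u b = b\<close> by blast
      then show ?thesis
      proof cases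
        case 1
        then have "l b = b" using ly by auto
        then have "q = 0" by (simp add: q_def v_def)
        then show ?thesis using f4' eps f4_neq by simp
      next
        case 2
        then have "l b - b = d" using ly by (auto simp: d_def)
        moreover have "q = l (l b - b)" by (simp add: q_def v_def)
        ultimately show ?thesis by simp
      qed
    qed
    have "l (2 * d) = l 0" using q2 by (simp add: q_d)
    then have d2: "2 * d = 0" by (metis l'_l)
    have f4i: "f (4 * i) = (\<Sum>j<i. (l ^^ (4 * j)) (f 4))" for i
    proof (induction i)
      case (Suc i)
      then show ?case using f_add[of "4 * i" 4] by (simp add: add.commute[of 4])
    qed simp
    define P where "P w = (\<Sum>j<h. (l ^^ (4 * j)) (l w))" for w
    have P_additive: "additive P"
      by (simp add: additive_def P_def sum.distrib)
    note P_lin = additive.add[OF P_additive] additive.diff[OF P_additive] additive.zero[OF P_additive]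
    have lP: "l (P w) = P (l w)" for w
      by (simp add: P_def additive.sum[OF l_additive] funpow_swap1)
    \<comment> \<open>\<open>t\<close> is the sum of the translates of \<open>f 4\<close> under
      powers of \<open>l^4\<close>, so \<open>d\<close> is expressed through
      \<open>l (f 4) - f 4\<close>, where only \<open>q = l d\<close> survives.\<close>
    have "d = (\<Sum>j<h. (l ^^ (4 * j)) (l (f 4) - f 4))"
      by (simp add: d_def t_def f4i additive.sum[OF l_additive] sum_subtractf funpow_swap1)
    also have "l (f 4) - f 4 = l (l (l d) - d)"
      by (simp add: f4' eps q_d)
    finally have d_P: "d = P (l (l d) - d)" by (simp only: P_def)
    have P_delta: "(\<delta> ^^ k) (P w) = P ((\<delta> ^^ k) w)" for k w
      by (induction k) (simp_all add: \<delta>_def lP P_lin)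
    have l_delta: "(\<delta> ^^ k) (l w) = l ((\<delta> ^^ k) w)" for k w
      by (induction k) (simp_all add: \<delta>_def)
    \<comment> \<open>\<open>d\<close> is the image of \<open>\<delta> d\<close> under an operator
      commuting with \<open>\<delta>\<close>, so the exponent that kills \<open>d\<close> can be
      lowered down to \<open>0\<close>.\<close>
    have nil: "d = 0" if "(\<delta> ^^ k) d = 0" for k
      using that
    proof (induction k)
      case (Suc k)
      have "l (l d) - d = l (\<delta> d) + \<delta> d" by (simp add: \<delta>_def)
      then have "d = P (l (\<delta> d) + \<delta> d)" using d_P by simp
      then have "(\<delta> ^^ k) d = (\<delta> ^^ k) (P (l (\<delta> d) + \<delta> d))" by (rule arg_cong)
      also have "\<dots> = P (l ((\<delta> ^^ k) (\<delta> d)) + (\<delta> ^^ k) (\<delta> d))"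
        by (simp only: P_delta deltapow_linear l_delta)
      also have "(\<delta> ^^ k) (\<delta> d) = 0" using Suc.prems by (simp add: funpow_swap1)
      finally show ?case using Suc.IH by (simp add: P_lin)
    qed simp
    have "d \<in> S" unfolding d_def t_def by (intro S_closed)
    then have "(\<delta> ^^ N) d = 0"
      using deltapow_pow2[OF d2, of n] l_N by (simp add: N)
    then have "d = 0" by (rule nil)
    then show False using ne by (simp add: d_def)
  qed
  have lpt: "(l ^^ i) t = t" for i by (induction i) (simp_all add: lt)
  have "f (4 * h + 4 * h) = 0" by (simp add: f_eq_0_iff h)
  then have "t + t = 0" unfolding f_add by (simp add: lpt flip: t_def)
  have "(l ^^ i) (u t) = u t" for i
  proof (induction i)
    case (Suc i)
    have "l (u t) = u (l' t)" by (rule u_l'[symmetric])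
    also have "l' t = t" using lt by (metis l'_l)
    finally show ?case using Suc by simp
  qed simp
  then have "u t = - t" using lpow_u_f[of "4 * h"] by (simp flip: t_def)
  then have "u t = t" using \<open>t + t = 0\<close> by (simp only: neg_eq_iff_add_eq_0)
  then show ?thesis using lt by (simp add: Nt flip: t_def)
qed

end

section \<open>Fourth power trivial: the possible values of \<open>l x - x\<close>\<close>

locale exact_module = dicyclic_module +
  fixes K :: nat
  assumes N_eq: "N = 2 * m" and m_even: "even m"
    and quartic: "v \<in> S \<Longrightarrow> l (l (l (l v))) = v"
    and uu: "v \<in> S \<Longrightarrow> u (u v) = v"
    and l_t [simp]: "l (f m) = f m" and u_t [simp]: "u (f m) = f m"
    and two_part: "v \<in> S \<Longrightarrow> 2 ^ K * (l v - v) = 0"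
begin

text \<open>\<open>t\<close> is now \<open>x^m\<close>, the involution of the group.
  \<open>c\<close> is again the norm of \<open>x\<close>; \<open>l\<close> fixes it and its additive
  order is \<open>M\<close>.\<close>

definition "t = f m"
definition "c = f 4"
definition "M = m div 2"

lemma m_eq: "m = 2 * M" and M_pos: "M > 0"
proof -
  show "m = 2 * M" using m_even by (simp add: M_def)
  then show "M > 0" using m_pos by (cases M) auto
qed

lemma N_M: "N = 4 * M"
proof -
  have "N = 2 * (2 * M)" by (subst m_eq[symmetric]) (rule N_eq)
  then show ?thesis by simp
qed

lemma of_nat_m: "of_nat m = (2 * of_nat M :: 'a)"
  by (metis m_eq of_nat_mult of_nat_numeral)

lemma t_fix [simp]: "l t = t" "u t = t" by (simp_all add: t_def)
lemma l'_t [simp]: "l' t = t" by (metis t_fix(1) l'_l)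
lemma lpow_t [simp]: "(l ^^ i) t = t" by (induction i) auto

lemma two_t: "2 * t = 0"
proof -
  have "f (m + m) = 0" unfolding f_eq_0_iff N_eq by (simp flip: mult_2)
  then have "t + t = 0" unfolding f_add t_def[symmetric] by simp
  then show ?thesis by (simp only: mult_2)
qed

lemma two_t': "t + t = 0"
  using two_t by (simp only: mult_2)

lemma u_y'': "u y = t - y"
  by (simp add: u_y' t_def)

lemma t_neq_0: "t \<noteq> 0"
  using m_pos by (auto simp: t_def f_eq_0_iff N_eq dest!: dvd_imp_le)

lemma minus_t: "- t = t"
  using two_t by (simp only: mult_2 neg_eq_iff_add_eq_0)

lemma t_S: "t \<in> S" and c_S: "c \<in> S" by (simp_all add: t_def c_def f_S)

lemma f_m_mult: "f (m * q) = of_nat q * t"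
  using f_mult_fixed[of m q] by (simp add: t_def mult.commute)

lemma of_nat_t: "of_nat i * t = (if even i then 0 else t)"
proof (induction i)
  case (Suc i)
  then show ?case using two_t' by (auto simp: distrib_right)
qed simp

text \<open>\<open>S\<close> may contain odd torsion here; only differences \<open>l v - v\<close>
  are known to be killed by \<open>2 ^ K\<close>, so this becomes a hypothesis on
  \<open>v\<close>.\<close>

lemma odd_cancel:
  assumes "2 ^ K * v = 0" "of_int k * v = 0" "odd k"
  shows "v = 0"
proof -
  have "coprime k (2 ^ K)" using assms(3) by simp
  then obtain a b where "a * k + b * 2 ^ K = 1"
    using bezout_int[of k "2 ^ K"] by (metis coprime_imp_gcd_eq_1)
  then have "v = of_int (a * k + b * 2 ^ K) * v" by simp
  also have "\<dots> = of_int a * (of_int k * v) + of_int b * (2 ^ K * v)"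
    by (simp add: algebra_simps)
  finally show ?thesis using assms by simp
qed

lemma c_eq: "c = x + l x + l (l x) + l (l (l x))"
  by (simp add: c_def numeral_eq_Suc f_Suc add.assoc)

lemma l_c [simp]: "l c = c"
  by (simp add: c_eq quartic x_S)

lemma l'_c [simp]: "l' c = c" by (metis l_c l'_l)
lemma lpow_c [simp]: "(l ^^ i) c = c" by (induction i) auto

lemma l'_eq3: "v \<in> S \<Longrightarrow> l' v = l (l (l v))"
  using arg_cong[OF quartic, of v l'] by simp

lemma u_c: "u c = - c"
proof -
  have l'4: "l' (l' (l' (l' v))) = v" if "v \<in> S" for v
    using arg_cong[OF quartic[OF that], of "\<lambda>v. l' (l' (l' (l' v)))"] by simp
  have "u c = l' (l' (l' (l' y))) - y - l' (l' (l' (l' c)))"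
    by (simp add: c_eq u_l u_x)
  then show ?thesis by (simp add: l'4 y_S)
qed

lemma f_4: "f (4 * i) = of_nat i * c"
  using f_mult_fixed[of 4 i] by (simp add: c_def[symmetric] mult.commute)

lemma lpow_4: "v \<in> S \<Longrightarrow> (l ^^ (4 * i)) v = v"
proof (induction i)
  case (Suc i)
  have "(l ^^ (4 * Suc i)) v = (l ^^ 4) ((l ^^ (4 * i)) v)"
    by (simp only: mult_Suc_right funpow_add o_apply)
  then show ?case using Suc quartic by (simp add: numeral_eq_Suc)
qed simp

lemma f_4_add: "f (4 * i + j) = of_nat i * c + f j"
  by (simp only: f_add f_4 lpow_4[OF f_S])

lemma lpow_4_add: "v \<in> S \<Longrightarrow> (l ^^ (4 * i + j)) v = (l ^^ j) v"
  by (simp only: funpow_add o_apply lpow_4 lpow_S)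

lemma c_of_nat: "of_nat i * c = 0 \<longleftrightarrow> M dvd i"
  by (simp add: f_4[symmetric] f_eq_0_iff N_M)

lemma c_of_int: "of_int k * c = 0 \<longleftrightarrow> int M dvd k"
proof (cases k)
  case (nonneg n)
  then show ?thesis using c_of_nat[of n] by simp
next
  case (neg n)
  then have "of_int k * c = 0 \<longleftrightarrow> of_nat (Suc n) * c = 0"
    by (simp del: of_nat_Suc)
  also have "\<dots> \<longleftrightarrow> int M dvd int (Suc n)" by (simp only: c_of_nat int_dvd_int_iff)
  finally show ?thesis using neg by (simp only: dvd_minus_iff)
qed

lemma M_c: "of_nat M * c = 0"
  by (simp add: c_of_nat)

lemma f_2: "f 2 = x + l x" and f_3: "f 3 = c - l' x"
proof -
  show "f 2 = x + l x" by (simp add: numeral_eq_Suc f_Suc)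
  have "f 3 = x + l x + l (l x)" by (simp add: numeral_eq_Suc f_Suc)
  then show "f 3 = c - l' x" by (simp add: c_eq l'_eq3[OF x_S])
qed

text \<open>As \<open>l\<close> fixes \<open>c\<close>, a rotation depends on its exponent modulo
  \<open>4\<close> up to multiples of \<open>c\<close>. The classification branches along these four
  cases.\<close>

lemma f_cases:
  obtains (0) a where "i = 4 * a" "f i = of_nat a * c" | (1) a where "i = 4 * a + 1" "f i = of_nat a * c + x"
    | (2) a where "i = 4 * a + 2" "f i = of_nat a * c + (x + l x)"
    | (3) a where "i = 4 * a + 3" "f i = of_nat a * c + (c - l' x)"
proof (cases i rule: nat_mod_4_cases)
  case (0 a) then show ?thesis using that(1)[of a] by (simp add: f_4)
next
  case (1 a) then show ?thesis using that(2)[of a] f_4_add[of a 1] by simp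
next
  case (2 a) then show ?thesis using that(3)[of a] f_4_add[of a 2] by (simp add: f_2)
next
  case (3 a) then show ?thesis using that(4)[of a] f_4_add[of a 3] by (simp add: f_3)
qed

lemma odd_f_neq_0: "odd i \<Longrightarrow> f i \<noteq> 0"
proof
  assume "odd i" "f i = 0"
  then have "4 * M dvd i" by (simp add: f_eq_0_iff N_M)
  then have "2 dvd i" by (rule dvd_trans[rotated]) simp
  then show False using \<open>odd i\<close> by simp
qed

text \<open>If \<open>l x - x\<close> were an odd rotation, \<open>l^4 x = x\<close> would make
  \<open>15\<close> or \<open>3\<close> times it vanish. Differences have \<open>2\<close>-power
  order, so it would be \<open>0\<close>, which no odd rotation is.\<close>

lemma diff_not_odd:
  assumes "odd i"
  shows "l x - x \<noteq> f i"
proof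
  assume v: "l x - x = f i"
  have K: "2 ^ K * f i = 0" using two_part[OF x_S] by (simp add: v)
  have "f i = 0"
  proof (cases i rule: f_cases)
    case (1 a)
    have lx: "l x = 2 * x + of_nat a * c" using v 1 by (simp add: algebra_simps)
    have "l (l (l (l x))) = 16 * x + 15 * (of_nat a * c)"
      by (simp add: lx algebra_simps)
    then have "of_int 15 * f i = 0" using quartic[OF x_S] 1 by (simp add: algebra_simps)
    then show ?thesis by (rule odd_cancel[OF K]) simp
  next
    case (3 a)
    define C where "C = of_nat (Suc a) * c"
    have lC: "l C = C" "l' C = C" by (simp_all add: C_def del: of_nat_Suc)
    have fi: "f i = C - l' x" using 3 by (simp add: C_def algebra_simps)
    have lx: "l x = x + C - l' x" using v fi by (simp add: algebra_simps)
    have "l (l x) = l x + C - x" using arg_cong[OF lx, of l] by (simp add: lC)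
    then have llx: "l (l x) = 2 * C - l' x" by (simp add: lx)
    have "l (l (l x)) = 2 * C - x" using arg_cong[OF llx, of l] by (simp add: lC)
    then have l'x: "l' x = 2 * C - x" by (simp add: l'_eq3 x_S)
    have "x = 2 * C - l x" using arg_cong[OF l'x, of l] by (simp add: lC)
    then have E: "3 * x = 3 * C" using lx l'x by (simp add: algebra_simps)
    have "of_int 3 * f i = 0"
      by (rule ring_cert_1[OF E, of _ _ 1]) (simp add: fi l'x algebra_simps)
    then show ?thesis by (rule odd_cancel[OF K]) simp
  qed (use assms in auto)
  then show False using odd_f_neq_0 assms by simp
qed

lemma two_torsion_X:
  assumes "2 * f i = 0" "l (f i) = f i"
  shows "f i = 0 \<or> f i = t"
proof -
  have "f (2 * i) = 0" using f_mult_fixed[OF assms(2), of 2] assms(1) by simp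
  then have "m dvd i" by (simp add: f_eq_0_iff N_eq)
  then obtain q where "i = m * q" by auto
  then show ?thesis by (simp add: f_m_mult of_nat_t)
qed

lemma u_e: "e = l y - y \<Longrightarrow> u e = l' e"
  by (simp add: u_l u_y'')

text \<open>As in \<open>caseB2a\<close>, \<open>X\<close> is the cyclic additive group generated by
  \<open>x\<close>, and \<open>l\<close>, \<open>u\<close> act on it by scalars, whence
  \<open>l^2 x = x\<close>. So \<open>w = l x - x\<close> has \<open>2 w = 0\<close> and is
  \<open>0\<close> or \<open>t\<close>. Its exponent is a multiple of \<open>4\<close>, which is
  where \<open>4 dvd m\<close> comes from when \<open>w = t\<close>.\<close>

lemma case_I:
  assumes v: "l x - x = of_nat a * c"
  shows "X = range (\<lambda>k. of_int k * x)" "l x = x \<or> l x = x + t \<and> 4 dvd m" "t = of_nat m * x"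
proof -
  define w where "w = of_nat a * c"
  have lx: "l x = x + w" using v by (simp add: w_def diff_eq_eq add.commute)
  have lw: "l w = w" by (simp add: w_def)
  have "l (l (l (l x))) = x + 4 * w" by (simp add: lx lw)
  then have w4: "4 * w = 0" using quartic[OF x_S] by simp
  have Mw: "of_nat M * w = 0" using M_c by (simp add: w_def mult.left_commute)
  have c_x: "c = 4 * x + 2 * w"
    by (rule ring_cert_1[OF w4, of _ _ 1]) (simp add: c_eq lx lw algebra_simps)
  have c_x': "c = of_int (4 * (1 + 2 * int a)) * x"
    by (rule ring_cert_3[OF c_x w4 w_def, of _ _ "of_int (1 + 2 * int a)" "of_int (int a)" 2])
       (simp add: algebra_simps)
  define H where "H = range (\<lambda>k. of_int k * x)"
  have HI: "of_int k * x \<in> H" for k by (auto simp: H_def)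
  define \<gamma> where "\<gamma> = 1 + int a * (4 * (1 + 2 * int a))"
  have lx': "l x = of_int \<gamma> * x" by (simp add: lx w_def c_x' \<gamma>_def algebra_simps)
  have lH: "l w \<in> H" if "w \<in> H" for w
    using that HI by (auto simp: H_def lx' simp flip: mult.assoc of_int_mult)
  have Hadd: "v + w \<in> H" and Hdiff: "v - w \<in> H" if "v \<in> H" "w \<in> H" for v w
    using that HI by (auto simp: H_def simp flip: distrib_right left_diff_distrib of_int_add of_int_diff)
  have "f i \<in> H" for i
  proof (induction i)
    case 0 then show ?case using HI[of 0] by simp
  next
    case (Suc i) then show ?case using Hadd[OF HI[of 1] lH[OF Suc]] by (simp add: f_Suc')
  qed
  then have XH: "X \<subseteq> H" by (auto simp: X_def)
  have Nx: "of_int (int N) * x = 0"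
    by (rule ring_cert_3[OF c_x M_c Mw, of _ _ "- of_nat M" 1 "- 2"]) (simp add: N_M algebra_simps)
  have Hsub: "H \<subseteq> (\<lambda>k. of_int (int k) * x) ` {..<N}"
  proof
    fix w assume "w \<in> H"
    then obtain k where "w = of_int k * x" by (auto simp: H_def)
    also have "of_int k * x = of_int (k mod int N + int N * (k div int N)) * x" by simp
    also have "\<dots> = of_int (k mod int N) * x + of_int (k div int N) * (of_int (int N) * x)"
      by (simp only: of_int_add of_int_mult algebra_simps)
    finally have "w = of_int (int (nat (k mod int N))) * x" using Nx N_pos by simp
    moreover have "nat (k mod int N) < N" using N_pos by (simp add: nat_less_iff)
    ultimately show "w \<in> (\<lambda>k. of_int (int k) * x) ` {..<N}" by blast
  qed
  then have "finite H" "card H \<le> N"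
    using finite_subset card_mono[OF _ Hsub] card_image_le[of "{..<N}" "\<lambda>k. of_int (int k) * x"]
    by (auto intro: le_trans)
  then have HX: "H = X"
    using card_subset_eq[OF _ XH] card_mono[OF _ XH] card_X by simp
  then show "X = range (\<lambda>k. of_int k * x)" by (simp add: H_def)
  have lpH: "(l ^^ i) w \<in> H" if "w \<in> H" for w i
    using that by (induction i) (auto simp: lH)
  have l'H: "l' w \<in> H" if "w \<in> H" for w
    using lpH[OF that] l'_eq[of w] that HX X_S by auto
  have "l' y \<notin> X"
    using lH[of "l' y"] y_X HX by auto
  then have "l' y - y \<in> X"
    using Hdiff unfolding HX by (intro X_index_2[OF _ l'_S[OF y_S] _ y_S y_X])
  then have "(l' y - y) - l' x \<in> H"
    using Hdiff[OF _ l'H[OF HI[of 1]]] HX by simp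
  moreover have "u x = (l' y - y) - l' x" by (simp add: u_x)
  ultimately have "u x \<in> H" by simp
  then obtain \<kappa> where \<kappa>: "u x = of_int \<kappa> * x" by (auto simp: H_def)
  have "l (u (l x)) = u x" by (simp only: u_l l_l')
  then have E1: "of_int (\<gamma> * \<kappa> * \<gamma>) * x = of_int \<kappa> * x"
    by (simp only: lx' linear \<kappa> of_int_mult mult.assoc)
  have "u (u x) = of_int (\<kappa> * \<kappa>) * x" by (simp only: \<kappa> linear of_int_mult mult.assoc)
  then have E2: "x = of_int (\<kappa> * \<kappa>) * x" by (simp only: uu[OF x_S])
  have "of_int (\<gamma> * \<gamma>) * x = x"
    by (rule ring_cert_2[OF E1 E2, of _ _ "of_int \<kappa>" "of_int (\<gamma> * \<gamma>) - 1"]) (simp add: algebra_simps)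
  moreover have "l (l x) = of_int (\<gamma> * \<gamma>) * x" by (simp only: lx' linear of_int_mult mult.assoc)
  ultimately have "l (l x) = x" by simp
  then have w2: "2 * w = 0" by (simp add: lx lw)
  have w_f: "w = f (4 * a)" by (simp add: w_def f_4)
  have w_t: "w = 0 \<or> w = t"
    using two_torsion_X[of "4 * a"] w2 lw by (simp flip: w_f)
  have dvd: "4 dvd m" if "w = t"
  proof -
    have "f (4 * a + m) = 0"
      unfolding f_add t_def[symmetric] w_f[symmetric] using that two_t' by simp
    then have "4 * M dvd 4 * a + m" by (simp add: f_eq_0_iff N_M)
    then have "4 dvd 4 * a + m" by (rule dvd_trans[rotated]) simp
    then show ?thesis by (simp add: dvd_add_right_iff)
  qed
  then show "l x = x \<or> l x = x + t \<and> 4 dvd m" using w_t lx by auto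
  have c4: "c = 4 * x" using c_x w2 by simp
  from w_t show "t = of_nat m * x"
  proof
    assume "w = 0"
    then have "f i = of_nat i * x" for i
      using lx by (induction i) (simp_all add: f_Suc' distrib_right)
    then show ?thesis by (simp add: t_def)
  next
    assume "w = t"
    then obtain q where q: "m = 4 * q" using dvd by (metis dvdE)
    have "t = f (4 * q)" unfolding t_def by (rule arg_cong[of m _ f, OF q])
    moreover have "(of_nat m :: 'a) = of_nat q * 4" by (simp add: q)
    ultimately show ?thesis by (simp add: f_4 c4 mult.assoc)
  qed
qed

text \<open>Index two of \<open>X\<close>, applied to the pairs \<open>y\<close>, \<open>- y\<close>
  and \<open>l y\<close>, \<open>y\<close>.\<close>

lemma X_facts:
  assumes X: "X = range (\<lambda>k. of_int k * x)"
  shows "v \<in> X \<Longrightarrow> w \<in> X \<Longrightarrow> v - w \<in> X"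
    "\<exists>q. 2 * y = of_int q * x" "l y - y \<in> X"
proof -
  have sub: "v - w \<in> X" if "v \<in> X" "w \<in> X" for v w
    using that by (auto simp: X simp flip: left_diff_distrib of_int_diff)
  then show "v \<in> X \<Longrightarrow> w \<in> X \<Longrightarrow> v - w \<in> X" .
  have X0: "0 \<in> X" by (simp add: X_def range_eqI[of _ _ 0])
  have "- y \<notin> X" using sub[OF X0, of "- y"] y_X by auto
  from X_index_2[OF sub y_S y_X S_minus[OF y_S] this] have "y - (- y) \<in> X" by blast
  then show "\<exists>q. 2 * y = of_int q * x" by (auto simp: X)
  have lX: "l v \<in> X" if "v \<in> X" for v
  proof -
    have "l x \<in> X"
    proof -
      have fX: "f i \<in> X" for i by (simp add: X_def)
      have "f 2 - f 1 \<in> X" by (rule sub[OF fX fX])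
      moreover have "l x = f 2 - f 1" by (simp add: f_2)
      ultimately show ?thesis by simp
    qed
    then obtain k where "l x = of_int k * x" by (auto simp: X)
    then show ?thesis using that by (auto simp: X simp flip: mult.assoc of_int_mult)
  qed
  have lpX: "(l ^^ i) v \<in> X" if "v \<in> X" for i v using that by (induction i) (auto simp: lX)
  have "l y \<notin> X"
  proof
    assume "l y \<in> X"
    from lpX[OF this, of "N - 1"] show False using y_X l'_eq[OF l_S[OF y_S]] by simp
  qed
  from X_index_2[OF sub l_S[OF y_S] this y_S y_X] show "l y - y \<in> X" by blast
qed

text \<open>Replacing \<open>y\<close> by \<open>x^i y\<close> changes \<open>q\<close> in
  \<open>2 y = q x\<close> by an even number, so only its parity matters. For odd \<open>q\<close>
  the relation \<open>u (2 y) = 2 t - 2 y\<close> forces \<open>l y = y\<close>.\<close>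

lemma case_Ia:
  assumes lx: "l x = x"
  obtains i y' where "y' = f i + (l ^^ i) y" "2 * y' = 0 \<or> 2 * y' = x \<and> l y' = y'"
    "l y' = y' \<or> l y' = y' + t"
proof -
  have "l x - x = of_nat 0 * c" using lx by simp
  note I = case_I[OF this] and F = X_facts[OF case_I(1)[OF this]]
  define e where "e = l y - y"
  have ly: "l y = y + e" by (simp add: e_def)
  obtain q where q: "2 * y = of_int q * x" using F(2) by blast
  obtain k where k: "e = f k" using F(3) by (auto simp: e_def X_def)
  have fi: "f i = of_nat i * x" for i
    by (induction i) (simp_all add: f_Suc' lx distrib_right)
  have fix_f: "l (f i) = f i" "f i = of_nat i * x" for i
    by (simp_all add: fi lx)
  have le: "l e = e" by (simp add: k fix_f lx)
  have "l (2 * y) = 2 * y" unfolding q by (simp add: lx)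
  then have e2: "2 * e = 0" by (simp add: ly)
  have e_t: "e = 0 \<or> e = t"
    using two_torsion_X[of k] e2 le by (simp flip: k)
  have l'e: "l' e = e" using le by (metis l'_l)
  have l'y: "l' y = y - e" using arg_cong[OF ly, of l'] l'e by (simp add: eq_diff_eq)
  have l'x: "l' x = x" using lx by (metis l'_l)
  have ux: "u x = - x - e" by (simp add: u_x l'y l'x)
  have "u (2 * y) = 2 * t - 2 * y" by (simp add: u_y'' right_diff_distrib)
  then have E: "of_int q * (- x - e) = - (of_int q * x)"
    using two_t' by (simp add: q ux u_y'' two_t)
  have qe: "of_int q * e = 0"
    by (rule ring_cert_1[OF E, of _ _ "- 1"]) (simp add: algebra_simps)
  have q_even: "even q" if "e = t"
  proof (rule ccontr)
    assume "odd q"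
    then obtain r where "q = 2 * r + 1" by (rule oddE)
    then have "of_int r * (2 * t) + t = 0" using qe that by (simp add: algebra_simps)
    then show False using two_t t_neq_0 by simp
  qed
  \<comment> \<open>Half of \<open>q\<close> with the opposite sign, reduced modulo \<open>N\<close>
    so as to be an exponent.\<close>
  define i where "i = nat ((- (q div 2)) mod int N)"
  define y' where "y' = f i + (l ^^ i) y"
  have iN: "of_int (int i) * x = of_int (- (q div 2)) * x"
  proof -
    have "int i = - (q div 2) - int N * ((- (q div 2)) div int N)"
      unfolding minus_mult_div_eq_mod using N_pos by (simp add: i_def)
    moreover have "f N = 0" by (simp add: f_eq_0_iff)
    then have "of_nat N * x = 0" by (simp only: fix_f(2))
    ultimately show ?thesis
      by (simp only: of_int_diff of_int_mult left_diff_distrib mult.assoc)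
        (simp add: mult.left_commute[of "of_nat N"])
  qed
  have liy: "(l ^^ i) y = y + of_nat i * e" for i
    by (induction i) (simp_all add: ly le algebra_simps)
  have y': "y' = of_int (int i) * x + y + of_nat i * e"
    by (simp add: y'_def fix_f(2) liy)
  have q2: "2 * (q div 2) + q mod 2 = q" by simp
  have "2 * y' = 2 * (of_int (int i) * x) + 2 * y + of_nat i * (2 * e)"
    unfolding y' by (simp only: distrib_left mult.left_commute[of 2])
  also have "\<dots> = 2 * (of_int (- (q div 2)) * x) + of_int q * x"
    by (simp only: iN e2 q mult_zero_right add_0_right)
  also have "\<dots> = of_int (2 * (- (q div 2)) + q) * x"
    by (simp only: of_int_add of_int_mult of_int_numeral distrib_right mult.assoc)
  also have "2 * (- (q div 2)) + q = q mod 2" using q2 by linarith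
  finally have y2: "2 * y' = of_int (q mod 2) * x" .
  have ly': "l y' = y' + e"
    by (simp add: y'_def fix_f(1) liy ly le add_ac)
  show ?thesis
  proof (rule that[OF y'_def])
    show "2 * y' = 0 \<or> 2 * y' = x \<and> l y' = y'"
    proof (cases "even q")
      case False
      then have "e = 0" using e_t q_even by auto
      then show ?thesis using y2 ly' False by (simp add: odd_iff_mod_2_eq_one)
    qed (use y2 in simp)
    show "l y' = y' \<or> l y' = y' + t" using e_t ly' by auto
  qed
qed

text \<open>Here \<open>u (2 y) = 2 t - 2 y\<close> gives \<open>q^2 t = 0\<close>, so
  \<open>q\<close> in \<open>2 y = q x\<close> is even and is removed by renaming \<open>y\<close>.
  Then \<open>2 e = 0\<close> makes the coefficient of \<open>e\<close> at \<open>x\<close> even, so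
  \<open>l\<close> fixes \<open>e\<close>, and \<open>e\<close> is \<open>0\<close> or
  \<open>t\<close>.\<close>

lemma case_Ib:
  assumes lx: "l x = x + t" and v: "l x - x = of_nat a * c"
  obtains i y' where "y' = f i + (l ^^ i) y" "2 * y' = 0" "l y' = y' \<or> l y' = y' + t"
proof -
  note I = case_I[OF v] and F = X_facts[OF case_I(1)[OF v]]
  define e where "e = l y - y"
  have ly: "l y = y + e" by (simp add: e_def)
  have m4: "4 dvd m" using I(2) lx t_neq_0 by auto
  obtain q where q: "2 * y = of_int q * x" using F(2) by blast
  obtain k where k: "e = of_int k * x" using F(3) I(1) by (auto simp: e_def)
  have e_X: "e \<in> X" using F(3) by (simp add: e_def)
  have le: "l e = e + of_int k * t" by (simp add: k lx distrib_left)
  have "l (2 * y) = of_int q * (x + t)" unfolding q by (simp add: lx)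
  then have E1: "2 * e = of_int q * t" using q by (simp add: ly algebra_simps)
  have l'x: "l' x = x - t" using arg_cong[OF lx, of l'] by (simp add: eq_diff_eq)
  have l'e: "l' e = e - of_int k * t" using arg_cong[OF le, of l'] by (simp add: eq_diff_eq)
  have l'y: "l' y = y - e + of_int k * t"
    using arg_cong[OF ly, of l'] by (simp add: l'e algebra_simps)
  have ux: "u x = - e + of_int k * t - x + t" by (simp add: u_x l'y l'x)
  have "u (2 * y) = 2 * t - 2 * y" by (simp add: u_y'' right_diff_distrib)
  then have E2: "of_int q * (- e + of_int k * t - x + t) = - (of_int q * x)"
    using two_t by (simp add: q ux)
  have E3: "of_int (q * q) * t = 0"
    by (rule ring_cert_3[OF E1 E2 two_t, of _ _ "- of_int q" "- 2" "of_int (q * k + q)"])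
       (simp add: algebra_simps)
  have q_even: "even q"
  proof (rule ccontr)
    assume "odd q"
    then obtain s where s: "q = 2 * s + 1" by (rule oddE)
    define r where "r = 2 * s * s + 2 * s"
    have "q * q = 2 * r + 1" by (simp add: s r_def algebra_simps)
    then have "of_int r * (2 * t) + t = 0" using E3 by (simp add: algebra_simps)
    then show False using two_t t_neq_0 by simp
  qed
  then obtain r where r: "q = 2 * r" by auto
  have e2: "2 * e = 0"
    by (rule ring_cert_2[OF E1 two_t, of _ _ 1 "of_int r"]) (simp add: r algebra_simps)
  have "even k"
  proof (rule ccontr)
    assume "odd k"
    then obtain j where j: "k = 2 * j + 1" by (rule oddE)
    have k2: "of_int (2 * k) * x = 0" using e2 by (simp add: k mult.assoc)
    have "t = 0"
      by (rule ring_cert_3[OF k2 I(3) two_t, of _ _ "of_nat M" "of_int k" "- of_int j"])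
        (simp add: of_nat_m j algebra_simps)
    then show False using t_neq_0 by simp
  qed
  then obtain j where j: "k = 2 * j" by auto
  have le': "l e = e"
    by (rule ring_cert_2[OF le two_t, of _ _ 1 "of_int j"]) (simp add: j algebra_simps)
  have e_t: "e = 0 \<or> e = t"
    using e_X two_torsion_X e2 le' by (auto simp: X_def)
  define i where "i = nat ((- r) mod int N)"
  define y' where "y' = f i + (l ^^ i) y"
  have Nx: "of_nat N * x = 0"
    by (rule ring_cert_2[OF I(3) two_t, of _ _ "- 2" 1]) (simp add: N_eq algebra_simps)
  have iN: "of_int (int i) * x = of_int (- r) * x"
  proof -
    have "int i = - r - int N * ((- r) div int N)"
      unfolding minus_mult_div_eq_mod using N_pos by (simp add: i_def)
    then show ?thesis using Nx
      by (simp only: of_int_diff of_int_mult left_diff_distrib mult.assoc)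
        (simp add: mult.left_commute[of "of_nat N"])
  qed
  have liy: "(l ^^ i) y = y + of_nat i * e" for i
    by (induction i) (simp_all add: ly le' algebra_simps)
  have lfi: "l (f i) = f i + of_nat i * t" for i
    by (induction i) (simp_all add: f_Suc' lx algebra_simps)
  have fi: "f i = of_nat i * x + of_nat (\<Sum>j<i. j) * t" for i
  proof (induction i)
    case (Suc i)
    have "f (Suc i) = x + f i + of_nat i * t" by (simp add: f_Suc' lfi add.assoc)
    then show ?case using Suc by (simp add: algebra_simps)
  qed simp
  have y': "y' = of_int (int i) * x + of_nat (\<Sum>j<i. j) * t + y + of_nat i * e"
    by (simp add: y'_def fi liy add.assoc)
  have ly': "l y' = y' + (of_nat i * t + e)"
    by (simp add: y'_def lfi liy ly le' algebra_simps)
  have "2 * y' = 2 * (of_int (int i) * x) + of_nat (\<Sum>j<i. j) * (2 * t) + 2 * y + of_nat i * (2 * e)"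
    unfolding y' by (simp only: distrib_left mult.left_commute[of 2])
  also have "\<dots> = 2 * (of_int (- r) * x) + of_int q * x"
    by (simp only: iN two_t e2 q mult_zero_right add_0_right)
  also have "\<dots> = 0" by (simp add: r)
  finally have "2 * y' = 0" .
  then show ?thesis
    using ly' e_t two_t' by (intro that[OF y'_def]) (auto simp: of_nat_t)
qed

text \<open>Cancelling \<open>l x\<close> leaves \<open>2 x = - a c\<close>, which \<open>l\<close>
  fixes; so \<open>D\<close> is killed by \<open>2\<close>. Since
  \<open>c = 2 x + 2 l x + D + l D\<close>, the sum \<open>D + l D\<close> is the odd multiple
  \<open>1 + 2 a\<close> of \<open>c\<close>.\<close>

lemma case_II:
  assumes v: "l x - x = of_nat a * c + (x + l x)"
  defines "D \<equiv> l (l x) - x"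
  shows "2 * x = - (of_nat a * c)" "2 * D = 0" "D + l D = of_int (1 + 2 * int a) * c"
    "of_int (2 * (1 + 2 * int a)) * c = 0"
proof -
  show x2: "2 * x = - (of_nat a * c)"
    by (rule ring_cert_1[OF v, of _ _ "- 1"]) (simp add: algebra_simps)
  have lx2: "2 * l x = - (of_nat a * c)"
    using arg_cong[OF x2, of l] by simp
  have "c = 2 * x + 2 * l x + (D + l D)"
    by (simp add: c_eq D_def algebra_simps)
  then show E: "D + l D = of_int (1 + 2 * int a) * c"
    by (rule ring_cert_3[OF _ x2 lx2, of _ _ _ _ "- 1" "- 1" "- 1"]) (simp add: algebra_simps)
  have llD: "l (l D) = - D" by (simp add: D_def quartic x_S)
  have "l D + l (l D) = of_int (1 + 2 * int a) * c"
    using arg_cong[OF E, of l] by (simp only: linear l_c)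
  then have E2: "l D - D = of_int (1 + 2 * int a) * c" by (simp add: llD)
  show D2: "2 * D = 0"
    by (rule ring_cert_2[OF E E2, of _ _ 1 "- 1"]) (simp add: algebra_simps)
  have lD2: "2 * l D = 0" using arg_cong[OF D2, of l] by simp
  show "of_int (2 * (1 + 2 * int a)) * c = 0"
    by (rule ring_cert_3[OF E D2 lD2, of _ _ "- 2" 1 1]) (simp add: algebra_simps)
qed

text \<open>Now \<open>m = 4 h + 2\<close> and \<open>t = h c + p\<close>; \<open>l\<close> fixes
  \<open>t\<close> and \<open>c\<close>, hence also \<open>p\<close>, and \<open>l^2 x = x\<close>.
  So \<open>X\<close> consists of the multiples of \<open>p\<close> and their translates by
  \<open>x\<close>. It is closed under subtraction, and its index two controls
  \<open>l y - y\<close> and \<open>2 y\<close>.\<close>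

lemma case_IIa:
  assumes v: "l x - x = of_nat a * c + (x + l x)" and M: "odd M"
  defines "p \<equiv> x + l x"
  obtains i y' where "l p = p" "l (l x) = x" "2 * x = of_int (1 + int M) * p"
    "of_int (2 * int M) * p = 0" "t = of_nat M * p"
    "y' = f i + (l ^^ i) y" "l y' = y'" "2 * y' = 0 \<or> 2 * y' = t"
proof -
  note II = case_II[OF v]
  have "int M dvd 2 * (1 + 2 * int a)" using II(4) by (simp only: c_of_int)
  moreover have "coprime (int M) 2" using M by simp
  ultimately have "int M dvd 1 + 2 * int a" by (simp only: coprime_dvd_mult_right_iff)
  then obtain s where s: "1 + 2 * int a = int M * s" by (rule dvdE)
  have "odd (int M * s)" by (simp flip: s)
  then have "odd s" by simp
  obtain h where h: "M = 2 * h + 1" using M by (rule oddE)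
  have f2: "f 2 = p" by (simp add: f_2 p_def)
  have "m = 4 * h + 2" using m_eq h by linarith
  from arg_cong[OF this, of f] have t_p: "t = of_nat h * c + p"
    by (simp only: f_4_add f2 flip: t_def)
  have "l t = of_nat h * c + l p" unfolding t_p by simp
  then have "of_nat h * c + l p = of_nat h * c + p" unfolding t_fix using t_p by (metis (full_types))
  then have lp: "l p = p" by (rule add_left_imp_eq)
  have llx: "l (l x) = x" using lp by (simp add: p_def)
  have l'x: "l' x = l x" using llx by (metis l'_l)
  have c_p: "c = 2 * p" by (simp add: c_eq p_def llx algebra_simps)
  have lx: "l x = p - x" by (simp add: p_def)
  have f_even: "f (2 * k) = of_nat k * p" for k
    using f_mult_fixed[of 2 k] lp by (simp add: f2 mult.commute)
  have tM: "t = of_nat M * p"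
    using f_even[of M] m_eq by (simp add: t_def)
  have p_2M: "of_int (2 * int M) * p = 0" using two_t by (simp add: tM mult.assoc)
  have st: "of_int s * t = t"
  proof -
    from \<open>odd s\<close> obtain r where "s = 2 * r + 1" by (rule oddE)
    then have "of_int s * t = of_int r * (2 * t) + t" by (simp add: algebra_simps)
    then show ?thesis using two_t by simp
  qed
  have spM: "of_int (1 + 2 * int a) * p = t"
  proof -
    have "of_int (1 + 2 * int a) * p = of_int s * t" unfolding s by (simp add: tM algebra_simps)
    then show ?thesis by (simp only: st)
  qed
  have x2: "2 * x = of_int (1 + int M) * p"
  proof -
    have "2 * x = - (2 * (of_nat a * p))" using II(1) by (simp add: c_p mult.left_commute)
    then show ?thesis
      by (rule ring_cert_3[OF _ spM two_t, of _ _ _ _ 1 "- 1" "- 1"])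
        (simp add: tM algebra_simps)
  qed
  have p_mod: "of_int k * p = f (2 * nat (k mod (2 * int M)))" for k
  proof -
    have "of_int k * p = of_int (k mod (2 * int M) + 2 * int M * (k div (2 * int M))) * p" by simp
    also have "\<dots> = of_int (k mod (2 * int M)) * p + of_int (k div (2 * int M)) * (of_int (2 * int M) * p)"
      by (simp only: of_int_add of_int_mult algebra_simps)
    finally have "of_int k * p = of_int (k mod (2 * int M)) * p" by (simp only: p_2M mult_zero_right add_0_right)
    also have "k mod (2 * int M) = int (nat (k mod (2 * int M)))" using M_pos by simp
    finally show ?thesis by (simp only: f_even of_int_of_nat_eq)
  qed
  have p0: "of_int k * p = 0 \<longleftrightarrow> 2 * int M dvd k" for k
  proof -
    have "of_int k * p = 0 \<longleftrightarrow> 4 * M dvd 2 * nat (k mod (2 * int M))"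
      by (simp only: p_mod f_eq_0_iff N_M)
    also have "\<dots> \<longleftrightarrow> 2 * M dvd nat (k mod (2 * int M))"
      using dvd_mult_cancel_left[of 2 "2 * M"] by simp
    also have "\<dots> \<longleftrightarrow> 2 * int M dvd k mod (2 * int M)"
    proof -
      have "k mod (2 * int M) \<ge> 0" using M_pos by simp
      then obtain z where "k mod (2 * int M) = int z" by (rule nonneg_int_cases)
      moreover have "2 * M dvd z \<longleftrightarrow> 2 * int M dvd int z"
        using int_dvd_int_iff[of "2 * M" z] by simp
      ultimately show ?thesis by simp
    qed
    finally show ?thesis by (simp add: dvd_mod_iff)
  qed
  have f_odd: "f (Suc (2 * k)) = of_nat k * p + x" for k
    by (simp add: f_Suc' f_even lp add.commute)
  have pX: "of_int k * p \<in> X" for k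
    using p_mod by (auto simp: X_def)
  have pxX: "of_int k * p + x \<in> X" for k
  proof -
    have "of_int k * p + x = f (Suc (2 * nat (k mod (2 * int M))))"
      using p_mod[of k] by (simp add: f_odd f_even)
    then show ?thesis by (auto simp: X_def)
  qed
  have X_cases: "\<exists>k. v = of_int k * p \<or> v = of_int k * p + x" if v: "v \<in> X" for v
  proof -
    obtain i where "v = f i" using v by (auto simp: X_def)
    then show ?thesis
      using f_even[of "i div 2"] f_odd[of "i div 2"]
      by (cases "even i") (auto intro: exI[of _ "int (i div 2)"] elim!: evenE oddE)
  qed
  have x_p: "x \<noteq> of_int k * p" for k
  proof
    assume x: "x = of_int k * p"
    have "f (Suc (2 * 0)) \<noteq> 0" by (rule odd_f_neq_0) simp
    define j where "j = nat (k mod (2 * int M))"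
    have "f 1 = f (2 * j)" using x p_mod[of k] by (simp add: j_def)
    moreover from this have "j \<noteq> 0" using odd_f_neq_0[of 1] by (auto intro!: Nat.gr0I)
    ultimately have "1 mod N = 2 * j mod N" using f_eq_iff[of 1 "2 * j"] by simp
    then have "1 mod N mod 2 = 2 * j mod N mod 2" by simp
    moreover have "2 dvd N" by (simp add: N_M)
    ultimately show False by (simp add: mod_mod_cancel)
  qed
  have sub: "v - w \<in> X" if vw: "v \<in> X" "w \<in> X" for v w
  proof -
    obtain k where k: "v = of_int k * p \<or> v = of_int k * p + x" using X_cases vw by blast
    obtain j where j: "w = of_int j * p \<or> w = of_int j * p + x" using X_cases vw by blast
    have "v - w = of_int (k - j) * p \<or> v - w = of_int (k - j) * p + x \<or>
        v - w = of_int (k - j - 1 - int M) * p + x"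
    proof -
      have "of_int k * p - (of_int j * p + x) = of_int (k - j - 1 - int M) * p + x"
        by (rule ring_cert_1[OF x2, of _ _ "- 1"]) (simp add: algebra_simps)
      then show ?thesis using k j by (auto simp: algebra_simps)
    qed
    then show ?thesis
      using pX[of "k - j"] pxX[of "k - j"] pxX[of "k - j - 1 - int M"] by auto
  qed
  have lX: "l v \<in> X" if v: "v \<in> X" for v
  proof -
    obtain k where "v = of_int k * p \<or> v = of_int k * p + x" using X_cases v by blast
    then have "l v = of_int k * p \<or> l v = of_int k * p + (p - x)" by (auto simp: lp lx)
    moreover have E: "of_int k * p + (p - x) = of_int (k - int M) * p + x"
      by (rule ring_cert_1[OF x2, of _ _ "- 1"]) (simp add: algebra_simps)
    ultimately show ?thesis using pX[of k] pxX[of "k - int M"] unfolding E by metis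
  qed
  have lpX: "(l ^^ i) v \<in> X" if "v \<in> X" for v i using that by (induction i) (auto simp: lX)
  define e where "e = l y - y"
  have ly: "l y = y + e" by (simp add: e_def)
  have "l y \<notin> X"
  proof
    assume "l y \<in> X"
    from lpX[OF this, of "N - 1"] show False using y_X l'_eq[OF l_S[OF y_S]] by simp
  qed
  from X_index_2[OF sub l_S[OF y_S] this y_S y_X] have eX: "e \<in> X" unfolding e_def by blast
  have X0: "0 \<in> X" using pX[of 0] by simp
  have "- y \<notin> X" using sub[OF X0, of "- y"] y_X by auto
  from X_index_2[OF sub y_S y_X S_minus[OF y_S] this] have yX: "2 * y \<in> X" by simp
  have llv: "l (l v) = v" if v: "v \<in> X" for v
    using X_cases[OF v] by (auto simp: lp llx)
  have "l (l (l (l y))) = y + 2 * (e + l e)"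
    by (simp add: ly llv[OF eX] algebra_simps)
  then have e4: "2 * (e + l e) = 0" using quartic[OF y_S] by simp
  have l'y: "l' y = y - l e"
    by (rule ring_cert_2[OF l'_eq3[OF y_S] e4, of _ _ 1 1]) (simp add: ly llv[OF eX] algebra_simps)
  have ux: "u x = - l e - l x" by (simp add: u_x l'y l'x)
  obtain \<alpha> where \<alpha>: "e = of_int \<alpha> * p \<or> e = of_int \<alpha> * p + x" using X_cases eX by blast
  \<comment> \<open>Otherwise \<open>u x\<close> would be a multiple of \<open>p\<close>, and then
    \<open>x = u (u x)\<close> would be one as well.\<close>
  have e_p: "e = of_int \<alpha> * p"
  proof (rule ccontr)
    assume "e \<noteq> of_int \<alpha> * p"
    then have e: "e = of_int \<alpha> * p + x" using \<alpha> by simp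
    define \<kappa> where "\<kappa> = int M - \<alpha> - 1"
    have ux': "u x = of_int \<kappa> * p"
      by (rule ring_cert_2[OF ux x2, of _ _ 1 1]) (simp add: e lp lx \<kappa>_def algebra_simps)
    have "u p = u x + l' (u x)" by (simp add: p_def u_l)
    also have "l' p = p" using lp by (metis l'_l)
    then have "u x + l' (u x) = of_int (2 * \<kappa>) * p" by (simp add: ux')
    finally have up: "u p = of_int (2 * \<kappa>) * p" .
    have "u (u x) = of_int (\<kappa> * (2 * \<kappa>)) * p"
      by (simp only: ux' linear up of_int_mult mult.assoc)
    then show False using x_p uu[OF x_S] by metis
  qed
  have le: "l e = e" by (simp add: e_p lp)
  have "2 * (e + e) = 0" using e4 by (simp only: le)
  then have "of_int (4 * \<alpha>) * p = 0"
    by (rule ring_cert_2[OF _ e_p, of _ _ _ _ 1 "- 4"]) (simp add: algebra_simps)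
  then have "2 * int M dvd 4 * \<alpha>" by (simp only: p0)
  then have "2 * int M dvd 2 * (2 * \<alpha>)" by simp
  then have "int M dvd 2 * \<alpha>" by (metis dvd_mult_cancel_left zero_neq_numeral)
  then have "int M dvd \<alpha>" using \<open>coprime (int M) 2\<close> by (simp only: coprime_dvd_mult_right_iff)
  then obtain s' where s': "\<alpha> = int M * s'" by (rule dvdE)
  have e_t: "e = 0 \<or> e = t"
  proof -
    have e: "e = of_int s' * t" by (simp add: e_p s' tM algebra_simps)
    show ?thesis
    proof (cases "even s'")
      case True
      then obtain r where "s' = 2 * r" by auto
      then have "e = of_int r * (2 * t)" by (simp add: e)
      then show ?thesis using two_t by simp
    next
      case False
      then obtain r where "s' = 2 * r + 1" by (rule oddE)
      then have "e = of_int r * (2 * t) + t" by (simp add: e algebra_simps)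
      then show ?thesis using two_t by simp
    qed
  qed
  have e2: "e + e = 0" using e_t two_t' by auto
  obtain \<beta> where \<beta>: "2 * y = of_int \<beta> * p \<or> 2 * y = of_int \<beta> * p + x" using X_cases yX by blast
  have y_p: "2 * y = of_int \<beta> * p"
  proof (rule ccontr)
    assume "2 * y \<noteq> of_int \<beta> * p"
    then have y2: "2 * y = of_int \<beta> * p + x" using \<beta> by simp
    have "l (2 * y) = 2 * y + (e + e)" by (simp add: ly algebra_simps)
    then have "of_int \<beta> * p + (p - x) = of_int \<beta> * p + x"
      unfolding y2 e2 by (simp add: lp lx)
    then have E: "p = 2 * x" by (simp add: algebra_simps)
    have "t = 0"
      by (rule ring_cert_2[OF E x2, of _ _ "- 1" "- 1"]) (simp add: tM algebra_simps)
    then show False using t_neq_0 by simp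
  qed
  have lly: "(l ^^ (2 * k)) y = y" for k
  proof (induction k)
    case (Suc k)
    have "(l ^^ (2 * Suc k)) y = l (l ((l ^^ (2 * k)) y))" by simp
    then show ?case using Suc e2 by (simp add: ly le add.assoc)
  qed simp
  \<comment> \<open>Chosen so that \<open>2 r + \<beta>\<close> is \<open>0\<close> or
    \<open>M\<close>, whichever has the parity of \<open>\<beta>\<close>; then \<open>2 y1\<close>
    is \<open>0\<close> or \<open>M p = t\<close>.\<close>
  define r where "r = (if even \<beta> then - (\<beta> div 2) else (int M - \<beta>) div 2)"
  have r2: "2 * r + \<beta> = (if even \<beta> then 0 else int M)"
    using M by (auto simp: r_def elim!: evenE oddE)
  define k where "k = nat (r mod (2 * int M))"
  define y1 where "y1 = of_int r * p + y"
  have y1: "y1 = f (2 * k) + (l ^^ (2 * k)) y"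
    by (simp only: y1_def p_mod k_def lly)
  have "2 * y1 = of_int (2 * r + \<beta>) * p"
    by (rule ring_cert_1[OF y_p, of _ _ 1]) (simp add: y1_def algebra_simps)
  then have y12: "2 * y1 = 0 \<or> 2 * y1 = t"
    unfolding r2 by (auto simp: tM)
  have ly1: "l y1 = y1 + e" by (simp add: y1_def lp ly add.assoc)
  show ?thesis
  proof (cases "e = 0")
    case True
    then show ?thesis
      using that[OF lp llx x2 p_2M tM y1] ly1 y12 by simp
  next
    case False
    then have et: "e = t" using e_t by simp
    \<comment> \<open>If \<open>l\<close> moves \<open>y1\<close> by \<open>t\<close>, it also moves
      the odd rotation \<open>f M\<close> by \<open>t\<close>. The two shifts cancel in the
      reflection \<open>f M + (l ^^ M) y1\<close>, which is \<open>y2\<close>.\<close>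
    define y2 where "y2 = f M + y1 + t"
    have lM: "(l ^^ M) v = (l ^^ (2 * h)) (l v)" for v
      unfolding h by (simp add: funpow_swap1)
    have "(l ^^ (2 * h)) y1 = y1"
    proof -
      have "(l ^^ (2 * h)) p = p" for h by (induction h) (simp_all add: lp)
      then show ?thesis by (simp add: y1_def lly)
    qed
    then have "(l ^^ M) y1 = y1 + t" by (simp add: lM ly1 et)
    then have y2: "y2 = f (M + 2 * k) + (l ^^ (M + 2 * k)) y"
      by (simp add: y2_def f_add funpow_add y1 add.assoc)
    have fM: "f M = of_nat h * p + x" unfolding h using f_odd[of h] by simp
    have "l y2 = of_nat h * p + (p - x) + (y1 + t) + t" by (simp add: y2_def fM lp lx ly1 et)
    then have "l y2 = y2"
      by (rule ring_cert_3[OF _ x2 two_t, of _ _ _ _ 1 "- 1" 0])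
        (simp add: y2_def fM tM algebra_simps)
    moreover have "2 * y2 = 2 * y1"
    proof -
      have hM: "(of_nat M :: 'a) = 2 * of_nat h + 1" by (simp add: h)
      show ?thesis
        by (rule ring_cert_3[OF x2 two_t p_2M, of _ _ 1 1 1])
          (simp add: y2_def fM hM algebra_simps)
    qed
    ultimately show ?thesis
      using that[OF lp llx x2 p_2M tM y2] y12 by simp
  qed
qed

text \<open>For even \<open>M\<close> the odd multiple of \<open>c\<close> in \<open>case_II\<close>
  is \<open>t\<close>, so \<open>l D = D + t\<close>. A rotation \<open>f i\<close> cannot behave
  so: summing along powers of \<open>l\<close> gives \<open>f (2 i) = i t\<close>, which contradicts
  \<open>4 dvd m\<close> for odd \<open>i\<close> and makes \<open>D\<close> fixed for even
  \<open>i\<close>.\<close>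

lemma case_IIb:
  assumes v: "l x - x = of_nat a * c + (x + l x)" and M: "even M"
  defines "D \<equiv> l (l x) - x"
  obtains i where "D = f i + (l ^^ i) y" "l D = D + t" "2 * D = 0"
    "of_int (1 + 2 * int a) * c = t" "t = of_nat (M div 2) * c"
proof -
  note II = case_II[OF v, folded D_def]
  define h where "h = M div 2"
  have h: "M = 2 * h" using M by (simp add: h_def)
  have "int M dvd 2 * (1 + 2 * int a)" using II(4) by (simp only: c_of_int)
  then have "2 * int h dvd 2 * (1 + 2 * int a)" by (simp only: h of_nat_mult of_nat_numeral)
  then have "int h dvd 1 + 2 * int a" by (metis dvd_mult_cancel_left zero_neq_numeral)
  then obtain s where s: "1 + 2 * int a = int h * s" by (rule dvdE)
  have "odd (int h * s)" by (simp flip: s)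
  then have "odd s" by simp
  have "m = 4 * h" using m_eq h by linarith
  from arg_cong[OF this, of f] have t_c: "t = of_nat h * c"
    by (simp only: f_4 flip: t_def)
  have c_t: "of_int (1 + 2 * int a) * c = t"
  proof -
    from \<open>odd s\<close> obtain r where "s = 2 * r + 1" by (rule oddE)
    then have "of_int (1 + 2 * int a) * c = of_int r * (2 * t) + t"
      unfolding s by (simp add: t_c algebra_simps)
    then show ?thesis using two_t by simp
  qed
  have lD: "l D = D + t"
    by (rule ring_cert_3[OF II(3) c_t II(2), of _ _ 1 1 "- 1"]) (simp add: algebra_simps)
  have "D \<in> S" unfolding D_def by (intro S_closed)
  then show ?thesis
  proof (cases rule: S_cases)
    case (rot i)
    have "(l ^^ j) D = D + of_nat j * t" for j
      by (induction j) (simp_all add: lD distrib_right add_ac)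
    then have "f (i + i) = 2 * D + of_nat i * t"
      unfolding f_add rot[symmetric] by simp
    then have f2i: "f (i + i) = of_nat i * t" by (simp add: II(2))
    show ?thesis
    proof (cases "even i")
      case True
      then have "N dvd 2 * i" using f2i by (simp add: of_nat_t f_eq_0_iff mult_2)
      then have "m dvd i" by (simp add: N_eq)
      then obtain q where "i = m * q" by auto
      then have "l D = D" by (simp add: rot f_m_mult)
      then show ?thesis using lD t_neq_0 by simp
    next
      case False
      then have "f (i + i + m) = 0"
        using f2i two_t' by (simp add: of_nat_t f_add[of "i + i" m] flip: t_def)
      then have "2 * m dvd i + i + m" by (simp add: f_eq_0_iff N_eq)
      then have "4 dvd i + i + m" using \<open>m = 4 * h\<close> by (metis dvd_trans dvd_triv_left dvd_triv_right)
      then have "4 dvd i + i" using \<open>m = 4 * h\<close> by (metis dvd_add_left_iff dvd_triv_left)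
      then have False using \<open>odd i\<close> by presburger
      then show ?thesis ..
    qed
  next
    case (refl i)
    then show ?thesis using that lD II(2) c_t t_c by (simp add: h_def)
  qed
qed

text \<open>If \<open>l x - x\<close> is not a rotation, it can be taken as the generator \<open>y\<close>.\<close>

lemma case_III:
  assumes v: "l x - x = y"
  shows "4 * y = 0" "2 * y = t" "l y = y \<and> 4 dvd m \<or> l y = y + t"
    "of_nat m * x + of_int (int M - 2) * y = 0"
proof -
  have lx: "l x = x + y" using v by (simp add: diff_eq_eq add.commute)
  have l'x: "l' x = x - l' y" using arg_cong[OF lx, of l'] by (simp add: eq_diff_eq)
  have ux: "u x = 2 * l' y - x - y" by (simp add: u_x l'x algebra_simps)
  have "u (l x) = l' (u x)" by (rule u_l)
  then have R: "2 * l' y - x - y + (t - y) = 2 * l' (l' y) - (x - l' y) - l' y"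
    by (simp add: lx ux u_y'' l'x)
  then have "l (2 * l' y - x - y + (t - y)) = l (2 * l' (l' y) - (x - l' y) - l' y)" by (rule arg_cong)
  then have R2: "2 * y - (x + y) - l y + (t - l y) = 2 * l' y - (x + y - y) - y"
    by (simp add: lx)
  define e where "e = l y - y"
  define g where "g = l e - e"
  have ly: "l y = y + e" and le: "l e = e + g" by (simp_all add: e_def g_def)
  have l'y: "l' y = y + 3 * e + 3 * g + (l g - g)"
    by (simp add: l'_eq3[OF y_S] ly le algebra_simps)
  have "l (l (l (l x))) = x + y + l y + l (l y) + l (l (l y))" by (simp add: lx)
  then have Sm: "y + l y + l (l y) + l (l (l y)) = 0" using quartic[OF x_S] by (simp add: add_ac)
  have l'y2: "l' y = - y - l y - l (l y)"
    by (rule ring_cert_1[OF Sm, of _ _ 1]) (simp add: l'_eq3[OF y_S] algebra_simps)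
  have A1: "t = - 4 * y - 2 * l (l y)"
    by (rule ring_cert_1[OF R2, of _ _ 1]) (simp add: l'y2 algebra_simps)
  have A2: "t = - 4 * l (l y) - 2 * y"
    using arg_cong[OF A1, of "\<lambda>v. l (l v)"] by (simp add: quartic y_S)
  have y6: "6 * y = t"
    by (rule ring_cert_3[OF A1 A2 two_t, of _ _ 2 "- 1" "- 1"]) (simp add: algebra_simps)
  \<comment> \<open>\<open>6 y = t\<close> gives \<open>12 y = 0\<close>, and the factor
    \<open>3\<close> cancels because \<open>y = l x - x\<close> has \<open>2\<close>-power
    order.\<close>
  have "2 ^ K * (4 * y) = 0"
    using two_part[OF x_S] by (simp add: v mult.left_commute)
  moreover have "of_int 3 * (4 * y) = 0"
    by (rule ring_cert_2[OF y6 two_t, of _ _ 2 1]) (simp add: algebra_simps)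
  ultimately show y4: "4 * y = 0" by (rule odd_cancel) simp
  show y2: "2 * y = t"
    by (rule ring_cert_2[OF y6 y4, of _ _ 1 "- 1"]) (simp add: algebra_simps)
  have "l (2 * y) = l t" by (simp only: y2)
  then have E: "2 * y + 2 * e = t" by (simp add: ly distrib_left)
  have e2: "2 * e = 0"
    by (rule ring_cert_2[OF E y2, of _ _ 1 "- 1"]) (simp add: algebra_simps)
  have "l (2 * e) = l 0" by (simp only: e2)
  then have E: "2 * e + 2 * g = 0" by (simp add: le distrib_left)
  have g2: "2 * g = 0"
    by (rule ring_cert_2[OF E e2, of _ _ 1 "- 1"]) (simp add: algebra_simps)
  have lg2: "2 * l g = 0" using arg_cong[OF g2, of l] by simp
  have S1: "4 * y + 6 * e + 4 * g + (l g - g) = 0"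
    using Sm by (simp add: ly le algebra_simps)
  have lg: "l g = g"
  proof -
    have "4 * y + 3 * (2 * e) + 2 * (2 * g) + (l g - g) = 0" using S1 by simp
    then show ?thesis by (simp only: y4 e2 g2) simp
  qed
  have l'g: "l' g = g" using lg by (metis l'_l)
  have l'e: "l' e = e + g"
  proof -
    have "e = l' e + g" using arg_cong[OF le, of l'] by (simp add: l'g)
    then show ?thesis
      by (rule ring_cert_2[OF _ g2, of _ _ _ _ "- 1" "- 1"]) (simp add: algebra_simps)
  qed
  have ue: "u e = e + g" using u_e[OF e_def] l'e by simp
  have ug: "u g = g"
  proof -
    have "u g = u (l e) - u e" by (simp add: g_def)
    also have "\<dots> = l' (u e) - u e" by (simp add: u_l)
    also have "\<dots> = g" by (simp add: ue l'e l'g)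
    finally show ?thesis .
  qed
  \<comment> \<open>\<open>g = (l - 1)^2 y\<close> is fixed by \<open>l\<close> and \<open>u\<close>
    and killed by \<open>2\<close>; a reflection with these properties would satisfy
    \<open>2 g = t\<close>.\<close>
  have "g \<in> S" unfolding g_def e_def by (intro S_closed)
  then have g_t: "g = 0 \<or> g = t"
  proof (cases rule: S_cases)
    case (rot i)
    then show ?thesis using two_torsion_X g2 lg by simp
  next
    case (refl i)
    have "(l ^^ i) g = g" by (induction i) (simp_all add: lg)
    then have "2 * g = t"
      using refl_square[of i] by (simp add: ug t_def flip: refl)
    then show ?thesis using g2 t_neq_0 by simp
  qed
  have c_y: "c = 4 * x + t + g"
    by (rule ring_cert_3[OF y6 e2 g2, of _ _ 1 2 0, THEN trans[rotated]])
      (simp_all add: c_eq lx ly le algebra_simps)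
  have "e \<in> S" unfolding e_def by (intro S_closed)
  have e_t: "l y = y \<and> 4 dvd m \<or> l y = y + t"
  proof (cases "even M")
    case False
    then obtain h where h: "M = 2 * h + 1" by (rule oddE)
    have "m = 4 * h + 2" using m_eq h by linarith
    from arg_cong[OF this, of f] have t_p: "t = of_nat h * c + (2 * x + y)"
      by (simp only: f_4_add f_2 flip: t_def) (simp add: lx)
    have E: "t = of_nat h * c + (2 * (x + y) + (y + e))"
      using arg_cong[OF t_p, of l] by (simp add: lx ly)
    have "e = - t"
      by (rule ring_cert_3[OF E t_p y2, of _ _ "- 1" 1 "- 1"]) (simp add: algebra_simps)
    then have "e = t" by (simp only: minus_t)
    then show ?thesis by (simp add: ly)
  next
    case True
    then obtain h where h: "M = 2 * h" by auto
    have m4: "m = 4 * h" using m_eq h by linarith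
    have "e = 0 \<or> e = t"
      using \<open>e \<in> S\<close>
    proof (cases rule: S_cases)
      case (rot i)
      have "(l ^^ j) e = e + of_nat j * g" for j
        by (induction j) (simp_all add: le lg distrib_right add_ac)
      then have "f (i + i) = 2 * e + of_nat i * g"
        unfolding f_add rot[symmetric] by simp
      then have f2i: "f (i + i) = of_nat i * g" by (simp add: e2)
      have "of_nat i * g = 0 \<or> of_nat i * g = t \<and> odd i"
        using g_t of_nat_t[of i] by (auto split: if_splits)
      then show ?thesis
      proof
        assume "of_nat i * g = 0"
        then have "N dvd 2 * i" using f2i by (simp add: f_eq_0_iff mult_2)
        then have "m dvd i" by (simp add: N_eq)
        then obtain q where "i = m * q" by auto
        then show ?thesis by (simp add: rot f_m_mult of_nat_t)
      next
        assume *: "of_nat i * g = t \<and> odd i"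
        then have "f (i + i + m) = 0"
          using f2i two_t' by (simp add: f_add[of "i + i" m] flip: t_def)
        then have "2 * m dvd i + i + m" by (simp add: f_eq_0_iff N_eq)
        then have "4 dvd i + i + m" using m4 by (metis dvd_trans dvd_triv_left dvd_triv_right)
        then have "4 dvd i + i" using m4 by (metis dvd_add_left_iff dvd_triv_left)
        moreover have "odd i" using * by simp
        ultimately have False by presburger
        then show ?thesis ..
      qed
    next
      \<comment> \<open>For a reflection the exponent modulo \<open>4\<close> decides after applying
        \<open>l\<close>: residue \<open>0\<close> gives \<open>e = g\<close>, the other three are
        impossible.\<close>
      case (refl i)
      show ?thesis
      proof (cases i rule: f_cases)
        case (0 a)
        have E: "e = of_nat a * c + y" using refl 0 lpow_4[OF y_S, of a] by simp
        have "l e = of_nat a * c + (y + e)" using arg_cong[OF E, of l] by (simp add: ly)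
        then have F: "e + g = of_nat a * c + (y + e)" by (simp only: le)
        have "g = e"
          by (rule ring_cert_2[OF F E, of _ _ 1 "- 1"]) (simp add: algebra_simps)
        then show ?thesis using g_t by simp
      next
        case (1 a)
        have "e = of_nat a * c + x + l y" using refl 1 lpow_4_add[OF y_S, of a 1] by simp
        then have E: "of_nat a * c + x + y = 0" by (simp add: ly add.assoc)
        have E': "of_nat a * c + (x + y) + l y = 0" using arg_cong[OF E, of l] by (simp add: lx)
        have "l y = 0"
          by (rule ring_cert_2[OF E' E, of _ _ 1 "- 1"]) (simp add: algebra_simps)
        then have "y = 0" using l'_l[of y] by simp
        then show ?thesis using y_X by (simp add: X_def) (metis f_0 rangeI)
      next
        case (2 a)
        have "e = of_nat a * c + (x + l x) + l (l y)"
          using refl 2 lpow_4_add[OF y_S, of a 2] by (simp add: numeral_2_eq_2)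
        then have E0: "e = of_nat a * c + 2 * x + y + (y + 2 * e + g)" by (simp add: lx ly le algebra_simps)
        have E: "e = of_nat a * c + 2 * x + t + g"
          by (rule ring_cert_3[OF E0 y2 e2, of _ _ 1 1 1]) (simp add: algebra_simps)
        have "l e = of_nat a * c + 2 * (x + y) + t + g" using arg_cong[OF E, of l] by (simp add: lx lg)
        then have "e + g = of_nat a * c + 2 * (x + y) + t + g" by (simp only: le)
        then have gt: "g = t"
          by (rule ring_cert_3[OF _ E y2, of _ _ _ _ 1 "- 1" 1]) (simp add: algebra_simps)
        have E2: "of_nat a * (2 * c) + 4 * x + 2 * (t + g) = 0"
          by (rule ring_cert_2[OF E e2, of _ _ "- 2" 1]) (simp add: algebra_simps)
        have "of_int (2 * int a + 1) * c = 0"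
          by (rule ring_cert_3[OF E2 c_y g2, of _ _ 1 1 0]) (use gt two_t in \<open>simp add: algebra_simps\<close>)
        then have "int M dvd 2 * int a + 1" by (simp only: c_of_int)
        then have "2 dvd 2 * int a + 1" by (rule dvd_trans[rotated]) (simp add: h)
        then show ?thesis by simp
      next
        case (3 a)
        have "e = of_nat a * c + (c - l' x) + l (l (l y))"
          using refl 3 lpow_4_add[OF y_S, of a 3] by (simp add: numeral_3_eq_3)
        then have "e = of_nat a * c + (c - (x - l' y)) + l' y" by (simp add: l'x l'_eq3 y_S)
        then have E: "e = of_nat a * c + c - x + l' (2 * y)" by (simp add: algebra_simps)
        then have E: "e = of_nat a * c + c - x + t" by (simp add: y2)
        have "l e = of_nat a * c + c - (x + y) + t" using arg_cong[OF E, of l] by (simp add: lx)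
        then have "e + g = of_nat a * c + c - (x + y) + t" by (simp only: le)
        then have gy: "g = - y"
          by (rule ring_cert_2[OF _ E, of _ _ _ _ 1 "- 1"]) (simp add: algebra_simps)
        have "t = 0"
          by (rule ring_cert_3[OF y2 g2 gy, of _ _ "- 1" "- 1" 2]) (simp add: algebra_simps)
        then show ?thesis using t_neq_0 by simp
      qed
    qed
    then show ?thesis using m4 by (auto simp: ly)
  qed
  then show "l y = y \<and> 4 dvd m \<or> l y = y + t" .
  have "g = 0"
    using e_t by (auto simp: g_def e_def)
  then have c_y': "c = 4 * x + t" using c_y by simp
  show "of_nat m * x + of_int (int M - 2) * y = 0"
  proof (cases "even M")
    case True
    then obtain h where h: "M = 2 * h" by auto
    have m4: "m = 4 * h" using m_eq h by linarith
    from arg_cong[OF this, of f] have t_c: "t = of_nat h * c"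
      by (simp only: f_4 flip: t_def)
    have om: "(of_nat m :: 'a) = 4 * of_nat h" by (metis m4 of_nat_mult of_nat_numeral)
    show ?thesis
      by (rule ring_cert_3[OF t_c c_y' y2, of _ _ "- 1" "- of_nat h" "of_nat h - 1"])
        (simp add: om h algebra_simps)
  next
    case False
    then obtain h where h: "M = 2 * h + 1" by (rule oddE)
    have m4: "m = 4 * h + 2" using m_eq h by linarith
    from arg_cong[OF this, of f] have t_p: "t = of_nat h * c + (2 * x + y)"
      by (simp only: f_4_add f_2 flip: t_def) (simp add: lx)
    have om: "(of_nat m :: 'a) = 4 * of_nat h + 2" by (metis m4 of_nat_add of_nat_mult of_nat_numeral)
    show ?thesis
      by (rule ring_cert_3[OF t_p c_y' y2, of _ _ "- 1" "- of_nat h" "of_nat h - 1"])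
        (simp add: om h algebra_simps)
  qed
qed

end

section \<open>An ambient ring for finite abelian groups\<close>

text \<open>The product of all residue rings: a ring whose additive group contains every finite
  cyclic group.\<close>

typedef zprod = "{f :: nat \<Rightarrow> int. \<forall>n. f n mod int n = f n}"
  by (rule exI[of _ "\<lambda>_. 0"]) simp

definition zp :: "(nat \<Rightarrow> int) \<Rightarrow> zprod" where "zp f = Abs_zprod (\<lambda>n. f n mod int n)"

lemma Rep_zp [simp]: "Rep_zprod (zp f) n = f n mod int n"
  by (simp add: zp_def Abs_zprod_inverse)

lemma Rep_zprod_mod [simp]: "Rep_zprod a n mod int n = Rep_zprod a n"
  using Rep_zprod[of a] by simp

lemma zprod_eqI: "(\<And>n. Rep_zprod a n = Rep_zprod b n) \<Longrightarrow> a = b"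
  by (simp add: Rep_zprod_inject[symmetric] fun_eq_iff)

instantiation zprod :: comm_ring_1
begin

definition "0 = zp (\<lambda>n. 0)"
definition "1 = zp (\<lambda>n. 1)"
definition "a + b = zp (\<lambda>n. Rep_zprod a n + Rep_zprod b n)"
definition "a - b = zp (\<lambda>n. Rep_zprod a n - Rep_zprod b n)"
definition "- a = zp (\<lambda>n. - Rep_zprod a n)"
definition "a * b = zp (\<lambda>n. Rep_zprod a n * Rep_zprod b n)"

instance
proof
  fix a b c :: zprod
  note defs = zero_zprod_def one_zprod_def plus_zprod_def minus_zprod_def uminus_zprod_def times_zprod_def
  show "a * b * c = a * (b * c)"
    by (rule zprod_eqI) (simp add: defs mod_simps mult.assoc)
  show "a * b = b * a" by (simp add: defs mult.commute)
  show "1 * a = a" by (rule zprod_eqI) (simp add: defs mod_simps)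
  show "a + b + c = a + (b + c)"
    by (rule zprod_eqI) (simp add: defs mod_simps add.assoc)
  show "a + b = b + a" by (simp add: defs add.commute)
  show "0 + a = a" by (rule zprod_eqI) (simp add: defs mod_simps)
  show "- a + a = 0" by (rule zprod_eqI) (simp add: defs mod_simps)
  show "a - b = a + - b" by (rule zprod_eqI) (simp add: defs mod_simps)
  show "(a + b) * c = a * c + b * c"
    by (rule zprod_eqI) (simp add: defs mod_simps distrib_right)
  \<comment> \<open>Coordinate \<open>0\<close> is the ring of integers itself, since
    \<open>mod 0\<close> changes nothing; it separates \<open>0\<close> from
    \<open>1\<close>.\<close>
  have "Rep_zprod 0 0 \<noteq> Rep_zprod 1 0" by (simp add: defs)
  then show "(0 :: zprod) \<noteq> 1" by auto
qed

end

lemma zp_add: "zp (\<lambda>n. f n + g n) = zp f + zp g"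
  by (rule zprod_eqI) (simp add: plus_zprod_def mod_simps)

section \<open>Characters of finite abelian groups\<close>

context comm_group
begin

text \<open>A homomorphism from \<open>H\<close> to the integers modulo \<open>N\<close>, kept as an
  integer-valued function that is constrained only on \<open>H\<close> and only modulo
  \<open>N\<close>.\<close>

definition partial_char :: "nat \<Rightarrow> 'a set \<Rightarrow> ('a \<Rightarrow> int) \<Rightarrow> bool" where
  "partial_char N H \<chi> \<longleftrightarrow> subgroup H G \<and>
    (\<forall>a\<in>H. \<forall>b\<in>H. \<chi> (a \<otimes> b) mod int N = (\<chi> a + \<chi> b) mod int N)"

lemma partial_char_mult:
  "partial_char N H \<chi> \<Longrightarrow> a \<in> H \<Longrightarrow> b \<in> H \<Longrightarrow> \<chi> (a \<otimes> b) mod int N = (\<chi> a + \<chi> b) mod int N"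
  by (simp add: partial_char_def)

lemma subgroup_pow_closed: "subgroup H G \<Longrightarrow> a \<in> H \<Longrightarrow> a [^] (k::nat) \<in> H"
  by (induction k) (auto intro: subgroup.m_closed subgroup.one_closed)

lemma partial_char_pow:
  assumes "partial_char N H \<chi>" "a \<in> H"
  shows "\<chi> (a [^] (k::nat)) mod int N = (int k * \<chi> a) mod int N"
proof (induction k)
  case 0
  have H: "subgroup H G" using assms by (simp add: partial_char_def)
  have "(\<chi> \<one> + \<chi> \<one>) mod int N = (\<chi> \<one> + 0) mod int N"
    using partial_char_mult[OF assms(1), of \<one> \<one>] subgroup.one_closed[OF H] by simp
  then have "int N dvd \<chi> \<one>" by (simp add: mod_eq_dvd_iff)
  then show ?case by simp
next
  case (Suc k)
  have H: "subgroup H G" using assms by (simp add: partial_char_def)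
  have ak: "a [^] k \<in> H" by (rule subgroup_pow_closed[OF H assms(2)])
  have "\<chi> (a [^] Suc k) mod int N = (\<chi> (a [^] k) + \<chi> a) mod int N"
    using partial_char_mult[OF assms(1) ak assms(2)] by simp
  also have "\<dots> = (\<chi> (a [^] k) mod int N + \<chi> a) mod int N" by (simp add: mod_simps)
  also have "\<dots> = (int k * \<chi> a + \<chi> a) mod int N" unfolding Suc by (simp add: mod_simps)
  finally show ?case by (simp add: algebra_simps)
qed

text \<open>The value \<open>q\<close> at \<open>b\<close> is consistent because \<open>n q\<close>
  is the value at \<open>b^n\<close>, the first power of \<open>b\<close> in \<open>H\<close>. The
  extension takes its value at \<open>h b^k\<close> from a chosen factorisation, and modulo
  \<open>N\<close> the choice does not matter.\<close>

lemma partial_char_extend: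
  assumes \<chi>: "partial_char N H \<chi>" and N: "N > 0" "\<And>a. a \<in> carrier G \<Longrightarrow> a [^] N = \<one>"
    and b: "b \<in> carrier G" "b \<notin> H"
    and n: "n > 0" "b [^] n \<in> H" "\<And>k. k > 0 \<Longrightarrow> b [^] k \<in> H \<Longrightarrow> n \<le> k"
    and q: "(int n * q) mod int N = \<chi> (b [^] n) mod int N"
  obtains H' \<chi>' where "partial_char N H' \<chi>'" "H \<subseteq> H'" "b \<in> H'"
    "\<And>a. a \<in> H \<Longrightarrow> \<chi>' a mod int N = \<chi> a mod int N" "\<chi>' b mod int N = q mod int N"
proof -
  have H: "subgroup H G" using \<chi> by (simp add: partial_char_def)
  note HG = subgroup.mem_carrier[OF H]
  have dvd: "n dvd k" if "b [^] k \<in> H" for k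
  proof (rule ccontr)
    assume "\<not> n dvd k"
    then have "k mod n > 0" by (simp add: dvd_eq_mod_eq_0)
    have "(b [^] n) [^] (k div n) \<in> H" by (rule subgroup_pow_closed[OF H n(2)])
    moreover have "b [^] k = (b [^] n) [^] (k div n) \<otimes> b [^] (k mod n)"
      using b by (simp add: nat_pow_pow nat_pow_mult)
    ultimately have "b [^] (k mod n) = inv ((b [^] n) [^] (k div n)) \<otimes> b [^] k"
      using b by (simp add: inv_solve_left)
    then have "b [^] (k mod n) \<in> H"
      using that \<open>(b [^] n) [^] (k div n) \<in> H\<close> by (simp add: subgroup.m_closed[OF H] subgroup.m_inv_closed[OF H])
    then have "n \<le> k mod n" using n(3) \<open>k mod n > 0\<close> by blast
    then show False using n(1) by (simp add: not_less[symmetric])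
  qed
  have pow: "\<chi> (b [^] k) mod int N = (int k * q) mod int N" if bk: "b [^] k \<in> H" for k
  proof -
    obtain j where j: "k = n * j" using dvd[OF bk] by auto
    have "\<chi> (b [^] k) mod int N = (int j * \<chi> (b [^] n)) mod int N"
      using partial_char_pow[OF \<chi> n(2), of j] b by (simp add: j nat_pow_pow)
    also have "\<dots> = (int j * (\<chi> (b [^] n) mod int N)) mod int N" by (simp add: mod_simps)
    also have "\<dots> = (int j * (int n * q)) mod int N" unfolding q[symmetric] by (simp add: mod_simps)
    finally show ?thesis by (simp add: j mult_ac)
  qed
  have well_le: "(\<chi> h + int k * q) mod int N = (\<chi> h' + int k' * q) mod int N"
    if le: "k \<le> k'" and "h \<in> H" "h' \<in> H" "h \<otimes> b [^] k = h' \<otimes> b [^] k'" for h h' and k k' :: nat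
  proof -
    obtain d where d: "k' = d + k" using le by (metis le_iff_add add.commute)
    have "h \<otimes> b [^] k = (h' \<otimes> b [^] d) \<otimes> b [^] k"
      using that(4) b HG[OF that(3)] by (simp add: d m_assoc nat_pow_mult)
    then have h: "h = h' \<otimes> b [^] d" using b HG[OF that(2)] HG[OF that(3)] right_cancel[of "b [^] k" h "h' \<otimes> b [^] d"] by simp
    then have "b [^] d = inv h' \<otimes> h" using b HG[OF that(2)] HG[OF that(3)] by (simp add: inv_solve_left)
    then have bd: "b [^] d \<in> H" using that by (simp add: subgroup.m_closed[OF H] subgroup.m_inv_closed[OF H])
    have "\<chi> h mod int N = (\<chi> h' + \<chi> (b [^] d)) mod int N"
      unfolding h by (rule partial_char_mult[OF \<chi> that(3) bd])
    also have "\<dots> = (\<chi> h' + \<chi> (b [^] d) mod int N) mod int N" by (simp add: mod_simps)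
    also have "\<dots> = (\<chi> h' + int d * q) mod int N" unfolding pow[OF bd] by (simp add: mod_simps)
    finally have "(\<chi> h mod int N + int k * q) mod int N = ((\<chi> h' + int d * q) mod int N + int k * q) mod int N"
      by simp
    then show ?thesis by (simp add: mod_simps d algebra_simps)
  qed
  have well: "(\<chi> h + int k * q) mod int N = (\<chi> h' + int k' * q) mod int N"
    if "h \<in> H" "h' \<in> H" "h \<otimes> b [^] k = h' \<otimes> b [^] k'" for h h' and k k' :: nat
    using well_le[OF _ that] well_le[OF _ that(2,1) that(3)[symmetric]] by (cases "k \<le> k'") auto
  define H' where "H' = {h \<otimes> b [^] k |h k. h \<in> H \<and> k \<in> (UNIV :: nat set)}"
  define \<chi>' where "\<chi>' g = (SOME v. \<exists>h k. h \<in> H \<and> g = h \<otimes> b [^] (k::nat) \<and> v = \<chi> h + int k * q)" for g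
  have \<chi>': "\<chi>' (h \<otimes> b [^] k) mod int N = (\<chi> h + int k * q) mod int N" if "h \<in> H" for h and k :: nat
  proof -
    have "\<exists>v. \<exists>h' k'. h' \<in> H \<and> h \<otimes> b [^] k = h' \<otimes> b [^] (k'::nat) \<and> v = \<chi> h' + int k' * q"
      using that by blast
    then have "\<exists>h' k'. h' \<in> H \<and> h \<otimes> b [^] k = h' \<otimes> b [^] (k'::nat) \<and> \<chi>' (h \<otimes> b [^] k) = \<chi> h' + int k' * q"
      unfolding \<chi>'_def by (rule someI_ex)
    then show ?thesis using well[OF _ that] by metis
  qed
  have mult': "(h \<otimes> b [^] k) \<otimes> (h' \<otimes> b [^] k') = (h \<otimes> h') \<otimes> b [^] (k + k')"
    if "h \<in> H" "h' \<in> H" for h h' and k k' :: nat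
    using HG that b by (simp add: m_ac nat_pow_mult[symmetric])
  have closed: "v \<otimes> w \<in> H'" if "v \<in> H'" "w \<in> H'" for v w
    using that mult' subgroup.m_closed[OF H] unfolding H'_def by blast
  have H'G: "H' \<subseteq> carrier G" using HG b by (auto simp: H'_def)
  have "b [^] (0::nat) = \<one>" by simp
  then have HH': "H \<subseteq> H'"
    unfolding H'_def using HG by (force intro: exI[of _ "0::nat"])
  have one': "\<one> \<in> H'" using HH' subgroup.one_closed[OF H] by blast
  have powH': "v [^] (k::nat) \<in> H'" if "v \<in> H'" for v k
    using that by (induction k) (auto simp: one' closed)
  have inv': "inv v \<in> H'" if "v \<in> H'" for v
  proof -
    have vG: "v \<in> carrier G" using that H'G by blast
    have "v [^] (N - 1) \<otimes> v = v [^] N" using N(1) by (cases N) simp_all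
    then have "v [^] (N - 1) \<otimes> v = \<one>" using N(2)[OF vG] by simp
    then have "inv v = v [^] (N - 1)" using vG by (intro inv_equality) auto
    then show ?thesis using powH'[OF that] by simp
  qed
  have "subgroup H' G"
    using H'G closed inv' one' by (intro subgroupI) auto
  moreover have "\<chi>' (v \<otimes> w) mod int N = (\<chi>' v + \<chi>' w) mod int N" if vw: "v \<in> H'" "w \<in> H'" for v w
  proof -
    obtain h k where v: "h \<in> H" "v = h \<otimes> b [^] (k::nat)" using vw by (auto simp: H'_def)
    obtain h' k' where w: "h' \<in> H" "w = h' \<otimes> b [^] (k'::nat)" using vw by (auto simp: H'_def)
    have "\<chi>' (v \<otimes> w) mod int N = (\<chi> (h \<otimes> h') + int (k + k') * q) mod int N"
      unfolding v(2) w(2) mult'[OF v(1) w(1)] by (intro \<chi>' subgroup.m_closed[OF H] v w)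
    also have "\<dots> = (\<chi> (h \<otimes> h') mod int N + int (k + k') * q) mod int N" by (simp add: mod_simps)
    also have "\<dots> = (\<chi> h + \<chi> h' + int (k + k') * q) mod int N"
      unfolding partial_char_mult[OF \<chi> v(1) w(1)] by (simp add: mod_simps)
    also have "\<dots> = ((\<chi> h + int k * q) mod int N + (\<chi> h' + int k' * q) mod int N) mod int N"
      by (simp only: mod_add_eq) (simp add: algebra_simps)
    also have "\<dots> = (\<chi>' v mod int N + \<chi>' w mod int N) mod int N"
      unfolding v(2) w(2) by (simp only: \<chi>'[OF v(1)] \<chi>'[OF w(1)])
    finally show ?thesis by (simp add: mod_simps)
  qed
  ultimately have "partial_char N H' \<chi>'" by (simp add: partial_char_def)
  moreover have "\<chi>' a mod int N = \<chi> a mod int N" if "a \<in> H" for a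
    using \<chi>'[OF that, of 0] HG[OF that] by simp
  moreover have b': "b = \<one> \<otimes> b [^] (1::nat)" using b by simp
  then have "b \<in> H'" unfolding H'_def using subgroup.one_closed[OF H] by blast
  moreover have "\<chi>' b mod int N = q mod int N"
  proof -
    have "\<chi> \<one> mod int N = 0"
      using partial_char_pow[OF \<chi> subgroup.one_closed[OF H], of 0] by simp
    then have "(\<chi> \<one> + q) mod int N = q mod int N" by (metis add.left_neutral mod_add_left_eq)
    then show ?thesis using \<chi>'[OF subgroup.one_closed[OF H], of 1] b by simp
  qed
  ultimately show ?thesis using that HH' by blast
qed

lemma least_power:
  assumes N: "(N::nat) > 0" "\<And>a. a \<in> carrier G \<Longrightarrow> a [^] N = \<one>" and H: "subgroup H G"
    and b: "b \<in> carrier G"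
  obtains n :: nat where "n > 0" "b [^] n \<in> H" "\<And>k. k > 0 \<Longrightarrow> b [^] k \<in> H \<Longrightarrow> n \<le> k"
proof -
  have "N > 0 \<and> b [^] N \<in> H" using assms subgroup.one_closed[OF H] by simp
  then have "(LEAST n::nat. n > 0 \<and> b [^] n \<in> H) > 0 \<and> b [^] (LEAST n::nat. n > 0 \<and> b [^] n \<in> H) \<in> H"
    by (rule LeastI[of "\<lambda>n::nat. n > 0 \<and> b [^] n \<in> H" N])
  then show ?thesis using that Least_le[of "\<lambda>n::nat. n > 0 \<and> b [^] n \<in> H"] by blast
qed

text \<open>Induction on the number of missing elements. One step needs
  \<open>n dvd \<chi> (b^n)\<close>: since \<open>n dvd N\<close> and \<open>b^N = 1\<close>, the
  value \<open>\<chi> (b^n)\<close> times \<open>N / n\<close> vanishes modulo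
  \<open>N\<close>.\<close>

lemma char_extend_total:
  assumes fin: "finite (carrier G)" and N: "N > 0" "\<And>a. a \<in> carrier G \<Longrightarrow> a [^] N = \<one>"
    and \<chi>: "partial_char N H \<chi>"
  shows "\<exists>\<chi>'. partial_char N (carrier G) \<chi>' \<and> (\<forall>a\<in>H. \<chi>' a mod int N = \<chi> a mod int N)"
  using \<chi>
proof (induction "card (carrier G) - card H" arbitrary: H \<chi> rule: less_induct)
  case less
  have H: "subgroup H G" using less.prems by (simp add: partial_char_def)
  show ?case
  proof (cases "H = carrier G")
    case False
    then obtain b where b: "b \<in> carrier G" "b \<notin> H" using subgroup.subset[OF H] by auto
    obtain n where n: "n > 0" "b [^] n \<in> H" "\<And>k::nat. k > 0 \<Longrightarrow> b [^] k \<in> H \<Longrightarrow> n \<le> k"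
      using least_power[OF N H b(1)] by metis
    have "n dvd N"
    proof (rule ccontr)
      assume "\<not> n dvd N"
      then have "N mod n > 0" by (simp add: dvd_eq_mod_eq_0)
      have "(b [^] n) [^] (N div n) \<otimes> b [^] (N mod n) = \<one>"
        using b N(2)[OF b(1)] by (simp add: nat_pow_pow nat_pow_mult)
      then have "b [^] (N mod n) = inv ((b [^] n) [^] (N div n))"
        using b by (metis inv_equality inv_inv nat_pow_closed m_comm)
      then have "b [^] (N mod n) \<in> H"
        using subgroup_pow_closed[OF H n(2)] subgroup.m_inv_closed[OF H] by simp
      then have "n \<le> N mod n" using n(3) \<open>N mod n > 0\<close> by blast
      then show False using n(1) by (simp add: not_less[symmetric])
    qed
    then obtain r where r: "N = n * r" by auto
    have "(int r * \<chi> (b [^] n)) mod int N = 0"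
    proof -
      have "(int r * \<chi> (b [^] n)) mod int N = \<chi> ((b [^] n) [^] r) mod int N"
        using partial_char_pow[OF less.prems n(2), of r] by simp
      also have "(b [^] n) [^] r = \<one>" using N(2)[OF b(1)] b by (simp add: nat_pow_pow r)
      also have "\<chi> \<one> mod int N = 0"
        using partial_char_pow[OF less.prems subgroup.one_closed[OF H], of 0] by simp
      finally show ?thesis .
    qed
    then have "int r * int n dvd int r * \<chi> (b [^] n)" by (simp add: mod_eq_0_iff_dvd r mult.commute)
    then have "int n dvd \<chi> (b [^] n)" using N(1) r by simp
    then obtain q where q: "\<chi> (b [^] n) = int n * q" by auto
    obtain H' \<chi>' where H': "partial_char N H' \<chi>'" "H \<subseteq> H'" "b \<in> H'"
      "\<And>a. a \<in> H \<Longrightarrow> \<chi>' a mod int N = \<chi> a mod int N"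
      using partial_char_extend[OF less.prems N b n, of q] q by metis
    have "H' \<subseteq> carrier G" using H'(1) subgroup.subset by (auto simp: partial_char_def)
    then have "card H < card H'" "card H' \<le> card (carrier G)"
      using H' b fin by (auto intro!: psubset_card_mono card_mono intro: finite_subset)
    then have "card (carrier G) - card H' < card (carrier G) - card H" by linarith
    from less.hyps[OF this H'(1)] show ?thesis using H'(2,4) by (metis subsetD)
  qed (use less.prems in blast)
qed

text \<open>The trivial character of \<open>H\<close> is extended to \<open>a\<close> with the value
  \<open>r = N / n\<close>: this is consistent since \<open>n r = N\<close>, and nonzero modulo
  \<open>N\<close> since \<open>n > 1\<close>.\<close>

lemma char_separates:
  assumes fin: "finite (carrier G)" and N: "N > 0" "\<And>a. a \<in> carrier G \<Longrightarrow> a [^] N = \<one>"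
    and H: "subgroup H G" and a: "a \<in> carrier G" "a \<notin> H"
  shows "\<exists>\<chi>. partial_char N (carrier G) \<chi> \<and> (\<forall>h\<in>H. \<chi> h mod int N = 0) \<and> \<chi> a mod int N \<noteq> 0"
proof -
  have \<chi>0: "partial_char N H (\<lambda>_. 0)" using H by (simp add: partial_char_def)
  obtain n where n: "n > 0" "a [^] n \<in> H" "\<And>k::nat. k > 0 \<Longrightarrow> a [^] k \<in> H \<Longrightarrow> n \<le> k"
    using least_power[OF N H a(1)] by metis
  have "n dvd N"
  proof (rule ccontr)
    assume "\<not> n dvd N"
    then have "N mod n > 0" by (simp add: dvd_eq_mod_eq_0)
    have "(a [^] n) [^] (N div n) \<otimes> a [^] (N mod n) = \<one>"
      using a N(2)[OF a(1)] by (simp add: nat_pow_pow nat_pow_mult)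
    then have "a [^] (N mod n) = inv ((a [^] n) [^] (N div n))"
      using a by (metis inv_equality inv_inv nat_pow_closed m_comm)
    then have "a [^] (N mod n) \<in> H"
      using subgroup_pow_closed[OF H n(2)] subgroup.m_inv_closed[OF H] by simp
    then have "n \<le> N mod n" using n(3) \<open>N mod n > 0\<close> by blast
    then show False using n(1) by (simp add: not_less[symmetric])
  qed
  then obtain r where r: "N = n * r" by auto
  have "n \<noteq> 1" using n(2) a by auto
  then have "n > 1" using n(1) by linarith
  moreover have "r > 0" using N(1) r by (cases r) auto
  ultimately have "1 * r < n * r" by (intro mult_strict_right_mono)
  then have "r < N" by (simp add: r)
  moreover have "r > 0" using N(1) r by (cases r) auto
  ultimately have rN: "int r mod int N \<noteq> 0" by simp
  obtain H' \<chi>' where H': "partial_char N H' \<chi>'" "H \<subseteq> H'" "a \<in> H'"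
      "\<And>h. h \<in> H \<Longrightarrow> \<chi>' h mod int N = 0 mod int N" "\<chi>' a mod int N = int r mod int N"
    using partial_char_extend[OF \<chi>0 N a n, of "int r"] r by (metis mod_self of_nat_mult mod_0)
  obtain \<chi> where \<chi>: "partial_char N (carrier G) \<chi>" "\<forall>a\<in>H'. \<chi> a mod int N = \<chi>' a mod int N"
    using char_extend_total[OF fin N H'(1)] by blast
  then show ?thesis using H' rN by (intro exI[of _ \<chi>]) (auto simp: subset_iff)
qed

end

section \<open>Braces acting on groups of characters\<close>

context brace
begin

definition lam :: "'a \<Rightarrow> 'a \<Rightarrow> 'a" where "lam g b = \<ominus> g \<oplus> g \<otimes> b"

lemma lam_closed [simp]: "g \<in> carrier B \<Longrightarrow> b \<in> carrier B \<Longrightarrow> lam g b \<in> carrier B"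
  by (simp add: lam_def)

lemma mult_eq_lam: "g \<in> carrier B \<Longrightarrow> b \<in> carrier B \<Longrightarrow> g \<otimes> b = g \<oplus> lam g b"
  by (simp add: lam_def r_neg2)

lemma lam_add:
  "g \<in> carrier B \<Longrightarrow> a \<in> carrier B \<Longrightarrow> b \<in> carrier B \<Longrightarrow> lam g (a \<oplus> b) = lam g a \<oplus> lam g b"
  by (simp add: lam_def brace_law a_minus_def a_ac)

lemma zero_eq_one: "\<zero> = \<one>"
proof -
  have "\<one> \<otimes> (\<zero> \<oplus> \<zero>) = (\<one> \<otimes> \<zero> \<ominus> \<one>) \<oplus> \<one> \<otimes> \<zero>"
    by (rule brace_law) simp_all
  moreover have "\<one> \<otimes> (\<zero> \<oplus> \<zero>) = \<zero>" by simp
  moreover have "(\<one> \<otimes> \<zero> \<ominus> \<one>) \<oplus> \<one> \<otimes> \<zero> = \<ominus> \<one>"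
    by (simp add: a_minus_def)
  ultimately have "\<ominus> \<one> = \<zero>" by simp
  then have "\<ominus> (\<ominus> \<one>) = \<ominus> \<zero>" by (rule arg_cong)
  moreover have "\<ominus> \<zero> = \<zero>" by (metis l_neg r_zero zero_closed a_inv_closed)
  ultimately show ?thesis by simp
qed

lemma minus_one: "\<ominus> \<one> = \<zero>"
  by (simp flip: zero_eq_one)

lemma lam_one [simp]: "b \<in> carrier B \<Longrightarrow> lam \<one> b = b"
  by (simp add: lam_def minus_one)

lemma lam_mult:
  assumes "g \<in> carrier B" "h \<in> carrier B" "b \<in> carrier B"
  shows "lam (g \<otimes> h) b = lam g (lam h b)"
proof -
  have "(g \<otimes> h) \<oplus> lam (g \<otimes> h) b = g \<otimes> (h \<oplus> lam h b)"
    using assms by (simp add: m_assoc flip: mult_eq_lam)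
  also have "\<dots> = g \<oplus> (lam g h \<oplus> lam g (lam h b))"
    using assms by (simp add: mult_eq_lam lam_add)
  also have "\<dots> = (g \<otimes> h) \<oplus> lam g (lam h b)"
    using assms by (simp add: mult_eq_lam a_assoc)
  finally show ?thesis using assms by simp
qed

text \<open>The quotient by \<open>I\<close> is realised inside a ring of functions on characters:
  \<open>\<iota> a\<close> evaluates at \<open>a\<close> the characters that kill \<open>I\<close>,
  and \<open>\<Lambda> g\<close> precomposes them with \<open>lam g\<close>. That
  \<open>\<iota>\<close> is injective modulo \<open>I\<close> is the separation of points by these
  characters.\<close>

lemma module_embedding:
  assumes fin: "finite (carrier B)" and I: "subgroup I (add_monoid B)"
    and inv: "\<And>g a. g \<in> carrier B \<Longrightarrow> a \<in> I \<Longrightarrow> lam g a \<in> I"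
  obtains \<iota> :: "'a \<Rightarrow> ('a \<Rightarrow> int) \<Rightarrow> zprod" and \<Lambda> :: "'a \<Rightarrow> (('a \<Rightarrow> int) \<Rightarrow> zprod) \<Rightarrow> ('a \<Rightarrow> int) \<Rightarrow> zprod"
  where "\<And>a b. a \<in> carrier B \<Longrightarrow> b \<in> carrier B \<Longrightarrow> \<iota> (a \<oplus> b) = \<iota> a + \<iota> b"
    "\<And>a b. a \<in> carrier B \<Longrightarrow> b \<in> carrier B \<Longrightarrow> \<iota> a = \<iota> b \<longleftrightarrow> a \<ominus> b \<in> I"
    "\<And>g. additive (\<Lambda> g)"
    "\<And>g h v. g \<in> carrier B \<Longrightarrow> h \<in> carrier B \<Longrightarrow> \<Lambda> (g \<otimes> h) v = \<Lambda> g (\<Lambda> h v)"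
    "\<And>v. \<Lambda> \<one> v = v"
    "\<And>g h. g \<in> carrier B \<Longrightarrow> h \<in> carrier B \<Longrightarrow> \<iota> (g \<otimes> h) = \<iota> g + \<Lambda> g (\<iota> h)"
proof -
  define N where "N = card (carrier B)"
  have N: "N > 0" using fin by (auto simp: N_def card_gt_0_iff)
  have expN: "[N] \<cdot> a = \<zero>" if "a \<in> carrier B" for a
    using add.pow_order_eq_1[of a] that by (simp add: N_def order_def)
  \<comment> \<open>Characters are normalised to \<open>0\<close> outside the carrier, so that
    precomposition with \<open>lam \<one>\<close> returns the very same function.\<close>
  define cut where "cut \<chi> a = (if a \<in> carrier B then \<chi> a else 0)" for \<chi> :: "'a \<Rightarrow> int" and a
  define Ch where "Ch = {\<chi>. add.partial_char N (carrier B) \<chi> \<and> (\<forall>h\<in>I. \<chi> h mod int N = 0) \<and> cut \<chi> = \<chi>}"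
  \<comment> \<open>Only coordinate \<open>N\<close> of \<open>zprod\<close> is occupied, a copy of
    the integers modulo \<open>N\<close>.\<close>
  define \<iota> where "\<iota> a \<chi> = (if \<chi> \<in> Ch then zp (\<lambda>n. if n = N then \<chi> a else 0) else 0)" for a \<chi>
  define \<Lambda> where "\<Lambda> g F \<chi> = (if \<chi> \<in> Ch then F (cut (\<lambda>a. \<chi> (lam g a))) else F \<chi>)"
    for g and F :: "('a \<Rightarrow> int) \<Rightarrow> zprod" and \<chi>
  have IB: "I \<subseteq> carrier B" using subgroup.subset[OF I] by simp
  have Ch_add: "\<chi> (a \<oplus> b) mod int N = (\<chi> a + \<chi> b) mod int N"
    if "\<chi> \<in> Ch" "a \<in> carrier B" "b \<in> carrier B" for \<chi> a b
    using that add.partial_char_mult[of N "carrier B" \<chi> a b] by (simp add: Ch_def)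
  have Ch_I: "\<chi> h mod int N = 0" if "\<chi> \<in> Ch" "h \<in> I" for \<chi> h
    using that by (simp add: Ch_def)
  have ChI: "cut \<chi> \<in> Ch"
    if "\<And>a b. a \<in> carrier B \<Longrightarrow> b \<in> carrier B \<Longrightarrow> \<chi> (a \<oplus> b) mod int N = (\<chi> a + \<chi> b) mod int N"
      "\<And>h. h \<in> I \<Longrightarrow> \<chi> h mod int N = 0" for \<chi>
    using that IB add.subgroup_self by (auto simp: Ch_def add.partial_char_def cut_def fun_eq_iff)
  have lam_Ch: "cut (\<lambda>a. \<chi> (lam g a)) \<in> Ch" if "\<chi> \<in> Ch" "g \<in> carrier B" for \<chi> g
    using that inv by (intro ChI) (simp_all add: lam_add Ch_add Ch_I)
  have zp_eq: "zp (\<lambda>n. if n = N then i else 0) = zp (\<lambda>n. if n = N then j else 0) \<longleftrightarrow>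
      i mod int N = j mod int N" for i j
  proof
    assume "zp (\<lambda>n. if n = N then i else 0) = zp (\<lambda>n. if n = N then j else 0)"
    from arg_cong[OF this, of "\<lambda>z. Rep_zprod z N"] show "i mod int N = j mod int N" by simp
  qed (auto intro!: zprod_eqI)
  have zp_plus: "zp (\<lambda>n. if n = N then i + j else 0) = zp (\<lambda>n. if n = N then i else 0) + zp (\<lambda>n. if n = N then j else 0)" for i j
    unfolding zp_add[symmetric] by (rule arg_cong[of _ _ zp]) auto
  show ?thesis
  proof (rule that[of \<iota> \<Lambda>])
    fix a b assume ab: "a \<in> carrier B" "b \<in> carrier B"
    show add: "\<iota> (a \<oplus> b) = \<iota> a + \<iota> b"
    proof
      fix \<chi>
      show "\<iota> (a \<oplus> b) \<chi> = (\<iota> a + \<iota> b) \<chi>"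
        using Ch_add[of \<chi> a b] ab by (simp add: \<iota>_def zp_eq flip: zp_plus)
    qed
    show "\<iota> a = \<iota> b \<longleftrightarrow> a \<ominus> b \<in> I"
    proof
      assume eq: "\<iota> a = \<iota> b"
      show "a \<ominus> b \<in> I"
      proof (rule ccontr)
        assume "a \<ominus> b \<notin> I"
        then obtain \<chi> where \<chi>: "add.partial_char N (carrier B) \<chi>" "\<forall>h\<in>I. \<chi> h mod int N = 0"
            "\<chi> (a \<ominus> b) mod int N \<noteq> 0"
          using add.char_separates[of N I "a \<ominus> b"] fin N expN I ab by auto
        have c: "cut \<chi> \<in> Ch"
          using \<chi> add.partial_char_mult[OF \<chi>(1)] by (intro ChI) auto
        have "cut \<chi> a mod int N = cut \<chi> b mod int N"
          using fun_cong[OF eq, of "cut \<chi>"] c by (simp add: \<iota>_def zp_eq)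
        moreover have "\<chi> ((a \<ominus> b) \<oplus> b) mod int N = (\<chi> (a \<ominus> b) + \<chi> b) mod int N"
          using add.partial_char_mult[OF \<chi>(1), of "a \<ominus> b" b] ab by simp
        moreover have "(a \<ominus> b) \<oplus> b = a" using ab by (simp add: a_minus_def a_assoc l_neg)
        ultimately have "(\<chi> (a \<ominus> b) + \<chi> b) mod int N = (0 + \<chi> b) mod int N"
          using ab by (simp add: cut_def)
        then have "int N dvd \<chi> (a \<ominus> b)" by (simp add: mod_eq_dvd_iff)
        then show False using \<chi>(3) by simp
      qed
    next
      assume I': "a \<ominus> b \<in> I"
      show "\<iota> a = \<iota> b"
      proof
        fix \<chi>
        show "\<iota> a \<chi> = \<iota> b \<chi>"
        proof (cases "\<chi> \<in> Ch")
          case True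
          have "(a \<ominus> b) \<oplus> b = a" using ab by (simp add: a_minus_def a_assoc l_neg)
          then have "\<chi> a mod int N = (\<chi> (a \<ominus> b) + \<chi> b) mod int N"
            using Ch_add[OF True, of "a \<ominus> b" b] ab by simp
          also have "\<dots> = (\<chi> (a \<ominus> b) mod int N + \<chi> b) mod int N" by (simp add: mod_simps)
          also have "\<dots> = \<chi> b mod int N" using Ch_I[OF True I'] by simp
          finally show ?thesis using True by (simp add: \<iota>_def zp_eq)
        qed (simp add: \<iota>_def)
      qed
    qed
  next
    show "additive (\<Lambda> g)" for g
      by (auto simp: additive_def \<Lambda>_def fun_eq_iff)
  next
    fix g h v assume gh: "g \<in> carrier B" "h \<in> carrier B"
    show "\<Lambda> (g \<otimes> h) v = \<Lambda> g (\<Lambda> h v)"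
    proof
      fix \<chi>
      have "cut (\<lambda>a. \<chi> (lam (g \<otimes> h) a)) = cut (\<lambda>a. cut (\<lambda>a. \<chi> (lam g a)) (lam h a))"
        using gh by (auto simp: cut_def lam_mult fun_eq_iff)
      then show "\<Lambda> (g \<otimes> h) v \<chi> = \<Lambda> g (\<Lambda> h v) \<chi>"
        using lam_Ch gh by (simp add: \<Lambda>_def)
    qed
  next
    fix v
    show "\<Lambda> \<one> v = v"
    proof
      fix \<chi>
      have "cut (\<lambda>a. \<chi> (lam \<one> a)) = \<chi>" if "\<chi> \<in> Ch"
      proof -
        have "cut (\<lambda>a. \<chi> (lam \<one> a)) = cut \<chi>" by (auto simp: cut_def fun_eq_iff)
        then show ?thesis using that by (simp add: Ch_def)
      qed
      then show "\<Lambda> \<one> v \<chi> = v \<chi>" by (simp add: \<Lambda>_def)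
    qed
  next
    fix g h assume gh: "g \<in> carrier B" "h \<in> carrier B"
    show "\<iota> (g \<otimes> h) = \<iota> g + \<Lambda> g (\<iota> h)"
    proof
      fix \<chi>
      show "\<iota> (g \<otimes> h) \<chi> = (\<iota> g + \<Lambda> g (\<iota> h)) \<chi>"
      proof (cases "\<chi> \<in> Ch")
        case True
        then have "\<iota> (g \<otimes> h) \<chi> = zp (\<lambda>n. if n = N then \<chi> g + \<chi> (lam g h) else 0)"
          using Ch_add[OF True, of g "lam g h"] gh by (simp add: \<iota>_def zp_eq mult_eq_lam)
        then show ?thesis using True lam_Ch[OF True gh(1)] gh
          by (simp add: \<iota>_def \<Lambda>_def cut_def zp_plus cong: if_cong)
      qed (simp add: \<iota>_def \<Lambda>_def)
    qed
  qed
qed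

end

section \<open>Braces with a dicyclic multiplicative group\<close>

context brace
begin

lemma a_inv_zero [simp]: "\<ominus> \<zero> = \<zero>"
  by (metis l_neg r_zero zero_closed a_inv_closed)

lemma lam_zero [simp]: "g \<in> carrier B \<Longrightarrow> lam g \<zero> = \<zero>"
  using lam_add[of g \<zero> \<zero>] lam_closed[of g \<zero>] by (metis add.r_cancel_one l_zero zero_closed)

end

text \<open>The presentation is replaced by its consequences: normal forms \<open>x^i\<close> and
  \<open>x^i y\<close>, the order \<open>2 m\<close> of \<open>x\<close>, and the two
  relations.\<close>

locale quaternion_brace = brace B for B (structure) +
  fixes m :: nat and x y :: 'a
  assumes m_pos: "m > 0"
    and x_closed [simp]: "x \<in> carrier B" and y_closed [simp]: "y \<in> carrier B"
    and carrier_eq: "carrier B = {x [^] i |i::nat. True} \<union> {x [^] i \<otimes> y |i::nat. True}"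
    and x_pow_eq_1: "x [^] (i::nat) = \<one> \<longleftrightarrow> 2 * m dvd i"
    and y_x: "y \<otimes> x = inv x \<otimes> y" and y_y: "y \<otimes> y = x [^] m"
    and y_neq: "y \<noteq> x [^] (i::nat)"
begin

lemma x_pow_mod: "x [^] (i mod (2 * m)) = x [^] (i::nat)"
proof -
  have "x [^] i = x [^] (i mod (2 * m)) \<otimes> x [^] (2 * m * (i div (2 * m)))"
    by (simp only: nat_pow_mult x_closed mod_mult_div_eq)
  moreover have "x [^] (2 * m * (i div (2 * m))) = \<one>" unfolding x_pow_eq_1 by simp
  ultimately show ?thesis by simp
qed

lemma x_pow_eq_iff: "x [^] (i::nat) = x [^] (j::nat) \<longleftrightarrow> i mod (2 * m) = j mod (2 * m)"
proof
  have le: "i mod (2 * m) = j mod (2 * m)" if "i \<le> j" "x [^] i = x [^] j" for i j :: nat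
  proof -
    have "x [^] i \<otimes> x [^] (j - i) = x [^] j"
      using that(1) by (simp add: nat_pow_mult)
    then have "inv (x [^] i) \<otimes> (x [^] i \<otimes> x [^] (j - i)) = inv (x [^] i) \<otimes> x [^] i"
      using that(2) by simp
    moreover have "inv (x [^] i) \<otimes> (x [^] i \<otimes> x [^] (j - i)) = x [^] (j - i)"
      by (simp only: m_assoc[symmetric] nat_pow_closed x_closed inv_closed l_inv l_one)
    ultimately have "x [^] (j - i) = \<one>" by simp
    then have "2 * m dvd j - i" by (simp only: x_pow_eq_1)
    then have "j mod (2 * m) = i mod (2 * m)" by (subst mod_eq_dvd_iff_nat[OF that(1)])
    then show ?thesis by (rule sym)
  qed
  assume "x [^] i = x [^] j"
  then show "i mod (2 * m) = j mod (2 * m)"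
    using le[of i j] le[of j i] linorder_linear[of i j] by metis
next
  assume "i mod (2 * m) = j mod (2 * m)"
  then show "x [^] i = x [^] j" by (metis x_pow_mod)
qed

lemma inv_x_pow: "inv (x [^] (i::nat)) = x [^] (2 * m * i - i)"
proof (rule inv_equality)
  have "2 * m * i - i + i = 2 * m * i" using m_pos by (cases m) auto
  then have "x [^] (2 * m * i - i) \<otimes> x [^] i = x [^] (2 * m * i)" by (simp only: nat_pow_mult x_closed)
  then show "x [^] (2 * m * i - i) \<otimes> x [^] i = \<one>" using x_pow_eq_1[of "2 * m * i"] by simp
qed simp_all

lemma carrier_cases:
  assumes "g \<in> carrier B"
  obtains (rot) i :: nat where "g = x [^] i" | (refl) i :: nat where "g = x [^] i \<otimes> y"
  using assms by (auto simp: carrier_eq)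

lemma finite_carrier: "finite (carrier B)"
proof -
  have "carrier B \<subseteq> (\<lambda>i. x [^] i) ` {..<2 * m} \<union> (\<lambda>i. x [^] i \<otimes> y) ` {..<2 * m}"
  proof
    fix g assume "g \<in> carrier B"
    then show "g \<in> (\<lambda>i. x [^] i) ` {..<2 * m} \<union> (\<lambda>i. x [^] i \<otimes> y) ` {..<2 * m}"
    proof (cases rule: carrier_cases)
      case (rot i)
      then have "g = x [^] (i mod (2 * m))" by (simp only: x_pow_mod)
      then show ?thesis using m_pos by auto
    next
      case (refl i)
      then have "g = x [^] (i mod (2 * m)) \<otimes> y" by (simp only: x_pow_mod)
      then show ?thesis using m_pos by auto
    qed
  qed
  then show ?thesis by (rule finite_subset) simp
qed

lemma y_x_pow: "y \<otimes> x [^] (i::nat) = inv (x [^] i) \<otimes> y"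
proof (induction i)
  case (Suc i)
  have "y \<otimes> x [^] Suc i = (y \<otimes> x [^] i) \<otimes> x" by (simp add: m_assoc)
  also have "\<dots> = inv (x [^] i) \<otimes> (y \<otimes> x)" unfolding Suc by (simp add: m_assoc)
  also have "\<dots> = inv (x [^] i) \<otimes> inv x \<otimes> y" by (simp add: y_x m_assoc)
  also have "inv (x [^] i) \<otimes> inv x = inv (x \<otimes> x [^] i)" by (simp add: inv_mult_group)
  also have "x \<otimes> x [^] i = x [^] Suc i" using nat_pow_mult[of x 1 i] by simp
  finally show ?case .
qed simp

lemma refl_neq: "x [^] (i::nat) \<otimes> y \<noteq> x [^] (j::nat)"
proof
  assume "x [^] i \<otimes> y = x [^] j"
  then have "y = inv (x [^] i) \<otimes> x [^] j" by (simp add: inv_solve_left)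
  also have "\<dots> = x [^] (2 * m * i - i + j)" by (simp add: inv_x_pow nat_pow_mult)
  finally show False using y_neq by blast
qed

lemma refl_square: "(x [^] (i::nat) \<otimes> y) \<otimes> (x [^] i \<otimes> y) = x [^] m"
proof -
  have "(x [^] i \<otimes> y) \<otimes> (x [^] i \<otimes> y) = x [^] i \<otimes> (y \<otimes> x [^] i) \<otimes> y"
    by (simp add: m_assoc)
  also have "\<dots> = (x [^] i \<otimes> inv (x [^] i)) \<otimes> (y \<otimes> y)"
    unfolding y_x_pow by (simp only: m_assoc nat_pow_closed x_closed y_closed inv_closed m_closed)
  also have "x [^] i \<otimes> inv (x [^] i) = \<one>" by simp
  finally show ?thesis by (simp add: y_y)
qed

lemma x_pow_comm: "x [^] (i::nat) \<otimes> x [^] (j::nat) = x [^] j \<otimes> x [^] i"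
  by (simp add: nat_pow_mult add.commute)

text \<open>Conjugation fixes or inverts a power of \<open>x\<close>; hence every subgroup of
  rotations is normal.\<close>

lemma conj_rot:
  assumes "g \<in> carrier B"
  shows "x [^] (i::nat) \<otimes> g = g \<otimes> x [^] i \<or> x [^] i \<otimes> g = g \<otimes> inv (x [^] i)"
  using assms
proof (cases rule: carrier_cases)
  case (rot j)
  then show ?thesis by (simp add: x_pow_comm)
next
  case (refl j)
  have "y \<otimes> inv (x [^] i) = x [^] i \<otimes> y"
    using y_x_pow[of "2 * m * i - i"] by (simp flip: inv_x_pow)
  then have "g \<otimes> inv (x [^] i) = x [^] j \<otimes> (x [^] i \<otimes> y)" by (simp add: refl m_assoc)
  then have "g \<otimes> inv (x [^] i) = x [^] i \<otimes> g" by (simp add: refl x_pow_comm flip: m_assoc)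
  then show ?thesis by simp
qed

text \<open>The generator \<open>y\<close> is determined only up to a power of \<open>x\<close>;
  later arguments choose \<open>k\<close> to give \<open>x^k y\<close> a special form.\<close>

lemma rename: "quaternion_brace B m x (x [^] (k::nat) \<otimes> y)"
proof unfold_locales
  show "carrier B = {x [^] i |i::nat. True} \<union> {x [^] i \<otimes> (x [^] k \<otimes> y) |i::nat. True}"
  proof -
    have "x [^] i \<otimes> y = x [^] (2 * m * k - k + i) \<otimes> (x [^] k \<otimes> y)" for i :: nat
    proof -
      have "2 * m * k - k + i + k = 2 * m * k + i" using m_pos by (cases m) auto
      then have "x [^] (2 * m * k - k + i) \<otimes> x [^] k = x [^] (2 * m * k + i)"
        by (simp only: nat_pow_mult x_closed)
      also have "\<dots> = x [^] i" unfolding x_pow_eq_iff by (simp only: mod_mult_self4)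
      finally show ?thesis by (simp flip: m_assoc)
    qed
    moreover have "x [^] i \<otimes> (x [^] k \<otimes> y) = x [^] (i + k) \<otimes> y" for i :: nat
      by (simp add: nat_pow_mult flip: m_assoc)
    ultimately show ?thesis unfolding carrier_eq by blast
  qed
  show "x [^] k \<otimes> y \<otimes> x = inv x \<otimes> (x [^] k \<otimes> y)"
  proof -
    have "x [^] k \<otimes> y \<otimes> x = x [^] k \<otimes> (inv x \<otimes> y)" by (simp add: m_assoc y_x)
    also have "x [^] k \<otimes> inv x = inv x \<otimes> x [^] k"
      using x_pow_comm[of k "2 * m * 1 - 1"] inv_x_pow[of 1] by simp
    then have "x [^] k \<otimes> (inv x \<otimes> y) = inv x \<otimes> (x [^] k \<otimes> y)" by (simp flip: m_assoc)
    finally show ?thesis .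
  qed
  show "x [^] k \<otimes> y \<otimes> (x [^] k \<otimes> y) = x [^] m" by (rule refl_square)
  show "x [^] k \<otimes> y \<noteq> x [^] i" for i :: nat by (rule refl_neq)
qed (simp_all add: m_pos x_pow_eq_1)

definition rots :: "nat \<Rightarrow> 'a set" where "rots N = {x [^] (N * k) |k::nat. True}"

text \<open>Normality in the multiplicative group is automatic for subgroups generated by a power of
  \<open>x\<close>, so only the additive structure and \<open>lam\<close> are mentioned.\<close>

definition ideal :: "nat \<Rightarrow> bool" where
  "ideal N \<longleftrightarrow> N dvd 2 * m \<and> subgroup (rots N) (add_monoid B) \<and>
    (\<forall>g\<in>carrier B. \<forall>a\<in>rots N. lam g a \<in> rots N)"

lemma x_pow_rots: "N dvd 2 * m \<Longrightarrow> x [^] (i::nat) \<in> rots N \<longleftrightarrow> N dvd i"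
proof -
  assume N: "N dvd 2 * m"
  show ?thesis
  proof
    assume "x [^] i \<in> rots N"
    then obtain k where "i mod (2 * m) = (N * k) mod (2 * m)"
      by (auto simp: rots_def x_pow_eq_iff)
    then have "i mod (2 * m) mod N = 0" using N by (simp add: mod_mod_cancel)
    then show "N dvd i" using N by (simp add: mod_mod_cancel dvd_eq_mod_eq_0)
  qed (auto simp: rots_def)
qed

lemma refl_rots: "x [^] (i::nat) \<otimes> y \<notin> rots N"
  using refl_neq by (auto simp: rots_def)

lemma rots_closed: "rots N \<subseteq> carrier B"
  by (auto simp: rots_def)

end

section \<open>The quotient of the brace by the rotations \<open>x^(N k)\<close>\<close>

locale quaternion_module = quaternion_brace +
  fixes N :: nat and \<iota> :: "'a \<Rightarrow> 'u::comm_ring_1" and \<Lambda> :: "'a \<Rightarrow> 'u \<Rightarrow> 'u"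
  assumes N_dvd: "N dvd 2 * m"
    and iota_add: "\<lbrakk>a \<in> carrier B; b \<in> carrier B\<rbrakk> \<Longrightarrow> \<iota> (a \<oplus> b) = \<iota> a + \<iota> b"
    and iota_eq_iff: "\<lbrakk>a \<in> carrier B; b \<in> carrier B\<rbrakk> \<Longrightarrow> \<iota> a = \<iota> b \<longleftrightarrow> a \<ominus> b \<in> rots N"
    and Lambda_additive: "additive (\<Lambda> g)"
    and Lambda_mult: "\<lbrakk>g \<in> carrier B; h \<in> carrier B\<rbrakk> \<Longrightarrow> \<Lambda> (g \<otimes> h) v = \<Lambda> g (\<Lambda> h v)"
    and Lambda_one: "\<Lambda> \<one> v = v"
    and iota_mult: "\<lbrakk>g \<in> carrier B; h \<in> carrier B\<rbrakk> \<Longrightarrow> \<iota> (g \<otimes> h) = \<iota> g + \<Lambda> g (\<iota> h)"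
begin

lemma rename_module: "quaternion_module B m x (x [^] (k::nat) \<otimes> y) N \<iota> \<Lambda>"
proof -
  interpret R: quaternion_brace B m x "x [^] k \<otimes> y" by (rule rename)
  have "R.rots N = rots N" by (simp add: R.rots_def rots_def)
  then show ?thesis
    by unfold_locales (simp_all add: N_dvd iota_add iota_eq_iff additive.add[OF Lambda_additive] Lambda_mult Lambda_one iota_mult)
qed

lemma iota_one: "\<iota> \<one> = 0"
proof -
  have "\<iota> (\<one> \<otimes> \<one>) = \<iota> \<one> + \<iota> \<one>" by (simp only: iota_mult one_closed Lambda_one)
  then show ?thesis by simp
qed

lemma iota_zero: "\<iota> \<zero> = 0"
  by (simp add: zero_eq_one iota_one)

lemma iota_minus: "a \<in> carrier B \<Longrightarrow> \<iota> (\<ominus> a) = - \<iota> a"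
  using iota_add[of "\<ominus> a" a] by (simp add: l_neg iota_zero eq_neg_iff_add_eq_0)

lemma Lambda_inv [simp]: "g \<in> carrier B \<Longrightarrow> \<Lambda> g (\<Lambda> (inv g) v) = v"
  "g \<in> carrier B \<Longrightarrow> \<Lambda> (inv g) (\<Lambda> g v) = v"
  using Lambda_mult[of g "inv g" v] Lambda_mult[of "inv g" g v] by (simp_all add: Lambda_one)

lemma iota_eq_0_iff: "a \<in> carrier B \<Longrightarrow> \<iota> a = 0 \<longleftrightarrow> a \<in> rots N"
  using iota_eq_iff[of a \<zero>] by (simp add: iota_zero a_minus_def)

lemma iota_inv: "g \<in> carrier B \<Longrightarrow> \<iota> (inv g) = - \<Lambda> (inv g) (\<iota> g)"
  using iota_mult[of "inv g" g] by (simp add: iota_one eq_neg_iff_add_eq_0)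

lemma iota_inv_mult:
  "a \<in> carrier B \<Longrightarrow> b \<in> carrier B \<Longrightarrow> \<iota> (inv b \<otimes> a) = \<Lambda> (inv b) (\<iota> a - \<iota> b)"
  by (simp add: iota_mult iota_inv additive.diff[OF Lambda_additive])

lemma iota_eq_mult_iff:
  "a \<in> carrier B \<Longrightarrow> b \<in> carrier B \<Longrightarrow> \<iota> a = \<iota> b \<longleftrightarrow> inv b \<otimes> a \<in> rots N"
proof -
  assume ab: "a \<in> carrier B" "b \<in> carrier B"
  have "inv b \<otimes> a \<in> rots N \<longleftrightarrow> \<Lambda> (inv b) (\<iota> a - \<iota> b) = 0"
    using ab iota_eq_0_iff[of "inv b \<otimes> a"] by (simp add: iota_inv_mult)
  also have "\<dots> \<longleftrightarrow> \<iota> a - \<iota> b = 0"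
    using ab by (metis Lambda_inv(1) additive.zero[OF Lambda_additive])
  finally show ?thesis by simp
qed

lemma iota_pow: "g \<in> carrier B \<Longrightarrow> \<iota> (g [^] (i::nat)) = (\<Sum>j<i. (\<Lambda> g ^^ j) (\<iota> g))"
  and Lambda_pow: "g \<in> carrier B \<Longrightarrow> \<Lambda> (g [^] (i::nat)) v = (\<Lambda> g ^^ i) v"
proof -
  assume g: "g \<in> carrier B"
  show L: "\<Lambda> (g [^] (i::nat)) v = (\<Lambda> g ^^ i) v" for i v
    by (induction i arbitrary: v) (simp_all add: Lambda_one Lambda_mult g funpow_swap1)
  show "\<iota> (g [^] (i::nat)) = (\<Sum>j<i. (\<Lambda> g ^^ j) (\<iota> g))"
    by (induction i) (simp_all add: iota_one iota_mult g L)
qed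

lemma iota_lam: "g \<in> carrier B \<Longrightarrow> b \<in> carrier B \<Longrightarrow> \<iota> (lam g b) = \<Lambda> g (\<iota> b)"
  by (simp add: lam_def iota_add iota_minus iota_mult)

text \<open>\<open>rots N\<close> is normal, so \<open>c b = b c'\<close> with \<open>c'\<close>
  again in \<open>rots N\<close>, and \<open>\<iota>\<close> kills both \<open>c\<close> and
  \<open>c'\<close>.\<close>

lemma Lambda_rots:
  assumes "c \<in> rots N" "b \<in> carrier B"
  shows "\<Lambda> c (\<iota> b) = \<iota> b"
proof -
  obtain k where c: "c = x [^] (N * k)" using assms by (auto simp: rots_def)
  have inv: "inv c \<in> rots N"
  proof -
    have "2 * m * (N * k) - N * k = N * (2 * m * k - k)" by (simp add: algebra_simps)
    then show ?thesis unfolding c inv_x_pow by (auto simp: rots_def)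
  qed
  have cB: "c \<in> carrier B" by (simp add: c)
  obtain c' where c': "c' \<in> rots N" "c \<otimes> b = b \<otimes> c'"
    using conj_rot[OF assms(2), of "N * k"] assms(1) inv by (auto simp flip: c)
  have c'B: "c' \<in> carrier B" using c' rots_closed by blast
  have "\<iota> (c \<otimes> b) = \<iota> (b \<otimes> c')" using c' by simp
  then have "\<iota> c + \<Lambda> c (\<iota> b) = \<iota> b + \<Lambda> b (\<iota> c')" by (simp only: iota_mult cB c'B assms(2))
  moreover have "\<iota> c = 0" "\<iota> c' = 0" using assms(1) c' cB c'B by (simp_all add: iota_eq_0_iff)
  ultimately show ?thesis by (simp add: additive.zero[OF Lambda_additive])
qed

lemma dicyclic: "dicyclic_module (\<Lambda> x) (\<Lambda> (inv x)) (\<Lambda> y) (\<iota> x) (\<iota> y) (\<iota> ` carrier B) N m"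
proof
  show "\<Lambda> y (\<Lambda> x v) = \<Lambda> (inv x) (\<Lambda> y v)" for v
    by (simp add: y_x flip: Lambda_mult)
  show "\<Lambda> y (\<Lambda> y v) = (\<Lambda> x ^^ m) v" for v
    by (simp add: y_y Lambda_pow flip: Lambda_mult)
  show "\<Lambda> y (\<iota> x) = \<Lambda> (inv x) (\<iota> y) - \<Lambda> (inv x) (\<iota> x) - \<iota> y"
  proof -
    have "\<iota> y + \<Lambda> y (\<iota> x) = \<iota> (inv x \<otimes> y)" by (simp flip: y_x iota_mult)
    then show ?thesis by (simp add: iota_mult iota_inv algebra_simps)
  qed
  show "\<Lambda> y (\<iota> y) = (\<Sum>j<m. (\<Lambda> x ^^ j) (\<iota> x)) - \<iota> y"
  proof -
    have "\<iota> y + \<Lambda> y (\<iota> y) = \<iota> (x [^] m)" by (simp flip: y_y iota_mult)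
    then show ?thesis by (simp add: iota_pow algebra_simps)
  qed
  fix v assume v: "v \<in> \<iota> ` carrier B"
  then obtain b where b: "b \<in> carrier B" "v = \<iota> b" by auto
  show "- v \<in> \<iota> ` carrier B" using b by (auto simp flip: iota_minus)
  show "\<Lambda> x v \<in> \<iota> ` carrier B" "\<Lambda> y v \<in> \<iota> ` carrier B" using b by (auto simp flip: iota_lam)
  show "v + w \<in> \<iota> ` carrier B" if "w \<in> \<iota> ` carrier B" for w
    using b that by (auto simp flip: iota_add)
  show "\<exists>i. v = (\<Sum>j<i. (\<Lambda> x ^^ j) (\<iota> x)) \<or> v = (\<Sum>j<i. (\<Lambda> x ^^ j) (\<iota> x)) + (\<Lambda> x ^^ i) (\<iota> y)"
    using b(1)
  proof (cases rule: carrier_cases)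
    case (rot i)
    then show ?thesis by (auto simp: b iota_pow)
  next
    case (refl i)
    then show ?thesis by (auto simp: b iota_pow iota_mult Lambda_pow)
  qed
  show "(\<Lambda> x ^^ N) v = v"
    using Lambda_rots[of "x [^] N" b] b(1) x_pow_rots[OF N_dvd, of N] by (simp add: b(2) Lambda_pow)
next
  fix i k
  show "(\<Sum>j<i. (\<Lambda> x ^^ j) (\<iota> x)) = 0 \<longleftrightarrow> N dvd i"
    using iota_eq_0_iff[of "x [^] i"] by (simp add: iota_pow x_pow_rots N_dvd)
  show "(\<Sum>j<i. (\<Lambda> x ^^ j) (\<iota> x)) \<noteq> (\<Sum>j<k. (\<Lambda> x ^^ j) (\<iota> x)) + (\<Lambda> x ^^ k) (\<iota> y)"
  proof
    assume "(\<Sum>j<i. (\<Lambda> x ^^ j) (\<iota> x)) = (\<Sum>j<k. (\<Lambda> x ^^ j) (\<iota> x)) + (\<Lambda> x ^^ k) (\<iota> y)"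
    then have "\<iota> (x [^] k \<otimes> y) = \<iota> (x [^] i)"
      by (simp add: iota_pow iota_mult Lambda_pow)
    then have "inv (x [^] i) \<otimes> (x [^] k \<otimes> y) \<in> rots N"
      by (subst (asm) iota_eq_mult_iff) simp_all
    moreover have "inv (x [^] i) \<otimes> (x [^] k \<otimes> y) = x [^] (2 * m * i - i + k) \<otimes> y"
      by (simp add: inv_x_pow nat_pow_mult flip: m_assoc)
    ultimately show False using refl_rots by simp
  qed
qed (simp_all add: additive.add[OF Lambda_additive] N_dvd m_pos)

sublocale M: dicyclic_module "\<Lambda> x" "\<Lambda> (inv x)" "\<Lambda> y" "\<iota> x" "\<iota> y" "\<iota> ` carrier B" N m
  by (rule dicyclic)

lemma M_f: "M.f i = \<iota> (x [^] i)"
  by (simp add: M.f_def iota_pow)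

end

context quaternion_brace
begin

lemma module_exists:
  assumes "ideal N"
  obtains \<iota> :: "'a \<Rightarrow> ('a \<Rightarrow> int) \<Rightarrow> zprod" and \<Lambda> where "quaternion_module B m x y N \<iota> \<Lambda>"
proof -
  have I: "subgroup (rots N) (add_monoid B)" "\<And>g a. g \<in> carrier B \<Longrightarrow> a \<in> rots N \<Longrightarrow> lam g a \<in> rots N"
    and N: "N dvd 2 * m"
    using assms by (auto simp: ideal_def)
  show ?thesis
  proof (rule module_embedding[OF finite_carrier I])
    fix \<iota> :: "'a \<Rightarrow> ('a \<Rightarrow> int) \<Rightarrow> zprod" and \<Lambda>
    assume *: "\<And>a b. a \<in> carrier B \<Longrightarrow> b \<in> carrier B \<Longrightarrow> \<iota> (a \<oplus> b) = \<iota> a + \<iota> b"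
      "\<And>a b. a \<in> carrier B \<Longrightarrow> b \<in> carrier B \<Longrightarrow> \<iota> a = \<iota> b \<longleftrightarrow> a \<ominus> b \<in> rots N"
      "\<And>g. additive (\<Lambda> g)"
      "\<And>g h v. g \<in> carrier B \<Longrightarrow> h \<in> carrier B \<Longrightarrow> \<Lambda> (g \<otimes> h) v = \<Lambda> g (\<Lambda> h v)"
      "\<And>v. \<Lambda> \<one> v = v"
      "\<And>g h. g \<in> carrier B \<Longrightarrow> h \<in> carrier B \<Longrightarrow> \<iota> (g \<otimes> h) = \<iota> g + \<Lambda> g (\<iota> h)"
    have "quaternion_module B m x y N \<iota> \<Lambda>"
      by unfold_locales (simp_all add: N * additive.add[OF *(3)])
    then show ?thesis by (rule that)
  qed
qed

lemma ideal_trivial: "ideal (2 * m)"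
proof -
  have "x [^] (2 * m * k) = \<zero>" for k :: nat
    using x_pow_eq_1[of "2 * m * k"] by (simp only: zero_eq_one dvd_triv_left)
  then have "rots (2 * m) = {\<zero>}" by (simp only: rots_def) blast
  moreover have "subgroup {\<zero>} (add_monoid B)"
    by (rule add.subgroupI) auto
  ultimately show ?thesis by (simp add: ideal_def)
qed

end

context quaternion_brace
begin

lemma y_inv_pow: "y \<otimes> inv (x [^] (i::nat)) = x [^] i \<otimes> y"
  using y_x_pow[of "2 * m * i - i"] by (simp flip: inv_x_pow)

lemma card_carrier: "card (carrier B) = 4 * m"
proof -
  define A where "A = (\<lambda>i::nat. x [^] i) ` {..<2 * m}"
  have "inj_on (\<lambda>i::nat. x [^] i) {..<2 * m}"
    by (rule inj_onI) (simp add: x_pow_eq_iff)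
  then have cA: "card A = 2 * m" by (simp add: A_def card_image)
  have AB: "A \<subseteq> carrier B" by (auto simp: A_def)
  have "inj_on (\<lambda>g. g \<otimes> y) A"
    using AB by (auto simp: inj_on_def subset_iff)
  then have cAy: "card ((\<lambda>g. g \<otimes> y) ` A) = 2 * m" by (simp add: card_image cA)
  have "carrier B = A \<union> (\<lambda>g. g \<otimes> y) ` A"
  proof
    show "carrier B \<subseteq> A \<union> (\<lambda>g. g \<otimes> y) ` A"
    proof
      fix g assume "g \<in> carrier B"
      then show "g \<in> A \<union> (\<lambda>g. g \<otimes> y) ` A"
      proof (cases rule: carrier_cases)
        case (rot i)
        then have "g = x [^] (i mod (2 * m))" by (simp only: x_pow_mod)
        then show ?thesis using m_pos by (auto simp: A_def)
      next
        case (refl i)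
        then have "g = x [^] (i mod (2 * m)) \<otimes> y" by (simp only: x_pow_mod)
        then show ?thesis using m_pos by (auto simp: A_def)
      qed
    qed
  qed (use AB in auto)
  moreover have "A \<inter> (\<lambda>g. g \<otimes> y) ` A = {}"
  proof -
    have False if z: "z \<in> A" "z \<in> (\<lambda>g. g \<otimes> y) ` A" for z
    proof -
      obtain i j :: nat where "z = x [^] i" "z = x [^] j \<otimes> y" using z unfolding A_def by blast
      then show False using refl_neq[of j i] by simp
    qed
    then show ?thesis by blast
  qed
  ultimately show ?thesis
    using cA cAy by (simp add: card_Un_disjoint A_def)
qed

end

context quaternion_module
begin

lemma iota_add_pow: "b \<in> carrier B \<Longrightarrow> \<iota> ([k] \<cdot> b) = of_nat k * \<iota> b"
  by (induction k) (simp_all add: iota_zero iota_add algebra_simps)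

lemma iota_order: "b \<in> carrier B \<Longrightarrow> of_nat (4 * m) * \<iota> b = 0"
  using add.pow_order_eq_1[of b] iota_add_pow[of b "4 * m"]
  by (simp add: order_def card_carrier iota_zero)

lemma Lambda_of_nat: "\<Lambda> g (of_nat k * v) = of_nat k * \<Lambda> g v"
  by (rule additive_of_nat[OF Lambda_additive])

lemma Lambda_of_int: "\<Lambda> g (of_int k * v) = of_int k * \<Lambda> g v"
  by (rule additive_of_int[OF Lambda_additive])

lemma Lambda_add: "\<Lambda> g (v + w) = \<Lambda> g v + \<Lambda> g w"
  by (rule additive.add[OF Lambda_additive])

lemma Lambda_minus: "\<Lambda> g (- v) = - \<Lambda> g v"
  by (rule additive.minus[OF Lambda_additive])

lemma Lambda_0: "\<Lambda> g 0 = 0"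
  by (rule additive.zero[OF Lambda_additive])

text \<open>The \<open>r\<close>-torsion of the quotient. Because every \<open>lam g\<close>
  preserves it, it is closed under addition and under the circle operation alike.\<close>

definition tors :: "nat \<Rightarrow> 'a set" where "tors r = {g \<in> carrier B. of_nat r * \<iota> g = 0}"

lemma tors_carrier: "g \<in> tors r \<Longrightarrow> g \<in> carrier B"
  and tors_iota: "g \<in> tors r \<Longrightarrow> of_nat r * \<iota> g = 0"
  by (simp_all add: tors_def)

lemma tors_one: "\<one> \<in> tors r"
  by (simp add: tors_def iota_one)

lemma tors_mult: "g \<in> tors r \<Longrightarrow> h \<in> tors r \<Longrightarrow> g \<otimes> h \<in> tors r"
  by (simp add: tors_def iota_mult distrib_left Lambda_0 flip: Lambda_of_nat)

lemma tors_pow: "g \<in> tors r \<Longrightarrow> g [^] (k::nat) \<in> tors r"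
  by (induction k) (simp_all add: tors_one tors_mult)

lemma tors_inv: "g \<in> tors r \<Longrightarrow> inv g \<in> tors r"
  by (simp add: tors_def iota_inv Lambda_0 flip: Lambda_of_nat)

lemma tors_lam: "g \<in> carrier B \<Longrightarrow> b \<in> tors r \<Longrightarrow> lam g b \<in> tors r"
  by (simp add: tors_def iota_lam Lambda_0 flip: Lambda_of_nat)

lemma tors_subgroup: "subgroup (tors r) (add_monoid B)"
  by (rule add.subgroupI)
    (auto simp: tors_def iota_minus iota_add distrib_left iota_zero intro!: exI[of _ \<zero>])

lemma iota_inj:
  assumes "N = 2 * m" "a \<in> carrier B" "b \<in> carrier B"
  shows "\<iota> a = \<iota> b \<longleftrightarrow> a = b"
proof
  assume "\<iota> a = \<iota> b"
  then have "inv b \<otimes> a \<in> rots (2 * m)" using assms by (simp add: iota_eq_mult_iff)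
  then have "inv b \<otimes> a = \<one>" using x_pow_eq_1 by (auto simp: rots_def)
  then show "a = b" using assms by (metis inv_closed inv_equality inv_inv)
qed simp

text \<open>If the order of \<open>h\<close> is prime to the exponent of its additive orbit, the affine map
  of \<open>h\<close> fixes the barycenter of this orbit; as the action is regular, \<open>h\<close> is trivial.\<close>

lemma coprime_order_trivial:
  assumes N: "N = 2 * m" and h: "h \<in> tors r" "h [^] (q::nat) = \<one>" and cop: "coprime q r"
  shows "h = \<one>"
proof -
  have hB: "h \<in> carrier B" using h tors_carrier by blast
  have "coprime (int q) (int r)" using cop by simp
  then obtain a b where ab: "a * int q + b * int r = 1"
    using bezout_int[of "int q" "int r"] by (metis coprime_imp_gcd_eq_1)
  \<comment> \<open>\<open>W\<close> is the sum over the orbit of \<open>0\<close> under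
    \<open>h\<close>; as \<open>a\<close> inverts \<open>q\<close> modulo \<open>r\<close>, the
    barycenter is \<open>a W\<close>.\<close>
  define W where "W = (\<Sum>j<q. \<iota> (h [^] j))"
  have sumS: "(\<Sum>j<k. \<iota> (h [^] j)) \<in> \<iota> ` carrier B" for k :: nat
    by (induction k) (auto intro!: M.S_add M.S_0 simp: hB)
  then have "of_int a * W \<in> \<iota> ` carrier B" unfolding W_def by (intro M.S_of_int)
  then obtain g where g: "g \<in> carrier B" "\<iota> g = of_int a * W" by auto
  have "(\<Sum>j<i. \<iota> (h [^] Suc j)) = (\<Sum>j<i. \<iota> (h [^] j)) + \<iota> (h [^] i) - \<iota> (h [^] (0::nat))" for i :: nat
    by (induction i) simp_all
  from this[of q] have "(\<Sum>j<q. \<iota> (h [^] Suc j)) = W + \<iota> (h [^] q) - \<iota> (h [^] (0::nat))"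
    unfolding W_def .
  then have shift: "(\<Sum>j<q. \<iota> (h [^] Suc j)) = W" using h(2) by simp
  have "\<iota> (h [^] Suc j) = \<iota> h + \<Lambda> h (\<iota> (h [^] j))" for j
    using hB iota_mult[of h "h [^] j"] nat_pow_mult[of h 1 j] by simp
  then have "W = of_nat q * \<iota> h + (\<Sum>j<q. \<Lambda> h (\<iota> (h [^] j)))"
    using shift by (simp add: sum.distrib)
  also have "(\<Sum>j<q. \<Lambda> h (\<iota> (h [^] j))) = \<Lambda> h W"
    by (simp add: W_def additive.sum[OF Lambda_additive])
  finally have W: "W = of_nat q * \<iota> h + \<Lambda> h W" .
  have "of_int (a * int q + b * int r) * \<iota> h = of_int a * (of_nat q * \<iota> h) + of_int b * (of_nat r * \<iota> h)"
    by (simp add: algebra_simps)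
  then have "\<iota> h = of_int a * (of_nat q * \<iota> h)" using ab tors_iota[OF h(1)] by simp
  then have "\<iota> h + \<Lambda> h (of_int a * W) = of_int a * W"
    using W by (metis Lambda_of_int distrib_left)
  then have "\<iota> (h \<otimes> g) = \<iota> g" using g hB by (simp add: iota_mult)
  then have "h \<otimes> g = g" using iota_inj[OF N, of "h \<otimes> g" g] hB g by simp
  then show "h = \<one>" using hB g by (metis r_cancel_one)
qed

end

section \<open>Splitting off the odd part of the brace\<close>

locale quaternion_odd_part = quaternion_module +
  fixes k n :: nat
  assumes N_eq: "N = 2 * m" and m_eq: "m = 2 ^ k * n" and n_odd: "odd n"
begin

text \<open>The largest power of \<open>2\<close> dividing the order \<open>4 m = q n\<close> of the
  additive group.\<close>

definition q :: nat where "q = 2 ^ (k + 2)"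

abbreviation "Gn \<equiv> tors n"
abbreviation "Gp \<equiv> tors q"

lemma n_coprime: "coprime n q" "coprime q n" "coprime 2 n" "coprime n 2"
proof -
  show "coprime n 2" "coprime 2 n" using n_odd by simp_all
  then show "coprime n q" "coprime q n" unfolding q_def by (auto simp only: coprime_power_left_iff coprime_power_right_iff)
qed

lemma order_split: "4 * m = q * n"
  by (simp add: m_eq q_def)

lemma n_coprime_int: "coprime (int n) (int q)"
  using n_coprime by simp

lemma torsion_disjoint: "of_nat q * (v :: 'c) = 0 \<Longrightarrow> of_nat n * v = 0 \<Longrightarrow> v = 0"
proof -
  assume v: "of_nat q * v = 0" "of_nat n * v = 0"
  obtain a b where ab: "a * int n + b * int q = 1"
    using n_coprime_int bezout_int[of "int n" "int q"] by (metis coprime_imp_gcd_eq_1)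
  have "v = of_int (a * int n + b * int q) * v" by (simp only: ab of_int_1 mult_1)
  also have "\<dots> = of_int a * (of_nat n * v) + of_int b * (of_nat q * v)"
    by (simp add: algebra_simps)
  finally show ?thesis using v by simp
qed

text \<open>The Bezout component \<open>c\<close> of \<open>g\<close> in the
  \<open>n\<close>-torsion is divided off from the left; the remaining factor
  \<open>inv c \<otimes> g\<close> is killed by \<open>q\<close>, since the action preserves
  torsion.\<close>

lemma decompose:
  assumes g: "g \<in> carrier B"
  obtains a h where "a \<in> Gn" "h \<in> Gp" "g = a \<otimes> h"
proof -
  obtain a b where ab: "a * int n + b * int q = 1"
    using n_coprime_int bezout_int[of "int n" "int q"] by (metis coprime_imp_gcd_eq_1)
  have ord: "of_nat q * (of_nat n * \<iota> g) = 0" "of_nat n * (of_nat q * \<iota> g) = 0"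
    using iota_order[OF g] unfolding order_split by (simp_all add: mult_ac)
  have "of_int b * (of_nat q * \<iota> g) \<in> \<iota> ` carrier B"
    using g by (intro M.S_of_int M.S_of_nat) auto
  then obtain c where c: "c \<in> carrier B" "\<iota> c = of_int b * (of_nat q * \<iota> g)" by auto
  have "of_nat n * \<iota> c = of_int b * (of_nat n * (of_nat q * \<iota> g))"
    unfolding c(2) by (simp only: mult_ac)
  then have cn: "c \<in> Gn" using c(1) by (simp add: tors_def ord)
  have "\<iota> g = of_int (a * int n + b * int q) * \<iota> g" by (simp only: ab of_int_1 mult_1)
  then have gc: "\<iota> g - \<iota> c = of_int a * (of_nat n * \<iota> g)"
    unfolding c(2) by (simp add: algebra_simps)
  have "of_nat q * (\<iota> g - \<iota> c) = of_int a * (of_nat q * (of_nat n * \<iota> g))"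
    unfolding gc by (simp add: mult_ac)
  then have "of_nat q * (\<iota> g - \<iota> c) = 0" by (simp only: ord mult_zero_right)
  then have "of_nat q * \<iota> (inv c \<otimes> g) = 0"
    using c g by (simp only: iota_inv_mult Lambda_of_nat[symmetric] Lambda_0)
  then have "inv c \<otimes> g \<in> Gp" using c g by (simp add: tors_def)
  moreover have "g = c \<otimes> (inv c \<otimes> g)" using c g by (simp flip: m_assoc)
  ultimately show ?thesis using that cn by blast
qed

lemma t_notin_Gn: "x [^] m \<notin> Gn"
proof
  assume t: "x [^] m \<in> Gn"
  have "(x [^] m) [^] (2::nat) = \<one>" using x_pow_eq_1[of "m * 2"] by (simp add: nat_pow_pow)
  then have "x [^] m = \<one>" by (rule coprime_order_trivial[OF N_eq t]) (rule n_coprime)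
  then show False using m_pos by (auto simp: x_pow_eq_1 dest!: dvd_imp_le)
qed

lemma x_pow_odd_m: "odd b \<Longrightarrow> x [^] (m * b) = x [^] m"
proof -
  assume "odd b"
  then obtain c where "b = 2 * c + 1" by (rule oddE)
  then have "m * b = 2 * m * c + m" by (simp add: algebra_simps)
  then show ?thesis unfolding x_pow_eq_iff by (simp only: mod_mult_self4)
qed

text \<open>The \<open>n\<close>-torsion avoids \<open>x^m\<close>, so it contains no reflection and
  no rotation having \<open>x^m\<close> as a power; what is left are powers of
  \<open>x^(2^(k+1))\<close>. Conversely, such a power splits as \<open>a h\<close> with
  \<open>h\<close> in the \<open>2\<close>-part and \<open>h^n = 1\<close>, so \<open>h\<close> is
  trivial.\<close>

lemma rots_Gn: "rots (2 ^ (k + 1)) = Gn"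
proof
  have dvd: "2 ^ (k + 1) dvd 2 * m" by (simp add: m_eq)
  show sub: "Gn \<subseteq> rots (2 ^ (k + 1))"
  proof
    fix a assume a: "a \<in> Gn"
    then have aB: "a \<in> carrier B" by (rule tors_carrier)
    then show "a \<in> rots (2 ^ (k + 1))"
    proof (cases rule: carrier_cases)
      case (refl i)
      have "a \<otimes> a \<in> Gn" using a by (simp add: tors_mult)
      then show ?thesis using t_notin_Gn by (simp add: refl refl_square)
    next
      case (rot i)
      have "2 ^ (k + 1) dvd i"
      proof (rule ccontr)
        assume nd: "\<not> 2 ^ (k + 1) dvd i"
        then have "i \<noteq> 0" by (metis dvd_0_right)
        then obtain d b where d: "i = 2 ^ d * b" "odd b" by (rule power_2_decompose)
        have "d \<le> k"
        proof (rule ccontr)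
          assume "\<not> d \<le> k"
          then have "2 ^ (k + 1) dvd (2::nat) ^ d" by (intro le_imp_power_dvd) simp
          then show False using nd d by simp
        qed
        then obtain e where e: "k = d + e" using le_Suc_ex by blast
        have "i * (2 ^ e * n) = m * b" by (simp add: d e m_eq power_add mult_ac)
        then have "a [^] (2 ^ e * n) = x [^] m" using x_pow_odd_m[OF d(2)] by (simp add: rot nat_pow_pow)
        then show False using t_notin_Gn tors_pow[OF a] by metis
      qed
      then show ?thesis using x_pow_rots[OF dvd] by (simp add: rot)
    qed
  qed
  show "rots (2 ^ (k + 1)) \<subseteq> Gn"
  proof
    fix z assume "z \<in> rots (2 ^ (k + 1))"
    then obtain i :: nat where z: "z = x [^] (2 ^ (k + 1) * i)" by (auto simp: rots_def)
    have zB: "z \<in> carrier B" by (simp add: z)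
    obtain a h where ah: "a \<in> Gn" "h \<in> Gp" "z = a \<otimes> h" using decompose[OF zB] .
    obtain j :: nat where a: "a = x [^] (2 ^ (k + 1) * j)" using sub ah(1) by (auto simp: rots_def)
    have hB: "h \<in> carrier B" using ah tors_carrier by blast
    have aB: "a \<in> carrier B" by (simp add: a)
    have "h = inv a \<otimes> z" using ah(3) aB hB by (simp add: m_assoc[symmetric])
    also have "\<dots> = x [^] (2 ^ (k + 1) * (2 * m * j - j + i))"
      by (simp add: a z inv_x_pow nat_pow_mult algebra_simps)
    finally have "h [^] n = x [^] (2 ^ (k + 1) * (2 * m * j - j + i) * n)" by (simp add: nat_pow_pow)
    also have "2 ^ (k + 1) * (2 * m * j - j + i) * n = 2 * m * (2 * m * j - j + i)"
      by (simp add: m_eq mult_ac)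
    finally have "h [^] n = \<one>" using x_pow_eq_1 by simp
    then have "h = \<one>" by (rule coprime_order_trivial[OF N_eq ah(2)]) (rule n_coprime)
    then show "z \<in> Gn" using ah aB by simp
  qed
qed

lemma ideal_odd_part: "ideal (2 ^ (k + 1))"
  unfolding ideal_def rots_Gn using tors_subgroup tors_lam by (simp add: m_eq)

lemma Gn_elim:
  assumes "a \<in> Gn"
  obtains j :: nat where "a = x [^] (2 ^ (k + 1) * j)"
  using assms unfolding rots_Gn[symmetric] rots_def by blast

text \<open>\<open>a g = g a'\<close> with \<open>a'\<close> in \<open>Gn\<close> equates
  \<open>\<Lambda> a (\<iota> g) - \<iota> g\<close>, killed by \<open>q\<close>, with
  \<open>\<Lambda> g (\<iota> a') - \<iota> a\<close>, killed by \<open>n\<close>; so both are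
  \<open>0\<close>.\<close>

lemma odd_even_commute:
  assumes a: "a \<in> Gn" and g: "g \<in> Gp"
  shows "\<Lambda> a (\<iota> g) = \<iota> g" "\<Lambda> g (\<iota> (inv g \<otimes> a \<otimes> g)) = \<iota> a"
proof -
  have aB: "a \<in> carrier B" and gB: "g \<in> carrier B" using a g tors_carrier by auto
  define a' where "a' = inv g \<otimes> a \<otimes> g"
  have a'B: "a' \<in> carrier B" using aB gB by (simp add: a'_def)
  have ag: "a \<otimes> g = g \<otimes> a'" using aB gB by (simp add: a'_def flip: m_assoc)
  obtain i :: nat where i: "a = x [^] (2 ^ (k + 1) * i)" using a by (rule Gn_elim)
  have "a \<otimes> g = g \<otimes> a \<or> a \<otimes> g = g \<otimes> inv a" using conj_rot[OF gB] by (simp add: i)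
  then have "a' = a \<or> a' = inv a" using ag aB gB a'B by auto
  then have a'n: "a' \<in> Gn" using a tors_inv by auto
  have eq: "\<iota> a + \<Lambda> a (\<iota> g) = \<iota> g + \<Lambda> g (\<iota> a')"
    using arg_cong[OF ag, of \<iota>] by (simp add: iota_mult aB gB a'B)
  then have d: "\<Lambda> a (\<iota> g) - \<iota> g = \<Lambda> g (\<iota> a') - \<iota> a" by (simp add: algebra_simps)
  have "of_nat q * (\<Lambda> a (\<iota> g) - \<iota> g) = 0"
    using tors_iota[OF g] by (simp only: right_diff_distrib Lambda_of_nat[symmetric] Lambda_0 diff_self)
  moreover have "of_nat n * (\<Lambda> g (\<iota> a') - \<iota> a) = 0"
    using tors_iota[OF a] tors_iota[OF a'n] by (simp only: right_diff_distrib Lambda_of_nat[symmetric] Lambda_0 diff_self)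
  ultimately have "\<Lambda> a (\<iota> g) - \<iota> g = 0" using torsion_disjoint d by metis
  then show "\<Lambda> a (\<iota> g) = \<iota> g" "\<Lambda> g (\<iota> (inv g \<otimes> a \<otimes> g)) = \<iota> a"
    using d by (simp_all add: a'_def)
qed

lemma Gn_comm: "a \<in> Gn \<Longrightarrow> b \<in> Gn \<Longrightarrow> a \<otimes> b = b \<otimes> a"
  unfolding rots_Gn[symmetric] by (auto simp: rots_def x_pow_comm)

text \<open>The \<open>2\<close>-part \<open>h0\<close> of \<open>y\<close> inverts
  \<open>Gn\<close> by conjugation, so it acts there by
  \<open>\<iota> b \<mapsto> \<iota> (inv b)\<close>. The vector
  \<open>\<iota> a + \<iota> (inv a)\<close> is invariant; its point is therefore its own inverse,
  and trivial by \<open>coprime_order_trivial\<close>.\<close>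

lemma iota_inv_Gn:
  assumes a: "a \<in> Gn"
  shows "\<iota> (inv a) = - \<iota> a"
proof -
  obtain a0 h0 where y: "a0 \<in> Gn" "h0 \<in> Gp" "y = a0 \<otimes> h0" using decompose[OF y_closed] .
  obtain j :: nat where a0: "a0 = x [^] (2 ^ (k + 1) * j)" using y(1) by (rule Gn_elim)
  have h0B: "h0 \<in> carrier B" using y tors_carrier by auto
  have conj: "inv h0 \<otimes> b \<otimes> h0 = inv b" if b: "b \<in> Gn" for b
  proof -
    obtain i :: nat where i: "b = x [^] (2 ^ (k + 1) * i)" using b by (rule Gn_elim)
    have bB: "b \<in> carrier B" and a0B: "a0 \<in> carrier B" by (simp_all add: i a0)
    have "a0 \<otimes> (h0 \<otimes> inv b) = y \<otimes> inv b" using y(3) a0B h0B bB by (simp add: m_assoc)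
    also have "\<dots> = b \<otimes> y" unfolding i by (rule y_inv_pow)
    also have "\<dots> = a0 \<otimes> (b \<otimes> h0)"
      using Gn_comm[OF b y(1)] y(3) a0B h0B bB by (simp flip: m_assoc)
    finally have "h0 \<otimes> inv b = b \<otimes> h0" using a0B h0B bB by simp
    then have "inv h0 \<otimes> (h0 \<otimes> inv b) = inv h0 \<otimes> (b \<otimes> h0)" by simp
    then show ?thesis using h0B bB by (simp flip: m_assoc)
  qed
  have L: "\<Lambda> h0 (\<iota> b) = \<iota> (inv b)" if b: "b \<in> Gn" for b
    using odd_even_commute(2)[OF tors_inv[OF b] y(2)] conj[OF tors_inv[OF b]] tors_carrier[OF b] by simp
  have aB: "a \<in> carrier B" using a tors_carrier by auto
  have "\<iota> a + \<iota> (inv a) \<in> \<iota> ` carrier B" using aB by (intro M.S_add) auto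
  then obtain b where b: "b \<in> carrier B" "\<iota> b = \<iota> a + \<iota> (inv a)" by auto
  have "b \<in> Gn" using b tors_iota[OF a] tors_iota[OF tors_inv[OF a]] by (simp add: tors_def distrib_left)
  have "\<iota> (inv b) = \<Lambda> h0 (\<iota> b)" by (simp add: L \<open>b \<in> Gn\<close>)
  also have "\<dots> = \<iota> b" using aB by (simp add: b(2) Lambda_add L a tors_inv)
  finally have "inv b = b" using iota_inj[OF N_eq, of "inv b" b] b by simp
  then have "b [^] (2::nat) = \<one>" using b(1) by (metis numeral_2_eq_2 nat_pow_Suc nat_pow_0 l_one r_inv)
  then have "b = \<one>" by (rule coprime_order_trivial[OF N_eq \<open>b \<in> Gn\<close>]) (rule n_coprime)
  then show ?thesis using b(2) by (simp add: iota_one eq_neg_iff_add_eq_0 add.commute)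
qed

text \<open>\<open>D a b\<close> is additive in \<open>b\<close>, symmetric since \<open>Gn\<close>
  is commutative, and \<open>D a a = 0\<close> since both kinds of inverses agree. Polarisation at
  \<open>a + b\<close> gives \<open>2 D a b = 0\<close>, and \<open>n\<close> is odd.\<close>

lemma Lambda_Gn_Gn:
  assumes a: "a \<in> Gn" and b: "b \<in> Gn"
  shows "\<Lambda> a (\<iota> b) = \<iota> b"
proof -
  define D where "D a b = \<Lambda> a (\<iota> b) - \<iota> b" for a b
  have D_self: "D a a = 0" if a: "a \<in> Gn" for a
  proof -
    have aB: "a \<in> carrier B" using a tors_carrier by auto
    have "\<iota> (a \<otimes> inv a) = \<iota> a - \<Lambda> a (\<iota> a)"
      using aB by (simp only: iota_mult inv_closed iota_inv_Gn[OF a] Lambda_minus) simp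
    then show ?thesis using aB by (simp add: D_def iota_one)
  qed
  have D_sym: "D a b = D b a" if ab: "a \<in> Gn" "b \<in> Gn" for a b
  proof -
    have "\<iota> (a \<otimes> b) = \<iota> (b \<otimes> a)" using Gn_comm ab by simp
    then show ?thesis using ab tors_carrier by (simp add: D_def iota_mult algebra_simps)
  qed
  have aB: "a \<in> carrier B" and bB: "b \<in> carrier B" using a b tors_carrier by auto
  have "\<iota> a + \<iota> b \<in> \<iota> ` carrier B" using aB bB by (intro M.S_add) auto
  then obtain c where c: "c \<in> carrier B" "\<iota> c = \<iota> a + \<iota> b" by auto
  have cn: "c \<in> Gn" using c tors_iota[OF a] tors_iota[OF b] by (simp add: tors_def distrib_left)
  have D_c: "D g c = D g a + D g b" for g by (simp add: D_def c Lambda_add)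
  have "0 = D a c + D b c" using D_self[OF cn] D_c[of c] D_sym[OF cn a] D_sym[OF cn b] by simp
  then have "2 * D a b = 0" using D_c[of a] D_c[of b] D_self a b D_sym[OF b a] by simp
  moreover have "of_nat n * D a b = 0"
    using tors_iota[OF b] by (simp only: D_def right_diff_distrib Lambda_of_nat[symmetric] Lambda_0 diff_self)
  ultimately have "D a b = 0"
  proof -
    assume d: "2 * D a b = 0" "of_nat n * D a b = 0"
    obtain q where "n = 2 * q + 1" using n_odd by (rule oddE)
    then have "of_nat n * D a b = of_nat q * (2 * D a b) + D a b" by (simp add: algebra_simps)
    then show ?thesis using d by simp
  qed
  then show ?thesis by (simp add: D_def)
qed

text \<open>The odd part of \<open>x\<close> acts trivially by \<open>Lambda_Gn_Gn\<close>, the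
  \<open>2\<close>-part because it commutes with \<open>Gn\<close>.\<close>

lemma Lambda_x_Gn:
  assumes a: "a \<in> Gn"
  shows "\<Lambda> x (\<iota> a) = \<iota> a"
proof -
  obtain b h where x: "b \<in> Gn" "h \<in> Gp" "x = b \<otimes> h" using decompose[OF x_closed] .
  have B: "a \<in> carrier B" "b \<in> carrier B" "h \<in> carrier B" using x a tors_carrier by auto
  have "b \<otimes> (h \<otimes> a) = x \<otimes> a" using x(3) B by (simp add: m_assoc)
  also have "x \<otimes> a = a \<otimes> x"
    using a by (rule Gn_elim) (use x_pow_comm[of 1] in simp)
  also have "\<dots> = b \<otimes> (a \<otimes> h)" using x(3) B Gn_comm[OF a x(1)] by (simp flip: m_assoc)
  finally have "h \<otimes> a = a \<otimes> h" using B by simp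
  then have "inv h \<otimes> a \<otimes> h = a" using B by (metis inv_solve_left m_assoc inv_closed m_closed)
  then have "\<Lambda> h (\<iota> a) = \<iota> a" using odd_even_commute(2)[OF a x(2)] by simp
  then show ?thesis using B x by (simp add: Lambda_mult Lambda_Gn_Gn a)
qed

text \<open>For the odd part \<open>a\<close> of \<open>x^m = a h\<close> the square
  \<open>a^2 = (h^2)^(-1)\<close> lies in both parts, so \<open>a^2 = 1\<close>, and
  \<open>a = 1\<close> by coprimality.\<close>

lemma t_Gp: "x [^] m \<in> Gp"
proof -
  have tB: "x [^] m \<in> carrier B" by simp
  obtain a h where ah: "a \<in> Gn" "h \<in> Gp" "x [^] m = a \<otimes> h" using decompose[OF tB] .
  obtain j :: nat where a: "a = x [^] (2 ^ (k + 1) * j)" using ah(1) by (rule Gn_elim)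
  have hB: "h \<in> carrier B" using ah tors_carrier by blast
  have aB: "a \<in> carrier B" by (simp add: a)
  have comm: "a \<otimes> h = h \<otimes> a"
  proof -
    have "a \<otimes> (a \<otimes> h) = (a \<otimes> h) \<otimes> a"
      unfolding ah(3)[symmetric] by (simp add: a x_pow_comm)
    then show ?thesis using aB hB by (simp add: m_assoc)
  qed
  have "(a \<otimes> h) \<otimes> (a \<otimes> h) = \<one>"
    unfolding ah(3)[symmetric] using x_pow_eq_1[of "m + m"] by (simp add: nat_pow_mult mult_2)
  then have "(a \<otimes> a) \<otimes> (h \<otimes> h) = \<one>" using aB hB comm by (metis m_assoc m_closed)
  then have aa: "a \<otimes> a = inv (h \<otimes> h)" using aB hB by (metis inv_equality m_closed)
  then have "a \<otimes> a \<in> Gp" using tors_inv[OF tors_mult[OF ah(2) ah(2)]] by simp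
  moreover have "a \<otimes> a \<in> Gn" using ah(1) by (simp add: tors_mult)
  ultimately have "\<iota> (a \<otimes> a) = 0" using torsion_disjoint tors_iota by blast
  then have "a \<otimes> a = \<one>" using iota_inj[OF N_eq, of "a \<otimes> a" \<one>] aB by (simp add: iota_one)
  then have "a [^] (2::nat) = \<one>" using aB by (simp add: numeral_2_eq_2)
  then have "a = \<one>" by (rule coprime_order_trivial[OF N_eq ah(1)]) (rule n_coprime)
  then show ?thesis using ah hB by simp
qed

lemma two_power_rots: "b \<in> carrier B \<Longrightarrow> [q] \<cdot> b \<in> rots (2 ^ (k + 1))"
proof -
  assume b: "b \<in> carrier B"
  then have "of_nat n * \<iota> ([q] \<cdot> b) = of_nat (4 * m) * \<iota> b"
    unfolding order_split by (simp add: iota_add_pow mult_ac)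
  then show ?thesis unfolding rots_Gn using b iota_order[OF b] by (simp add: tors_def)
qed

end

section \<open>The chain of ideals of rotations\<close>

context quaternion_module
begin

lemma iota_lam_x4: "b \<in> carrier B \<Longrightarrow> \<iota> (lam (x [^] (4::nat)) b) = \<Lambda> x (\<Lambda> x (\<Lambda> x (\<Lambda> x (\<iota> b))))"
proof -
  assume b: "b \<in> carrier B"
  have "\<iota> (lam (x [^] (4::nat)) b) = (\<Lambda> x ^^ 4) (\<iota> b)"
    using b by (simp only: iota_lam nat_pow_closed x_closed Lambda_pow)
  then show ?thesis by (simp add: numeral_eq_Suc)
qed

lemma Lambda_carrier_fixed:
  assumes "\<Lambda> x v = v" "\<Lambda> y v = v" "g \<in> carrier B"
  shows "\<Lambda> g v = v"
proof -
  have p: "(\<Lambda> x ^^ i) v = v" for i by (induction i) (simp_all add: assms)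
  show ?thesis using assms(3)
    by (cases rule: carrier_cases) (simp_all add: Lambda_pow Lambda_mult assms p)
qed

lemma mid_carrier:
  assumes "2 * N' = N" "\<And>g. g \<in> carrier B \<Longrightarrow> \<Lambda> g (\<iota> (x [^] N')) = \<iota> (x [^] N')"
  shows "b \<in> rots N' \<longleftrightarrow> b \<in> carrier B \<and> (\<iota> b = 0 \<or> \<iota> b = \<iota> (x [^] N'))"
proof
  assume "b \<in> rots N'"
  then obtain k where b: "b = x [^] (N' * k)" by (auto simp: rots_def)
  have N: "x [^] (N * j) \<in> rots N" for j by (auto simp: rots_def)
  show "b \<in> carrier B \<and> (\<iota> b = 0 \<or> \<iota> b = \<iota> (x [^] N'))"
  proof (cases "even k")
    case True
    then obtain j where "k = 2 * j" by (rule evenE)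
    then have "b = x [^] (N * j)" unfolding b assms(1)[symmetric] by (simp add: mult_ac)
    then show ?thesis using N[of j] by (simp add: iota_eq_0_iff)
  next
    case False
    then obtain j where "k = 2 * j + 1" by (rule oddE)
    then have "N' * k = N' + N * j" using assms(1) by (simp add: algebra_simps)
    then have "b = x [^] N' \<otimes> x [^] (N * j)" by (simp add: b nat_pow_mult)
    moreover have "\<iota> (x [^] (N * j)) = 0" using N[of j] by (simp add: iota_eq_0_iff)
    ultimately show ?thesis by (simp add: iota_mult additive.zero[OF Lambda_additive])
  qed
next
  assume b: "b \<in> carrier B \<and> (\<iota> b = 0 \<or> \<iota> b = \<iota> (x [^] N'))"
  have sub: "r \<in> rots N \<Longrightarrow> \<exists>k. r = x [^] (N' * (2 * k))" for r
    using assms(1) by (auto simp: rots_def mult.assoc[symmetric] mult.commute[of N' 2])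
  from b show "b \<in> rots N'"
  proof (elim conjE disjE)
    assume "b \<in> carrier B" "\<iota> b = 0"
    then show ?thesis using sub[of b] by (auto simp: iota_eq_0_iff rots_def)
  next
    assume bB: "b \<in> carrier B" and "\<iota> b = \<iota> (x [^] N')"
    then have "inv (x [^] N') \<otimes> b \<in> rots N" by (simp add: iota_eq_mult_iff)
    then obtain k where "inv (x [^] N') \<otimes> b = x [^] (N' * (2 * k))" using sub by blast
    then have "b = x [^] N' \<otimes> x [^] (N' * (2 * k))"
      using bB by (metis inv_solve_left nat_pow_closed x_closed)
    also have "\<dots> = x [^] (N' * (1 + 2 * k))" by (simp add: nat_pow_mult algebra_simps)
    finally show ?thesis unfolding rots_def by blast
  qed
qed

text \<open>A middle rotation fixed by the action spans a stable subgroup of order two in the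
  quotient, and \<open>rots N'\<close> is its preimage.\<close>

lemma ideal_mid:
  assumes N': "2 * N' = N" and fx: "\<And>g. g \<in> carrier B \<Longrightarrow> \<Lambda> g (\<iota> (x [^] N')) = \<iota> (x [^] N')"
  shows "ideal N'"
proof -
  have mem: "b \<in> rots N' \<longleftrightarrow> b \<in> carrier B \<and> (\<iota> b = 0 \<or> \<iota> b = \<iota> (x [^] N'))" for b
    by (rule mid_carrier[OF N']) (rule fx)
  have "\<iota> (x [^] N') + \<iota> (x [^] N') = \<iota> (x [^] N' \<otimes> x [^] N')"
    by (simp only: iota_mult nat_pow_closed x_closed fx)
  also have "x [^] N' \<otimes> x [^] N' = x [^] N" using N' by (simp only: nat_pow_mult x_closed mult_2)
  also have "\<iota> (x [^] N) = 0" using x_pow_rots[OF N_dvd, of N] by (subst iota_eq_0_iff) auto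
  finally have two: "\<iota> (x [^] N') + \<iota> (x [^] N') = 0" .
  then have neg: "- \<iota> (x [^] N') = \<iota> (x [^] N')" by (rule Groups.group_add_class.minus_unique)
  have "subgroup (rots N') (add_monoid B)"
  proof (rule add.subgroupI)
    show "rots N' \<subseteq> carrier B" by (rule rots_closed)
    show "rots N' \<noteq> {}" by (auto simp: rots_def)
  next
    fix a assume "a \<in> rots N'"
    then show "\<ominus> a \<in> rots N'" unfolding mem by (auto simp: iota_minus neg)
  next
    fix a b assume "a \<in> rots N'" "b \<in> rots N'"
    then show "a \<oplus> b \<in> rots N'" unfolding mem by (auto simp: iota_add two)
  qed
  moreover have "lam g a \<in> rots N'" if "g \<in> carrier B" "a \<in> rots N'" for g a
    using that unfolding mem by (auto simp: iota_lam fx additive.zero[OF Lambda_additive])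
  moreover have "N' dvd 2 * m" using N' N_dvd by (metis dvd_mult_right mult.commute)
  ultimately show ?thesis by (simp add: ideal_def)
qed

text \<open>The image of \<open>rots N'\<close> in the quotient has order two, and an automorphism
  preserving it fixes its nonzero element.\<close>

lemma mid_fixed_of_ideal:
  assumes N': "2 * N' = N" and I: "ideal N'" and g: "g \<in> carrier B"
  shows "\<Lambda> g (\<iota> (x [^] N')) = \<iota> (x [^] N')"
proof -
  have "N' > 0" using N' M.N_pos by auto
  have "x [^] N' \<in> rots N'" by (auto simp: rots_def intro!: exI[of _ 1])
  then have r: "lam g (x [^] N') \<in> rots N'" using I g by (simp add: ideal_def)
  then obtain k where k: "lam g (x [^] N') = x [^] (N' * k)" by (auto simp: rots_def)
  have e: "\<Lambda> g (\<iota> (x [^] N')) = \<iota> (x [^] (N' * k))" using g by (simp add: k flip: iota_lam)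
  have nz: "\<iota> (x [^] N') \<noteq> 0"
    using N' \<open>N' > 0\<close> by (auto simp: iota_eq_0_iff x_pow_rots[OF N_dvd] dest!: dvd_imp_le)
  have "odd k"
  proof
    assume "even k"
    then obtain j where "k = 2 * j" by (rule evenE)
    then have "N dvd N' * k" using N' by auto
    then have "\<Lambda> g (\<iota> (x [^] N')) = 0" by (simp add: e iota_eq_0_iff x_pow_rots[OF N_dvd])
    then have "\<Lambda> (inv g) (\<Lambda> g (\<iota> (x [^] N'))) = 0" by (simp add: additive.zero[OF Lambda_additive])
    then show False using g nz by simp
  qed
  then obtain j where "k = 2 * j + 1" by (rule oddE)
  then have "N' * k = N' + N * j" using N' by (simp add: algebra_simps)
  then have "x [^] (N' * k) = x [^] N' \<otimes> x [^] (N * j)" by (simp add: nat_pow_mult)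
  moreover have "\<iota> (x [^] (N * j)) = 0" by (subst iota_eq_0_iff) (auto simp: rots_def)
  ultimately show ?thesis by (simp add: e iota_mult additive.zero[OF Lambda_additive])
qed

text \<open>In the quotient \<open>t = x^i\<close> equals its inverse, so conjugation cannot be seen
  by \<open>\<iota>\<close>, and \<open>t b = b c\<close> with \<open>\<iota> c = \<iota> t\<close>
  reads \<open>\<iota> t + \<Lambda> t (\<iota> b) = \<iota> b + \<iota> t\<close>.\<close>

lemma Lambda_fixed_rot:
  assumes "\<And>g. g \<in> carrier B \<Longrightarrow> \<Lambda> g (\<iota> (x [^] (i::nat))) = \<iota> (x [^] i)" "2 * \<iota> (x [^] i) = 0" "b \<in> carrier B"
  shows "\<Lambda> (x [^] i) (\<iota> b) = \<iota> b"
proof -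
  let ?t = "x [^] i"
  have "\<iota> ?t + \<iota> ?t = 0" using assms(2) by (simp only: mult_2)
  then have neg: "- \<iota> ?t = \<iota> ?t" by (rule Groups.group_add_class.minus_unique)
  have inv: "\<iota> (inv ?t) = \<iota> ?t" by (simp add: iota_inv assms(1) neg)
  have "\<exists>c. c \<in> carrier B \<and> \<iota> c = \<iota> ?t \<and> ?t \<otimes> b = b \<otimes> c"
  proof (rule disjE[OF conj_rot[OF assms(3), of i]])
    assume "?t \<otimes> b = b \<otimes> ?t"
    then show ?thesis by (intro exI[of _ ?t]) simp
  next
    assume "?t \<otimes> b = b \<otimes> inv ?t"
    then show ?thesis using inv by (intro exI[of _ "inv ?t"]) simp
  qed
  then obtain c where c: "c \<in> carrier B" "\<iota> c = \<iota> ?t" "?t \<otimes> b = b \<otimes> c" by blast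
  have "\<iota> ?t + \<Lambda> ?t (\<iota> b) = \<iota> (?t \<otimes> b)" using assms(3) by (simp add: iota_mult)
  also have "\<dots> = \<iota> b + \<iota> ?t" unfolding c(3) using c(1,2) assms(1,3) by (simp add: iota_mult)
  finally show ?thesis by simp
qed

text \<open>The fixed vector of the quotient is a rotation or a reflection. A reflection is made the
  generator \<open>y\<close>, and the result is translated back at the end; the side condition on
  \<open>N\<close> is that of \<open>mid_fixed_refl\<close>.\<close>

lemma mid_fixed:
  assumes N: "N = 2 ^ Suc j" "8 dvd N \<or> \<not> N dvd m"
    and K: "\<And>b. b \<in> carrier B \<Longrightarrow> [(2 ^ K :: nat)] \<cdot> b \<in> rots N" and g: "g \<in> carrier B"
  shows "\<Lambda> g (\<iota> (x [^] (2 ^ j :: nat))) = \<iota> (x [^] (2 ^ j :: nat))"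
proof -
  have two: "2 ^ K * v = 0" if v: "v \<in> \<iota> ` carrier B" for v
  proof -
    obtain b where b: "b \<in> carrier B" "v = \<iota> b" using v by auto
    have "2 ^ K * v = \<iota> ([(2 ^ K :: nat)] \<cdot> b)" using b by (simp add: iota_add_pow)
    then show ?thesis using K[OF b(1)] b(1) by (simp add: iota_eq_0_iff)
  qed
  have half: "N div 2 = 2 ^ j" using N by simp
  obtain w where w: "w \<in> \<iota> ` carrier B" "w \<noteq> 0" "\<Lambda> x w = w" "\<Lambda> y w = w"
    by (rule M.fixed_vector[OF N(1) _ two]) simp_all
  have pw: "(\<Lambda> x ^^ i) w = w" for i by (induction i) (simp_all add: w)
  have mid: "\<Lambda> x (\<iota> (x [^] (2 ^ j :: nat))) = \<iota> (x [^] (2 ^ j :: nat)) \<and>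
    \<Lambda> y (\<iota> (x [^] (2 ^ j :: nat))) = \<iota> (x [^] (2 ^ j :: nat))"
    using w(1)
  proof (cases rule: M.S_cases)
    case (rot i)
    have "\<not> N dvd i" using w(2) by (simp add: rot M.f_eq_0_iff)
    then show ?thesis using M.mid_fixed_rot[OF N(1) _ w(3,4)[unfolded rot]] unfolding half M_f by simp
  next
    case (refl i)
    interpret R: quaternion_module B m x "x [^] i \<otimes> y" N \<iota> \<Lambda> by (rule rename_module)
    have yi: "\<iota> (x [^] i \<otimes> y) = w" by (simp add: refl M_f iota_mult Lambda_pow)
    have "R.M.f m \<noteq> 0 \<or> 8 dvd N" using N(2) by (auto simp: R.M.f_eq_0_iff)
    then have "\<Lambda> x (R.M.f (N div 2)) = R.M.f (N div 2) \<and>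
        \<Lambda> (x [^] i \<otimes> y) (R.M.f (N div 2)) = R.M.f (N div 2)"
      by (intro R.M.mid_fixed_refl[OF N(1)]) (auto simp: yi w Lambda_mult Lambda_pow pw)
    then have fx: "\<Lambda> x (\<iota> (x [^] (2 ^ j :: nat))) = \<iota> (x [^] (2 ^ j :: nat))"
      and fy: "(\<Lambda> x ^^ i) (\<Lambda> y (\<iota> (x [^] (2 ^ j :: nat)))) = \<iota> (x [^] (2 ^ j :: nat))"
      unfolding half R.M_f by (simp_all add: Lambda_mult Lambda_pow)
    have "(\<Lambda> x ^^ i) (\<iota> (x [^] (2 ^ j :: nat))) = \<iota> (x [^] (2 ^ j :: nat))" by (induction i) (simp_all add: fx)
    then have "(\<Lambda> x ^^ i) (\<Lambda> y (\<iota> (x [^] (2 ^ j :: nat))) - \<iota> (x [^] (2 ^ j :: nat))) = 0" by (simp add: fy)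
    then show ?thesis using fx by (simp only: M.lpow_eq_0_iff) simp
  qed
  then show ?thesis using Lambda_carrier_fixed g by blast
qed

text \<open>\<open>caseA\<close> and the two outcomes of \<open>caseB\<close>, each after the
  renaming of \<open>y\<close> that it asks for, leave only \<open>ph\<close> zero at both
  generators. If both defects equal \<open>t\<close>, then \<open>x y\<close> has defect
  \<open>0\<close> and takes the place of \<open>y\<close>.\<close>

lemma quartic_trivial:
  assumes N: "N = 16 * h" "h > 0" "h = 1 \<or> even h"
    and quartic: "\<And>b. b \<in> carrier B \<Longrightarrow> \<Lambda> x (\<Lambda> x (\<Lambda> x (\<Lambda> x (\<iota> b)))) = \<iota> b \<or>
      \<Lambda> x (\<Lambda> x (\<Lambda> x (\<Lambda> x (\<iota> b)))) = \<iota> b + \<iota> (x [^] (8 * h))"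
    and mid: "\<And>g. g \<in> carrier B \<Longrightarrow> \<Lambda> g (\<iota> (x [^] (8 * h))) = \<iota> (x [^] (8 * h))"
    and fm: "\<iota> (x [^] m) = 0 \<or> \<iota> (x [^] m) = \<iota> (x [^] (8 * h))"
    and uu: "\<And>b. b \<in> carrier B \<Longrightarrow> \<Lambda> (x [^] m) (\<iota> b) = \<iota> b"
    and two: "\<And>b. b \<in> carrier B \<Longrightarrow> 2 ^ K * \<iota> b = 0"
    and b: "b \<in> carrier B"
  shows "\<Lambda> x (\<Lambda> x (\<Lambda> x (\<Lambda> x (\<iota> b)))) = \<iota> b"
proof -
  have Q: "quartic_step (\<Lambda> x) (\<Lambda> (inv x)) (\<Lambda> (x [^] i \<otimes> y)) (\<iota> x) (\<iota> (x [^] i \<otimes> y)) (\<iota> ` carrier B) N m h K"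
    for i :: nat
  proof -
    interpret R: quaternion_module B m x "x [^] i \<otimes> y" N \<iota> \<Lambda> by (rule rename_module)
    have sq: "(x [^] i \<otimes> y) \<otimes> (x [^] i \<otimes> y) = x [^] m" by (rule refl_square)
    show ?thesis
    proof (intro quartic_step.intro R.dicyclic quartic_step_axioms.intro)
      fix v assume "v \<in> \<iota> ` carrier B"
      then obtain b where b: "b \<in> carrier B" "v = \<iota> b" by auto
      show "\<Lambda> (x [^] i \<otimes> y) (\<Lambda> (x [^] i \<otimes> y) v) = v"
        using Lambda_mult[of "x [^] i \<otimes> y" "x [^] i \<otimes> y" v] uu[OF b(1)] by (simp add: sq b(2))
      show "2 ^ K * v = 0" using two b by simp
      show "\<Lambda> x (\<Lambda> x (\<Lambda> x (\<Lambda> x v))) = v \<or> \<Lambda> x (\<Lambda> x (\<Lambda> x (\<Lambda> x v))) = v + R.M.f (8 * h)"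
        using quartic[OF b(1)] by (simp only: R.M_f b(2))
    qed (use N fm mid in \<open>simp_all only: R.M_f x_closed y_closed nat_pow_closed m_closed simp_thms\<close>)
  qed
  interpret Q0: quartic_step "\<Lambda> x" "\<Lambda> (inv x)" "\<Lambda> y" "\<iota> x" "\<iota> y" "\<iota> ` carrier B" N m h K
    using Q[of 0] by simp
  have refl_iota: "M.f k + (\<Lambda> x ^^ k) (\<iota> (x [^] i \<otimes> y)) = \<iota> (x [^] (k + i) \<otimes> y)" for k i :: nat
    by (simp add: M_f m_assoc flip: iota_mult Lambda_pow nat_pow_mult)
  have B: "Q0.ph (\<iota> (x [^] i \<otimes> y)) \<noteq> 0" if phx: "Q0.ph (\<iota> x) = Q0.t" for i :: nat
  proof
    assume phy: "Q0.ph (\<iota> (x [^] i \<otimes> y)) = 0"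
    interpret Qi: quartic_step "\<Lambda> x" "\<Lambda> (inv x)" "\<Lambda> (x [^] i \<otimes> y)" "\<iota> x" "\<iota> (x [^] i \<otimes> y)" "\<iota> ` carrier B" N m h K
      by (rule Q)
    have phk: "Q0.ph (\<iota> (x [^] (k + i) \<otimes> y)) = 0" if "even k" for k
      using Qi.ph_f_y[of k] that by (simp add: refl_iota phx phy Q0.of_nat_t)
    show False
    proof (rule Qi.caseB[OF phx phy])
      fix k assume k: "even k" "\<Lambda> x Q0.p - Q0.p = M.f k + (\<Lambda> x ^^ k) (\<iota> (x [^] i \<otimes> y))"
      show False
        by (rule quartic_step.caseB1[OF Q[of "k + i"] phx phk[OF k(1)]]) (use k(2) in \<open>simp only: refl_iota\<close>)
    next
      fix k j assume k: "even k" "\<Lambda> x Q0.p - Q0.p = of_nat j * Q0.c"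
        "\<Lambda> x (\<iota> x) - \<iota> x = M.f k + (\<Lambda> x ^^ k) (\<iota> (x [^] i \<otimes> y))"
      show False
        by (rule quartic_step.caseB2c[OF Q[of "k + i"] phx phk[OF k(1)] k(2)]) (use k(3) in \<open>simp only: refl_iota\<close>)
    qed
  qed
  have ph0: "Q0.ph (\<iota> x) = 0 \<and> Q0.ph (\<iota> y) = 0"
  proof (rule disjE[OF Q0.ph_cases[OF M.x_S]])
    assume x0: "Q0.ph (\<iota> x) = 0"
    then show ?thesis using Q0.ph_cases[OF M.y_S] Q0.caseA by blast
  next
    assume xt: "Q0.ph (\<iota> x) = Q0.t"
    then have "Q0.ph (\<iota> y) \<noteq> 0" using B[of 0] by simp
    then have yt: "Q0.ph (\<iota> y) = Q0.t" using Q0.ph_cases[OF M.y_S] by blast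
    have e: "M.f 1 + (\<Lambda> x ^^ 1) (\<iota> y) = \<iota> (x [^] (1::nat) \<otimes> y)"
      using refl_iota[of 1 0] by simp
    have "Q0.ph (\<iota> (x [^] (1::nat) \<otimes> y)) = 0"
      using Q0.ph_f_y[of 1] by (simp only: e xt yt of_nat_1 mult_1 Q0.two_t')
    then show ?thesis using B[OF xt, of 1] by blast
  qed
  have "Q0.ph v = 0" if "v \<in> \<iota> ` carrier B" for v
    using that
    by (cases rule: M.S_cases)
       (simp_all only: Q0.ph_f Q0.ph_f_y ph0 mult_zero_right add_0_left)
  then show ?thesis using b by (simp add: Q0.ph_def)
qed

end

context quaternion_brace
begin

lemma ideal_half:
  assumes "ideal N" "N = 2 ^ Suc j" "8 dvd N \<or> \<not> N dvd m"
    and K: "\<And>b. b \<in> carrier B \<Longrightarrow> [(2 ^ K :: nat)] \<cdot> b \<in> rots N"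
  shows "ideal (2 ^ j)"
proof -
  obtain \<iota> :: "'a \<Rightarrow> ('a \<Rightarrow> int) \<Rightarrow> zprod" and \<Lambda> where "quaternion_module B m x y N \<iota> \<Lambda>"
    using module_exists[OF assms(1)] .
  then interpret Q: quaternion_module B m x y N \<iota> \<Lambda> .
  show ?thesis by (rule Q.ideal_mid) (use assms(2) Q.mid_fixed[OF assms(2,3) K] in auto)
qed

end

locale quaternion_ideal_chain = quaternion_brace +
  fixes k n K :: nat
  assumes m_eq: "m = 2 ^ k * n" and n_odd: "odd n"
    and ideal_top: "ideal (2 ^ (k + 1))"
    and exponent: "\<And>b. b \<in> carrier B \<Longrightarrow> [(2 ^ K :: nat)] \<cdot> b \<in> rots (2 ^ (k + 1))"
    and t_fixed: "\<And>g. g \<in> carrier B \<Longrightarrow> lam g (x [^] m) = x [^] m"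
begin

lemma exponent':
  assumes "j \<le> k + 1" "b \<in> carrier B"
  shows "[(2 ^ K :: nat)] \<cdot> b \<in> rots (2 ^ j)"
proof -
  obtain i where i: "k + 1 = j + i" using assms(1) le_Suc_ex by blast
  have "rots (2 ^ (k + 1)) \<subseteq> rots (2 ^ j)" unfolding i by (auto simp: rots_def power_add mult.assoc)
  then show ?thesis using exponent assms(2) by blast
qed

text \<open>The bound \<open>j = 2\<close> is where halving stops: it asks for \<open>8\<close> to
  divide the larger modulus.\<close>

lemma ideal_chain:
  assumes "2 \<le> j" "j \<le> k + 1"
  shows "ideal (2 ^ j)"
  using assms(2,1)
proof (induction rule: inc_induct)
  case base
  show ?case by (rule ideal_top)
next
  case (step j)
  obtain i where "j = 2 + i" using step.prems le_Suc_ex by blast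
  then have "(2::nat) ^ Suc j = 8 * 2 ^ i" by (simp add: power_add)
  then have "(8::nat) dvd 2 ^ Suc j" by simp
  then show ?case
    using step by (intro ideal_half[OF step.IH refl]) (auto intro!: exponent' simp del: power_Suc)
qed

text \<open>Modulo \<open>x^8\<close> the element \<open>x^4\<close> is the middle rotation and acts
  trivially. Each further step doubles the modulus and is an instance of
  \<open>quartic_trivial\<close>: by induction \<open>x^4\<close> moves points at most by the new
  middle rotation.\<close>

lemma x4_chain:
  assumes "3 \<le> j" "j \<le> k + 1" "b \<in> carrier B"
  shows "lam (x [^] (4::nat)) b \<ominus> b \<in> rots (2 ^ j)"
  using assms
proof (induction j arbitrary: b rule: dec_induct)
  case base
  obtain \<iota> :: "'a \<Rightarrow> ('a \<Rightarrow> int) \<Rightarrow> zprod" and \<Lambda> where "quaternion_module B m x y (2 ^ 3) \<iota> \<Lambda>"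
    using module_exists[OF ideal_chain[of 3]] base by auto
  then interpret Q: quaternion_module B m x y "2 ^ 3" \<iota> \<Lambda> .
  have I: "ideal 4" using ideal_chain[of 2] base by simp
  have fx: "\<Lambda> g (\<iota> (x [^] (4::nat))) = \<iota> (x [^] (4::nat))" if "g \<in> carrier B" for g
    by (rule Q.mid_fixed_of_ideal[OF _ I that]) simp
  have "2 * \<iota> (x [^] (4::nat)) = \<iota> (x [^] (4::nat) \<otimes> x [^] (4::nat))" by (simp add: Q.iota_mult fx)
  also have "\<dots> = \<iota> (x [^] (8::nat))" by (simp add: nat_pow_mult)
  also have "\<dots> = 0" using Q.iota_eq_0_iff[of "x [^] (8::nat)"] x_pow_rots[OF Q.N_dvd, of 8] by simp
  finally have "\<Lambda> (x [^] (4::nat)) (\<iota> b) = \<iota> b" using Q.Lambda_fixed_rot[OF fx] base by simp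
  then have "\<iota> (lam (x [^] (4::nat)) b) = \<iota> b" using base by (simp add: Q.iota_lam)
  then show ?case using base by (subst (asm) Q.iota_eq_iff) auto
next
  case (step j)
  have IH: "lam (x [^] (4::nat)) b \<ominus> b \<in> rots (2 ^ j)" if "b \<in> carrier B" for b
    using step.IH[OF _ that] step.prems by simp
  \<comment> \<open>The new modulus is \<open>16 h\<close>; being a power of \<open>2\<close>,
    \<open>h\<close> is \<open>1\<close> or even.\<close>
  define h where "h = (2::nat) ^ (j - 3)"
  obtain i where i: "j = i + 3" using step.hyps le_Suc_ex by (metis add.commute)
  have h: "2 ^ Suc j = 16 * h" "2 ^ j = 8 * h" "h > 0" "h = 1 \<or> even h"
    by (auto simp: h_def i power_add)
  have IN: "ideal (2 ^ Suc j)" "ideal (8 * h)" using ideal_chain[of "Suc j"] ideal_chain[of j] step by (simp_all add: h(2) del: power_Suc)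
  obtain \<iota> :: "'a \<Rightarrow> ('a \<Rightarrow> int) \<Rightarrow> zprod" and \<Lambda> where "quaternion_module B m x y (2 ^ Suc j) \<iota> \<Lambda>"
    using module_exists[OF IN(1)] .
  then interpret Q: quaternion_module B m x y "2 ^ Suc j" \<iota> \<Lambda> .
  have NN: "2 * (8 * h) = 2 ^ Suc j" using h(1) by simp
  have fx: "\<Lambda> g (\<iota> (x [^] (8 * h))) = \<iota> (x [^] (8 * h))" if "g \<in> carrier B" for g
    by (rule Q.mid_fixed_of_ideal[OF NN IN(2) that])
  have mem: "b \<in> rots (8 * h) \<longleftrightarrow> b \<in> carrier B \<and> (\<iota> b = 0 \<or> \<iota> b = \<iota> (x [^] (8 * h)))" for b
    by (rule Q.mid_carrier[OF NN]) (rule fx)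
  have L4: "\<Lambda> x (\<Lambda> x (\<Lambda> x (\<Lambda> x (\<iota> b)))) = \<iota> (lam (x [^] (4::nat)) b)" if "b \<in> carrier B" for b
    using Q.iota_lam_x4[OF that] by simp
  have "\<Lambda> x (\<Lambda> x (\<Lambda> x (\<Lambda> x (\<iota> b)))) = \<iota> b"
  proof (rule Q.quartic_trivial[OF h(1,3,4) _ fx])
    fix b assume b: "b \<in> carrier B"
    have "\<iota> (lam (x [^] (4::nat)) b \<ominus> b) = \<iota> (lam (x [^] (4::nat)) b) - \<iota> b"
      using b by (simp add: a_minus_def Q.iota_add Q.iota_minus)
    moreover have "\<iota> (lam (x [^] (4::nat)) b \<ominus> b) = 0 \<or> \<iota> (lam (x [^] (4::nat)) b \<ominus> b) = \<iota> (x [^] (8 * h))"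
      using IH[OF b] unfolding h(2) mem by blast
    ultimately show "\<Lambda> x (\<Lambda> x (\<Lambda> x (\<Lambda> x (\<iota> b)))) = \<iota> b \<or>
      \<Lambda> x (\<Lambda> x (\<Lambda> x (\<Lambda> x (\<iota> b)))) = \<iota> b + \<iota> (x [^] (8 * h))"
      unfolding L4[OF b] by (auto simp: algebra_simps)
    have tf: "\<Lambda> g (\<iota> (x [^] m)) = \<iota> (x [^] m)" if "g \<in> carrier B" for g
      using t_fixed[OF that] Q.iota_lam[OF that, of "x [^] m"] by simp
    have "2 * \<iota> (x [^] m) = \<iota> (x [^] m \<otimes> x [^] m)" by (simp add: Q.iota_mult tf)
    also have "x [^] m \<otimes> x [^] m = \<one>" using x_pow_eq_1[of "m + m"] by (simp add: nat_pow_mult mult_2)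
    finally have "2 * \<iota> (x [^] m) = 0" by (simp only: Q.iota_one)
    then show "\<Lambda> (x [^] m) (\<iota> b) = \<iota> b"
      by (rule Q.Lambda_fixed_rot[rotated]) (auto intro: tf b)
    have "2 ^ K * \<iota> b = \<iota> ([(2 ^ K :: nat)] \<cdot> b)" using b by (simp add: Q.iota_add_pow)
    also have "\<dots> = 0" using exponent'[of "Suc j" b] step.prems b by (subst Q.iota_eq_0_iff) auto
    finally show "2 ^ K * \<iota> b = 0" .
  next
    have "2 ^ j dvd m" using step.prems by (auto simp: m_eq le_imp_power_dvd)
    then obtain i where "m = 2 ^ j * i" by (rule dvdE)
    then have "x [^] m \<in> rots (8 * h)" by (auto simp: rots_def h)
    then show "\<iota> (x [^] m) = 0 \<or> \<iota> (x [^] m) = \<iota> (x [^] (8 * h))" unfolding mem by blast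
    show "b \<in> carrier B" by (rule step.prems)
  qed
  then have "\<iota> (lam (x [^] (4::nat)) b) = \<iota> b" using L4 step.prems by simp
  then show ?case using step.prems by (subst (asm) Q.iota_eq_iff) auto
qed

text \<open>For \<open>k < 2\<close> the modulus divides \<open>4\<close>, so \<open>x^4\<close>
  lies in the ideal itself.\<close>

lemma x4_top:
  assumes "b \<in> carrier B"
  shows "lam (x [^] (4::nat)) b \<ominus> b \<in> rots (2 ^ (k + 1))"
proof (cases "k \<ge> 2")
  case True
  then show ?thesis using x4_chain[of "k + 1"] assms by simp
next
  case False
  obtain \<iota> :: "'a \<Rightarrow> ('a \<Rightarrow> int) \<Rightarrow> zprod" and \<Lambda> where "quaternion_module B m x y (2 ^ (k + 1)) \<iota> \<Lambda>"
    using module_exists[OF ideal_top] .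
  then interpret Q: quaternion_module B m x y "2 ^ (k + 1)" \<iota> \<Lambda> .
  have "k = 0 \<or> k = 1" using False by auto
  then have "2 ^ (k + 1) dvd (4::nat)" by auto
  then have "x [^] (4::nat) \<in> rots (2 ^ (k + 1))" using x_pow_rots[OF Q.N_dvd] by blast
  then have "\<iota> (lam (x [^] (4::nat)) b) = \<iota> b" using Q.Lambda_rots assms by (simp add: Q.iota_lam)
  then show ?thesis using assms by (subst (asm) Q.iota_eq_iff) auto
qed

end

context quaternion_odd_part
begin

text \<open>\<open>2^(k+1)\<close> does not divide \<open>m\<close>, so the second alternative of
  \<open>ideal_half\<close> is available for every \<open>k\<close>.\<close>

lemma ideal_x2k: "ideal (2 ^ k)"
proof (rule ideal_half[OF ideal_odd_part])
  show "8 dvd (2::nat) ^ (k + 1) \<or> \<not> 2 ^ (k + 1) dvd m" using n_odd by (simp add: m_eq)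
  show "[(2 ^ (k + 2) :: nat)] \<cdot> b \<in> rots (2 ^ (k + 1))" if "b \<in> carrier B" for b
    using two_power_rots[OF that] by (simp add: q_def)
qed simp

text \<open>The image of \<open>x^m\<close> lies in the ideal generated by \<open>x^(2^k)\<close>,
  which is \<open>Gn\<close> together with \<open>x^m Gn\<close>. It also lies in the
  \<open>2\<close>-part and is not \<open>\<one>\<close>, so it is \<open>x^m\<close>.\<close>

lemma t_fixed:
  assumes g: "g \<in> carrier B"
  shows "lam g (x [^] m) = x [^] m"
proof -
  have "x [^] m \<in> rots (2 ^ k)" by (auto simp: rots_def m_eq)
  then have "lam g (x [^] m) \<in> rots (2 ^ k)" using ideal_x2k g by (simp add: ideal_def)
  then obtain j :: nat where j: "lam g (x [^] m) = x [^] (2 ^ k * j)" by (auto simp: rots_def)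
  have P: "lam g (x [^] m) \<in> Gp" using t_Gp g by (simp add: tors_lam)
  have disj: "a = \<one>" if "a \<in> Gn" "a \<in> Gp" for a
    using torsion_disjoint[OF tors_iota[OF that(2)] tors_iota[OF that(1)]] iota_inj[OF N_eq, of a \<one>]
      tors_carrier[OF that(1)] by (simp add: iota_one)
  have G: "x [^] (2 ^ (k + 1) * i) \<in> Gn" for i :: nat
    unfolding rots_Gn[symmetric] by (auto simp: rots_def)
  have "odd j"
  proof
    assume "even j"
    then obtain i where "j = 2 * i" by (rule evenE)
    then have "lam g (x [^] m) \<in> Gn" using G[of i] by (simp add: j mult_ac)
    then have "lam g (x [^] m) = \<one>" using P disj by blast
    then have "lam (inv g) (lam g (x [^] m)) = \<one>" using g lam_zero[of "inv g"] by (simp add: zero_eq_one)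
    then have "x [^] m = \<one>" using g by (simp flip: lam_mult)
    then show False using m_pos by (auto simp: x_pow_eq_1 dest!: dvd_imp_le)
  qed
  \<comment> \<open>With \<open>j\<close> and \<open>n\<close> odd, this writes \<open>2^k j\<close>
    as \<open>m + 2^(k+1) i\<close> modulo \<open>2 m\<close>.\<close>
  define i where "i = (j + n) div 2"
  have i: "j + n = 2 * i" using \<open>odd j\<close> n_odd by (simp add: i_def)
  have "2 ^ k * (j + 2 * n) = m + 2 ^ (k + 1) * i"
    using arg_cong[OF i, of "\<lambda>z. 2 ^ k * z"] by (simp add: m_eq algebra_simps)
  moreover have "2 ^ k * (j + 2 * n) = 2 * m * 1 + 2 ^ k * j" by (simp add: m_eq algebra_simps)
  ultimately have "x [^] (2 ^ k * j) = x [^] (m + 2 ^ (k + 1) * i)"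
    unfolding x_pow_eq_iff by (metis mod_mult_self4)
  then have e: "lam g (x [^] m) = x [^] m \<otimes> x [^] (2 ^ (k + 1) * i)" by (simp add: j nat_pow_mult)
  then have "x [^] (2 ^ (k + 1) * i) = inv (x [^] m) \<otimes> lam g (x [^] m)" by (simp flip: m_assoc)
  then have "x [^] (2 ^ (k + 1) * i) \<in> Gp" using tors_mult[OF tors_inv[OF t_Gp] P] by simp
  then have "x [^] (2 ^ (k + 1) * i) = \<one>" using G disj by blast
  then show ?thesis using e by simp
qed

sublocale C: quaternion_ideal_chain B m x y k n "k + 2"
proof unfold_locales
  show "m = 2 ^ k * n" by (rule m_eq)
  show "odd n" by (rule n_odd)
  show "ideal (2 ^ (k + 1))" by (rule ideal_odd_part)
  show "[(2 ^ (k + 2) :: nat)] \<cdot> b \<in> rots (2 ^ (k + 1))" if "b \<in> carrier B" for b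
    using two_power_rots[OF that] by (simp only: q_def)
  show "lam g (x [^] m) = x [^] m" if "g \<in> carrier B" for g by (rule t_fixed[OF that])
qed

lemma Lambda_t: "b \<in> carrier B \<Longrightarrow> \<Lambda> (x [^] m) (\<iota> b) = \<iota> b"
  and t_fixed': "g \<in> carrier B \<Longrightarrow> \<Lambda> g (\<iota> (x [^] m)) = \<iota> (x [^] m)"
proof -
  show tf: "\<Lambda> g (\<iota> (x [^] m)) = \<iota> (x [^] m)" if "g \<in> carrier B" for g
    using t_fixed[OF that] iota_lam[OF that, of "x [^] m"] by simp
  have "2 * \<iota> (x [^] m) = \<iota> (x [^] m \<otimes> x [^] m)" by (simp add: iota_mult tf)
  also have "x [^] m \<otimes> x [^] m = \<one>" using x_pow_eq_1[of "m + m"] by (simp add: nat_pow_mult mult_2)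
  finally have "2 * \<iota> (x [^] m) = 0" by (simp only: iota_one)
  then show "b \<in> carrier B \<Longrightarrow> \<Lambda> (x [^] m) (\<iota> b) = \<iota> b"
    by (rule Lambda_fixed_rot[rotated]) (auto intro: tf)
qed

lemma q_iota_Gn: "b \<in> carrier B \<Longrightarrow> [q] \<cdot> b \<in> Gn"
  using two_power_rots unfolding rots_Gn by blast

lemma Lambda_x_two_part:
  assumes b: "b \<in> carrier B"
  shows "of_nat q * (\<Lambda> x (\<iota> b) - \<iota> b) = 0"
proof -
  have "of_nat q * (\<Lambda> x (\<iota> b) - \<iota> b) = \<Lambda> x (\<iota> ([q] \<cdot> b)) - \<iota> ([q] \<cdot> b)"
    using b by (simp add: iota_add_pow Lambda_of_nat right_diff_distrib)
  then show ?thesis using Lambda_x_Gn[OF q_iota_Gn[OF b]] by simp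
qed

text \<open>The difference is killed by \<open>n\<close> through the top of the chain, and by
  \<open>q\<close> because \<open>q b\<close> lies in \<open>Gn\<close>, where \<open>x\<close> acts
  trivially.\<close>

lemma Lambda_x4:
  assumes b: "b \<in> carrier B"
  shows "\<Lambda> x (\<Lambda> x (\<Lambda> x (\<Lambda> x (\<iota> b)))) = \<iota> b"
proof -
  let ?D = "\<Lambda> x (\<Lambda> x (\<Lambda> x (\<Lambda> x (\<iota> b)))) - \<iota> b"
  have "\<iota> (lam (x [^] (4::nat)) b \<ominus> b) = ?D"
    using b by (simp add: a_minus_def iota_add iota_minus iota_lam_x4)
  moreover have "lam (x [^] (4::nat)) b \<ominus> b \<in> Gn" using C.x4_top[OF b] unfolding rots_Gn .
  ultimately have "of_nat n * ?D = 0" using tors_iota by metis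
  moreover have "of_nat q * ?D = \<Lambda> x (\<Lambda> x (\<Lambda> x (\<Lambda> x (\<iota> ([q] \<cdot> b))))) - \<iota> ([q] \<cdot> b)"
    using b by (simp add: iota_add_pow Lambda_of_nat right_diff_distrib)
  then have "of_nat q * ?D = 0" using Lambda_x_Gn[OF q_iota_Gn[OF b]] by simp
  ultimately have "?D = 0" by (rule torsion_disjoint[rotated])
  then show ?thesis by simp
qed

theorem exact:
  assumes "even m"
  shows "exact_module (\<Lambda> x) (\<Lambda> (inv x)) (\<Lambda> y) (\<iota> x) (\<iota> y) (\<iota> ` carrier B) N m (k + 2)"
proof (intro exact_module.intro dicyclic exact_module_axioms.intro)
  show "N = 2 * m" by (rule N_eq)
  show "even m" by (rule assms)
  show "\<Lambda> x (M.f m) = M.f m" "\<Lambda> y (M.f m) = M.f m" by (simp_all only: M_f t_fixed' x_closed y_closed)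
  fix v assume "v \<in> \<iota> ` carrier B"
  then obtain b where b: "b \<in> carrier B" "v = \<iota> b" by auto
  show "\<Lambda> x (\<Lambda> x (\<Lambda> x (\<Lambda> x v))) = v" using Lambda_x4 b by simp
  have "\<Lambda> y (\<Lambda> y v) = \<Lambda> (y \<otimes> y) v" by (simp only: Lambda_mult y_closed)
  then show "\<Lambda> y (\<Lambda> y v) = v" unfolding y_y b(2) Lambda_t[OF b(1)] .
  show "2 ^ (k + 2) * (\<Lambda> x v - v) = 0"
    using Lambda_x_two_part[OF b(1)] unfolding q_def b(2) by (simp only: of_nat_power of_nat_numeral)
qed

end

section \<open>Models\<close>

text \<open>Affine models of braces: the brace is \<open>'v\<close> modulo \<open>L\<close>, and the two generators of its
  multiplicative group act as \<open>v \<mapsto> x + l v\<close> and \<open>v \<mapsto> y + u v\<close>.\<close>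

locale quaternion_premodel =
  fixes L :: "'v::ab_group_add set" and l u :: "'v \<Rightarrow> 'v" and x y :: 'v and m :: nat
  assumes L_0: "0 \<in> L" and L_diff: "v \<in> L \<Longrightarrow> w \<in> L \<Longrightarrow> v - w \<in> L"
    and l_add: "l (v + w) = l v + l w" and u_add: "u (v + w) = u v + u w"
    and l_L: "v \<in> L \<Longrightarrow> l v \<in> L" and u_L: "v \<in> L \<Longrightarrow> u v \<in> L"
    and l4: "l (l (l (l v))) - v \<in> L" and uu: "u (u v) - v \<in> L" and lm: "(l ^^ m) v - v \<in> L"
    and ul: "u (l v) - l (l (l (u v))) \<in> L"
    and ux: "u x - (l (l (l y)) - l (l (l x)) - y) \<in> L"
    and uy: "u y - ((\<Sum>j<m. (l ^^ j) x) - y) \<in> L"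
    and sum_L_iff: "(\<Sum>j<i. (l ^^ j) x) \<in> L \<longleftrightarrow> 2 * m dvd i"
    and refl_L: "(\<Sum>j<i. (l ^^ j) x) + (l ^^ i) y \<notin> L"
    and m_gt_0: "m > 0"
begin

definition f :: "nat \<Rightarrow> 'v" where "f i = (\<Sum>j<i. (l ^^ j) x)"

definition cg :: "'v \<Rightarrow> 'v \<Rightarrow> bool" (infix "\<approx>" 50) where "v \<approx> w \<longleftrightarrow> v - w \<in> L"

lemma L_minus: "v \<in> L \<Longrightarrow> - v \<in> L"
  using L_diff[OF L_0] by simp

lemma L_add: "v \<in> L \<Longrightarrow> w \<in> L \<Longrightarrow> v + w \<in> L"
  using L_diff[OF _ L_minus] by fastforce

lemma cg_refl [simp]: "v \<approx> v"
  by (simp add: cg_def L_0)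

lemma cg_sym: "v \<approx> w \<Longrightarrow> w \<approx> v"
  using L_minus[of "v - w"] by (simp add: cg_def)

lemma cg_trans [trans]: "v \<approx> w \<Longrightarrow> w \<approx> z \<Longrightarrow> v \<approx> z"
  using L_add[of "v - w" "w - z"] by (simp add: cg_def)

lemma cg_eq_trans [trans]: "v \<approx> w \<Longrightarrow> w = z \<Longrightarrow> v \<approx> z" "v = w \<Longrightarrow> w \<approx> z \<Longrightarrow> v \<approx> z"
  by simp_all

lemma cg_add: "v \<approx> v' \<Longrightarrow> w \<approx> w' \<Longrightarrow> v + w \<approx> v' + w'"
  using L_add[of "v - v'" "w - w'"] by (simp add: cg_def algebra_simps)

lemma cg_minus: "v \<approx> v' \<Longrightarrow> - v \<approx> - v'"
  using L_minus[of "v - v'"] by (simp add: cg_def)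

lemma cg_diff: "v \<approx> v' \<Longrightarrow> w \<approx> w' \<Longrightarrow> v - w \<approx> v' - w'"
  using cg_add[OF _ cg_minus] by fastforce

lemma l_0 [simp]: "l 0 = 0" and u_0 [simp]: "u 0 = 0"
  using l_add[of 0 0] u_add[of 0 0] by simp_all

lemma l_minus: "l (- v) = - l v" and u_minus: "u (- v) = - u v"
  using l_add[of v "- v"] u_add[of v "- v"] by (simp_all add: eq_neg_iff_add_eq_0 add.commute)

lemma l_diff: "l (v - w) = l v - l w" and u_diff: "u (v - w) = u v - u w"
  using l_add[of v "- w"] u_add[of v "- w"] by (simp_all add: l_minus u_minus)

lemma lpow_add: "(l ^^ i) (v + w) = (l ^^ i) v + (l ^^ i) w"
  by (induction i) (simp_all add: l_add)

lemma lpow_0 [simp]: "(l ^^ i) 0 = 0"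
  by (induction i) simp_all

lemma cg_l: "v \<approx> w \<Longrightarrow> l v \<approx> l w" and cg_u: "v \<approx> w \<Longrightarrow> u v \<approx> u w"
  using l_L[of "v - w"] u_L[of "v - w"] by (simp_all add: cg_def l_diff u_diff)

lemma cg_lpow: "v \<approx> w \<Longrightarrow> (l ^^ i) v \<approx> (l ^^ i) w"
  by (induction i) (simp_all add: cg_l)

lemma f_0 [simp]: "f 0 = 0"
  by (simp add: f_def)

lemma f_Suc: "f (Suc i) = f i + (l ^^ i) x"
  by (simp add: f_def)

lemma f_Suc': "f (Suc i) = x + l (f i)"
proof (induction i)
  case (Suc i)
  have "f (Suc (Suc i)) = f (Suc i) + l ((l ^^ i) x)" by (simp add: f_Suc[of "Suc i"])
  also have "f (Suc i) = x + l (f i)" by (rule Suc)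
  finally show ?case by (simp add: f_Suc[of i] l_add add.assoc)
qed (simp add: f_Suc)

lemma f_L: "f i \<in> L \<longleftrightarrow> 2 * m dvd i"
  using sum_L_iff by (simp add: f_def)

lemma refl_L': "\<not> f i + (l ^^ i) y \<approx> 0"
  using refl_L by (simp add: f_def cg_def)

lemma cg_0: "v \<approx> 0 \<longleftrightarrow> v \<in> L"
  by (simp add: cg_def)

lemma f_add: "f (i + j) = f i + (l ^^ i) (f j)"
  by (induction j) (simp_all add: f_Suc lpow_add funpow_add add.assoc)

lemma lpow_4: "(l ^^ (4 * i)) v \<approx> v"
proof (induction i)
  case (Suc i)
  have "(l ^^ (4 * Suc i)) v = l (l (l (l ((l ^^ (4 * i)) v))))" by (simp add: numeral_eq_Suc)
  also have "\<dots> \<approx> (l ^^ (4 * i)) v" using l4 by (simp add: cg_def)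
  also note Suc
  finally show ?case .
qed simp

lemma lpow_L_iff: "(l ^^ i) v \<approx> 0 \<longleftrightarrow> v \<approx> 0"
proof
  assume "(l ^^ i) v \<approx> 0"
  then have "(l ^^ (3 * i)) ((l ^^ i) v) \<approx> (l ^^ (3 * i)) 0" by (rule cg_lpow)
  moreover have "(l ^^ (3 * i)) ((l ^^ i) v) = (l ^^ (4 * i)) v"
    using funpow_add[of "3 * i" i l] by (simp add: fun_eq_iff)
  ultimately have "(l ^^ (4 * i)) v \<approx> 0" by simp
  then show "v \<approx> 0" using lpow_4 cg_sym cg_trans by blast
next
  assume "v \<approx> 0"
  then show "(l ^^ i) v \<approx> 0" using cg_lpow[of v 0 i] by simp
qed

lemma f_cg_iff: "i < 2 * m \<Longrightarrow> j < 2 * m \<Longrightarrow> f i \<approx> f j \<longleftrightarrow> i = j"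
proof -
  have le: "i = j" if "i \<le> j" "j < 2 * m" "f i \<approx> f j" for i j
  proof -
    have "f j - f i = (l ^^ i) (f (j - i))" using that(1) f_add[of i "j - i"] by simp
    moreover have "f j - f i \<approx> 0" using cg_sym[OF that(3)] by (simp add: cg_def)
    ultimately have "f (j - i) \<approx> 0" by (simp add: lpow_L_iff)
    then have "2 * m dvd j - i" by (simp add: cg_0 f_L)
    then have "j - i = 0" using that(2) by (meson dvd_imp_le gr0I less_imp_diff_less not_less)
    then show ?thesis using that(1) by simp
  qed
  show "i < 2 * m \<Longrightarrow> j < 2 * m \<Longrightarrow> f i \<approx> f j \<longleftrightarrow> i = j"
    using le[of i j] le[of j i] cg_sym[of "f i" "f j"] by (cases "i \<le> j") auto
qed

end

text \<open>Surjectivity is split off because counting supplies it once the other conditions are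
  known, see \<open>quaternion_modelI\<close>.\<close>

locale quaternion_model = quaternion_premodel +
  assumes surj: "\<exists>i. v - (\<Sum>j<i. (l ^^ j) x) \<in> L \<or> v - ((\<Sum>j<i. (l ^^ j) x) + (l ^^ i) y) \<in> L"
begin

lemma surj': obtains i where "v \<approx> f i" | i where "v \<approx> f i + (l ^^ i) y"
  using surj[of v] by (auto simp: f_def cg_def)

end

text \<open>\<open>F\<close> selects representatives, so its laws hold modulo \<open>L\<close>; up
  to this ambiguity it is an isomorphism onto the quotient that carries \<open>X\<close> and
  \<open>Y\<close> to the two affine maps.\<close>

locale modelled_brace = quaternion_model L l u x y m + quaternion_brace B m X Y
  for L :: "'v::ab_group_add set" and l u x y m and B (structure) and X Y +
  fixes F :: "'a \<Rightarrow> 'v"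
  assumes F_add: "\<lbrakk>a \<in> carrier B; b \<in> carrier B\<rbrakk> \<Longrightarrow> F (a \<oplus>\<^bsub>B\<^esub> b) \<approx> F a + F b"
    and F_ker: "\<lbrakk>a \<in> carrier B; F a \<approx> 0\<rbrakk> \<Longrightarrow> a = \<one>\<^bsub>B\<^esub>"
    and F_surj: "\<exists>a\<in>carrier B. F a \<approx> v"
    and F_X: "a \<in> carrier B \<Longrightarrow> F (X \<otimes>\<^bsub>B\<^esub> a) \<approx> x + l (F a)"
    and F_Y: "a \<in> carrier B \<Longrightarrow> F (Y \<otimes>\<^bsub>B\<^esub> a) \<approx> y + u (F a)"
begin

lemma F_zero: "F \<zero> \<approx> 0"
  using F_add[of \<zero> \<zero>] L_minus by (fastforce simp: cg_def)

lemma F_one: "F \<one> \<approx> 0"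
  using F_zero by (simp add: zero_eq_one)

lemma F_minus: "a \<in> carrier B \<Longrightarrow> F (\<ominus> a) \<approx> - F a"
proof -
  assume a: "a \<in> carrier B"
  have "F (\<ominus> a) + F a \<approx> F (\<ominus> a \<oplus> a)" using a F_add[of "\<ominus> a" a] cg_sym by simp
  also have "\<ominus> a \<oplus> a = \<zero>" using a by (simp add: l_neg)
  also note F_zero
  finally show ?thesis by (simp add: cg_def)
qed

lemma F_eq_iff: "a \<in> carrier B \<Longrightarrow> b \<in> carrier B \<Longrightarrow> F a \<approx> F b \<longleftrightarrow> a = b"
proof
  assume ab: "a \<in> carrier B" "b \<in> carrier B" "F a \<approx> F b"
  have "F (a \<oplus> \<ominus> b) \<approx> F a + F (\<ominus> b)" using ab by (simp add: F_add)
  also have "\<dots> \<approx> F b + - F b" using ab by (intro cg_add F_minus)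
  finally have "a \<oplus> \<ominus> b = \<zero>" using F_ker[of "a \<oplus> \<ominus> b"] ab by (simp add: zero_eq_one)
  then have "a \<ominus> b = \<zero>" by (simp add: a_minus_def)
  then show "a = b" using ab by (metis a_minus_def add.inv_solve_right' add.m_closed l_zero zero_closed a_inv_closed minus_equality minus_minus)
qed simp

lemma F_X_pow: "a \<in> carrier B \<Longrightarrow> F (X [^] i \<otimes> a) \<approx> f i + (l ^^ i) (F a)"
proof (induction i)
  case (Suc i)
  have "X [^] Suc i \<otimes> a = X \<otimes> (X [^] i \<otimes> a)"
    using Suc.prems nat_pow_mult[of X 1 i] by (simp flip: m_assoc)
  then have "F (X [^] Suc i \<otimes> a) \<approx> x + l (F (X [^] i \<otimes> a))" using F_X Suc.prems by simp
  also have "\<dots> \<approx> x + l (f i + (l ^^ i) (F a))" using Suc by (intro cg_add cg_l) simp_all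
  finally show ?case by (simp add: f_Suc' l_add add.assoc)
qed simp

lemma F_pow: "F (X [^] i) \<approx> f i"
proof -
  have "F (X [^] i \<otimes> \<one>) \<approx> f i + (l ^^ i) (F \<one>)" by (rule F_X_pow) simp
  also have "\<dots> \<approx> f i + (l ^^ i) 0" by (intro cg_add cg_lpow F_one) simp
  finally show ?thesis by simp
qed

lemma F_lam: "a \<in> carrier B \<Longrightarrow> F (lam (X [^] i) a) \<approx> (l ^^ i) (F a)"
proof -
  assume a: "a \<in> carrier B"
  have "F (lam (X [^] i) a) \<approx> F (\<ominus> (X [^] i)) + F (X [^] i \<otimes> a)" using a by (simp add: lam_def F_add)
  also have "\<dots> \<approx> - f i + (f i + (l ^^ i) (F a))"
    using a by (intro cg_add F_X_pow cg_trans[OF F_minus] cg_minus F_pow) simp_all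
  finally show ?thesis by simp
qed

end

text \<open>Both braces are identified with the same quotient. The resulting bijection is additive
  and commutes with left multiplication by the two generators, hence by every normal form.\<close>

lemma modelled_isomorphic:
  assumes "modelled_brace L l u x y m B X Y F" "modelled_brace L l u x y m C X' Y' F'"
  shows "brace_isomorphic B C"
proof -
  interpret B: modelled_brace L l u x y m B X Y F by fact
  interpret C: modelled_brace L l u x y m C X' Y' F' by fact
  define \<phi> where "\<phi> a = (SOME b. b \<in> carrier C \<and> B.cg (F' b) (F a))" for a
  have \<phi>: "\<phi> a \<in> carrier C" "B.cg (F' (\<phi> a)) (F a)" for a
    using someI_ex[of "\<lambda>b. b \<in> carrier C \<and> B.cg (F' b) (F a)"] C.F_surj[of "F a"]
    unfolding \<phi>_def by blast+
  have \<phi>I: "\<phi> a = b" if "b \<in> carrier C" "B.cg (F a) (F' b)" for a b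
    using \<phi>[of a] C.F_eq_iff that B.cg_trans by blast
  have add: "\<phi> (a \<oplus>\<^bsub>B\<^esub> b) = \<phi> a \<oplus>\<^bsub>C\<^esub> \<phi> b" if "a \<in> carrier B" "b \<in> carrier B" for a b
  proof (rule \<phi>I)
    have "B.cg (F (a \<oplus>\<^bsub>B\<^esub> b)) (F a + F b)" using that by (rule B.F_add)
    moreover have "B.cg (F a + F b) (F' (\<phi> a) + F' (\<phi> b))" by (intro B.cg_add B.cg_sym[OF \<phi>(2)])
    moreover have "B.cg (F' (\<phi> a) + F' (\<phi> b)) (F' (\<phi> a \<oplus>\<^bsub>C\<^esub> \<phi> b))"
      by (intro B.cg_sym[OF C.F_add] \<phi>)
    ultimately show "B.cg (F (a \<oplus>\<^bsub>B\<^esub> b)) (F' (\<phi> a \<oplus>\<^bsub>C\<^esub> \<phi> b))" using B.cg_trans by blast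
  qed (simp add: \<phi>)
  have X: "\<phi> (X \<otimes>\<^bsub>B\<^esub> a) = X' \<otimes>\<^bsub>C\<^esub> \<phi> a" if "a \<in> carrier B" for a
  proof (rule \<phi>I)
    have "B.cg (F (X \<otimes>\<^bsub>B\<^esub> a)) (x + l (F a))" using that by (rule B.F_X)
    moreover have "B.cg (x + l (F a)) (x + l (F' (\<phi> a)))" by (intro B.cg_add B.cg_l B.cg_sym[OF \<phi>(2)]) simp
    moreover have "B.cg (x + l (F' (\<phi> a))) (F' (X' \<otimes>\<^bsub>C\<^esub> \<phi> a))" by (intro B.cg_sym[OF C.F_X] \<phi>)
    ultimately show "B.cg (F (X \<otimes>\<^bsub>B\<^esub> a)) (F' (X' \<otimes>\<^bsub>C\<^esub> \<phi> a))" using B.cg_trans by blast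
  qed (simp add: \<phi>)
  have Y: "\<phi> (Y \<otimes>\<^bsub>B\<^esub> a) = Y' \<otimes>\<^bsub>C\<^esub> \<phi> a" if "a \<in> carrier B" for a
  proof (rule \<phi>I)
    have "B.cg (F (Y \<otimes>\<^bsub>B\<^esub> a)) (y + u (F a))" using that by (rule B.F_Y)
    moreover have "B.cg (y + u (F a)) (y + u (F' (\<phi> a)))" by (intro B.cg_add B.cg_u B.cg_sym[OF \<phi>(2)]) simp
    moreover have "B.cg (y + u (F' (\<phi> a))) (F' (Y' \<otimes>\<^bsub>C\<^esub> \<phi> a))" by (intro B.cg_sym[OF C.F_Y] \<phi>)
    ultimately show "B.cg (F (Y \<otimes>\<^bsub>B\<^esub> a)) (F' (Y' \<otimes>\<^bsub>C\<^esub> \<phi> a))" using B.cg_trans by blast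
  qed (simp add: \<phi>)
  have one: "\<phi> \<one>\<^bsub>B\<^esub> = \<one>\<^bsub>C\<^esub>"
    using B.F_one C.F_one B.cg_sym B.cg_trans by (intro \<phi>I) blast+
  have Xp: "\<phi> (X [^]\<^bsub>B\<^esub> i \<otimes>\<^bsub>B\<^esub> a) = X' [^]\<^bsub>C\<^esub> i \<otimes>\<^bsub>C\<^esub> \<phi> a" if "a \<in> carrier B" for a and i :: nat
    using that
  proof (induction i arbitrary: a)
    case (Suc i)
    have "\<phi> (X [^]\<^bsub>B\<^esub> Suc i \<otimes>\<^bsub>B\<^esub> a) = X' [^]\<^bsub>C\<^esub> i \<otimes>\<^bsub>C\<^esub> \<phi> (X \<otimes>\<^bsub>B\<^esub> a)"
      using Suc by (simp add: B.m_assoc)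
    then show ?case using X[OF Suc.prems] \<phi> by (simp add: C.m_assoc)
  qed (simp add: \<phi>)
  have Xp1: "\<phi> (X [^]\<^bsub>B\<^esub> i) = X' [^]\<^bsub>C\<^esub> i" for i :: nat
    using Xp[of "\<one>\<^bsub>B\<^esub>" i] by (simp add: one)
  have mult: "\<phi> (a \<otimes>\<^bsub>B\<^esub> b) = \<phi> a \<otimes>\<^bsub>C\<^esub> \<phi> b" if "a \<in> carrier B" "b \<in> carrier B" for a b
    using that(1)
  proof (cases rule: B.carrier_cases)
    case (rot i)
    then show ?thesis using Xp[OF that(2)] Xp1 by simp
  next
    case (refl i)
    have Y1: "\<phi> Y = Y'" using Y[of "\<one>\<^bsub>B\<^esub>"] one by simp
    have "\<phi> (a \<otimes>\<^bsub>B\<^esub> b) = X' [^]\<^bsub>C\<^esub> i \<otimes>\<^bsub>C\<^esub> \<phi> (Y \<otimes>\<^bsub>B\<^esub> b)"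
      using Xp[of "Y \<otimes>\<^bsub>B\<^esub> b" i] that by (simp add: refl B.m_assoc)
    also have "\<dots> = (X' [^]\<^bsub>C\<^esub> i \<otimes>\<^bsub>C\<^esub> Y') \<otimes>\<^bsub>C\<^esub> \<phi> b" using Y that \<phi> by (simp add: C.m_assoc)
    also have "X' [^]\<^bsub>C\<^esub> i \<otimes>\<^bsub>C\<^esub> Y' = \<phi> a" using Xp[of Y i] Y1 by (simp add: refl)
    finally show ?thesis .
  qed
  have bij: "bij_betw \<phi> (carrier B) (carrier C)"
  proof (rule bij_betwI')
    fix a b assume "a \<in> carrier B" "b \<in> carrier B"
    then show "\<phi> a = \<phi> b \<longleftrightarrow> a = b"
      using \<phi>(2)[of a] \<phi>(2)[of b] B.F_eq_iff B.cg_sym B.cg_trans by metis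
  next
    fix c assume c: "c \<in> carrier C"
    obtain a where "a \<in> carrier B" "B.cg (F a) (F' c)" using B.F_surj by blast
    then show "\<exists>a\<in>carrier B. c = \<phi> a" using \<phi>I c by metis
  qed (simp add: \<phi>)
  have "\<phi> \<in> brace_iso B C"
    using bij by (auto simp: brace_iso_def iso_def hom_def add mult \<phi>)
  then show ?thesis by (auto simp: brace_isomorphic_def)
qed

subsection \<open>Realising a model on the presented group\<close>

lemma (in group) inv_pow_cyclic:
  assumes a: "a \<in> carrier G" "a [^] (r::nat) = \<one>" "r > 0"
  shows "inv (a [^] (i::nat)) = a [^] ((r - 1) * i)"
proof (rule inv_equality)
  have "(r - 1) * i + i = r * i" using a(3) by (cases r) auto
  then have "a [^] ((r - 1) * i) \<otimes> a [^] i = (a [^] r) [^] i" using a(1) by (simp add: nat_pow_mult nat_pow_pow)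
  then show "a [^] ((r - 1) * i) \<otimes> a [^] i = \<one>" using a(2) by simp
qed (use a in simp_all)

text \<open>Stability under left multiplication by single letters; induction over words then shows
  that the normal forms exhaust the presented group.\<close>

lemma (in group) quaternion_normal_form:
  assumes x: "x \<in> carrier G" and y: "y \<in> carrier G" and m: "m > 0"
    and rel: "x [^] (2 * m) = \<one>" "y \<otimes> x = inv x \<otimes> y" "y \<otimes> y = x [^] (m::nat)"
  defines "N \<equiv> {x [^] i |i::nat. True} \<union> {x [^] i \<otimes> y |i::nat. True}"
  assumes a: "a \<in> N"
  shows "x \<otimes> a \<in> N" "inv x \<otimes> a \<in> N" "y \<otimes> a \<in> N" "inv y \<otimes> a \<in> N"
proof -
  have NX: "x [^] j \<otimes> a \<in> N" if "a \<in> N" for a and j :: nat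
    using that x y unfolding N_def by (fastforce simp: nat_pow_mult m_assoc[symmetric])
  have inv: "inv (x [^] i) = x [^] ((2 * m - 1) * i)" for i :: nat
    using rel(1) m x by (intro inv_pow_cyclic) simp_all
  show "x \<otimes> a \<in> N" using NX[OF a, of 1] x by simp
  show "inv x \<otimes> a \<in> N" using NX[OF a, of "(2 * m - 1) * 1"] inv[of 1] x by simp
  have yx: "y \<otimes> x [^] i = inv (x [^] i) \<otimes> y" for i :: nat
  proof (induction i)
    case (Suc i)
    have "y \<otimes> x [^] Suc i = (y \<otimes> x [^] i) \<otimes> x" using x y by (simp add: m_assoc)
    also have "\<dots> = inv (x [^] i) \<otimes> (y \<otimes> x)" unfolding Suc using x y by (simp add: m_assoc)
    also have "\<dots> = inv (x [^] i) \<otimes> inv x \<otimes> y" using x y by (simp add: rel(2) m_assoc)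
    also have "inv (x [^] i) \<otimes> inv x = inv (x \<otimes> x [^] i)" using x by (simp add: inv_mult_group)
    also have "x \<otimes> x [^] i = x [^] Suc i" using x nat_pow_mult[of x 1 i] by simp
    finally show ?case .
  qed (use y in simp)
  have yN: "y \<otimes> a \<in> N" if aN: "a \<in> N" for a
  proof -
    have "x [^] i \<in> N" "x [^] i \<otimes> y \<in> N" for i :: nat by (auto simp: N_def)
    note N = NX[OF this(1)] NX[OF this(2)]
    consider i where "a = x [^] (i::nat)" | i where "a = x [^] (i::nat) \<otimes> y"
      using aN by (auto simp: N_def)
    then show ?thesis
    proof cases
      case (1 i)
      then show ?thesis using \<open>\<And>i. x [^] i \<otimes> y \<in> N\<close> by (simp only: yx inv)
    next
      case (2 i)
      then have "y \<otimes> a = (y \<otimes> x [^] i) \<otimes> y" using x y by (simp add: m_assoc)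
      also have "\<dots> = x [^] ((2 * m - 1) * i) \<otimes> x [^] m"
        unfolding yx inv using x y by (simp add: m_assoc rel(3))
      finally show ?thesis using N(1) by simp
    qed
  qed
  then show "y \<otimes> a \<in> N" using a by blast
  have "inv y = x [^] m \<otimes> y"
  proof (rule inv_equality)
    have "x [^] m \<otimes> y \<otimes> y = x [^] m \<otimes> x [^] m" using x y by (simp add: m_assoc rel(3))
    then show "x [^] m \<otimes> y \<otimes> y = \<one>" using x rel(1) by (simp add: nat_pow_mult mult_2)
  qed (use x y in simp_all)
  moreover have "a \<in> carrier G" using a x y by (auto simp: N_def)
  ultimately have "inv y \<otimes> a = x [^] m \<otimes> (y \<otimes> a)" using x y by (simp add: m_assoc)
  then show "inv y \<otimes> a \<in> N" using NX[OF yN[OF a], of m] by simp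
qed

context quaternion_premodel
begin

text \<open>Letters act on the model by affine maps. The inverse letters use \<open>l^3\<close> and
  \<open>u\<close>, which invert \<open>l\<close> and \<open>u\<close> modulo
  \<open>L\<close>.\<close>

fun aff :: "quaternion_gen letter \<Rightarrow> 'v \<Rightarrow> 'v" where
  "aff (Gen qx) v = x + l v"
| "aff (Inv qx) v = l (l (l (v - x)))"
| "aff (Gen qy) v = y + u v"
| "aff (Inv qy) v = u (v - y)"

definition act :: "quaternion_gen letter list \<Rightarrow> 'v \<Rightarrow> 'v" where "act w v = foldr aff w v"

lemma act_simps [simp]: "act [] v = v" "act (g # w) v = aff g (act w v)" "act (w @ w') v = act w (act w' v)"
  by (simp_all add: act_def)

text \<open>Preserving \<open>p + q - r\<close> characterises affine maps without reference to their
  value at \<open>0\<close>; the case \<open>r = 0\<close> becomes the brace law.\<close>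

lemma aff_affine: "aff g (p + q - r) = aff g p + aff g q - aff g r"
  by (induction g p rule: aff.induct) (simp_all add: l_add l_diff u_add u_diff algebra_simps)

lemma act_affine: "act w (p + q - r) = act w p + act w q - act w r"
  by (induction w) (simp_all add: aff_affine)

lemma aff_cg: "v \<approx> w \<Longrightarrow> aff g v \<approx> aff g w"
  by (cases "(g, v)" rule: aff.cases) (auto intro!: cg_add cg_l cg_u cg_diff)

lemma act_cg: "v \<approx> w \<Longrightarrow> act z v \<approx> act z w"
  by (induction z) (auto intro: aff_cg)

lemma act_replicate: "act (replicate i (Gen qx)) v = f i + (l ^^ i) v"
  by (induction i) (simp_all add: f_Suc' l_add add.assoc)

lemma aff_cancel: "aff g (aff (inv_letter g) v) \<approx> v"
proof -
  have 1: "x + l (l (l (l (v - x)))) \<approx> v" using l4[of "v - x"] by (simp add: cg_def algebra_simps)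
  have 2: "l (l (l (x + l v - x))) \<approx> v" using l4[of v] by (simp add: cg_def)
  have 3: "y + u (u (v - y)) \<approx> v" using uu[of "v - y"] by (simp add: cg_def algebra_simps)
  have 4: "u (y + u v - y) \<approx> v" using uu[of v] by (simp add: cg_def)
  show ?thesis
    by (cases "(g, v)" rule: aff.cases) (use 1 2 3 4 in auto)
qed

abbreviation "R \<equiv> {(replicate (2 * m) (Gen qx), []), ([Gen qy, Gen qx], [Inv qx, Gen qy]),
  ([Gen qy, Gen qy], replicate m (Gen qx))}"

text \<open>Each defining relation of the group reduces to the corresponding congruence of the
  locale.\<close>

lemma act_word_eq: "word_eq R w w' \<Longrightarrow> act w v \<approx> act w' v"
proof (induction arbitrary: v rule: word_eq.induct)
  case (word_rel r s)
  have 1: "f (2 * m) + (l ^^ (2 * m)) v \<approx> v"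
  proof -
    have lm': "(l ^^ m) w \<approx> w" for w using lm by (simp add: cg_def)
    have "(l ^^ (2 * m)) v = (l ^^ m) ((l ^^ m) v)" by (simp add: mult_2 funpow_add)
    also have "\<dots> \<approx> v" using lm' cg_trans by blast
    finally have "f (2 * m) + (l ^^ (2 * m)) v \<approx> 0 + v" by (intro cg_add) (simp_all add: cg_0 f_L)
    then show ?thesis by simp
  qed
  have 2: "y + u (x + l v) \<approx> l (l (l (y + u v - x)))"
  proof -
    have "y + u x + (u (l v)) \<approx> y + (l (l (l y)) - l (l (l x)) - y) + l (l (l (u v)))"
      using ux ul by (intro cg_add) (simp_all add: cg_def)
    then show ?thesis by (simp add: u_add l_add l_diff algebra_simps)
  qed
  have 3: "y + u (y + u v) \<approx> f m + (l ^^ m) v"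
  proof -
    have "y + u y + u (u v) \<approx> y + (f m - y) + (l ^^ m) v"
      using uy uu[of v] cg_sym[of "(l ^^ m) v" v] lm[of v] cg_trans[of "u (u v)" v "(l ^^ m) v"]
      by (intro cg_add) (simp_all add: cg_def f_def)
    then show ?thesis by (simp add: u_add algebra_simps)
  qed
  from word_rel show ?case using 1 2 3 by (auto simp: act_replicate)
next
  case (word_cancel g)
  then show ?case by (simp add: aff_cancel)
next
  case (word_append w w' z z')
  have "act w (act z v) \<approx> act w (act z' v)" by (intro act_cg word_append.IH)
  also have "\<dots> \<approx> act w' (act z' v)" by (rule word_append.IH)
  finally show ?case by simp
qed (auto intro: cg_sym cg_trans)

definition G where "G = presented_group R"

lemma G_eq: "G = gen_quaternion m"
  by (simp add: G_def gen_quaternion_def)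

lemma group_G: "group G"
  unfolding G_def by (rule group_presented_group)

abbreviation "cls \<equiv> word_class R"

lemma carrier_G: "carrier G = range cls" and one_G: "\<one>\<^bsub>G\<^esub> = cls []"
  and mult_G: "cls w \<otimes>\<^bsub>G\<^esub> cls w' = cls (w @ w')"
  using mult_presented_group[of R w w'] by (simp_all add: G_def) (simp_all add: presented_group_def)

text \<open>The orbit map at \<open>0\<close>; choosing a representative word is harmless modulo
  \<open>L\<close>.\<close>

definition \<Phi> where "\<Phi> W = act (SOME w. w \<in> W) 0"

lemma Phi_cls: "\<Phi> (cls w) \<approx> act w 0"
proof -
  have "(SOME w'. w' \<in> cls w) \<in> cls w" by (rule someI[of _ w]) (simp add: word_class_def word_refl)
  then have "word_eq R w (SOME w'. w' \<in> cls w)" by (simp add: word_class_def)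
  then show ?thesis unfolding \<Phi>_def by (intro cg_sym[OF act_word_eq])
qed

lemma cls_pow: "cls [Gen qx] [^]\<^bsub>G\<^esub> (i::nat) = cls (replicate i (Gen qx))"
proof (induction i)
  case (Suc i)
  have "cls [Gen qx] [^]\<^bsub>G\<^esub> Suc i = cls (replicate i (Gen qx) @ [Gen qx])"
    by (simp add: Suc mult_G)
  then show ?case by (simp flip: replicate_append_same)
qed (simp add: one_G)

lemma cls_inv: "inv\<^bsub>G\<^esub> (cls [Gen g]) = cls [Inv g]"
proof (rule group.inv_equality[OF group_G])
  show "cls [Inv g] \<otimes>\<^bsub>G\<^esub> cls [Gen g] = \<one>\<^bsub>G\<^esub>"
    using word_cancel[of R "Inv g"] by (simp add: mult_G one_G word_class_eq_iff)
qed (simp_all add: carrier_G)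

lemma G_rel:
  "cls [Gen qx] [^]\<^bsub>G\<^esub> (2 * m) = \<one>\<^bsub>G\<^esub>"
  "cls [Gen qy] \<otimes>\<^bsub>G\<^esub> cls [Gen qx] = inv\<^bsub>G\<^esub> (cls [Gen qx]) \<otimes>\<^bsub>G\<^esub> cls [Gen qy]"
  "cls [Gen qy] \<otimes>\<^bsub>G\<^esub> cls [Gen qy] = cls [Gen qx] [^]\<^bsub>G\<^esub> m"
  by (auto simp: cls_pow cls_inv one_G mult_G word_class_eq_iff intro!: word_rel)

lemma G_cases:
  assumes "a \<in> carrier G"
  shows "a \<in> {cls [Gen qx] [^]\<^bsub>G\<^esub> i |i::nat. True} \<union> {cls [Gen qx] [^]\<^bsub>G\<^esub> i \<otimes>\<^bsub>G\<^esub> cls [Gen qy] |i::nat. True}"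
proof -
  interpret G: group G by (rule group_G)
  have car: "cls w \<in> carrier G" for w by (simp add: carrier_G)
  note nf = G.quaternion_normal_form[OF car car m_gt_0 G_rel]
  obtain w where a: "a = cls w" using assms by (auto simp: carrier_G)
  show ?thesis unfolding a
  proof (induction w)
    case Nil
    have "cls [] = cls [Gen qx] [^]\<^bsub>G\<^esub> (0::nat)" by (simp add: one_G)
    then show ?case by blast
  next
    case (Cons g w)
    have e: "cls (g # w) = cls [g] \<otimes>\<^bsub>G\<^esub> cls w" by (simp add: mult_G)
    consider "g = Gen qx" | "g = Inv qx" | "g = Gen qy" | "g = Inv qy"
      by (metis letter.exhaust quaternion_gen.exhaust)
    then show ?case
      by cases (use e nf[OF Cons.IH] in \<open>simp_all only: cls_inv\<close>)
  qed
qed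

lemma Phi_mult: "a \<in> carrier G \<Longrightarrow> \<exists>A. (\<forall>b\<in>carrier G. \<Phi> (a \<otimes>\<^bsub>G\<^esub> b) \<approx> A (\<Phi> b)) \<and>
  (\<forall>p q r. A (p + q - r) = A p + A q - A r) \<and> (\<forall>p q. p \<approx> q \<longrightarrow> A p \<approx> A q) \<and> A 0 \<approx> \<Phi> a"
proof -
  assume "a \<in> carrier G"
  then obtain w where a: "a = cls w" by (auto simp: carrier_G)
  have "\<Phi> (a \<otimes>\<^bsub>G\<^esub> b) \<approx> act w (\<Phi> b)" if bG: "b \<in> carrier G" for b
  proof -
    obtain w' where b: "b = cls w'" using bG by (auto simp: carrier_G)
    have "\<Phi> (a \<otimes>\<^bsub>G\<^esub> b) \<approx> act w (act w' 0)" using Phi_cls[of "w @ w'"] by (simp add: a b mult_G)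
    also have "\<dots> \<approx> act w (\<Phi> b)" unfolding b by (intro act_cg cg_sym[OF Phi_cls])
    finally show ?thesis .
  qed
  then show ?thesis
    using act_affine[of w] act_cg[of _ _ w] cg_sym[OF Phi_cls[of w]] by (intro exI[of _ "act w"]) (simp add: a)
qed

lemma Phi_gen:
  assumes "b \<in> carrier G"
  shows "\<Phi> (cls [Gen qx] \<otimes>\<^bsub>G\<^esub> b) \<approx> x + l (\<Phi> b)" "\<Phi> (cls [Gen qy] \<otimes>\<^bsub>G\<^esub> b) \<approx> y + u (\<Phi> b)"
proof -
  obtain w where b: "b = cls w" using assms by (auto simp: carrier_G)
  have "\<Phi> (cls [g] \<otimes>\<^bsub>G\<^esub> b) \<approx> aff g (\<Phi> b)" for g
  proof -
    have "\<Phi> (cls [g] \<otimes>\<^bsub>G\<^esub> b) \<approx> aff g (act w 0)" using Phi_cls[of "g # w"] by (simp add: b mult_G)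
    also have "\<dots> \<approx> aff g (\<Phi> b)" unfolding b by (intro aff_cg cg_sym[OF Phi_cls])
    finally show ?thesis .
  qed
  from this[of "Gen qx"] this[of "Gen qy"]
  show "\<Phi> (cls [Gen qx] \<otimes>\<^bsub>G\<^esub> b) \<approx> x + l (\<Phi> b)" "\<Phi> (cls [Gen qy] \<otimes>\<^bsub>G\<^esub> b) \<approx> y + u (\<Phi> b)"
    by simp_all
qed

lemma Phi_pow: "\<Phi> (cls [Gen qx] [^]\<^bsub>G\<^esub> (i::nat)) \<approx> f i"
  and Phi_refl: "\<Phi> (cls [Gen qx] [^]\<^bsub>G\<^esub> (i::nat) \<otimes>\<^bsub>G\<^esub> cls [Gen qy]) \<approx> f i + (l ^^ i) y"
  using Phi_cls[of "replicate i (Gen qx)"] Phi_cls[of "replicate i (Gen qx) @ [Gen qy]"]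
  by (simp_all add: cls_pow mult_G act_replicate)

lemma Phi_one: "\<Phi> \<one>\<^bsub>G\<^esub> \<approx> 0"
  using Phi_cls[of "[]"] by (simp add: one_G)

text \<open>The presentation bounds the order of \<open>x\<close> from above, the orbit of
  \<open>0\<close> in the model from below.\<close>

lemma G_pow_eq_1: "cls [Gen qx] [^]\<^bsub>G\<^esub> (i::nat) = \<one>\<^bsub>G\<^esub> \<longleftrightarrow> 2 * m dvd i"
proof
  assume "cls [Gen qx] [^]\<^bsub>G\<^esub> i = \<one>\<^bsub>G\<^esub>"
  then have "f i \<approx> 0" using Phi_pow[of i] Phi_one cg_sym cg_trans by metis
  then show "2 * m dvd i" by (simp add: cg_0 f_L)
next
  interpret G: group G by (rule group_G)
  assume "2 * m dvd i"
  then obtain j where "i = 2 * m * j" by (rule dvdE)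
  moreover have "cls [Gen qx] \<in> carrier G" by (simp add: carrier_G)
  ultimately have "cls [Gen qx] [^]\<^bsub>G\<^esub> i = (cls [Gen qx] [^]\<^bsub>G\<^esub> (2 * m)) [^]\<^bsub>G\<^esub> j"
    by (simp only: G.nat_pow_pow)
  then show "cls [Gen qx] [^]\<^bsub>G\<^esub> i = \<one>\<^bsub>G\<^esub>" by (simp only: G_rel(1) G.nat_pow_one)
qed

lemma Phi_ker: "a \<in> carrier G \<Longrightarrow> \<Phi> a \<approx> 0 \<Longrightarrow> a = \<one>\<^bsub>G\<^esub>"
proof -
  assume a: "a \<in> carrier G" "\<Phi> a \<approx> 0"
  from G_cases[OF a(1)]
  consider i where "a = cls [Gen qx] [^]\<^bsub>G\<^esub> (i::nat)"
    | i where "a = cls [Gen qx] [^]\<^bsub>G\<^esub> (i::nat) \<otimes>\<^bsub>G\<^esub> cls [Gen qy]" by auto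
  then show ?thesis
  proof cases
    case (1 i)
    then have "f i \<approx> 0" using a(2) Phi_pow[of i] cg_sym cg_trans by metis
    then show ?thesis by (simp only: 1 G_pow_eq_1 cg_0 f_L)
  next
    case (2 i)
    then have "f i + (l ^^ i) y \<approx> 0" using a(2) Phi_refl[of i] cg_sym cg_trans by metis
    then show ?thesis using refl_L' by blast
  qed
qed

lemma Phi_inj: "a \<in> carrier G \<Longrightarrow> b \<in> carrier G \<Longrightarrow> \<Phi> a \<approx> \<Phi> b \<Longrightarrow> a = b"
proof -
  interpret G: group G by (rule group_G)
  assume ab: "a \<in> carrier G" "b \<in> carrier G" "\<Phi> a \<approx> \<Phi> b"
  obtain A where A: "\<forall>c\<in>carrier G. \<Phi> (inv\<^bsub>G\<^esub> b \<otimes>\<^bsub>G\<^esub> c) \<approx> A (\<Phi> c)" "\<forall>p q. p \<approx> q \<longrightarrow> A p \<approx> A q"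
    using Phi_mult[of "inv\<^bsub>G\<^esub> b"] ab by auto
  have "\<Phi> (inv\<^bsub>G\<^esub> b \<otimes>\<^bsub>G\<^esub> a) \<approx> A (\<Phi> a)" using A(1) ab by blast
  also have "\<dots> \<approx> A (\<Phi> b)" using A(2) ab by blast
  also have "\<dots> \<approx> \<Phi> (inv\<^bsub>G\<^esub> b \<otimes>\<^bsub>G\<^esub> b)" using A(1) ab cg_sym by blast
  also have "\<dots> \<approx> 0" using Phi_one ab by simp
  finally have "inv\<^bsub>G\<^esub> b \<otimes>\<^bsub>G\<^esub> a = \<one>\<^bsub>G\<^esub>" by (intro Phi_ker) (use ab in simp_all)
  then show "a = b" using ab by (metis G.inv_equality G.inv_inv G.inv_closed)
qed

lemma cls_y_neq: "cls [Gen qx] [^]\<^bsub>G\<^esub> (i::nat) \<otimes>\<^bsub>G\<^esub> cls [Gen qy] \<noteq> cls [Gen qx] [^]\<^bsub>G\<^esub> (j::nat)"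
proof
  interpret G: group G by (rule group_G)
  have c: "cls w \<in> carrier G" for w by (simp add: carrier_G)
  assume y: "cls [Gen qx] [^]\<^bsub>G\<^esub> i \<otimes>\<^bsub>G\<^esub> cls [Gen qy] = cls [Gen qx] [^]\<^bsub>G\<^esub> j"
  define k where "k = (2 * m - 1) * j"
  have "inv\<^bsub>G\<^esub> (cls [Gen qx] [^]\<^bsub>G\<^esub> j) = cls [Gen qx] [^]\<^bsub>G\<^esub> k"
    unfolding k_def by (rule G.inv_pow_cyclic[OF c G_rel(1)]) (use m_gt_0 in simp)
  then have "cls [Gen qx] [^]\<^bsub>G\<^esub> k \<otimes>\<^bsub>G\<^esub> (cls [Gen qx] [^]\<^bsub>G\<^esub> i \<otimes>\<^bsub>G\<^esub> cls [Gen qy]) = \<one>\<^bsub>G\<^esub>"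
    unfolding y using c by (metis G.l_inv G.nat_pow_closed)
  then have "cls [Gen qx] [^]\<^bsub>G\<^esub> (k + i) \<otimes>\<^bsub>G\<^esub> cls [Gen qy] = \<one>\<^bsub>G\<^esub>"
    by (simp add: c G.m_assoc flip: G.nat_pow_mult)
  then have "f (k + i) + (l ^^ (k + i)) y \<approx> 0" using Phi_refl[of "k + i"] Phi_one cg_sym cg_trans by metis
  then show False using refl_L' by blast
qed

text \<open>Since the \<open>4m\<close> points of the orbit of \<open>0\<close> are pairwise incongruent, surjectivity only needs a
  set of at most \<open>4m\<close> representatives.\<close>

lemma quaternion_modelI:
  assumes R: "finite Rep" "card Rep \<le> 4 * m" "\<And>v. \<exists>r\<in>Rep. v - r \<in> L"
  shows "quaternion_model L l u x y m"
proof unfold_locales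
  interpret G: group G by (rule group_G)
  have c: "cls w \<in> carrier G" for w by (simp add: carrier_G)
  define \<rho> where "\<rho> v = (SOME r. r \<in> Rep \<and> v \<approx> r)" for v
  have \<rho>: "\<rho> v \<in> Rep" "v \<approx> \<rho> v" for v
    using someI_ex[of "\<lambda>r. r \<in> Rep \<and> v \<approx> r"] R(3)[of v] unfolding \<rho>_def cg_def by blast+
  define A where "A = (\<lambda>i::nat. cls [Gen qx] [^]\<^bsub>G\<^esub> i) ` {..<2 * m}"
  define A' where "A' = (\<lambda>i::nat. cls [Gen qx] [^]\<^bsub>G\<^esub> i \<otimes>\<^bsub>G\<^esub> cls [Gen qy]) ` {..<2 * m}"
  have pow_inj: "i = j" if "cls [Gen qx] [^]\<^bsub>G\<^esub> i = cls [Gen qx] [^]\<^bsub>G\<^esub> j" "i < 2 * m" "j < 2 * m" for i j :: nat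
  proof -
    have "f i \<approx> f j"
      by (rule cg_trans[OF cg_sym[OF Phi_pow[of i]]]) (simp only: that(1) Phi_pow[of j])
    then show ?thesis using f_cg_iff that by blast
  qed
  have "card A = 2 * m" unfolding A_def by (subst card_image) (auto intro!: inj_onI pow_inj)
  moreover have "card A' = 2 * m" unfolding A'_def
    by (subst card_image) (auto intro!: inj_onI pow_inj simp: c)
  moreover have "A \<inter> A' = {}" unfolding A_def A'_def using cls_y_neq by fastforce
  moreover have fin: "finite A" "finite A'" by (simp_all add: A_def A'_def)
  ultimately have card: "card (A \<union> A') = 4 * m" by (simp add: card_Un_disjoint)
  have sub: "A \<union> A' \<subseteq> carrier G" by (auto simp: A_def A'_def c)
  have "inj_on (\<lambda>a. \<rho> (\<Phi> a)) (A \<union> A')"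
  proof (rule inj_onI)
    fix a b assume ab: "a \<in> A \<union> A'" "b \<in> A \<union> A'" "\<rho> (\<Phi> a) = \<rho> (\<Phi> b)"
    then have "\<Phi> a \<approx> \<Phi> b" using \<rho>(2)[of "\<Phi> a"] \<rho>(2)[of "\<Phi> b"] cg_sym cg_trans by metis
    then show "a = b" using Phi_inj ab sub by blast
  qed
  then have "card ((\<lambda>a. \<rho> (\<Phi> a)) ` (A \<union> A')) = 4 * m" using card by (simp add: card_image)
  moreover have sub': "(\<lambda>a. \<rho> (\<Phi> a)) ` (A \<union> A') \<subseteq> Rep" using \<rho>(1) by blast
  ultimately have "card ((\<lambda>a. \<rho> (\<Phi> a)) ` (A \<union> A')) = card Rep"
    using card_mono[OF R(1) sub'] R(2) by linarith
  then have onto: "(\<lambda>a. \<rho> (\<Phi> a)) ` (A \<union> A') = Rep" by (rule card_subset_eq[OF R(1) sub'])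
  fix v
  obtain a where a: "a \<in> A \<union> A'" "\<rho> v = \<rho> (\<Phi> a)" using onto \<rho>(1)[of v] by blast
  then have va: "v \<approx> \<Phi> a" using \<rho>(2)[of v] \<rho>(2)[of "\<Phi> a"] cg_sym cg_trans by metis
  have "\<exists>i. v \<approx> f i \<or> v \<approx> f i + (l ^^ i) y"
    using a(1) unfolding A_def A'_def
  proof (elim UnE imageE)
    fix i :: nat assume "a = cls [Gen qx] [^]\<^bsub>G\<^esub> i"
    then show ?thesis using va Phi_pow[of i] cg_trans by metis
  next
    fix i :: nat assume "a = cls [Gen qx] [^]\<^bsub>G\<^esub> i \<otimes>\<^bsub>G\<^esub> cls [Gen qy]"
    then show ?thesis using va Phi_refl[of i] cg_trans by metis
  qed
  then show "\<exists>i. v - (\<Sum>j<i. (l ^^ j) x) \<in> L \<or> v - ((\<Sum>j<i. (l ^^ j) x) + (l ^^ i) y) \<in> L"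
    by (simp add: cg_def f_def)
qed

end

text \<open>The sums defining \<open>f\<close> are replaced by any sequences satisfying their recursions modulo \<open>L\<close>.\<close>

lemma quaternion_premodelI:
  fixes L :: "'v::ab_group_add set"
  assumes L: "0 \<in> L" "\<And>v w. v \<in> L \<Longrightarrow> w \<in> L \<Longrightarrow> v - w \<in> L"
    and add: "\<And>v w. l (v + w) = l v + l w" "\<And>v w. u (v + w) = u v + u w"
    and inv: "\<And>v. v \<in> L \<Longrightarrow> l v \<in> L" "\<And>v. v \<in> L \<Longrightarrow> u v \<in> L"
    and l4: "\<And>v. l (l (l (l v))) - v \<in> L" and uu: "\<And>v. u (u v) - v \<in> L"
    and l2: "4 dvd m \<or> even m \<and> (\<forall>v. l (l v) - v \<in> L) \<or> (\<forall>v. l v - v \<in> L)"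
    and ul: "\<And>v. u (l v) - l (l (l (u v))) \<in> L"
    and ux: "u x - (l (l (l y)) - l (l (l x)) - y) \<in> L"
    and uy: "u y - (g m - y) \<in> L"
    and g: "g 0 \<in> L" "\<And>i. g (Suc i) - (x + l (g i)) \<in> L"
    and k: "k 0 - y \<in> L" "\<And>i. k (Suc i) - l (k i) \<in> L"
    and iff: "\<And>i. g i \<in> L \<longleftrightarrow> 2 * m dvd i" and refl: "\<And>i. g i + k i \<notin> L" and m: "m > 0"
  shows "quaternion_premodel L l u x y m"
proof -
  have neg: "- v \<in> L" if "v \<in> L" for v using L(2)[OF L(1) that] by simp
  have plus: "v + w \<in> L" if "v \<in> L" "w \<in> L" for v w using L(2)[OF that(1) neg[OF that(2)]] by simp
  have trans: "a - c \<in> L" if "a - b \<in> L" "b - c \<in> L" for a b c using plus[OF that] by simp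
  have mem: "a \<in> L \<longleftrightarrow> b \<in> L" if "a - b \<in> L" for a b
    using plus[OF that, of b] L(2)[of a "a - b"] that by auto
  have l0: "l 0 = 0" using add(1)[of 0 0] by simp
  have lneg: "l (- v) = - l v" for v using add(1)[of v "- v"] by (simp add: l0 eq_neg_iff_add_eq_0 add.commute)
  have ld: "l (v - w) = l v - l w" for v w using add(1)[of v "- w"] by (simp add: lneg)
  have f_Suc: "(\<Sum>j<Suc i. (l ^^ j) x) = x + l (\<Sum>j<i. (l ^^ j) x)" for i
  proof (induction i)
    case (Suc i)
    have "(\<Sum>j<Suc (Suc i). (l ^^ j) x) = (\<Sum>j<Suc i. (l ^^ j) x) + l ((l ^^ i) x)" by simp
    also have "(\<Sum>j<Suc i. (l ^^ j) x) = x + l (\<Sum>j<i. (l ^^ j) x)" by (rule Suc)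
    finally have E: "(\<Sum>j<Suc (Suc i). (l ^^ j) x) = x + l (\<Sum>j<i. (l ^^ j) x) + l ((l ^^ i) x)" .
    have "l (\<Sum>j<Suc i. (l ^^ j) x) = l (\<Sum>j<i. (l ^^ j) x) + l ((l ^^ i) x)"
      by (simp only: sum.lessThan_Suc add)
    then show ?case unfolding E by (simp only: add.assoc)
  qed (simp add: l0)
  have fg: "(\<Sum>j<i. (l ^^ j) x) - g i \<in> L" for i
  proof (induction i)
    case (Suc i)
    have "(x + l (\<Sum>j<i. (l ^^ j) x)) - (x + l (g i)) \<in> L" using inv(1)[OF Suc] by (simp add: ld)
    moreover have "(x + l (g i)) - g (Suc i) \<in> L" using neg[OF g(2)[of i]] by simp
    ultimately show ?case unfolding f_Suc by (rule trans)
  qed (use neg[OF g(1)] in simp)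
  have lk: "(l ^^ i) y - k i \<in> L" for i
  proof (induction i)
    case (Suc i)
    have "l ((l ^^ i) y) - l (k i) \<in> L" using inv(1)[OF Suc] by (simp add: ld)
    moreover have "l (k i) - k (Suc i) \<in> L" using neg[OF k(2)[of i]] by simp
    ultimately show ?case by (simp only: funpow.simps o_apply) (rule trans)
  qed (use neg[OF k(1)] in simp)
  have it: "((\<lambda>v. (l ^^ r) v) ^^ i) v - v \<in> L" if "\<And>v. (l ^^ r) v - v \<in> L" for r i v
    by (induction i) (use L(1) trans[OF that] in auto)
  have lm: "(l ^^ m) v - v \<in> L" for v
  proof -
    have *: ?thesis if r: "r dvd m" "\<And>v. (l ^^ r) v - v \<in> L" for r
    proof -
      obtain i where "m = r * i" using r(1) by (rule dvdE)
      then have "l ^^ m = (l ^^ r) ^^ i" by (simp add: funpow_mult)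
      then show ?thesis using it[OF r(2), of i v] by simp
    qed
    show ?thesis
      using l2 *[of 4] *[of 2] *[of 1] l4 by (auto simp: numeral_eq_Suc)
  qed
  show ?thesis
  proof (rule quaternion_premodel.intro)
    show "u y - ((\<Sum>j<m. (l ^^ j) x) - y) \<in> L"
    proof (rule trans[OF uy])
      show "(g m - y) - ((\<Sum>j<m. (l ^^ j) x) - y) \<in> L" using neg[OF fg[of m]] by simp
    qed
    show "(\<Sum>j<i. (l ^^ j) x) \<in> L \<longleftrightarrow> 2 * m dvd i" for i using mem[OF fg[of i]] iff by simp
    show "(\<Sum>j<i. (l ^^ j) x) + (l ^^ i) y \<notin> L" for i
    proof -
      have "((\<Sum>j<i. (l ^^ j) x) + (l ^^ i) y) - (g i + k i) \<in> L"
        using plus[OF fg[of i] lk[of i]] by (simp add: algebra_simps)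
      then show ?thesis using mem refl by blast
    qed
  qed (use L add inv l4 uu ul ux m lm in \<open>simp_all add: algebra_simps\<close>)
qed

text \<open>When \<open>l^2\<close> is the identity modulo \<open>L\<close>, \<open>l^3\<close> may
  be read as \<open>l\<close> in all conditions.\<close>

lemma quaternion_premodelI2:
  fixes L :: "'v::ab_group_add set"
  assumes L: "0 \<in> L" "\<And>v w. v \<in> L \<Longrightarrow> w \<in> L \<Longrightarrow> v - w \<in> L"
    and add: "\<And>v w. l (v + w) = l v + l w" "\<And>v w. u (v + w) = u v + u w"
    and inv: "\<And>v. v \<in> L \<Longrightarrow> l v \<in> L" "\<And>v. v \<in> L \<Longrightarrow> u v \<in> L"
    and l2: "\<And>v. l (l v) - v \<in> L" and uu: "\<And>v. u (u v) - v \<in> L"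
    and m2: "even m \<or> (\<forall>v. l v - v \<in> L)"
    and ul: "\<And>v. u (l v) - l (u v) \<in> L"
    and ux: "u x - (l y - l x - y) \<in> L"
    and uy: "u y - (g m - y) \<in> L"
    and g: "g 0 \<in> L" "\<And>i. g (Suc i) - (x + l (g i)) \<in> L"
    and k: "k 0 - y \<in> L" "\<And>i. k (Suc i) - l (k i) \<in> L"
    and iff: "\<And>i. g i \<in> L \<longleftrightarrow> 2 * m dvd i" and refl: "\<And>i. g i + k i \<notin> L" and m: "m > 0"
  shows "quaternion_premodel L l u x y m"
proof -
  have neg: "- v \<in> L" if "v \<in> L" for v using L(2)[OF L(1) that] by simp
  have trans: "a - c \<in> L" if "a - b \<in> L" "b - c \<in> L" for a b c
    using L(2)[OF that(1) neg[OF that(2)]] by simp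
  have ln: "l (- v) = - l v" for v
    using add(1)[of v "- v"] add(1)[of 0 0] by (simp add: eq_neg_iff_add_eq_0 add.commute)
  have ld: "l (v - w) = l v - l w" for v w using add(1)[of v "- w"] by (simp add: ln)
  have l3: "l v - l (l (l v)) \<in> L" for v using neg[OF l2[of "l v"]] by simp
  show ?thesis
  proof (rule quaternion_premodelI[where g = g and k = k])
    show "l (l (l (l v))) - v \<in> L" for v by (rule trans[OF l2 l2])
    show "u (l v) - l (l (l (u v))) \<in> L" for v by (rule trans[OF ul l3])
    show "4 dvd m \<or> even m \<and> (\<forall>v. l (l v) - v \<in> L) \<or> (\<forall>v. l v - v \<in> L)" using m2 l2 by blast
    show "u x - (l (l (l y)) - l (l (l x)) - y) \<in> L"
      using trans[OF ux, of "l (l (l y)) - l (l (l x)) - y"] l3[of "y - x"] by (simp add: ld algebra_simps)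
  qed (fact L add inv uu uy g k iff refl m)+
qed

context quaternion_model
begin

lemma Phi_surj: "\<exists>a\<in>carrier G. \<Phi> a \<approx> v"
proof -
  interpret G: group G by (rule group_G)
  have c: "cls [Gen qx] \<in> carrier G" "cls [Gen qy] \<in> carrier G" by (simp_all add: carrier_G)
  show ?thesis
  proof (rule surj'[of v])
    fix i assume "v \<approx> f i"
    then have "\<Phi> (cls [Gen qx] [^]\<^bsub>G\<^esub> i) \<approx> v" using Phi_pow cg_sym cg_trans by blast
    then show ?thesis using c G.m_closed G.nat_pow_closed by blast
  next
    fix i assume "v \<approx> f i + (l ^^ i) y"
    then have "\<Phi> (cls [Gen qx] [^]\<^bsub>G\<^esub> i \<otimes>\<^bsub>G\<^esub> cls [Gen qy]) \<approx> v" using Phi_refl cg_sym cg_trans by blast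
    then show ?thesis using c G.m_closed G.nat_pow_closed by blast
  qed
qed

definition \<Psi> where "\<Psi> v = (SOME a. a \<in> carrier G \<and> \<Phi> a \<approx> v)"

lemma Psi: "\<Psi> v \<in> carrier G" "\<Phi> (\<Psi> v) \<approx> v"
  using someI_ex[of "\<lambda>a. a \<in> carrier G \<and> \<Phi> a \<approx> v"] Phi_surj[of v] unfolding \<Psi>_def by blast+

lemma PsiI: "a \<in> carrier G \<Longrightarrow> \<Phi> a \<approx> v \<Longrightarrow> \<Psi> v = a"
  using Phi_inj Psi cg_sym cg_trans by metis

text \<open>The circle operation is that of the presented group, so the multiplicative group is
  right by construction; the addition is carried over from the quotient through
  \<open>\<Phi>\<close> and its inverse \<open>\<Psi>\<close>.\<close>

definition model_brace :: "quaternion_gen letter list set ring" where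
  "model_brace = \<lparr>carrier = carrier G, mult = (\<otimes>\<^bsub>G\<^esub>), one = \<one>\<^bsub>G\<^esub>, zero = \<one>\<^bsub>G\<^esub>,
     add = \<lambda>a b. \<Psi> (\<Phi> a + \<Phi> b)\<rparr>"

lemma model_brace_simps [simp]:
  "carrier model_brace = carrier G" "a \<otimes>\<^bsub>model_brace\<^esub> b = a \<otimes>\<^bsub>G\<^esub> b" "\<one>\<^bsub>model_brace\<^esub> = \<one>\<^bsub>G\<^esub>"
  "\<zero>\<^bsub>model_brace\<^esub> = \<one>\<^bsub>G\<^esub>" "a \<oplus>\<^bsub>model_brace\<^esub> b = \<Psi> (\<Phi> a + \<Phi> b)"
  by (simp_all add: model_brace_def)

lemma abelian_group_model_brace: "abelian_group model_brace"
proof (rule abelian_groupI)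
  interpret G: group G by (rule group_G)
  fix a assume a: "a \<in> carrier model_brace"
  show "\<zero>\<^bsub>model_brace\<^esub> \<oplus>\<^bsub>model_brace\<^esub> a = a"
    using a cg_add[OF Phi_one, of "\<Phi> a" "\<Phi> a"] by (auto intro!: PsiI cg_sym[of _ "\<Phi> a"])
  show "\<exists>b\<in>carrier model_brace. b \<oplus>\<^bsub>model_brace\<^esub> a = \<zero>\<^bsub>model_brace\<^esub>"
  proof (rule bexI[of _ "\<Psi> (- \<Phi> a)"])
    have "\<Phi> (\<Psi> (- \<Phi> a)) + \<Phi> a \<approx> - \<Phi> a + \<Phi> a" by (intro cg_add Psi) simp
    then have "\<Phi> \<one>\<^bsub>G\<^esub> \<approx> \<Phi> (\<Psi> (- \<Phi> a)) + \<Phi> a" using cg_trans[OF Phi_one] cg_sym by simp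
    then show "\<Psi> (- \<Phi> a) \<oplus>\<^bsub>model_brace\<^esub> a = \<zero>\<^bsub>model_brace\<^esub>" by (simp add: PsiI)
  qed (simp add: Psi)
  fix b c
  show "a \<oplus>\<^bsub>model_brace\<^esub> b = b \<oplus>\<^bsub>model_brace\<^esub> a" by (simp add: add.commute)
  show "a \<oplus>\<^bsub>model_brace\<^esub> b \<oplus>\<^bsub>model_brace\<^esub> c = a \<oplus>\<^bsub>model_brace\<^esub> (b \<oplus>\<^bsub>model_brace\<^esub> c)"
  proof -
    have "\<Phi> (\<Psi> (\<Phi> a + \<Phi> (\<Psi> (\<Phi> b + \<Phi> c)))) \<approx> \<Phi> a + \<Phi> (\<Psi> (\<Phi> b + \<Phi> c))" by (rule Psi)
    also have "\<dots> \<approx> \<Phi> a + (\<Phi> b + \<Phi> c)" by (intro cg_add Psi) simp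
    also have "\<dots> = (\<Phi> a + \<Phi> b) + \<Phi> c" by (simp add: add.assoc)
    also have "\<dots> \<approx> \<Phi> (\<Psi> (\<Phi> a + \<Phi> b)) + \<Phi> c" by (intro cg_add cg_sym[OF Psi(2)]) simp
    finally show ?thesis by (simp add: PsiI Psi)
  qed
qed (simp_all add: Psi monoid.one_closed[OF group.is_monoid[OF group_G]])

lemma group_model_brace: "group model_brace"
proof (rule groupI)
  interpret G: group G by (rule group_G)
  fix a assume "a \<in> carrier model_brace"
  then show "\<exists>b\<in>carrier model_brace. b \<otimes>\<^bsub>model_brace\<^esub> a = \<one>\<^bsub>model_brace\<^esub>"
    by (intro bexI[of _ "inv\<^bsub>G\<^esub> a"]) simp_all
qed (use group_G in \<open>simp_all add: group.is_monoid monoid.m_closed monoid.m_assoc\<close>)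

text \<open>The brace law says that left multiplications are affine for the transported
  addition.\<close>

lemma model_brace_brace: "brace model_brace"
proof (intro brace.intro abelian_group_model_brace group_model_brace brace_axioms.intro)
  interpret A: abelian_group model_brace by (rule abelian_group_model_brace)
  interpret G: group G by (rule group_G)
  fix a b c
  assume abc: "a \<in> carrier model_brace" "b \<in> carrier model_brace" "c \<in> carrier model_brace"
  have P: "\<Phi> (p \<oplus>\<^bsub>model_brace\<^esub> q) \<approx> \<Phi> p + \<Phi> q" for p q by (simp add: Psi)
  obtain A where A: "\<forall>c\<in>carrier G. \<Phi> (a \<otimes>\<^bsub>G\<^esub> c) \<approx> A (\<Phi> c)" "\<forall>p q r. A (p + q - r) = A p + A q - A r"
      "\<forall>p q. p \<approx> q \<longrightarrow> A p \<approx> A q" "A 0 \<approx> \<Phi> a"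
    using Phi_mult[of a] abc by auto
  define s where "s = a \<otimes>\<^bsub>model_brace\<^esub> b \<ominus>\<^bsub>model_brace\<^esub> a"
  have s: "s \<in> carrier model_brace" unfolding s_def by (intro A.minus_closed) (use abc in simp_all)
  have "s \<oplus>\<^bsub>model_brace\<^esub> a = a \<otimes>\<^bsub>model_brace\<^esub> b"
    using abc G.m_closed[of a b] unfolding s_def a_minus_def
    by (metis A.a_assoc A.a_inv_closed A.l_neg A.r_zero model_brace_simps(1,2))
  then have "\<Phi> (a \<otimes>\<^bsub>G\<^esub> b) \<approx> \<Phi> s + \<Phi> a" using P[of s a] by simp
  then have s2: "\<Phi> s \<approx> \<Phi> (a \<otimes>\<^bsub>G\<^esub> b) - \<Phi> a"
    using cg_sym[of "\<Phi> (a \<otimes>\<^bsub>G\<^esub> b)"] by (simp add: cg_def algebra_simps)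
  have "\<Phi> (a \<otimes>\<^bsub>G\<^esub> (b \<oplus>\<^bsub>model_brace\<^esub> c)) \<approx> A (\<Phi> (b \<oplus>\<^bsub>model_brace\<^esub> c))"
    using A(1) by (simp add: Psi)
  also have "\<dots> \<approx> A (\<Phi> b + \<Phi> c - 0)" using A(3) P[of b c] by simp
  also have "\<dots> = A (\<Phi> b) + A (\<Phi> c) - A 0" using A(2) by blast
  also have "\<dots> \<approx> \<Phi> (a \<otimes>\<^bsub>G\<^esub> b) + \<Phi> (a \<otimes>\<^bsub>G\<^esub> c) - \<Phi> a"
    using abc by (intro cg_diff cg_add A(4) cg_sym[OF A(1)[rule_format]]) simp_all
  also have "\<dots> = (\<Phi> (a \<otimes>\<^bsub>G\<^esub> b) - \<Phi> a) + \<Phi> (a \<otimes>\<^bsub>G\<^esub> c)" by simp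
  also have "\<dots> \<approx> \<Phi> s + \<Phi> (a \<otimes>\<^bsub>G\<^esub> c)" by (intro cg_add cg_sym[OF s2]) simp
  also have "\<dots> \<approx> \<Phi> (s \<oplus>\<^bsub>model_brace\<^esub> (a \<otimes>\<^bsub>G\<^esub> c))" by (rule cg_sym[OF P])
  finally have "a \<otimes>\<^bsub>G\<^esub> (b \<oplus>\<^bsub>model_brace\<^esub> c) = s \<oplus>\<^bsub>model_brace\<^esub> (a \<otimes>\<^bsub>G\<^esub> c)"
    using abc by (intro Phi_inj) (simp_all add: Psi)
  then show "a \<otimes>\<^bsub>model_brace\<^esub> (b \<oplus>\<^bsub>model_brace\<^esub> c) =
      (a \<otimes>\<^bsub>model_brace\<^esub> b \<ominus>\<^bsub>model_brace\<^esub> a) \<oplus>\<^bsub>model_brace\<^esub> a \<otimes>\<^bsub>model_brace\<^esub> c"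
    unfolding s_def by simp
qed

lemma model_brace_pow: "a [^]\<^bsub>model_brace\<^esub> (i::nat) = a [^]\<^bsub>G\<^esub> i"
  by (induction i) simp_all

lemma model_brace_inv: "a \<in> carrier G \<Longrightarrow> inv\<^bsub>model_brace\<^esub> a = inv\<^bsub>G\<^esub> a"
proof -
  interpret G: group G by (rule group_G)
  assume "a \<in> carrier G"
  then show ?thesis by (intro group.inv_equality[OF group_model_brace]) simp_all
qed

lemma model_brace_cong: "model_brace \<cong> gen_quaternion m"
  by (auto simp: is_iso_def iso_def hom_def simp flip: G_eq intro!: exI[of _ id])

lemma countable_model_brace: "countable (carrier model_brace)"
proof -
  interpret G: group G by (rule group_G)
  have "carrier G \<subseteq> range (\<lambda>i::nat. cls [Gen qx] [^]\<^bsub>G\<^esub> i) \<union>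
      range (\<lambda>i::nat. cls [Gen qx] [^]\<^bsub>G\<^esub> i \<otimes>\<^bsub>G\<^esub> cls [Gen qy])"
    using G_cases by blast
  moreover have "countable (range (\<lambda>i::nat. cls [Gen qx] [^]\<^bsub>G\<^esub> i) \<union>
      range (\<lambda>i::nat. cls [Gen qx] [^]\<^bsub>G\<^esub> i \<otimes>\<^bsub>G\<^esub> cls [Gen qy]))"
    by (intro countable_Un countable_image) auto
  ultimately show ?thesis unfolding model_brace_simps by (rule countable_subset)
qed

theorem model_brace_modelled:
  "modelled_brace L l u x y m model_brace (cls [Gen qx]) (cls [Gen qy]) \<Phi>"
proof (intro modelled_brace.intro quaternion_brace.intro model_brace_brace
    quaternion_brace_axioms.intro modelled_brace_axioms.intro)
  interpret G: group G by (rule group_G)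
  have c: "cls w \<in> carrier G" for w by (simp add: carrier_G)
  show "quaternion_model L l u x y m" by (rule quaternion_model_axioms)
  show "0 < m" by (rule m_gt_0)
  show "cls [Gen qx] \<in> carrier model_brace" "cls [Gen qy] \<in> carrier model_brace" by (simp_all add: c)
  show "carrier model_brace = {cls [Gen qx] [^]\<^bsub>model_brace\<^esub> i |i::nat. True} \<union>
      {cls [Gen qx] [^]\<^bsub>model_brace\<^esub> i \<otimes>\<^bsub>model_brace\<^esub> cls [Gen qy] |i::nat. True}"
    unfolding model_brace_pow model_brace_simps using G_cases c by auto
  show "cls [Gen qx] [^]\<^bsub>model_brace\<^esub> i = \<one>\<^bsub>model_brace\<^esub> \<longleftrightarrow> 2 * m dvd i" for i :: nat
    by (simp only: model_brace_pow model_brace_simps G_pow_eq_1)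
  show "cls [Gen qy] \<otimes>\<^bsub>model_brace\<^esub> cls [Gen qx] =
      inv\<^bsub>model_brace\<^esub> cls [Gen qx] \<otimes>\<^bsub>model_brace\<^esub> cls [Gen qy]"
    by (simp only: model_brace_simps model_brace_inv c G_rel)
  show "cls [Gen qy] \<otimes>\<^bsub>model_brace\<^esub> cls [Gen qy] = cls [Gen qx] [^]\<^bsub>model_brace\<^esub> m"
    by (simp only: model_brace_simps model_brace_pow G_rel)
  show "cls [Gen qy] \<noteq> cls [Gen qx] [^]\<^bsub>model_brace\<^esub> i" for i :: nat
    using cls_y_neq[of 0 i] c unfolding model_brace_pow by simp
  fix a assume a: "a \<in> carrier model_brace"
  then show "cg (\<Phi> (cls [Gen qx] \<otimes>\<^bsub>model_brace\<^esub> a)) (x + l (\<Phi> a))"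
    "cg (\<Phi> (cls [Gen qy] \<otimes>\<^bsub>model_brace\<^esub> a)) (y + u (\<Phi> a))"
    by (simp_all add: Phi_gen)
  show "a = \<one>\<^bsub>model_brace\<^esub>" if "cg (\<Phi> a) 0" using a that Phi_ker by simp
  show "cg (\<Phi> (a \<oplus>\<^bsub>model_brace\<^esub> b)) (\<Phi> a + \<Phi> b)" for b by (simp add: Psi)
next
  show "\<exists>a\<in>carrier model_brace. cg (\<Phi> a) v" for v using Phi_surj by simp
qed

end

section \<open>The models\<close>

type_synonym vec = "int \<times> int \<times> int \<times> int"

text \<open>The types follow the value of \<open>l x - x\<close>. It is \<open>0\<close> in
  \<open>M1\<close> and \<open>M2\<close>, where \<open>2 y\<close> is \<open>0\<close> or
  \<open>x\<close>, and \<open>t\<close> in \<open>M3\<close>. In \<open>MB\<close> it is a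
  reflection, taken as \<open>y\<close>. In \<open>MA\<close> and \<open>MA'\<close> it is a
  rotation with exponent \<open>2\<close> modulo \<open>4\<close>, for \<open>m / 2\<close> odd and
  even respectively.\<close>

datatype brace_type = M1 bool | M2 | M3 bool | MB bool | MA bool | MA' bool

definition types :: "nat \<Rightarrow> brace_type set" where
  "types m = (if odd m then {M1 False, M2}
    else {M1 False, M1 True, M2, MB True} \<union>
      (if m mod 4 = 2 then {MA False, MA True} else {M3 False, M3 True, MB False}) \<union>
      (if m mod 8 = 4 then {MA' False, MA' True} else {}))"

lemma card_types: "card (types m) = (if odd m then 2 else if m mod 4 = 2 then 6 else if m mod 8 = 4 then 9 else 7)"
proof -
  have "m mod 8 \<noteq> 4" if "m mod 4 = 2"
    using that by presburger
  then show ?thesis by (simp add: types_def)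
qed

text \<open>In type \<open>MA'\<close>, \<open>2 x = - a c\<close> where \<open>a\<close> solves \<open>2 a + 1 = m/4\<close> modulo \<open>m/2\<close>; there are two
  solutions.\<close>

definition MA'_coeff :: "nat \<Rightarrow> bool \<Rightarrow> int" where
  "MA'_coeff m e = (int m div 4 - 1) div 2 + of_bool e * (int m div 4)"

text \<open>A vector \<open>(a, b, c, d)\<close> stands for \<open>a x + b y + c e3 + d e4\<close>
  and \<open>mL\<close> lists the relations. In \<open>MA\<close> the vector \<open>e3\<close> is
  \<open>x + l x\<close>; in \<open>MA'\<close> it is \<open>x^4\<close>, and \<open>e4\<close> is
  \<open>l x - x\<close>. The other coordinates are unconstrained and disappear in the
  quotient.\<close>

fun mL :: "nat \<Rightarrow> brace_type \<Rightarrow> vec set" where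
  "mL m (M1 e) = {(a, b, c, d). 2 * int m dvd a \<and> even b}"
| "mL m M2 = {(a, b, c, d). 4 * int m dvd 2 * a + b}"
| "mL m (M3 e) = {(a, b, c, d). 2 * int m dvd a \<and> even b}"
| "mL m (MB e) = {(a, b, c, d). \<exists>i j. a = int m * i \<and> b = (int m div 2 - 2) * i + 4 * j}"
| "mL m (MA e) = {(a, b, c, d). \<exists>i j k. a = 2 * i \<and> b = 2 * j \<and>
    c + (1 + int m div 2) * i + of_bool e * (int m div 2) * j = int m * k}"
| "mL m (MA' e) = {(a, b, c, d). \<exists>i k. a = 2 * i \<and> even b \<and> even d \<and> c - MA'_coeff m e * i = int m div 2 * k}"

fun ml :: "nat \<Rightarrow> brace_type \<Rightarrow> vec \<Rightarrow> vec" where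
  "ml m (M1 e) (a, b, c, d) = (a + of_bool e * int m * b, b, c, d)"
| "ml m M2 v = v"
| "ml m (M3 e) (a, b, c, d) = (a + int m * a + of_bool e * int m * b, b, c, d)"
| "ml m (MB e) (a, b, c, d) = (a, a + (1 + 2 * of_bool e) * b, c, d)"
| "ml m (MA e) (a, b, c, d) = (- a, b, c + a, d)"
| "ml m (MA' e) (a, b, c, d) = (a, b + d, c + int m div 4 * b, d + a)"

fun mu :: "nat \<Rightarrow> brace_type \<Rightarrow> vec \<Rightarrow> vec" where
  "mu m (M1 e) (a, b, c, d) = ((of_bool e * int m - 1) * a + int m * b, - b, c, d)"
| "mu m M2 (a, b, c, d) = (int m * b - a, - b, c, d)"
| "mu m (M3 e) (a, b, c, d) = ((int m + of_bool e * int m - 1) * a + int m * b, - b, c, d)"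
| "mu m (MB e) (a, b, c, d) = (- a, a + b, c, d)"
| "mu m (MA e) (a, b, c, d) = (a, - b, int m div 2 * b - a - c, d)"
| "mu m (MA' e) (a, b, c, d) = (- a, b + a, int m div 4 * b + int m div 4 * d - c, d + a)"

abbreviation "mx \<equiv> (1, 0, 0, 0) :: vec"
abbreviation "my \<equiv> (0, 1, 0, 0) :: vec"

abbreviation "model m T \<equiv> quaternion_model (mL m T) (ml m T) (mu m T) mx my m"

lemma vec_simps [simp]:
  "(a, b, c, d) + (a', b', c', d') = (a + a', b + b', c + c', d + d' :: int)"
  "(a, b, c, d) - (a', b', c', d') = (a - a', b - b', c - c', d - d' :: int)"
  "- (a, b, c, d) = (- a, - b, - c, - d :: int)" "(0 :: vec) = (0, 0, 0, 0)" "(0 :: int \<times> int \<times> int) = (0, 0, 0)" "(0 :: int \<times> int) = (0, 0)"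
  by (simp_all add: zero_prod_def)

lemma exI2: "P a b \<Longrightarrow> \<exists>a b. P a b" and exI3: "Q a b c \<Longrightarrow> \<exists>a b c. Q a b c"
  by blast+

lemma int_dvd_2_iff: "2 * int m dvd int i \<longleftrightarrow> 2 * m dvd i"
  using int_dvd_int_iff[of "2 * m" i] by simp

text \<open>Triangular numbers, as they appear in the closed forms of the powers of \<open>x\<close>.\<close>

definition tri :: "nat \<Rightarrow> int" where "tri i = (\<Sum>j<i. int j)"

lemma tri_simps [simp]: "tri 0 = 0" "tri (Suc i) = tri i + int i"
  by (simp_all add: tri_def)

lemma two_tri: "2 * tri i = int i * (int i - 1)"
  by (induction i) (simp_all add: algebra_simps)

lemma even_tri: "4 dvd i \<Longrightarrow> even (tri i)"
proof -
  assume "4 dvd i"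
  then obtain k where "i = 4 * k" by (rule dvdE)
  then have "tri i = 2 * (int k * (int i - 1))" using two_tri[of i] by simp
  then show ?thesis by simp
qed

text \<open>Types \<open>M1\<close> (\<open>s = 0\<close>) and \<open>M3\<close> (\<open>s = 1\<close>) are treated together.\<close>

lemma model_M:
  fixes s e :: int
  assumes m: "m > 0" and s: "s = 0 \<or> s = 1 \<and> 4 dvd m" and e: "e = 0 \<or> e = 1 \<and> even m"
    and l: "\<And>a b c d. l (a, b, c, d) = (a + s * int m * a + e * int m * b, b, c, d)"
    and u: "\<And>a b c d. u (a, b, c, d) = ((s * int m + e * int m - 1) * a + int m * b, - b, c, d)"
  shows "quaternion_model {(a, b, c, d). 2 * int m dvd a \<and> even b} l u mx my m"
proof -
  let ?L = "{(a, b, c, d). 2 * int m dvd a \<and> even (b::int)} :: vec set"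
  define n where "n = int m"
  define p q where "p = s * n" and "q = e * n"
  have l': "l (a, b, c, d) = (a + p * a + q * b, b, c, d)" for a b c d using l by (simp add: p_def q_def n_def)
  have u': "u (a, b, c, d) = ((p + q - 1) * a + n * b, - b, c, d)" for a b c d using u by (simp add: p_def q_def n_def)
  \<comment> \<open>Nonzero \<open>s\<close> or \<open>e\<close> makes \<open>n\<close> even, and
    then \<open>n^2\<close> is a multiple of \<open>2 n\<close>.\<close>
  have n2: "even n \<or> s = 0 \<and> e = 0" using s e by (auto simp: n_def)
  have nn: "2 * n dvd n * n * z" if nz: "\<not> (s = 0 \<and> e = 0)" for z
  proof -
    obtain r where "n = 2 * r" using n2 nz by (auto elim: evenE)
    then have "n * n * z = (2 * n) * (r * z)" by simp
    then show ?thesis by (simp only: dvd_triv_left)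
  qed
  have pq: "p * p = n * n * (s * s)" "p * q = n * n * (s * e)" "q * q = n * n * (e * e)" "p * n = n * n * s" "q * n = n * n * e"
    by (simp_all add: p_def q_def mult_ac)
  have D: "2 * n dvd 2 * p" "2 * n dvd 2 * q" "2 * n dvd p * p" "2 * n dvd p * q" "2 * n dvd q * q"
    "2 * n dvd p * n" "2 * n dvd q * n"
  proof -
    show "2 * n dvd 2 * p" "2 * n dvd 2 * q" by (simp_all add: p_def q_def)
    show "2 * n dvd p * p" "2 * n dvd p * q" "2 * n dvd q * q" "2 * n dvd p * n" "2 * n dvd q * n"
      unfolding pq by (cases "s = 0 \<and> e = 0", simp, rule nn, assumption)+
  qed
  \<comment> \<open>The multiples of \<open>2 n\<close> that occur below are combinations of these
    eight; \<open>C'\<close> verifies one from its coefficients.\<close>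
  have C: "2 * n dvd c1 * (2 * p) + c2 * (2 * q) + c3 * (p * p) + c4 * (p * q) + c5 * (q * q)
      + c6 * (p * n) + c7 * (q * n) + c8 * (2 * n)" for c1 c2 c3 c4 c5 c6 c7 c8
    by (intro dvd_add dvd_mult[OF D(1)] dvd_mult[OF D(2)] dvd_mult[OF D(3)] dvd_mult[OF D(4)]
        dvd_mult[OF D(5)] dvd_mult[OF D(6)] dvd_mult[OF D(7)] dvd_triv_right)
  have C': "2 * n dvd E" if "E = c1 * (2 * p) + c2 * (2 * q) + c3 * (p * p) + c4 * (p * q) + c5 * (q * q)
      + c6 * (p * n) + c7 * (q * n) + c8 * (2 * n)" for E c1 c2 c3 c4 c5 c6 c7 c8
    using C that by simp
  have pi: "2 * n dvd p * tri i" if i4: "4 dvd i" for i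
  proof -
    obtain r where r: "tri i = 2 * r" using even_tri[OF i4] by (auto elim: evenE)
    have "p * tri i = (2 * p) * r" unfolding r by (simp only: mult_ac)
    then show ?thesis using dvd_mult2[OF D(1), of r] by (simp only:)
  qed
  have tri_p: "2 * n dvd p * tri m"
    using s pi[of m] by (auto simp: p_def)
  have i2: "2 * n dvd int i \<longleftrightarrow> 2 * m dvd i" for i unfolding n_def by (rule int_dvd_2_iff)
  have iff: "2 * n dvd int i + p * tri i \<longleftrightarrow> 2 * m dvd i" for i
  proof (cases "s = 0")
    case True
    then show ?thesis using i2 by (simp add: p_def)
  next
    case False
    then have s1: "s = 1" and m4: "4 dvd m" using s by auto
    show ?thesis
    proof (cases "4 dvd i")
      case True
      then show ?thesis using pi[OF True] i2[of i] by (simp add: dvd_add_left_iff)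
    next
      case False
      have "\<not> 2 * m dvd i" using False m4 dvd_trans dvd_mult_right[of 2 m i] by blast
      moreover have "\<not> 2 * n dvd int i + p * tri i"
      proof
        assume "2 * n dvd int i + p * tri i"
        then have "n dvd int i + p * tri i" by (rule dvd_mult_right)
        then have "n dvd int i" by (simp add: p_def s1 dvd_add_left_iff)
        then have "m dvd i" by (simp add: n_def)
        then have "4 dvd i" by (rule dvd_trans[OF m4])
        then show False using False by simp
      qed
      ultimately show ?thesis by simp
    qed
  qed
  have Lm: "(a, b, c, d) \<in> ?L \<longleftrightarrow> 2 * n dvd a \<and> even b" for a b c d by (simp add: n_def)
  have PM: "quaternion_premodel ?L l u mx my m"
  \<comment> \<open>Since \<open>p^2\<close> vanishes modulo \<open>2 n\<close>,
    \<open>l^j x = (1 + j p) x\<close>, and summation gives the triangular number; likewise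
    \<open>l^i y = y + i q x\<close>.\<close>
  proof (rule quaternion_premodelI2[where g = "\<lambda>i. (int i + p * tri i, 0, 0, 0)" and k = "\<lambda>i. (q * int i, 1, 0, 0)"])
    fix v w :: vec
    obtain a b c d a' b' c' d' where v: "v = (a, b, c, d)" and w: "w = (a', b', c', d')"
      by (cases v, cases w)
    show "l (v + w) = l v + l w" "u (v + w) = u v + u w"
      by (simp_all add: v w l' u' algebra_simps)
    show "v - w \<in> ?L" if "v \<in> ?L" "w \<in> ?L" using that by (auto simp: v w)
    show "l v \<in> ?L" "u v \<in> ?L" if vL: "v \<in> ?L"
    proof -
      obtain a2 b2 where ab: "a = 2 * n * a2" "b = 2 * b2" using vL unfolding v Lm by (auto elim!: dvdE evenE)
      show "l v \<in> ?L" unfolding v l' Lm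
        by (rule conjI, rule C'[of _ 0 b2 0 0 0 "2 * a2" 0 a2]) (simp_all add: ab algebra_simps)
      show "u v \<in> ?L" unfolding v u' Lm
        by (rule conjI, rule C'[of _ 0 0 0 0 0 "2 * a2" "2 * a2" "b2 - a2"]) (simp_all add: ab algebra_simps)
    qed
    show "l (l v) - v \<in> ?L"
      unfolding v l' u' vec_simps Lm
        by (rule conjI, rule C'[of _ a b a b 0 0 0 0]) (simp_all add: algebra_simps)
    show "u (u v) - v \<in> ?L"
      unfolding v l' u' vec_simps Lm
        by (rule conjI, rule C'[of _ "- a" "- a" a "2 * a" a b b "- b"]) (simp_all add: algebra_simps)
    show "u (l v) - l (u v) \<in> ?L"
      unfolding v l' u' vec_simps Lm
        by (rule conjI, rule C'[of _ 0 0 0 b b "- b" 0 0]) (simp_all add: algebra_simps)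
  next
    fix i
    show "(int (Suc i) + p * tri (Suc i), 0, 0, 0) - (mx + l (int i + p * tri i, 0, 0, 0)) \<in> ?L"
      unfolding l' u' vec_simps Lm
        by (rule conjI, rule C'[of _ 0 0 "- tri i" 0 0 0 0 0]) (simp_all add: algebra_simps)
    show "(q * int (Suc i), 1, 0, 0) - l (q * int i, 1, 0, 0) \<in> ?L"
      unfolding l' u' vec_simps Lm
        by (rule conjI, rule C'[of _ 0 0 0 "- int i" 0 0 0 0]) (simp_all add: algebra_simps)
    show "(int i + p * tri i, 0, 0, 0) \<in> ?L \<longleftrightarrow> 2 * m dvd i" using iff[of i] by (simp add: n_def)
    show "(int i + p * tri i, 0, 0, 0) + (q * int i, 1, 0, 0) \<notin> ?L" by simp
  next
    show "u mx - (l my - l mx - my) \<in> ?L"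
      unfolding l' u' vec_simps Lm
        by (rule conjI, rule C'[of _ 1 0 0 0 0 0 0 0]) (simp_all add: algebra_simps)
    show "u my - ((int m + p * tri m, 0, 0, 0) - my) \<in> ?L"
      using tri_p by (simp add: u' n_def)
    show "even m \<or> (\<forall>v. l v - v \<in> ?L)"
      using s e by (auto simp: l' p_def q_def)
  qed (use m in simp_all)
  show ?thesis
  proof (rule quaternion_premodel.quaternion_modelI[OF PM])
    let ?R = "{0..<2 * int m} \<times> {0..<2::int} \<times> {0::int} \<times> {0::int}"
    show "finite ?R" "card ?R \<le> 4 * m" by (simp_all add: nat_mult_distrib)
    fix v :: vec
    obtain a b c d where v: "v = (a, b, c, d)" by (cases v)
    show "\<exists>r\<in>?R. v - r \<in> ?L"
      by (rule bexI[of _ "(a mod (2 * int m), b mod 2, 0, 0)"]) (use m in \<open>simp_all add: v\<close>)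
  qed
qed

text \<open>\<open>2 a + b\<close> identifies the quotient with the cyclic group of order
  \<open>4 m\<close>, with \<open>y \<mapsto> 1\<close> and \<open>x \<mapsto> 2\<close>.\<close>

lemma model_M2:
  assumes m: "m > 0"
  shows "model m M2"
proof -
  let ?L = "mL m M2"
  have PM: "quaternion_premodel ?L (ml m M2) (mu m M2) mx my m"
  proof (rule quaternion_premodelI2[where g = "\<lambda>i. (int i, 0, 0, 0)" and k = "\<lambda>i. my"])
    fix v w :: vec
    obtain a b c d a' b' c' d' where v: "v = (a, b, c, d)" and w: "w = (a', b', c', d')"
      by (cases v, cases w)
    show "ml m M2 (v + w) = ml m M2 v + ml m M2 w" "mu m M2 (v + w) = mu m M2 v + mu m M2 w"
      by (simp_all add: v w algebra_simps)
    show "v - w \<in> ?L" if "v \<in> ?L" "w \<in> ?L"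
      using dvd_diff[of "4 * int m" "2 * a + b" "2 * a' + b'"] that by (simp add: v w algebra_simps)
    show "ml m M2 v \<in> ?L" if "v \<in> ?L" using that by simp
    show "mu m M2 v \<in> ?L" if vL: "v \<in> ?L"
    proof -
      obtain r where r: "2 * a + b = 4 * int m * r" using vL by (auto simp: v elim: dvdE)
      then have b: "b = 2 * (2 * int m * r - a)" by simp
      have "2 * (int m * b - a) - b = 4 * int m * (2 * int m * r - a - r)"
        unfolding b by (simp add: algebra_simps)
      then show ?thesis by (simp add: v)
    qed
    show "ml m M2 (ml m M2 v) - v \<in> ?L" "mu m M2 (ml m M2 v) - ml m M2 (mu m M2 v) \<in> ?L" by (simp_all add: v)
    have "2 * (int m * (- b) - (int m * b - a) - a) + 0 = 4 * int m * (- b)" by (simp add: algebra_simps)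
    then show "mu m M2 (mu m M2 v) - v \<in> ?L"
      unfolding v mu.simps vec_simps mL.simps by (simp only: mem_Collect_eq case_prod_conv dvd_triv_left) simp
  next
    fix i
    have "4 * int m dvd 2 * int i \<longleftrightarrow> 2 * int m dvd int i"
      using dvd_mult_cancel_left[of 2 "2 * int m" "int i"] by simp
    then show "(int i, 0, 0, 0) \<in> ?L \<longleftrightarrow> 2 * m dvd i" using int_dvd_2_iff[of m i] by simp
    have "4 * int m = 2 * (2 * int m)" by simp
    then have "\<not> 4 * int m dvd 2 * int i + 1" using dvd_mult_left[of 2 "2 * int m" "2 * int i + 1"] by auto
    then show "(int i, 0, 0, 0) + my \<notin> ?L" by simp
  qed (use m in simp_all)
  show ?thesis
  proof (rule quaternion_premodel.quaternion_modelI[OF PM])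
    let ?R = "{0..<2 * int m} \<times> {0..<2::int} \<times> {0::int} \<times> {0::int}"
    show "finite ?R" "card ?R \<le> 4 * m" by (simp_all add: nat_mult_distrib)
    fix v :: vec
    obtain a b c d where v: "v = (a, b, c, d)" by (cases v)
    let ?a = "a + b div 2"
    have "2 * (a - ?a mod (2 * int m)) + (b - b mod 2) = 2 * (?a - ?a mod (2 * int m))"
      using minus_mod_eq_mult_div[of b 2] by simp
    also have "\<dots> = 4 * int m * (?a div (2 * int m))"
      using minus_mod_eq_mult_div[of ?a "2 * int m"] by simp
    finally have "4 * int m dvd 2 * (a - ?a mod (2 * int m)) + (b - b mod 2)" by simp
    then show "\<exists>r\<in>?R. v - r \<in> ?L"
      by (intro bexI[of _ "(?a mod (2 * int m), b mod 2, 0, 0)"]) (use m in \<open>simp_all add: v\<close>)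
  qed
qed

text \<open>The relation \<open>m x + (m / 2 - 2) y = 0\<close> encodes \<open>x^m = 2 y\<close>:
  \<open>u\<close> fixes \<open>y\<close>, so the square of \<open>y\<close> is
  \<open>2 y\<close>.\<close>

lemma model_MB:
  assumes m: "m > 0" "even m" "e \<or> 4 dvd m"
  shows "model m (MB e)"
proof -
  let ?L = "mL m (MB e)"
  define M where "M = int m div 2"
  have mM: "int m = 2 * M" using m by (simp add: M_def)
  have L: "(a, b, c, d) \<in> ?L \<longleftrightarrow> (\<exists>i j. a = 2 * M * i \<and> b = (M - 2) * i + 4 * j)" for a b c d
    by (simp add: mM)
  have L4: "(0, 4 * j, c, d) \<in> ?L" for j c d unfolding L by (auto intro: exI[of _ 0])
  \<comment> \<open>With \<open>l y = 3 y\<close> and \<open>4 y = 0\<close> the summands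
    \<open>l^j x\<close> alternate between \<open>x\<close> and \<open>x + y\<close>; with
    \<open>l y = y\<close> they are \<open>x + j y\<close>, which sum to a triangular
    number.\<close>
  define g where "g i = (int i, (if e then int (i div 2) else tri i), 0::int, 0::int)" for i
  define k where "k i = (0::int, (if e \<and> odd i then 3 else 1 :: int), 0::int, 0::int)" for i :: nat
  have N: "\<not> e \<Longrightarrow> \<exists>N. M = 2 * N" using m by (auto simp: M_def elim!: dvdE)
  have tri_eq: "tri i = M * p * (2 * M * p - 1)" if "int i = 2 * M * p" for i p
    using two_tri[of i] by (simp add: that algebra_simps)
  have PM: "quaternion_premodel ?L (ml m (MB e)) (mu m (MB e)) mx my m"
  proof (rule quaternion_premodelI[where g = g and k = k])
    fix v w :: vec
    obtain a b c d a' b' c' d' where v: "v = (a, b, c, d)" and w: "w = (a', b', c', d')"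
      by (cases v, cases w)
    show "ml m (MB e) (v + w) = ml m (MB e) v + ml m (MB e) w" "mu m (MB e) (v + w) = mu m (MB e) v + mu m (MB e) w"
      by (simp_all add: v w algebra_simps)
    show "v - w \<in> ?L" if vw: "v \<in> ?L" "w \<in> ?L"
    proof -
      obtain i j i' j' where "a = 2 * M * i" "b = (M - 2) * i + 4 * j" "a' = 2 * M * i'" "b' = (M - 2) * i' + 4 * j'"
        using vw unfolding v w L by blast
      then show ?thesis unfolding v w vec_simps L
        by (intro exI2[of _ "i - i'" "j - j'"]) (simp add: algebra_simps)
    qed
    show "ml m (MB e) v \<in> ?L" if vL: "v \<in> ?L"
    proof -
      obtain i j where ij: "a = 2 * M * i" "b = (M - 2) * i + 4 * j" using vL unfolding v L by blast
      show ?thesis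
      proof (cases e)
        case True
        then show ?thesis unfolding v ml.simps L
          by (intro exI2[of _ i "M * i - i + 3 * j"]) (simp add: ij algebra_simps)
      next
        case False
        then obtain N where "M = 2 * N" using N by blast
        then show ?thesis unfolding v ml.simps L using False
          by (intro exI2[of _ i "N * i + j"]) (simp add: ij algebra_simps)
      qed
    qed
    show "mu m (MB e) v \<in> ?L" if vL: "v \<in> ?L"
    proof -
      obtain i j where ij: "a = 2 * M * i" "b = (M - 2) * i + 4 * j" using vL unfolding v L by blast
      show ?thesis unfolding v mu.simps L
        by (intro exI2[of _ "- i" "M * i - i + j"]) (simp add: ij algebra_simps)
    qed
    show "ml m (MB e) (ml m (MB e) (ml m (MB e) (ml m (MB e) v))) - v \<in> ?L"
      using L4[of a 0 0] L4[of "10 * a + 20 * b" 0 0] by (cases e) (simp_all add: v L algebra_simps)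
    show "mu m (MB e) (mu m (MB e) v) - v \<in> ?L" using L4[of 0 0 0] by (simp add: v)
    show "mu m (MB e) (ml m (MB e) v) - ml m (MB e) (ml m (MB e) (ml m (MB e) (mu m (MB e) v))) \<in> ?L"
      using L4[of a 0 0] L4[of "- 3 * a - 6 * b" 0 0] by (cases e) (simp_all add: v L algebra_simps)
  next
    show "(0::vec) \<in> ?L" using L4[of 0 0 0] by simp
    show "4 dvd m \<or> even m \<and> (\<forall>v. ml m (MB e) (ml m (MB e) v) - v \<in> ?L) \<or> (\<forall>v. ml m (MB e) v - v \<in> ?L)"
    proof (cases e)
      case True
      have "ml m (MB e) (ml m (MB e) v) - v \<in> ?L" for v :: vec
        using L4[of "fst v + 2 * fst (snd v)" 0 0] True by (cases v) (simp add: L algebra_simps)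
      then show ?thesis using m by simp
    qed (use m in simp)
    show "mu m (MB e) mx - (ml m (MB e) (ml m (MB e) (ml m (MB e) my)) - ml m (MB e) (ml m (MB e) (ml m (MB e) mx)) - my) \<in> ?L"
      using L4[of 1 0 0] L4[of "-3" 0 0] by (cases e) (simp_all add: L)
    show "mu m (MB e) my - (g m - my) \<in> ?L"
    proof (cases e)
      case True
      have "int (m div 2) = M" by (simp add: M_def zdiv_int)
      then show ?thesis unfolding g_def mu.simps vec_simps L if_True using True
        by (intro exI2[of _ "-1" 0], simp add: mM)
    next
      case False
      then obtain N where N: "M = 2 * N" using N by blast
      have "tri m = 4 * (2 * N * N) - 2 * N" using tri_eq[of m 1] by (simp add: mM N algebra_simps)
      then show ?thesis unfolding g_def mu.simps vec_simps L if_False using False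
        by (intro exI2[of _ "-1" "N - 2 * N * N"], simp add: mM N)
    qed
    show "g 0 \<in> ?L" "k 0 - my \<in> ?L" using L4[of 0 0 0] by (simp_all add: g_def k_def)
    fix i
    show "g (Suc i) - (mx + ml m (MB e) (g i)) \<in> ?L"
    proof (cases e)
      case True
      then have e: "g (Suc i) - (mx + ml m (MB e) (g i)) = (0, 4 * (- int (i div 2)), 0, 0)"
        unfolding g_def by (cases "even i") (auto elim!: evenE oddE)
      show ?thesis unfolding e by (rule L4)
    qed (use L4[of 0 0 0] in \<open>simp add: g_def\<close>)
    show "k (Suc i) - ml m (MB e) (k i) \<in> ?L"
      using L4[of 0 0 0] L4[of "-2" 0 0] by (auto simp: k_def L)
    have parity: "odd (r + 2 * p) \<Longrightarrow> r + 2 * p \<noteq> 4 * (j::int)" for r p j by presburger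
    show "g i \<in> ?L \<longleftrightarrow> 2 * m dvd i"
    proof
      assume "g i \<in> ?L"
      then obtain p j where p: "int i = 2 * M * p" "(if e then int (i div 2) else tri i) = (M - 2) * p + 4 * j"
        unfolding g_def L by blast
      have "even p"
      proof (cases e)
        case True
        have "int (i div 2) = M * p" using p(1) by (simp add: zdiv_int)
        then have "2 * p = 4 * j" using p(2) True by (simp add: algebra_simps)
        then show ?thesis by presburger
      next
        case False
        then obtain N where N: "M = 2 * N" using N by blast
        have "2 * N * p * (4 * N * p - 1) = (2 * N - 2) * p + 4 * j"
          using p(2) tri_eq[OF p(1)] False by (simp add: N)
        then have "p = 2 * (j - 2 * (N * p) * (N * p) + N * p)" by (simp add: algebra_simps)
        then show ?thesis by (metis dvd_triv_left)
      qed
      then obtain r where "p = 2 * r" by (rule evenE)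
      then have "int i = 2 * int m * r" using p(1) by (simp add: mM)
      then have "2 * int m dvd int i" by simp
      then show "2 * m dvd i" by (simp only: int_dvd_2_iff)
    next
      assume "2 * m dvd i"
      then obtain r where "i = 2 * m * r" by (rule dvdE)
      then have i: "int i = 2 * M * (2 * int r)" using mM by simp
      show "g i \<in> ?L"
      proof (cases e)
        case True
        have "int (i div 2) = M * (2 * int r)" using i by (simp add: zdiv_int)
        then show ?thesis unfolding g_def L using True i
          by (intro exI2[of _ "2 * int r" "int r"]) (simp add: algebra_simps)
      next
        case False
        then obtain N where N: "M = 2 * N" using N by blast
        show ?thesis unfolding g_def L using False i tri_eq[OF i]
          by (intro exI2[of _ "2 * int r" "8 * N * N * int r * int r - 2 * N * int r + int r"])
             (simp add: N algebra_simps)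
      qed
    qed
    show "g i + k i \<notin> ?L"
    proof
      assume "g i + k i \<in> ?L"
      then obtain p j where p: "int i = 2 * M * p"
          "(if e then int (i div 2) else tri i) + (if e \<and> odd i then 3 else 1) = (M - 2) * p + 4 * j"
        unfolding g_def k_def vec_simps L by auto
      show False
      proof (cases e)
        case True
        have "int (i div 2) = M * p" using p(1) by (simp add: zdiv_int)
        then have "(if odd i then 3 else 1) + 2 * p = 4 * j" using p(2) True by (simp add: algebra_simps)
        then have "3 + 2 * p = 4 * j \<or> 1 + 2 * p = 4 * j" by (simp split: if_splits)
        then show False by presburger
      next
        case False
        then obtain N where N: "M = 2 * N" using N by blast
        have "2 * N * p * (4 * N * p - 1) + 1 = (2 * N - 2) * p + 4 * j"
          using p(2) tri_eq[OF p(1)] False by (simp add: N)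
        then have "2 * p + 1 = 4 * (j - 2 * (N * p) * (N * p) + N * p)" by (simp add: algebra_simps)
        moreover have "2 * p + 1 \<noteq> 4 * z" for z :: int by presburger
        ultimately show False by blast
      qed
    qed
  qed (rule m(1))
  show ?thesis
  proof (rule quaternion_premodel.quaternion_modelI[OF PM])
    let ?R = "{0..<int m} \<times> {0..<4::int} \<times> {0::int} \<times> {0::int}"
    show "finite ?R" "card ?R \<le> 4 * m" by simp_all
    fix v :: vec
    obtain a b c d where v: "v = (a, b, c, d)" by (cases v)
    let ?q = "a div int m" let ?b = "b - (M - 2) * (a div int m)"
    have "v - (a mod int m, ?b mod 4, 0, 0) \<in> ?L" unfolding v vec_simps L
      by (intro exI2[of _ ?q "?b div 4"])
         (use minus_mod_eq_mult_div[of a "int m"] minus_mod_eq_mult_div[of ?b 4] in \<open>simp add: mM algebra_simps\<close>)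
    then show "\<exists>r\<in>?R. v - r \<in> ?L"
      by (rule bexI) (use m in simp_all)
  qed
qed

lemma model_MA:
  assumes m: "m > 0" "even m"
  shows "model m (MA e)"
proof -
  let ?L = "mL m (MA e)"
  define M s where "M = int m div 2" and "s = of_bool e * M"
  have mM: "int m = 2 * M" using m by (simp add: M_def)
  have L: "(a, b, c, d) \<in> ?L \<longleftrightarrow> (\<exists>i j k. a = 2 * i \<and> b = 2 * j \<and> c + (1 + M) * i + s * j = 2 * M * k)" for a b c d
    by (simp add: mM s_def)
  have L0: "(0, 0, 2 * M * k, d) \<in> ?L" for k d unfolding L by (intro exI3[of _ 0 0 k]) simp
  have u: "mu m (MA e) (a, b, c, d) = (a, - b, M * b - a - c, d)" for a b c d by (simp add: M_def)
  \<comment> \<open>\<open>l\<close> fixes \<open>p = x + l x\<close>, so \<open>x^(2 r)\<close> is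
    \<open>r p\<close> and \<open>x^(2 r + 1)\<close> is \<open>x + r p\<close>.\<close>
  define g where "g i = (if even i then (0, 0, int (i div 2), 0) else (1::int, 0::int, int (i div 2), 0::int))" for i :: nat
  have PM: "quaternion_premodel ?L (ml m (MA e)) (mu m (MA e)) mx my m"
  proof (rule quaternion_premodelI2[where g = g and k = "\<lambda>i. my"])
    fix v w :: vec
    obtain a b c d a' b' c' d' where v: "v = (a, b, c, d)" and w: "w = (a', b', c', d')"
      by (cases v, cases w)
    show "ml m (MA e) (v + w) = ml m (MA e) v + ml m (MA e) w" "mu m (MA e) (v + w) = mu m (MA e) v + mu m (MA e) w"
      by (simp_all add: v w algebra_simps)
    show "v - w \<in> ?L" if vw: "v \<in> ?L" "w \<in> ?L"
    proof -
      obtain i j k i' j' k' where "a = 2 * i" "b = 2 * j" "c + (1 + M) * i + s * j = 2 * M * k"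
          "a' = 2 * i'" "b' = 2 * j'" "c' + (1 + M) * i' + s * j' = 2 * M * k'"
        using vw unfolding v w L by blast
      then show ?thesis unfolding v w vec_simps L
        by (intro exI3[of _ "i - i'" "j - j'" "k - k'"]) (simp add: algebra_simps)
    qed
    show "ml m (MA e) v \<in> ?L" "mu m (MA e) v \<in> ?L" if vL: "v \<in> ?L"
    proof -
      obtain i j k where ij: "a = 2 * i" "b = 2 * j" "c + (1 + M) * i + s * j = 2 * M * k"
        using vL unfolding v L by blast
      show "ml m (MA e) v \<in> ?L" unfolding v ml.simps L
        by (intro exI3[of _ "- i" j "k - i"]) (use ij in \<open>simp add: algebra_simps\<close>)
      show "mu m (MA e) v \<in> ?L" unfolding v u L
        by (intro exI3[of _ i "- j" "j + i - k"]) (use ij in \<open>simp add: algebra_simps\<close>)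
    qed
    show "ml m (MA e) (ml m (MA e) v) - v \<in> ?L" using L0[of 0 0] by (simp add: v)
    show "mu m (MA e) (mu m (MA e) v) - v \<in> ?L"
      using L0[of "- b" 0] by (simp add: v u algebra_simps del: mL.simps ml.simps mu.simps)
    show "mu m (MA e) (ml m (MA e) v) - ml m (MA e) (mu m (MA e) v) \<in> ?L" using L0[of 0 0] by (simp add: v u algebra_simps)
  next
    show "(0::vec) \<in> ?L" using L0[of 0 0] by simp
    show "mu m (MA e) mx - (ml m (MA e) my - ml m (MA e) mx - my) \<in> ?L" using L0[of 0 0] by (simp add: u)
    have "int (m div 2) = M" by (simp add: M_def zdiv_int)
    then show "mu m (MA e) my - (g m - my) \<in> ?L"
      using L0[of 0 0] m by (simp add: u g_def del: mL.simps ml.simps mu.simps)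
    show "g 0 \<in> ?L" "my - my \<in> ?L" using L0[of 0 0] by (simp_all add: g_def)
    fix i
    show "g (Suc i) - (mx + ml m (MA e) (g i)) \<in> ?L"
      using L0[of 0 0] by (cases "even i") (auto simp: g_def elim!: evenE oddE)
    show "my - ml m (MA e) my \<in> ?L" using L0[of 0 0] by simp
    show "g i \<in> ?L \<longleftrightarrow> 2 * m dvd i"
    proof (cases "even i")
      case True
      then obtain r where r: "i = 2 * r" by (rule evenE)
      have "g i \<in> ?L \<longleftrightarrow> int m dvd int r" unfolding g_def L using True by (auto simp: r mM dvd_def)
      then show ?thesis by (simp add: r)
    next
      case False
      moreover have "\<not> 2 * m dvd i" using False by (meson dvd_mult_left)
      moreover have "1 \<noteq> 2 * (z::int)" for z by presburger
      ultimately show ?thesis unfolding g_def by (simp only: if_False L) simp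
    qed
    have "1 \<noteq> 2 * (z::int)" for z by presburger
    then show "g i + my \<notin> ?L" by (simp add: g_def L)
  qed (use m in simp_all)
  show ?thesis
  proof (rule quaternion_premodel.quaternion_modelI[OF PM])
    let ?R = "{0..<2::int} \<times> {0..<2::int} \<times> {0..<int m} \<times> {0::int}"
    show "finite ?R" "card ?R \<le> 4 * m" by simp_all
    fix v :: vec
    obtain a b c d where v: "v = (a, b, c, d)" by (cases v)
    let ?c = "c + (1 + M) * (a div 2) + s * (b div 2)"
    have "v - (a mod 2, b mod 2, ?c mod int m, 0) \<in> ?L" unfolding v vec_simps L
      by (intro exI3[of _ "a div 2" "b div 2" "?c div int m"])
         (use minus_mod_eq_mult_div[of ?c "int m"] minus_mod_eq_mult_div[of a 2] minus_mod_eq_mult_div[of b 2]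
          in \<open>simp add: mM\<close>)
    then show "\<exists>r\<in>?R. v - r \<in> ?L"
      by (rule bexI) (use m in simp_all)
  qed
qed

lemma model_MA':
  assumes m: "m mod 8 = 4"
  shows "model m (MA' e)"
proof -
  let ?L = "mL m (MA' e)"
  define h A where "h = int m div 4" and "A = MA'_coeff m e"
  have mh: "int m = 4 * h" and hodd: "odd h" using m unfolding h_def by presburger+
  have A: "2 * A = h - 1 + 2 * of_bool e * h"
    using hodd by (simp add: A_def MA'_coeff_def flip: h_def)
  have M: "int m div 2 = 2 * h" by (simp add: mh)
  have L: "(a, b, c, d) \<in> ?L \<longleftrightarrow> (\<exists>i k. a = 2 * i \<and> even b \<and> even d \<and> c - A * i = 2 * h * k)" for a b c d
    by (simp add: A_def M)
  have L0: "(0, b, 2 * h * k, d) \<in> ?L" if "even b" "even d" for b d k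
    unfolding L using that by (intro exI2[of _ 0 k]) simp
  have l: "ml m (MA' e) (a, b, c, d) = (a, b + d, c + h * b, d + a)"
    and u: "mu m (MA' e) (a, b, c, d) = (- a, b + a, h * b + h * d - c, d + a)" for a b c d by (simp_all add: h_def)
  \<comment> \<open>With \<open>l x = x + v\<close> and \<open>l v = v + y\<close>, the first points
    \<open>x^i\<close> are \<open>0\<close>, \<open>x\<close>, \<open>2 x + v\<close> and
    \<open>3 x + 3 v + y\<close>; four further factors \<open>x\<close> add
    \<open>c\<close>.\<close>
  define g where "g i = (if i mod 4 = 0 then (0, 0, int (i div 4), 0) else if i mod 4 = 1 then (1, 0, int (i div 4), 0)
    else if i mod 4 = 2 then (2, 0, int (i div 4), 1) else (3::int, 1::int, int (i div 4), 3::int))" for i :: nat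
  have cases4: "i = 4 * (i div 4) \<or> i = 4 * (i div 4) + 1 \<or> i = 4 * (i div 4) + 2 \<or> i = 4 * (i div 4) + 3" for i :: nat
    by presburger
  have odd_neq: "2 * z \<noteq> 1" "1 \<noteq> 2 * z" "2 * z \<noteq> 3" "3 \<noteq> 2 * z" for z :: int by presburger+
  have PM: "quaternion_premodel ?L (ml m (MA' e)) (mu m (MA' e)) mx my m"
  proof (rule quaternion_premodelI[where g = g and k = "\<lambda>i. (0, 1, h * int i, 0)"])
    fix v w :: vec
    obtain a b c d a' b' c' d' where v: "v = (a, b, c, d)" and w: "w = (a', b', c', d')"
      by (cases v, cases w)
    show "ml m (MA' e) (v + w) = ml m (MA' e) v + ml m (MA' e) w" "mu m (MA' e) (v + w) = mu m (MA' e) v + mu m (MA' e) w"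
      by (simp_all add: v w l u algebra_simps)
    show "v - w \<in> ?L" if vw: "v \<in> ?L" "w \<in> ?L"
    proof -
      obtain i k i' k' where "a = 2 * i" "even b" "even d" "c - A * i = 2 * h * k"
          "a' = 2 * i'" "even b'" "even d'" "c' - A * i' = 2 * h * k'"
        using vw unfolding v w L by blast
      then show ?thesis unfolding v w vec_simps L
        by (intro exI2[of _ "i - i'" "k - k'"]) (simp add: algebra_simps)
    qed
    show "ml m (MA' e) v \<in> ?L" "mu m (MA' e) v \<in> ?L" if vL: "v \<in> ?L"
    proof -
      obtain i k b2 d2 where ij: "a = 2 * i" "b = 2 * b2" "d = 2 * d2" "c - A * i = 2 * h * k"
        using vL unfolding v L by (auto elim!: evenE)
      show "ml m (MA' e) v \<in> ?L" unfolding v l L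
        by (intro exI2[of _ i "k + b2"]) (use ij in \<open>simp add: algebra_simps\<close>)
      show "mu m (MA' e) v \<in> ?L" unfolding v u L
        by (intro exI2[of _ "- i" "b2 + d2 - k"]) (use ij in \<open>simp add: algebra_simps\<close>)
    qed
    show "ml m (MA' e) (ml m (MA' e) (ml m (MA' e) (ml m (MA' e) v))) - v \<in> ?L"
      using L0[of "4 * d + 6 * a" "4 * a" "2 * b + 3 * d + 2 * a"] by (simp add: v l algebra_simps del: mL.simps ml.simps mu.simps)
    show "mu m (MA' e) (mu m (MA' e) v) - v \<in> ?L"
      using L0[of 0 0 a] by (simp add: v u algebra_simps del: mL.simps ml.simps mu.simps)
    show "mu m (MA' e) (ml m (MA' e) v) - ml m (MA' e) (ml m (MA' e) (ml m (MA' e) (mu m (MA' e) v))) \<in> ?L"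
    proof -
      have "mu m (MA' e) (ml m (MA' e) v) - ml m (MA' e) (ml m (MA' e) (ml m (MA' e) (mu m (MA' e) v)))
          = (0, - 2 * d, 2 * h * (- 2 * b - d - 2 * a), 4 * a)"
        by (simp add: v u l algebra_simps del: mL.simps ml.simps mu.simps)
      then show ?thesis using L0[of "- 2 * d" "4 * a" "- 2 * b - d - 2 * a"] by simp
    qed
  next
    show "(0::vec) \<in> ?L" using L0[of 0 0 0] by simp
    show "4 dvd m \<or> even m \<and> (\<forall>v. ml m (MA' e) (ml m (MA' e) v) - v \<in> ?L) \<or> (\<forall>v. ml m (MA' e) v - v \<in> ?L)"
      using m by (intro disjI1) presburger
    show "mu m (MA' e) mx - (ml m (MA' e) (ml m (MA' e) (ml m (MA' e) my)) - ml m (MA' e) (ml m (MA' e) (ml m (MA' e) mx)) - my) \<in> ?L"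
      using L0[of 4 4 "-1"] by (simp add: u l del: mL.simps ml.simps mu.simps)
    have "m mod 4 = 0" "int (m div 4) = h" using m by (presburger, simp add: h_def zdiv_int)
    then show "mu m (MA' e) my - (g m - my) \<in> ?L" using L0[of 2 0 0] by (simp add: u g_def del: mL.simps ml.simps mu.simps)
    show "g 0 \<in> ?L" "(0, 1, h * int 0, 0) - my \<in> ?L" using L0[of 0 0 0] by (simp_all add: g_def)
    fix i
    show "(0, 1, h * int (Suc i), 0) - ml m (MA' e) (0, 1, h * int i, 0) \<in> ?L"
      using L0[of 0 0 0] by (simp add: l algebra_simps del: mL.simps ml.simps mu.simps)
    define q where "q = i div 4"
    have qc: "i = 4 * q \<or> i = 4 * q + 1 \<or> i = 4 * q + 2 \<or> i = 4 * q + 3" unfolding q_def by (rule cases4)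
    \<comment> \<open>The relation \<open>c = 4 x + 4 y + 6 v + h c\<close> that closes the cycle of
      four. It holds because \<open>2 A + 1\<close> is \<open>h\<close> modulo \<open>2 h\<close>,
      the equation behind \<open>MA'_coeff\<close>.\<close>
    have L1: "(- 4, - 4, 1 - h, - 6) \<in> ?L" unfolding L
      by (intro exI2[of _ "- 2" "of_bool e"]) (use A in \<open>simp add: algebra_simps\<close>)
    have g4: "g (4 * q) = (0, 0, int q, 0)" "g (4 * q + 1) = (1, 0, int q, 0)" "g (4 * q + 2) = (2, 0, int q, 1)"
      "g (4 * q + 3) = (3, 1, int q, 3)" for q
    proof -
      have dm: "(4 * q) mod 4 = 0" "(4 * q + 1) mod 4 = 1" "(4 * q + 2) mod 4 = 2" "(4 * q + 3) mod 4 = 3"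
        "(4 * q) div 4 = q" "(4 * q + 1) div 4 = q" "(4 * q + 2) div 4 = q" "(4 * q + 3) div 4 = q" by presburger+
      show "g (4 * q) = (0, 0, int q, 0)" "g (4 * q + 1) = (1, 0, int q, 0)" "g (4 * q + 2) = (2, 0, int q, 1)"
        "g (4 * q + 3) = (3, 1, int q, 3)" unfolding g_def dm by simp_all
    qed
    have S: "Suc (4 * q) = 4 * q + 1" "Suc (4 * q + 1) = 4 * q + 2" "Suc (4 * q + 2) = 4 * q + 3"
      "Suc (4 * q + 3) = 4 * (q + 1)" by simp_all
    have z: "(0, 0, 0, 0) \<in> ?L" using L0[of 0 0 0] by simp
    show "g (Suc i) - (mx + ml m (MA' e) (g i)) \<in> ?L"
      using qc
    proof (elim disjE)
      assume i: "i = 4 * q"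
      show ?thesis unfolding i S g4 l vec_simps using z by (simp del: mL.simps ml.simps mu.simps)
    next
      assume i: "i = 4 * q + 1"
      show ?thesis unfolding i S g4 l vec_simps using z by (simp del: mL.simps ml.simps mu.simps)
    next
      assume i: "i = 4 * q + 2"
      show ?thesis unfolding i S g4 l vec_simps using z by (simp del: mL.simps ml.simps mu.simps)
    next
      assume i: "i = 4 * q + 3"
      have "(0, 0, int (q + 1), 0) - (mx + (3, 1 + 3, int q + h * 1, 3 + 3)) = (- 4, - 4, 1 - h, - 6)" by simp
      then show ?thesis unfolding i S g4 l using L1 by (simp only:)
    qed
    show "g i \<in> ?L \<longleftrightarrow> 2 * m dvd i"
    proof (cases "4 dvd i")
      case True
      then obtain r where r: "i = 4 * r" by (rule dvdE)
      have "g i \<in> ?L \<longleftrightarrow> 2 * h dvd int r" unfolding r g4 L by (auto simp: dvd_def)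
      also have "\<dots> \<longleftrightarrow> 4 * (2 * h) dvd 4 * int r" by (subst dvd_mult_cancel_left) simp
      also have "\<dots> \<longleftrightarrow> 2 * int m dvd int i" by (simp add: r mh)
      finally show ?thesis by (simp only: int_dvd_2_iff)
    next
      case False
      have "4 dvd 2 * m" using m by presburger
      then have "\<not> 2 * m dvd i" using False by (meson dvd_trans)
      moreover have "g i \<notin> ?L"
      proof -
        have "i \<noteq> 4 * q" using False by auto
        then consider "i = 4 * q + 1" | "i = 4 * q + 2" | "i = 4 * q + 3" using qc by blast
        then show ?thesis
          by cases (use odd_neq in \<open>simp_all only: g4 L even_numeral odd_one simp_thms\<close>)
      qed
      ultimately show ?thesis by simp
    qed
    show "g i + (0, 1, h * int i, 0) \<notin> ?L"
    proof -
      consider "i = 4 * q" | "i = 4 * q + 1" | "i = 4 * q + 2" | "i = 4 * q + 3" using qc by blast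
      then have "g i + (0, 1, h * int i, 0) = (0, 1, int q + h * int i, 0) \<or>
          g i + (0, 1, h * int i, 0) = (1, 1, int q + h * int i, 0) \<or>
          g i + (0, 1, h * int i, 0) = (2, 1, int q + h * int i, 1) \<or>
          g i + (0, 1, h * int i, 0) = (3, 2, int q + h * int i, 3)"
        by cases (simp_all only: g4 vec_simps, simp_all)
      then show ?thesis
        by (elim disjE) (use odd_neq in \<open>simp_all only: L even_numeral odd_one simp_thms\<close>)
    qed
  qed (use m in presburger)
  show ?thesis
  proof (rule quaternion_premodel.quaternion_modelI[OF PM])
    let ?R = "{0..<2::int} \<times> {0..<2::int} \<times> {0..<2 * h} \<times> {0..<2::int}"
    have "h > 0" using mh hodd by (cases "h = 0") auto
    have "int (nat (2 * h) * 2) = int m" using \<open>h > 0\<close> mh by simp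
    then have "nat (2 * h) * 2 = m" by (simp only: of_nat_eq_iff)
    then show "finite ?R" "card ?R \<le> 4 * m" by simp_all
    fix v :: vec
    obtain a b c d where v: "v = (a, b, c, d)" by (cases v)
    let ?c = "c - A * (a div 2)"
    have "v - (a mod 2, b mod 2, ?c mod (2 * h), d mod 2) \<in> ?L" unfolding v vec_simps L
      by (intro exI2[of _ "a div 2" "?c div (2 * h)"])
         (use minus_mod_eq_mult_div[of ?c "2 * h"] minus_mod_eq_mult_div[of a 2] in simp)
    then show "\<exists>r\<in>?R. v - r \<in> ?L"
      by (rule bexI) (use \<open>h > 0\<close> in simp_all)
  qed
qed

theorem model_exists:
  assumes m: "m > 0" and T: "T \<in> types m"
  shows "model m T"
proof -
  have modM1: "model m (M1 e)" if "e \<longrightarrow> even m" for e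
    unfolding mL.simps by (rule model_M[of m 0 "of_bool e"]) (use m that in auto)
  have modM3: "model m (M3 e)" if "4 dvd m" for e
  proof -
    have "even m" using that by (meson dvd_trans even_numeral)
    then show ?thesis unfolding mL.simps by (intro model_M[of m 1 "of_bool e"]) (use m that in auto)
  qed
  show ?thesis
  proof (cases T)
    case (M1 e)
    then show ?thesis using T modM1 by (cases e) (auto simp: types_def split: if_splits)
  next
    case M2
    then show ?thesis using model_M2[OF m] by simp
  next
    case (M3 e)
    then have "even m" "m mod 4 \<noteq> 2" using T unfolding types_def by (simp_all split: if_splits)
    then have "4 dvd m" by presburger
    then show ?thesis using modM3 M3 by simp
  next
    case (MB e)
    then have "even m" "e \<or> m mod 4 \<noteq> 2" using T unfolding types_def by (auto split: if_splits)
    moreover have "4 dvd m" if "even m" "m mod 4 \<noteq> 2" using that by presburger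
    ultimately show ?thesis using model_MB[OF m] MB by blast
  next
    case (MA e)
    then have "even m" using T unfolding types_def by (simp split: if_splits)
    then show ?thesis using model_MA[OF m] MA by simp
  next
    case (MA' e)
    then have "m mod 8 = 4" using T unfolding types_def by (simp split: if_splits)
    then show ?thesis using model_MA' MA' by simp
  qed
qed

section \<open>Isomorphism invariants\<close>

definition brace_lam :: "('a, 'c) ring_scheme \<Rightarrow> 'a \<Rightarrow> 'a \<Rightarrow> 'a" where
  "brace_lam B g b = \<ominus>\<^bsub>B\<^esub> g \<oplus>\<^bsub>B\<^esub> (g \<otimes>\<^bsub>B\<^esub> b)"

text \<open>In a brace on \<open>Q\<^sub>4\<^sub>m\<close> with \<open>m \<ge> 3\<close> this is a characteristic set of rotations.\<close>

definition big_order :: "('a, 'c) ring_scheme \<Rightarrow> 'a set" where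
  "big_order B = {h \<in> carrier B. h [^]\<^bsub>B\<^esub> (4::nat) \<noteq> \<one>\<^bsub>B\<^esub>}"

definition inv_exp :: "nat \<Rightarrow> ('a, 'c) ring_scheme \<Rightarrow> bool" where
  "inv_exp k B \<longleftrightarrow> (\<forall>a\<in>carrier B. [k] \<cdot>\<^bsub>B\<^esub> a = \<zero>\<^bsub>B\<^esub>)"

text \<open>Quantifying over \<open>big_order\<close> replaces the generator \<open>X\<close>, which
  an isomorphism need not preserve: all members are powers of \<open>X\<close>, and \<open>X\<close>
  is one of them.\<close>

definition inv_self :: "('a, 'c) ring_scheme \<Rightarrow> bool" where
  "inv_self B \<longleftrightarrow> (\<forall>h\<in>big_order B. brace_lam B h h = h)"

definition inv_triv :: "('a, 'c) ring_scheme \<Rightarrow> bool" where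
  "inv_triv B \<longleftrightarrow> (\<forall>h\<in>big_order B. \<forall>g\<in>carrier B. brace_lam B h g = g)"

definition inv_double :: "('a, 'c) ring_scheme \<Rightarrow> bool" where
  "inv_double B \<longleftrightarrow> (\<forall>h\<in>big_order B. \<forall>g\<in>carrier B.
    brace_lam B h g \<oplus>\<^bsub>B\<^esub> brace_lam B h g = g \<oplus>\<^bsub>B\<^esub> g)"

definition inv_square :: "('a, 'c) ring_scheme \<Rightarrow> bool" where
  "inv_square B \<longleftrightarrow> (\<forall>h\<in>big_order B. \<forall>g\<in>carrier B. brace_lam B h (brace_lam B h g) = g)"

text \<open>In \<open>Q_4m\<close> the condition on \<open>g \<otimes> g\<close> excludes just
  \<open>\<one>\<close> and \<open>x^m\<close>.\<close>

definition inv_fixed :: "('a, 'c) ring_scheme \<Rightarrow> bool" where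
  "inv_fixed B \<longleftrightarrow> (\<exists>g\<in>carrier B. g \<oplus>\<^bsub>B\<^esub> g = \<zero>\<^bsub>B\<^esub> \<and> g \<otimes>\<^bsub>B\<^esub> g \<noteq> \<one>\<^bsub>B\<^esub> \<and>
    (\<forall>h\<in>big_order B. brace_lam B h g = g))"

lemma brace_isomorphic_invariants:
  assumes "brace B" "brace C" "brace_isomorphic B C"
  shows "inv_exp k C \<longleftrightarrow> inv_exp k B" "inv_self C \<longleftrightarrow> inv_self B" "inv_triv C \<longleftrightarrow> inv_triv B"
    "inv_double C \<longleftrightarrow> inv_double B" "inv_square C \<longleftrightarrow> inv_square B" "inv_fixed C \<longleftrightarrow> inv_fixed B"
proof -
  interpret B: brace B by fact
  interpret C: brace C by fact
  obtain \<phi> where \<phi>: "\<phi> \<in> brace_iso B C" using assms(3) by (auto simp: brace_isomorphic_def)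
  then have bij: "inj_on \<phi> (carrier B)" "carrier C = \<phi> ` carrier B"
    by (auto simp: brace_iso_def iso_def bij_betw_def)
  have mult: "\<phi> a \<otimes>\<^bsub>C\<^esub> \<phi> b = \<phi> (a \<otimes>\<^bsub>B\<^esub> b)" and add: "\<phi> a \<oplus>\<^bsub>C\<^esub> \<phi> b = \<phi> (a \<oplus>\<^bsub>B\<^esub> b)"
    if "a \<in> carrier B" "b \<in> carrier B" for a b
    using \<phi> that by (auto simp: brace_iso_def iso_def hom_def)
  have cl: "\<phi> a \<in> carrier C" if "a \<in> carrier B" for a using bij that by auto
  have eq: "\<phi> a = \<phi> b \<longleftrightarrow> a = b" if "a \<in> carrier B" "b \<in> carrier B" for a b
    using inj_onD[OF bij(1)] that by auto
  have one: "\<one>\<^bsub>C\<^esub> = \<phi> \<one>\<^bsub>B\<^esub>"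
    using mult[of "\<one>\<^bsub>B\<^esub>" "\<one>\<^bsub>B\<^esub>"] cl[of "\<one>\<^bsub>B\<^esub>"] by (metis B.one_closed B.l_one C.r_cancel_one)
  have zero: "\<zero>\<^bsub>C\<^esub> = \<phi> \<zero>\<^bsub>B\<^esub>"
    using one by (simp add: B.zero_eq_one C.zero_eq_one)
  have minus: "\<ominus>\<^bsub>C\<^esub> \<phi> a = \<phi> (\<ominus>\<^bsub>B\<^esub> a)" if "a \<in> carrier B" for a
    using that by (intro C.minus_equality) (simp_all add: add zero cl B.l_neg)
  have lam: "brace_lam C (\<phi> a) (\<phi> b) = \<phi> (brace_lam B a b)" if "a \<in> carrier B" "b \<in> carrier B" for a b
    using that by (simp add: brace_lam_def mult add minus)
  have lamB: "brace_lam B a b \<in> carrier B" if "a \<in> carrier B" "b \<in> carrier B" for a b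
    using that by (simp add: brace_lam_def)
  have pow: "\<phi> a [^]\<^bsub>C\<^esub> (i::nat) = \<phi> (a [^]\<^bsub>B\<^esub> i)" if "a \<in> carrier B" for a i
    using that by (induction i) (simp_all add: one mult)
  have smul: "[(i::nat)] \<cdot>\<^bsub>C\<^esub> \<phi> a = \<phi> ([i] \<cdot>\<^bsub>B\<^esub> a)" if "a \<in> carrier B" for a i
    using that by (induction i) (simp_all add: zero add)
  have big: "big_order C = \<phi> ` big_order B"
    unfolding big_order_def bij(2) by (auto simp: pow one eq)
  have sub: "h \<in> carrier B" if "h \<in> big_order B" for h using that by (simp add: big_order_def)
  note S = big bij(2) lam lamB mult add one zero eq sub smul
  show "inv_exp k C \<longleftrightarrow> inv_exp k B" by (simp add: inv_exp_def S cong: ball_cong)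
  show "inv_self C \<longleftrightarrow> inv_self B" by (simp add: inv_self_def S cong: ball_cong)
  show "inv_triv C \<longleftrightarrow> inv_triv B" by (simp add: inv_triv_def S cong: ball_cong)
  show "inv_double C \<longleftrightarrow> inv_double B" by (simp add: inv_double_def S cong: ball_cong)
  show "inv_square C \<longleftrightarrow> inv_square B" by (simp add: inv_square_def S cong: ball_cong)
  show "inv_fixed C \<longleftrightarrow> inv_fixed B" by (simp add: inv_fixed_def S cong: ball_cong bex_cong)
qed

primrec nmul :: "nat \<Rightarrow> 'v::ab_group_add \<Rightarrow> 'v" where
  "nmul 0 v = 0"
| "nmul (Suc k) v = nmul k v + v"

context modelled_brace
begin

lemma brace_lam_eq: "brace_lam B = lam"
  by (simp add: fun_eq_iff brace_lam_def lam_def)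

text \<open>The square of a reflection is \<open>X^m\<close>, so its fourth power is
  \<open>\<one>\<close>.\<close>

lemma big_order_rot: "h \<in> big_order B \<Longrightarrow> \<exists>i::nat. h = X [^] i"
proof -
  assume h: "h \<in> big_order B"
  then have "h \<in> carrier B" by (simp add: big_order_def)
  then show ?thesis
  proof (cases rule: carrier_cases)
    case (refl i)
    have "h [^] (4::nat) = (h \<otimes> h) \<otimes> (h \<otimes> h)"
      using \<open>h \<in> carrier B\<close> by (simp add: numeral_eq_Suc m_assoc)
    also have "\<dots> = X [^] (2 * m)" unfolding refl refl_square by (simp add: nat_pow_mult mult_2)
    also have "\<dots> = \<one>" using x_pow_eq_1[of "2 * m"] by simp
    finally show ?thesis using h by (simp add: big_order_def)
  qed auto
qed

lemma X_big_order: "m \<ge> 3 \<Longrightarrow> X \<in> big_order B"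
  using x_pow_eq_1[of 4] by (auto simp: big_order_def dest: dvd_imp_le)

lemma F_x: "F X \<approx> x"
  using F_pow[of 1] f_Suc[of 0] by simp

lemma F_y: "F Y \<approx> y"
proof -
  have "F (Y \<otimes> \<one>) \<approx> y + u (F \<one>)" by (rule F_Y) simp
  also have "\<dots> \<approx> y + u 0" by (intro cg_add cg_u F_one) simp
  finally show ?thesis by simp
qed

lemma F_lam_X: "a \<in> carrier B \<Longrightarrow> F (lam X a) \<approx> l (F a)"
  using F_lam[of a 1] by simp

lemma lpow_fixed: "l v \<approx> v \<Longrightarrow> (l ^^ i) v \<approx> v"
proof (induction i)
  case (Suc i)
  have "(l ^^ Suc i) v \<approx> l v" using cg_l[OF Suc.IH[OF Suc.prems]] by simp
  then show ?case using Suc.prems cg_trans by blast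
qed simp

lemma inv_selfI: "l x \<approx> x \<Longrightarrow> inv_self B"
proof -
  assume lx: "l x \<approx> x"
  have lf: "l (f i) \<approx> f i" for i
  proof (induction i)
    case (Suc i)
    have "l (f (Suc i)) \<approx> f i + (l ^^ i) (l x)"
      unfolding f_Suc l_add using Suc by (intro cg_add) (simp_all add: funpow_swap1)
    also have "\<dots> \<approx> f (Suc i)" unfolding f_Suc by (intro cg_add cg_lpow lx) simp
    finally show ?case .
  qed simp
  show ?thesis unfolding inv_self_def brace_lam_eq
  proof
    fix h assume "h \<in> big_order B"
    then obtain i :: nat where h: "h = X [^] i" using big_order_rot by blast
    have "F (lam h h) \<approx> (l ^^ i) (F h)" unfolding h by (rule F_lam) simp
    also have "\<dots> \<approx> (l ^^ i) (f i)" unfolding h by (intro cg_lpow F_pow)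
    also have "\<dots> \<approx> f i" by (rule lpow_fixed[OF lf])
    also have "\<dots> \<approx> F h" unfolding h by (rule cg_sym[OF F_pow])
    finally show "lam h h = h" by (subst (asm) F_eq_iff) (simp_all add: h)
  qed
qed

lemma inv_selfD: "inv_self B \<Longrightarrow> m \<ge> 3 \<Longrightarrow> l x \<approx> x"
proof -
  assume "inv_self B" "m \<ge> 3"
  then have "lam X X = X" using X_big_order by (auto simp: inv_self_def brace_lam_eq)
  then have "F X \<approx> l (F X)" using F_lam_X[of X] by simp
  then have "x \<approx> l (F X)" using cg_trans[OF cg_sym[OF F_x]] by blast
  then have "x \<approx> l x" using cg_trans cg_l[OF F_x] by blast
  then show ?thesis by (rule cg_sym)
qed

lemma inv_trivI: "(\<And>v. l v \<approx> v) \<Longrightarrow> inv_triv B"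
  unfolding inv_triv_def brace_lam_eq
proof (intro ballI)
  fix h g assume l: "\<And>v. l v \<approx> v" and "h \<in> big_order B" and g: "g \<in> carrier B"
  then obtain i :: nat where h: "h = X [^] i" using big_order_rot by blast
  have "F (lam h g) \<approx> F g" unfolding h using F_lam[OF g] lpow_fixed[OF l] by (rule cg_trans)
  then show "lam h g = g" by (subst (asm) F_eq_iff) (simp_all add: h g)
qed

lemma inv_trivD: "inv_triv B \<Longrightarrow> m \<ge> 3 \<Longrightarrow> l v \<approx> v"
proof -
  assume T: "inv_triv B" "m \<ge> 3"
  obtain g where g: "g \<in> carrier B" "F g \<approx> v" using F_surj by blast
  have "lam X g = g" using T X_big_order g by (auto simp: inv_triv_def brace_lam_eq)
  then have "F g \<approx> l (F g)" using F_lam_X[OF g(1)] by simp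
  then have "v \<approx> l (F g)" using cg_trans[OF cg_sym[OF g(2)]] by blast
  then show ?thesis using cg_trans cg_l[OF g(2)] cg_sym by blast
qed

lemma inv_doubleI: "(\<And>v. l v + l v \<approx> v + v) \<Longrightarrow> inv_double B"
  unfolding inv_double_def brace_lam_eq
proof (intro ballI)
  fix h g assume l: "\<And>v. l v + l v \<approx> v + v" and "h \<in> big_order B" and g: "g \<in> carrier B"
  then obtain i :: nat where h: "h = X [^] i" using big_order_rot by blast
  have p: "(l ^^ i) v + (l ^^ i) v \<approx> v + v" for v
  proof (induction i)
    case (Suc i)
    have "(l ^^ Suc i) v + (l ^^ Suc i) v \<approx> (l ^^ i) v + (l ^^ i) v" using l[of "(l ^^ i) v"] by simp
    then show ?case using Suc cg_trans by blast
  qed simp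
  have "F (lam h g \<oplus> lam h g) \<approx> F (lam h g) + F (lam h g)" using g by (intro F_add) (simp_all add: h)
  also have "\<dots> \<approx> (l ^^ i) (F g) + (l ^^ i) (F g)" unfolding h by (intro cg_add F_lam g)
  also note p
  also have "F g + F g \<approx> F (g \<oplus> g)" using g by (intro cg_sym[OF F_add])
  finally show "lam h g \<oplus> lam h g = g \<oplus> g" by (subst (asm) F_eq_iff) (simp_all add: h g)
qed

lemma inv_doubleD: "inv_double B \<Longrightarrow> m \<ge> 3 \<Longrightarrow> l x + l x \<approx> x + x"
proof -
  assume T: "inv_double B" "m \<ge> 3"
  have e: "lam X X \<oplus> lam X X = X \<oplus> X" using T X_big_order by (auto simp: inv_double_def brace_lam_eq)
  have lX: "F (lam X X) \<approx> l x" using F_lam_X[of X] cg_l[OF F_x] cg_trans by fastforce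
  have "l x + l x \<approx> F (lam X X) + F (lam X X)" by (intro cg_add cg_sym[OF lX])
  also have "\<dots> \<approx> F (lam X X \<oplus> lam X X)" by (intro cg_sym[OF F_add]) simp_all
  also have "\<dots> \<approx> F X + F X" unfolding e by (intro F_add) simp_all
  also have "\<dots> \<approx> x + x" by (intro cg_add F_x)
  finally show ?thesis .
qed

lemma inv_squareI: "(\<And>v. l (l v) \<approx> v) \<Longrightarrow> inv_square B"
  unfolding inv_square_def brace_lam_eq
proof (intro ballI)
  fix h g assume l: "\<And>v. l (l v) \<approx> v" and "h \<in> big_order B" and g: "g \<in> carrier B"
  then obtain i :: nat where h: "h = X [^] i" using big_order_rot by blast
  have p: "(l ^^ i) ((l ^^ i) v) \<approx> v" for v
  proof (induction i)
    case (Suc i)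
    have "(l ^^ Suc i) ((l ^^ Suc i) v) = l (l ((l ^^ i) ((l ^^ i) v)))" by (simp add: funpow_swap1)
    then show ?case using cg_trans[OF l Suc] by simp
  qed simp
  have "F (lam h (lam h g)) \<approx> (l ^^ i) (F (lam h g))" unfolding h using g by (intro F_lam) simp
  also have "\<dots> \<approx> (l ^^ i) ((l ^^ i) (F g))" unfolding h using g by (intro cg_lpow F_lam)
  also note p
  finally show "lam h (lam h g) = g" by (subst (asm) F_eq_iff) (simp_all add: h g)
qed

lemma inv_squareD: "inv_square B \<Longrightarrow> m \<ge> 3 \<Longrightarrow> l (l x) \<approx> x"
proof -
  assume T: "inv_square B" "m \<ge> 3"
  have e: "lam X (lam X X) = X" using T X_big_order by (auto simp: inv_square_def brace_lam_eq)
  have lX: "F (lam X X) \<approx> l x" using F_lam_X[of X] cg_l[OF F_x] cg_trans by fastforce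
  have "F (lam X (lam X X)) \<approx> l (F (lam X X))" by (rule F_lam_X) simp
  also have "\<dots> \<approx> l (l x)" by (rule cg_l[OF lX])
  finally have "F X \<approx> l (l x)" unfolding e .
  then show ?thesis using F_x cg_sym cg_trans by blast
qed

lemma inv_fixedI: "y + y \<approx> 0 \<Longrightarrow> l y \<approx> y \<Longrightarrow> inv_fixed B"
  unfolding inv_fixed_def brace_lam_eq
proof (intro bexI[of _ Y] conjI ballI)
  assume y: "y + y \<approx> 0" "l y \<approx> y"
  have "F (Y \<oplus> Y) \<approx> F Y + F Y" by (rule F_add) simp_all
  also have "\<dots> \<approx> y + y" by (intro cg_add F_y)
  also note y(1)
  finally show "Y \<oplus> Y = \<zero>" using F_ker by (simp add: zero_eq_one)
  show "Y \<otimes> Y \<noteq> \<one>" using m_pos x_pow_eq_1[of m] by (auto simp: y_y dest: dvd_imp_le)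
  fix h assume "h \<in> big_order B"
  then obtain i :: nat where h: "h = X [^] i" using big_order_rot by blast
  have "F (lam h Y) \<approx> (l ^^ i) (F Y)" unfolding h by (rule F_lam) simp
  also have "\<dots> \<approx> (l ^^ i) y" by (rule cg_lpow[OF F_y])
  also have "\<dots> \<approx> y" by (rule lpow_fixed[OF y(2)])
  also have "\<dots> \<approx> F Y" by (rule cg_sym[OF F_y])
  finally show "lam h Y = Y" by (subst (asm) F_eq_iff) (simp_all add: h)
qed simp

text \<open>Rotations with exponent divisible by \<open>m\<close> square to \<open>\<one>\<close>,
  so the witness is none of them.\<close>

lemma inv_fixedD: "inv_fixed B \<Longrightarrow> m \<ge> 3 \<Longrightarrow> \<exists>v. v + v \<approx> 0 \<and> l v \<approx> v \<and> (\<forall>i. \<not> v \<approx> f (m * i))"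
proof -
  assume T: "inv_fixed B" "m \<ge> 3"
  then obtain g where g: "g \<in> carrier B" "g \<oplus> g = \<zero>" "g \<otimes> g \<noteq> \<one>" "lam X g = g"
    using X_big_order by (auto simp: inv_fixed_def brace_lam_eq)
  show ?thesis
  proof (intro exI[of _ "F g"] conjI allI notI)
    show "F g + F g \<approx> 0" using cg_trans[OF cg_sym[OF F_add[OF g(1,1)]]] F_zero by (simp add: g(2))
    show "l (F g) \<approx> F g" using F_lam_X[OF g(1)] cg_sym by (simp add: g(4))
    fix i assume "F g \<approx> f (m * i)"
    then have "F g \<approx> F (X [^] (m * i))" using F_pow cg_sym cg_trans by blast
    then have "g = X [^] (m * i)" using g(1) by (subst (asm) F_eq_iff) simp_all
    then have "g \<otimes> g = X [^] (2 * m * i)" by (simp add: nat_pow_mult mult_2 distrib_right)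
    then show False using g(3) x_pow_eq_1[of "2 * m * i"] by simp
  qed
qed

lemma nmul_cg: "v \<approx> w \<Longrightarrow> nmul k v \<approx> nmul k w"
  by (induction k) (auto intro: cg_add)

lemma F_nmul: "a \<in> carrier B \<Longrightarrow> F ([(k::nat)] \<cdot> a) \<approx> nmul k (F a)"
proof (induction k)
  case (Suc k)
  have "F ([Suc k] \<cdot> a) \<approx> F ([k] \<cdot> a) + F a" using F_add[of "[k] \<cdot> a" a] Suc.prems by simp
  also have "\<dots> \<approx> nmul k (F a) + F a" using Suc by (intro cg_add) simp_all
  finally show ?case by simp
qed (simp add: F_zero)

lemma inv_exp_iff: "inv_exp k B \<longleftrightarrow> (\<forall>v. nmul k v \<in> L)"
proof
  assume E: "inv_exp k B"
  show "\<forall>v. nmul k v \<in> L"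
  proof
    fix v
    obtain a where a: "a \<in> carrier B" "F a \<approx> v" using F_surj by blast
    have "nmul k v \<approx> nmul k (F a)" by (rule nmul_cg[OF cg_sym[OF a(2)]])
    also have "\<dots> \<approx> F ([k] \<cdot> a)" by (rule cg_sym[OF F_nmul[OF a(1)]])
    also have "[k] \<cdot> a = \<zero>" using E a by (simp add: inv_exp_def)
    also note F_zero
    finally show "nmul k v \<in> L" by (simp add: cg_0)
  qed
next
  assume E: "\<forall>v. nmul k v \<in> L"
  show "inv_exp k B" unfolding inv_exp_def
  proof
    fix a assume a: "a \<in> carrier B"
    have "nmul k (F a) \<approx> 0" using E by (simp add: cg_0)
    then have "F ([k] \<cdot> a) \<approx> 0" by (rule cg_trans[OF F_nmul[OF a]])
    then show "[k] \<cdot> a = \<zero>" using F_ker a by (simp add: zero_eq_one)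
  qed
qed

end

lemma nmul_vec [simp]: "nmul k (a, b, c, d :: int) = (int k * a, int k * b, int k * c, int k * d)"
  by (induction k) (simp_all add: algebra_simps)

locale typed_brace = modelled_brace "mL m T" "ml m T" "mu m T" mx my m B X Y F
  for m T and B (structure) and X Y and F :: "'a \<Rightarrow> vec" +
  assumes m_ge: "m \<ge> 3" and T_types: "T \<in> types m"
begin

lemma cgI: "v - w \<in> mL m T \<Longrightarrow> cg v w"
  by (simp add: cg_def)

lemma cg_of_eq: "v - w = z \<Longrightarrow> z \<in> mL m T \<Longrightarrow> cg v w"
  by (simp add: cg_def)

lemma self_iff: "inv_self B \<longleftrightarrow> (\<exists>e. T = M1 e) \<or> T = M2"
proof -
  have "inv_self B \<longleftrightarrow> ml m T mx - mx \<in> mL m T"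
    using inv_selfI inv_selfD[OF _ m_ge] unfolding cg_def by blast
  also have "\<dots> \<longleftrightarrow> (\<exists>e. T = M1 e) \<or> T = M2"
  proof (cases T)
    case (MB e)
    have "1 \<noteq> 4 * (j::int)" for j by presburger
    then show ?thesis using m_ge by (simp add: MB)
  next
    case (MA e)
    then have m2: "m mod 4 = 2" using T_types by (simp add: types_def split: if_splits)
    have "1 + (1 + int m div 2) * i + of_bool e * (int m div 2) * 0 \<noteq> int m * k" if "- 2 = 2 * i" for i k
    proof
      assume A: "1 + (1 + int m div 2) * i + of_bool e * (int m div 2) * 0 = int m * k"
      define M where "M = int m div 2"
      have M: "int m = 2 * M" "M > 0" using m2 m_ge unfolding M_def by presburger+
      have "i = - 1" using that by simp
      then have "M * (1 + 2 * k) = 0" using A by (simp add: M(1) algebra_simps)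
      then have "1 + 2 * k = 0" using M(2) by simp
      then show False by presburger
    qed
    then show ?thesis by (auto simp: MA)
  qed (use m_ge in \<open>auto simp: zdvd_not_zless\<close>)
  finally show ?thesis .
qed

lemma triv_iff: "T = M1 e \<Longrightarrow> inv_triv B \<longleftrightarrow> \<not> e"
proof -
  assume T: "T = M1 e"
  have "ml m T v - v \<in> mL m T" if "\<not> e" for v using that by (cases v) (simp add: T)
  moreover have "ml m T my - my \<notin> mL m T" if e using that m_ge by (simp add: T zdvd_not_zless)
  ultimately show ?thesis using inv_trivI inv_trivD[OF _ m_ge, of my] unfolding cg_def by blast
qed

lemma exp_2m: "T = M1 e \<Longrightarrow> inv_exp (2 * m) B" "T = M2 \<Longrightarrow> \<not> inv_exp (2 * m) B"
proof -
  show "inv_exp (2 * m) B" if "T = M1 e" unfolding inv_exp_iff by (auto simp: that)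
  have "\<not> 4 * int m dvd 2 * int m" using m_ge by (intro zdvd_not_zless) simp_all
  then have "nmul (2 * m) my \<notin> mL m T" if "T = M2" using that by simp
  then show "\<not> inv_exp (2 * m) B" if "T = M2" unfolding inv_exp_iff using that by blast
qed

text \<open>\<open>inv_double\<close> says that every \<open>l v - v\<close> is killed by
  \<open>2\<close>. It separates \<open>M3\<close>, \<open>MA\<close> and \<open>MA'\<close> from
  \<open>MB\<close>, where twice \<open>l x - x = y\<close> is nonzero.\<close>

lemma double_M3: "T = M3 e \<Longrightarrow> inv_double B"
proof (rule inv_doubleI)
  fix v :: vec
  obtain a b c d where v: "v = (a, b, c, d)" by (cases v)
  assume T: "T = M3 e"
  have "ml m T v + ml m T v - (v + v) = (2 * int m * (a + of_bool e * b), 0, 0, 0)"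
    by (simp add: T v algebra_simps)
  then show "cg (ml m T v + ml m T v) (v + v)" by (intro cgI) (simp add: T)
qed

lemma double_MA: "T = MA e \<Longrightarrow> inv_double B"
proof (rule inv_doubleI)
  fix v :: vec
  obtain a b c d where v: "v = (a, b, c, d)" by (cases v)
  assume T: "T = MA e"
  have "even m" using T_types T by (simp add: types_def split: if_splits)
  then have m: "int m = 2 * (int m div 2)" by presburger
  have "2 * a + (1 + int m div 2) * (- 2 * a) + of_bool e * (int m div 2) * 0 = (2 * (int m div 2)) * - a"
    by (simp add: algebra_simps)
  then have "2 * a + (1 + int m div 2) * (- 2 * a) + of_bool e * (int m div 2) * 0 = int m * - a"
    by (simp only: m[symmetric])
  then have mem: "(2 * (- 2 * a), 2 * 0, 2 * a, 0) \<in> mL m T" unfolding T mL.simps by blast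
  have "ml m T v + ml m T v - (v + v) = (2 * (- 2 * a), 2 * 0, 2 * a, 0)"
    by (simp add: T v)
  then show "cg (ml m T v + ml m T v) (v + v)" using mem by (rule cg_of_eq)
qed

lemma double_MA': "T = MA' e \<Longrightarrow> inv_double B"
proof (rule inv_doubleI)
  fix v :: vec
  obtain a b c d where v: "v = (a, b, c, d)" by (cases v)
  assume T: "T = MA' e"
  have "m mod 8 = 4" using T_types T by (simp add: types_def split: if_splits)
  then have "m = 8 * (m div 8) + 4" using mod_mult_div_eq[of m 8] by simp
  then obtain k where k: "m = 8 * k + 4" by blast
  have m: "int m div 2 = 2 * (int m div 4)" unfolding k by simp
  have mem: "(2 * 0, 2 * d, 2 * (int m div 4) * b, 2 * a) \<in> mL m T"
    unfolding T mL.simps mem_Collect_eq prod.case m by (intro exI2[of _ 0 b] conjI) simp_all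
  have "ml m T v + ml m T v - (v + v) = (2 * 0, 2 * d, 2 * (int m div 4) * b, 2 * a)"
    by (simp add: T v)
  then show "cg (ml m T v + ml m T v) (v + v)" using mem by (rule cg_of_eq)
qed

lemma double_MB: "T = MB e \<Longrightarrow> \<not> inv_double B"
proof
  assume T: "T = MB e" and "inv_double B"
  then have "ml m T mx + ml m T mx - (mx + mx) \<in> mL m T" using inv_doubleD[OF _ m_ge] unfolding cg_def by blast
  moreover have "2 \<noteq> 4 * (j::int)" for j by presburger
  ultimately show False using m_ge by (simp add: T)
qed

lemma square_MB: "T = MB e \<Longrightarrow> inv_square B \<longleftrightarrow> e"
proof -
  assume T: "T = MB e"
  have 1: "inv_square B" if e
  proof (rule inv_squareI)
    fix v :: vec
    obtain a b c d where v: "v = (a, b, c, d)" by (cases v)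
    have "ml m T (ml m T v) - v = (int m * 0, (int m div 2 - 2) * 0 + 4 * (a + 2 * b), 0, 0)"
      using that by (simp add: T v algebra_simps)
    then show "cg (ml m T (ml m T v)) v" by (rule cg_of_eq) (unfold T mL.simps, blast)
  qed
  have 2: "e" if "inv_square B"
  proof (rule ccontr)
    assume "\<not> e"
    have "ml m T (ml m T mx) - mx \<in> mL m T" using inv_squareD[OF that m_ge] unfolding cg_def .
    moreover have "2 \<noteq> 4 * (j::int)" for j by presburger
    ultimately show False using m_ge \<open>\<not> e\<close> by (simp add: T)
  qed
  show ?thesis using 1 2 by blast
qed

text \<open>For false \<open>e\<close> the generator \<open>y\<close> is a witness. For true
  \<open>e\<close>, being killed by \<open>2\<close> and fixed by \<open>l\<close> makes both
  coordinates \<open>a\<close> and \<open>b\<close> even, so the vector is a multiple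
  \<open>m j x\<close>; this is the point \<open>x^(m i)\<close> with \<open>i = j mod 2\<close>,
  which is excluded.\<close>

lemma fixed_M3: "T = M3 e \<Longrightarrow> inv_fixed B \<longleftrightarrow> \<not> e"
proof -
  assume T: "T = M3 e"
  have m4: "4 dvd m" using T_types T unfolding types_def by (simp split: if_splits) presburger+
  have 1: "inv_fixed B" if "\<not> e"
    by (rule inv_fixedI; rule cgI) (use that in \<open>simp_all add: T\<close>)
  have 2: "\<not> e" if I: "inv_fixed B"
  proof
    assume e: e
    obtain v where v: "v + v \<in> mL m T" "ml m T v - v \<in> mL m T" "\<And>i. \<not> cg v (f (m * i))"
      using inv_fixedD[OF I m_ge] by (auto simp: cg_def)
    obtain a b c d where abcd: "v = (a, b, c, d)" by (cases v)
    have "int m dvd a" using v(1) by (simp add: T abcd)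
    then obtain j where j: "a = int m * j" by (rule dvdE)
    have "even a" using j m4 by (auto dest: dvd_trans[of 2 4])
    have "2 * int m dvd int m * (a + b)" using v(2) e by (simp add: T abcd algebra_simps)
    then have "int m * 2 dvd int m * (a + b)" by (simp only: mult.commute)
    then have "even (a + b)" using m_ge by simp
    then have b: "even b" using \<open>even a\<close> by simp
    have fi: "cg (f i) (int i + int m * tri i, 0, 0, 0)" for i
    proof (induction i)
      case (Suc i)
      have "cg (f (Suc i)) (mx + ml m T (int i + int m * tri i, 0, 0, 0))"
        unfolding f_Suc' by (intro cg_add cg_l Suc) simp
      also have "mx + ml m T (int i + int m * tri i, 0, 0, 0) = (1 + (int i + int m * tri i) + int m * (int i + int m * tri i), 0, 0, 0)"
        by (simp add: T)
      also have "cg \<dots> (int (Suc i) + int m * tri (Suc i), 0, 0, 0)"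
      proof -
        obtain r where "int m = 2 * r" using m4 by (metis dvd_trans even_numeral evenE even_of_nat)
        then have E: "int m * int m * tri i = 2 * int m * (r * tri i)" by simp
        have "(1 + (int i + int m * tri i) + int m * (int i + int m * tri i), 0, 0, 0) -
            (int (Suc i) + int m * tri (Suc i), 0, 0, 0) = ((int m * int m * tri i, 0, 0, 0) :: vec)"
          by (simp add: algebra_simps)
        then show ?thesis
          by (rule cg_of_eq) (simp only: E T mL.simps mem_Collect_eq prod.case dvd_triv_left even_zero simp_thms)
      qed
      finally show ?case .
    qed simp
    define i where "i = nat (j mod 2)"
    have "int i = j mod 2" by (simp add: i_def)
    then obtain j' where j': "j = int i + 2 * j'" by (metis mod_mult_div_eq)
    have "4 dvd m * i" using m4 by simp
    then have "even (tri (m * i))" by (rule even_tri)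
    then obtain r where r: "tri (m * i) = 2 * r" by (rule evenE)
    have "a - (int (m * i) + int m * tri (m * i)) = 2 * int m * (j' - r)"
      unfolding j j' r by (simp add: algebra_simps)
    then have "v - (int (m * i) + int m * tri (m * i), 0, 0, 0) = (2 * int m * (j' - r), b, c, d)"
      unfolding abcd vec_simps by simp
    then have "cg v (int (m * i) + int m * tri (m * i), 0, 0, 0)"
      by (rule cg_of_eq) (simp only: T mL.simps mem_Collect_eq prod.case dvd_triv_left b simp_thms)
    then have "cg v (f (m * i))" using fi[of "m * i"] cg_sym cg_trans by blast
    then show False using v(3) by blast
  qed
  show ?thesis using 1 2 by blast
qed

lemma exp_m_M3: "T = M3 e \<Longrightarrow> \<not> inv_exp m B"
proof -
  assume T: "T = M3 e"
  have "\<not> 2 * int m dvd int m" using m_ge by (intro zdvd_not_zless) simp_all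
  then have "nmul m mx \<notin> mL m T" by (simp add: T)
  then show ?thesis unfolding inv_exp_iff by blast
qed

text \<open>With \<open>M = m / 2\<close>, \<open>m y = M (2 y)\<close> equals \<open>M^2 p\<close>
  when \<open>e\<close> holds; this is nonzero because \<open>M\<close> is odd and \<open>p\<close>
  has order \<open>2 M\<close>.\<close>

lemma exp_m_MA: "T = MA e \<Longrightarrow> inv_exp m B \<longleftrightarrow> \<not> e"
proof -
  assume T: "T = MA e"
  define M where "M = int m div 2"
  have m2: "m mod 4 = 2" using T_types T by (simp add: types_def split: if_splits)
  then have M: "int m = 2 * M" "odd M" "M > 0" unfolding M_def by presburger+
  obtain r where r: "M = 2 * r + 1" using M(2) by (rule oddE)
  have 1: "nmul m v \<in> mL m T" if "\<not> e" for v :: vec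
  proof -
    obtain a b c d where v: "v = (a, b, c, d)" by (cases v)
    have "int m * a = 2 * (M * a) \<and> int m * b = 2 * (M * b) \<and>
        int m * c + (1 + int m div 2) * (M * a) + of_bool e * (int m div 2) * (M * b) = int m * (c + (r + 1) * a)"
      using that by (simp add: M_def[symmetric] M(1)) (simp add: r algebra_simps)
    then show ?thesis unfolding T v nmul_vec mL.simps by blast
  qed
  have 2: "nmul m my \<notin> mL m T" if e
  proof
    assume N: "nmul m my \<in> mL m T"
    have "nmul m my = (0, int m, 0, 0)" by simp
    then obtain i j k where "0 = 2 * i" "int m = 2 * j" "0 + (1 + M) * i + of_bool e * M * j = int m * k"
      using N unfolding T mL.simps M_def by auto
    then have "0 = 2 * i" "int m = 2 * j" "(1 + M) * i + M * j = int m * k" using that by simp_all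
    then have "M * M = M * (2 * k)" using M(1) by simp
    then have "M = 2 * k" using M(3) by simp
    then show False using M(2) by simp
  qed
  show ?thesis unfolding inv_exp_iff using 1 2 by blast
qed

text \<open>With \<open>h = m / 4\<close>, \<open>(m / 2) x = h (2 x)\<close> is \<open>- h\<close>
  times the coefficient times \<open>c\<close>. As \<open>c\<close> has order \<open>2 h\<close>, it
  vanishes exactly when the coefficient is even.\<close>

lemma exp_MA': "T = MA' e \<Longrightarrow> inv_exp m B" "T = MA' e \<Longrightarrow> inv_exp (m div 2) B \<longleftrightarrow> even (MA'_coeff m e)"
proof -
  assume T: "T = MA' e"
  define h where "h = int m div 4"
  have m4: "m mod 8 = 4" using T_types T by (simp add: types_def split: if_splits)
  have "m = 8 * (m div 8) + 4" using m4 mod_mult_div_eq[of m 8] by simp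
  then obtain k where k: "m = 8 * k + 4" by blast
  have hk: "h = 2 * int k + 1" by (simp add: h_def k)
  have h: "int m = 4 * h" "int m div 2 = 2 * h" "int (m div 2) = 2 * h" "h > 0"
    unfolding hk k by simp_all
  show "inv_exp m B" unfolding inv_exp_iff
  proof
    fix v :: vec
    obtain a b c d where v: "v = (a, b, c, d)" by (cases v)
    have "int m * a = 2 * (2 * h * a) \<and> even (int m * b) \<and> even (int m * d) \<and>
        int m * c - MA'_coeff m e * (2 * h * a) = int m div 2 * (2 * c - MA'_coeff m e * a)"
      unfolding h(2) by (simp add: h(1) algebra_simps)
    then show "nmul m v \<in> mL m T" unfolding T v nmul_vec mL.simps by blast
  qed
  have 1: "nmul (m div 2) v \<in> mL m T" if ev: "even (MA'_coeff m e)" for v :: vec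
  proof -
    obtain a b c d where v: "v = (a, b, c, d)" by (cases v)
    obtain A where A: "MA'_coeff m e = 2 * A" using ev by (rule evenE)
    have "int (m div 2) * a = 2 * (h * a) \<and> even (int (m div 2) * b) \<and> even (int (m div 2) * d) \<and>
        int (m div 2) * c - MA'_coeff m e * (h * a) = int m div 2 * (c - A * a)"
      unfolding h A by (simp add: algebra_simps)
    then show ?thesis unfolding T v nmul_vec mL.simps by blast
  qed
  have 2: "even (MA'_coeff m e)" if "nmul (m div 2) mx \<in> mL m T"
  proof -
    have "nmul (m div 2) mx = (2 * h, 0, 0, 0)" using h(3) by simp
    then have "\<exists>i k. 2 * h = 2 * i \<and> even (0::int) \<and> even (0::int) \<and> 0 - MA'_coeff m e * i = 2 * h * k"
      using that unfolding T mL.simps h(2) by simp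
    then obtain k where "0 - MA'_coeff m e * h = 2 * h * k" by auto
    then have "h * MA'_coeff m e = h * (2 * (- k))" by (simp add: algebra_simps)
    then have "MA'_coeff m e = 2 * (- k)" by (metis h(4) less_irrefl mult_left_cancel)
    then show ?thesis by (metis dvd_triv_left)
  qed
  show "inv_exp (m div 2) B \<longleftrightarrow> even (MA'_coeff m e)" unfolding inv_exp_iff using 1 2 by blast
qed

end

text \<open>The two coefficients differ by the odd number \<open>m / 4\<close>.\<close>

lemma MA'_coeff_parity: "m mod 8 = 4 \<Longrightarrow> even (MA'_coeff m e) = even (MA'_coeff m e') \<Longrightarrow> e = e'"
proof -
  assume m: "m mod 8 = 4" and p: "even (MA'_coeff m e) = even (MA'_coeff m e')"
  have "odd (int m div 4)" using m by presburger
  then show ?thesis using p by (cases e; cases e') (auto simp: MA'_coeff_def)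
qed

text \<open>\<open>inv_self\<close> isolates \<open>M1\<close> and \<open>M2\<close>, and
  \<open>inv_double\<close> isolates \<open>MB\<close> among the rest. Additive exponents,
  \<open>inv_triv\<close>, \<open>inv_square\<close> and \<open>inv_fixed\<close> settle the other
  pairs, apart from those that no single \<open>m\<close> admits.\<close>

theorem type_unique:
  assumes B: "typed_brace m T B X Y F" and C: "typed_brace m T' C X' Y' F'"
    and iso: "brace_isomorphic B C"
  shows "T = T'"
proof -
  interpret B: typed_brace m T B X Y F by fact
  interpret C: typed_brace m T' C X' Y' F' by fact
  note I = brace_isomorphic_invariants[OF B.brace_axioms C.brace_axioms iso]
  have ty: "T \<in> types m" "T' \<in> types m" by (rule B.T_types C.T_types)+
  have self: "(\<exists>e. T = M1 e) \<or> T = M2 \<longleftrightarrow> (\<exists>e. T' = M1 e) \<or> T' = M2"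
    using B.self_iff C.self_iff I(2) by simp
  have MA_M3: "\<not> (MA e \<in> types m \<and> M3 e' \<in> types m)" "\<not> (MA e \<in> types m \<and> MA' e' \<in> types m)" for e e'
  proof -
    have "m mod 8 \<noteq> 4" if "m mod 4 = 2" using that by presburger
    then show "\<not> (MA e \<in> types m \<and> M3 e' \<in> types m)" "\<not> (MA e \<in> types m \<and> MA' e' \<in> types m)"
      by (auto simp: types_def split: if_splits)
  qed
  have CE: "e = e'" if T: "T = MA' e" "T' = MA' e'" for e e'
  proof -
    have "m mod 8 = 4" using ty(1) T(1) by (simp add: types_def split: if_splits)
    then show ?thesis using MA'_coeff_parity B.exp_MA'(2)[OF T(1)] C.exp_MA'(2)[OF T(2)] I(1)[of "m div 2"] by blast
  qed
  show ?thesis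
  proof (cases T)
    case (M1 e)
    then show ?thesis using self B.exp_2m(1)[OF M1] C.exp_2m(2) I(1)[of "2 * m"] B.triv_iff[OF M1] C.triv_iff I(3) by auto
  next
    case M2
    then show ?thesis using self B.exp_2m(2)[OF M2] C.exp_2m(1) I(1)[of "2 * m"] by auto
  next
    case (M3 e)
    then show ?thesis
      using self B.double_M3[OF M3] C.double_MB I(4) B.exp_m_M3[OF M3] C.exp_MA'(1) I(1)[of m] MA_M3(1) ty
        B.fixed_M3[OF M3] C.fixed_M3 I(6)
      by (cases T') auto
  next
    case (MB e)
    then show ?thesis
      using self B.double_MB[OF MB] C.double_M3 C.double_MA C.double_MA' I(4) B.square_MB[OF MB] C.square_MB I(5)
      by (cases T') auto
  next
    case (MA e)
    then show ?thesis
      using self B.double_MA[OF MA] C.double_MB I(4) MA_M3 ty B.exp_m_MA[OF MA] C.exp_m_MA I(1)[of m]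
      by (cases T') auto
  next
    case (MA' e)
    then show ?thesis
      using self B.double_MA'[OF MA'] C.double_MB I(4) MA_M3 ty B.exp_MA'(1)[OF MA'] C.exp_m_M3 I(1)[of m] CE[OF MA']
      by (cases T') auto
  qed
qed

section \<open>Classification\<close>

context quaternion_module
begin

text \<open>An additive \<open>E\<close> that kills \<open>L\<close> and matches the generators has
  kernel exactly \<open>L\<close>: modulo \<open>L\<close> every vector lies in the orbit of
  \<open>0\<close>, and \<open>E\<close> carries it to the corresponding point of the brace, which
  is zero only for a rotation with exponent divisible by \<open>2 m\<close>.\<close>

lemma modelled_of_embedding:
  assumes N: "N = 2 * m" and model: "quaternion_model L l u vx vy m"
    and E_add: "\<And>v w. E (v + w) = E v + E w"
    and E_l: "\<And>v. E (l v) = \<Lambda> x (E v)" and E_u: "\<And>v. E (u v) = \<Lambda> y (E v)"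
    and E_x: "E vx = \<iota> x" and E_y: "E vy = \<iota> y" and E_L: "\<And>v. v \<in> L \<Longrightarrow> E v = 0"
  shows "\<exists>F. modelled_brace L l u vx vy m B x y F"
proof -
  interpret Q: quaternion_model L l u vx vy m by fact
  have E0: "E 0 = 0" using E_add[of 0 0] by simp
  have E_minus: "E (- v) = - E v" for v using E_add[of v "- v"] by (simp add: E0 eq_neg_iff_add_eq_0 add.commute)
  have E_diff: "E (v - w) = E v - E w" for v w using E_add[of v "- w"] by (simp add: E_minus)
  have E_lpow: "E ((l ^^ i) v) = (\<Lambda> x ^^ i) (E v)" for i v by (induction i) (simp_all add: E_l)
  have E_f: "E (Q.f i) = M.f i" for i by (induction i) (simp_all add: E0 Q.f_Suc M.f_Suc E_add E_lpow E_x)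
  have cgE: "E v = E w" if "Q.cg v w" for v w using E_L[of "v - w"] that by (simp add: Q.cg_def E_diff)
  have ker: "v \<in> L" if v: "E v = 0" for v
  proof (rule Q.surj'[of v])
    fix i assume vi: "Q.cg v (Q.f i)"
    then have "M.f i = 0" using cgE v by (simp add: E_f)
    then have "Q.f i \<in> L" by (simp add: M.f_eq_0_iff Q.f_L N)
    then show ?thesis using vi Q.cg_0 Q.cg_trans by blast
  next
    fix i assume "Q.cg v (Q.f i + (l ^^ i) vy)"
    then have "M.f i + (\<Lambda> x ^^ i) (\<iota> y) = 0" using cgE v by (simp add: E_f E_add E_lpow E_y)
    then show ?thesis using M.f_neq[of 0 i] by simp
  qed
  have cgI: "Q.cg v w" if "E v = E w" for v w using ker[of "v - w"] that by (simp add: Q.cg_def E_diff)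
  have ex: "\<exists>v. E v = \<iota> a" if "a \<in> carrier B" for a
    using that
  proof (cases rule: carrier_cases)
    case (rot i)
    then show ?thesis using E_f[of i] by (auto simp: M_f)
  next
    case (refl i)
    then have "E (Q.f i + (l ^^ i) vy) = \<iota> a" by (simp add: E_add E_f E_lpow E_y M_f iota_mult Lambda_pow)
    then show ?thesis by blast
  qed
  define F where "F a = (SOME v. E v = \<iota> a)" for a
  have F: "E (F a) = \<iota> a" if "a \<in> carrier B" for a using someI_ex[OF ex[OF that]] by (simp add: F_def)
  have "modelled_brace L l u vx vy m B x y F"
  proof (intro modelled_brace.intro model quaternion_brace_axioms modelled_brace_axioms.intro)
    fix a b assume a: "a \<in> carrier B"
    show "Q.cg (F (a \<oplus> b)) (F a + F b)" if "b \<in> carrier B"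
      using a that by (intro cgI) (simp add: F E_add iota_add)
    show "a = \<one>" if "Q.cg (F a) 0"
      using cgE[OF that] F[OF a] iota_inj[OF N a one_closed] by (simp add: E0 iota_one)
    show "Q.cg (F (x \<otimes> a)) (vx + l (F a))" using a by (intro cgI) (simp add: F E_add E_x E_l iota_mult)
    show "Q.cg (F (y \<otimes> a)) (vy + u (F a))" using a by (intro cgI) (simp add: F E_add E_y E_u iota_mult)
  next
    fix v
    have "\<exists>a\<in>carrier B. \<iota> a = E v"
    proof (rule Q.surj'[of v])
      fix i assume "Q.cg v (Q.f i)"
      then show ?thesis using cgE E_f[of i] by (intro bexI[of _ "x [^] i"]) (simp_all add: M_f)
    next
      fix i assume "Q.cg v (Q.f i + (l ^^ i) vy)"
      then have "E v = \<iota> (x [^] i \<otimes> y)" using cgE by (simp add: E_add E_f E_lpow E_y M_f iota_mult Lambda_pow)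
      then show ?thesis by (intro bexI[of _ "x [^] i \<otimes> y"]) simp_all
    qed
    then show "\<exists>a\<in>carrier B. Q.cg (F a) v" using cgI F by metis
  qed
  then show ?thesis by blast
qed

definition E where
  "E e3 e4 = (\<lambda>(a::int, b::int, c::int, d::int). of_int a * \<iota> x + of_int b * \<iota> y + of_int c * e3 + of_int d * e4)"

lemma E_simp [simp]: "E e3 e4 (a, b, c, d) = of_int a * \<iota> x + of_int b * \<iota> y + of_int c * e3 + of_int d * e4"
  by (simp add: E_def)

lemma E_add: "E e3 e4 (v + w) = E e3 e4 v + E e3 e4 w"
  by (cases v; cases w) (simp add: algebra_simps)

section \<open>Fitting the brace to each of the models\<close>

abbreviation "modelled T \<equiv> \<exists>F. modelled_brace (mL m T) (ml m T) (mu m T) mx my m B x y F"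

lemma modelledI:
  assumes N: "N = 2 * m" and model: "model m T"
    and l: "\<And>a b c d. E e3 e4 (ml m T (a, b, c, d)) =
      of_int a * \<Lambda> x (\<iota> x) + of_int b * \<Lambda> x (\<iota> y) + of_int c * \<Lambda> x e3 + of_int d * \<Lambda> x e4"
    and u: "\<And>a b c d. E e3 e4 (mu m T (a, b, c, d)) =
      of_int a * \<Lambda> y (\<iota> x) + of_int b * \<Lambda> y (\<iota> y) + of_int c * \<Lambda> y e3 + of_int d * \<Lambda> y e4"
    and L: "\<And>a b c d. (a, b, c, d) \<in> mL m T \<Longrightarrow> E e3 e4 (a, b, c, d) = 0"
  shows "modelled T"
proof (rule modelled_of_embedding[OF N model, of "E e3 e4"])
  fix v w :: vec
  obtain a b c d where v: "v = (a, b, c, d)" by (cases v)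
  show "E e3 e4 (v + w) = E e3 e4 v + E e3 e4 w" by (rule E_add)
  show "E e3 e4 (ml m T v) = \<Lambda> x (E e3 e4 v)" unfolding v l by simp
  show "E e3 e4 (mu m T v) = \<Lambda> y (E e3 e4 v)" unfolding v u by simp
  show "E e3 e4 v = 0" if "v \<in> mL m T" using L that unfolding v by blast
qed simp_all

lemma modelled_M:
  assumes N: "N = 2 * m" and m: "m > 0" and t: "2 * of_nat m * \<iota> x = 0" and ft: "M.f m = of_nat m * \<iota> x"
    and lx: "\<Lambda> x (\<iota> x) = \<iota> x + of_bool s * (of_nat m * \<iota> x)"
    and ly: "\<Lambda> x (\<iota> y) = \<iota> y + of_bool e * (of_nat m * \<iota> x)"
    and lt: "\<Lambda> x (of_nat m * \<iota> x) = of_nat m * \<iota> x" and y: "2 * \<iota> y = 0"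
    and T: "T = (if s then M3 e else M1 e)" and model: "model m T"
  shows "modelled T"
proof (rule modelledI[OF N model, of 0 0])
  define tt where "tt = of_nat m * \<iota> x"
  have tt: "tt + tt = 0" using t unfolding tt_def by (metis mult.assoc mult_2)
  have ttn: "- tt = tt" using tt by (rule Groups.group_add_class.minus_unique)
  have l't: "\<Lambda> (inv x) tt = tt" using lt M.l'_l[of tt] unfolding tt_def by simp
  have l'x: "\<Lambda> (inv x) (\<iota> x) = \<iota> x - of_bool s * tt"
  proof -
    have "\<iota> x = \<Lambda> (inv x) (\<Lambda> x (\<iota> x))" by simp
    also have "\<dots> = \<Lambda> (inv x) (\<iota> x) + of_bool s * tt" unfolding lx by (cases s) (simp_all add: l't flip: tt_def)
    finally show ?thesis by (simp add: algebra_simps)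
  qed
  have l'y: "\<Lambda> (inv x) (\<iota> y) = \<iota> y - of_bool e * tt"
  proof -
    have "\<iota> y = \<Lambda> (inv x) (\<Lambda> x (\<iota> y))" by simp
    also have "\<dots> = \<Lambda> (inv x) (\<iota> y) + of_bool e * tt" unfolding ly by (cases e) (simp_all add: l't flip: tt_def)
    finally show ?thesis by (simp add: algebra_simps)
  qed
  have ux: "\<Lambda> y (\<iota> x) = of_bool s * tt + of_bool e * tt - \<iota> x"
  proof -
    have "\<Lambda> y (\<iota> x) = of_bool s * tt + of_bool e * (- tt) - \<iota> x" unfolding M.u_x l'x l'y by (simp add: algebra_simps)
    then show ?thesis by (simp only: ttn)
  qed
  have uy: "\<Lambda> y (\<iota> y) = tt - \<iota> y" using M.u_y' ft by (simp add: tt_def)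
  fix a b c d :: int
  show "E 0 0 (ml m T (a, b, c, d)) = of_int a * \<Lambda> x (\<iota> x) + of_int b * \<Lambda> x (\<iota> y) + of_int c * \<Lambda> x 0 + of_int d * \<Lambda> x 0"
    unfolding lx ly T by (cases s) (simp_all add: algebra_simps)
  show "E 0 0 (mu m T (a, b, c, d)) = of_int a * \<Lambda> y (\<iota> x) + of_int b * \<Lambda> y (\<iota> y) + of_int c * \<Lambda> y 0 + of_int d * \<Lambda> y 0"
    unfolding ux uy T by (cases s) (simp_all add: tt_def algebra_simps)
  assume "(a, b, c, d) \<in> mL m T"
  then obtain i j where "a = 2 * int m * i" "b = 2 * j" unfolding T by (cases s) (auto elim!: dvdE evenE)
  then have "E 0 0 (a, b, c, d) = of_int i * (2 * of_nat m * \<iota> x) + of_int j * (2 * \<iota> y)"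
    by (simp add: algebra_simps)
  then show "E 0 0 (a, b, c, d) = 0" by (simp only: t y mult_zero_right add_0)
qed

lemma modelled_M2:
  assumes N: "N = 2 * m" and ft: "M.f m = of_nat m * \<iota> x"
    and lx: "\<Lambda> x (\<iota> x) = \<iota> x" and ly: "\<Lambda> x (\<iota> y) = \<iota> y" and y: "2 * \<iota> y = \<iota> x"
  shows "modelled M2"
proof (rule modelledI[OF N model_M2[OF m_pos], of 0 0])
  have l': "\<Lambda> (inv x) (\<iota> x) = \<iota> x" "\<Lambda> (inv x) (\<iota> y) = \<iota> y"
    using M.l'_l[of "\<iota> x"] M.l'_l[of "\<iota> y"] by (simp_all only: lx ly)
  have ux: "\<Lambda> y (\<iota> x) = - \<iota> x" unfolding M.u_x l' by simp
  have uy: "\<Lambda> y (\<iota> y) = of_nat m * \<iota> x - \<iota> y" using M.u_y' ft by simp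
  fix a b c d :: int
  show "E 0 0 (ml m M2 (a, b, c, d)) = of_int a * \<Lambda> x (\<iota> x) + of_int b * \<Lambda> x (\<iota> y) + of_int c * \<Lambda> x 0 + of_int d * \<Lambda> x 0"
    unfolding lx ly by simp
  show "E 0 0 (mu m M2 (a, b, c, d)) = of_int a * \<Lambda> y (\<iota> x) + of_int b * \<Lambda> y (\<iota> y) + of_int c * \<Lambda> y 0 + of_int d * \<Lambda> y 0"
    unfolding ux uy by (simp add: algebra_simps)
  assume "(a, b, c, d) \<in> mL m M2"
  then obtain i where i: "2 * a + b = 4 * int m * i" by (auto elim: dvdE)
  have "E 0 0 (a, b, c, d) = of_int (2 * a + b) * \<iota> y" by (simp add: y[symmetric] algebra_simps)
  also have "\<dots> = of_int i * (of_nat (4 * m) * \<iota> y)" unfolding i by (simp add: algebra_simps)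
  also have "\<dots> = 0" by (simp only: iota_order y_closed mult_zero_right)
  finally show "E 0 0 (a, b, c, d) = 0" .
qed

lemma modelled_MB:
  assumes N: "N = 2 * m" and m: "even m" "e \<or> 4 dvd m"
    and lx: "\<Lambda> x (\<iota> x) = \<iota> x + \<iota> y" and ly: "\<Lambda> x (\<iota> y) = (1 + 2 * of_bool e) * \<iota> y"
    and y: "4 * \<iota> y = 0" "M.f m = 2 * \<iota> y"
    and rel: "of_nat m * \<iota> x + of_int (int (m div 2) - 2) * \<iota> y = 0"
  shows "modelled (MB e)"
proof (rule modelledI[OF N model_MB[OF m_pos m], of 0 0])
  have l'y: "\<Lambda> (inv x) (\<iota> y) = (1 + 2 * of_bool e) * \<iota> y"
  proof (cases e)
    case True
    have "\<Lambda> x (3 * \<iota> y) = 3 * (3 * \<iota> y)" by (simp add: ly True)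
    also have "3 * (3 * \<iota> y) = \<iota> y" by (rule ring_cert_1[OF y(1), of _ _ 2]) (simp add: algebra_simps)
    finally have "\<Lambda> x (3 * \<iota> y) = \<iota> y" .
    then show ?thesis using M.l'_l[of "3 * \<iota> y"] True by simp
  next
    case False
    then show ?thesis using M.l'_l[of "\<iota> y"] ly by simp
  qed
  have l'x: "\<Lambda> (inv x) (\<iota> x) = \<iota> x - \<Lambda> (inv x) (\<iota> y)"
    using arg_cong[OF lx, of "\<Lambda> (inv x)"] by (simp add: algebra_simps)
  have ux: "\<Lambda> y (\<iota> x) = \<iota> y - \<iota> x"
    unfolding M.u_x l'x l'y
    by (rule ring_cert_1[OF y(1), of _ _ "of_bool e"]) (simp add: algebra_simps)
  have uy: "\<Lambda> y (\<iota> y) = \<iota> y" using M.u_y' y(2) by simp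
  fix a b c d :: int
  show "E 0 0 (ml m (MB e) (a, b, c, d)) = of_int a * \<Lambda> x (\<iota> x) + of_int b * \<Lambda> x (\<iota> y) + of_int c * \<Lambda> x 0 + of_int d * \<Lambda> x 0"
    unfolding lx ly by (cases e) (simp_all add: algebra_simps)
  show "E 0 0 (mu m (MB e) (a, b, c, d)) = of_int a * \<Lambda> y (\<iota> x) + of_int b * \<Lambda> y (\<iota> y) + of_int c * \<Lambda> y 0 + of_int d * \<Lambda> y 0"
    unfolding ux uy by (simp add: algebra_simps)
  assume "(a, b, c, d) \<in> mL m (MB e)"
  then obtain i j where ij: "a = int m * i" "b = (int m div 2 - 2) * i + 4 * j" by auto
  define M where "M = int m div 2"
  have "int (m div 2) = M" by (simp add: M_def zdiv_int)
  then have rel': "of_nat m * \<iota> x + of_int (M - 2) * \<iota> y = 0" using rel by (simp only:)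
  have "E 0 0 (a, b, c, d) = of_int i * (of_nat m * \<iota> x + of_int (M - 2) * \<iota> y) + of_int j * (4 * \<iota> y)"
    unfolding ij M_def[symmetric] by (simp add: algebra_simps)
  then show "E 0 0 (a, b, c, d) = 0" by (simp only: rel' y mult_zero_right add_0)
qed

lemma modelled_MA:
  assumes N: "N = 2 * m" and m: "even m"
    and p: "p = \<iota> x + \<Lambda> x (\<iota> x)" "\<Lambda> x p = p" and llx: "\<Lambda> x (\<Lambda> x (\<iota> x)) = \<iota> x"
    and x: "2 * \<iota> x = of_int (1 + int (m div 2)) * p" and p0: "of_int (2 * int (m div 2)) * p = 0"
    and t: "M.f m = of_nat (m div 2) * p" and ly: "\<Lambda> x (\<iota> y) = \<iota> y"
    and y: "2 * \<iota> y = of_bool e * (of_nat (m div 2) * p)"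
  shows "modelled (MA e)"
proof (rule modelledI[OF N model_MA[OF m_pos m], of p 0])
  have M: "int m div 2 = int (m div 2)" "int m = 2 * int (m div 2)" using m by (simp_all add: zdiv_int)
  have lx: "\<Lambda> x (\<iota> x) = p - \<iota> x" using p(1) by simp
  have "\<Lambda> (inv x) (\<Lambda> x (\<Lambda> x (\<iota> x))) = \<Lambda> x (\<iota> x)" by simp
  then have "\<Lambda> (inv x) (\<iota> x) = \<Lambda> x (\<iota> x)" unfolding llx .
  then have l'x: "\<Lambda> (inv x) (\<iota> x) = p - \<iota> x" unfolding lx .
  have l'y: "\<Lambda> (inv x) (\<iota> y) = \<iota> y" using M.l'_l[of "\<iota> y"] by (simp only: ly)
  have l'p: "\<Lambda> (inv x) p = p" using M.l'_l[of p] by (simp only: p(2))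
  have ux: "\<Lambda> y (\<iota> x) = \<iota> x - p" unfolding M.u_x l'x l'y by simp
  have "\<Lambda> y (\<Lambda> x (\<iota> x)) = \<Lambda> (inv x) (\<iota> x - p)" by (simp only: M.u_l ux)
  then have "\<Lambda> y (\<Lambda> x (\<iota> x)) = - \<iota> x" by (simp add: l'x l'p)
  moreover have "\<Lambda> y p = \<Lambda> y (\<iota> x) + \<Lambda> y (\<Lambda> x (\<iota> x))"
    unfolding p(1) by (rule additive.add[OF M.u_additive])
  ultimately have up: "\<Lambda> y p = - p" using ux by simp
  have uy: "\<Lambda> y (\<iota> y) = of_nat (m div 2) * p - \<iota> y" using M.u_y' t by simp
  fix a b c d :: int
  show "E p 0 (ml m (MA e) (a, b, c, d)) = of_int a * \<Lambda> x (\<iota> x) + of_int b * \<Lambda> x (\<iota> y) + of_int c * \<Lambda> x p + of_int d * \<Lambda> x 0"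
    unfolding lx ly p(2) by (simp add: algebra_simps)
  show "E p 0 (mu m (MA e) (a, b, c, d)) = of_int a * \<Lambda> y (\<iota> x) + of_int b * \<Lambda> y (\<iota> y) + of_int c * \<Lambda> y p + of_int d * \<Lambda> y 0"
    unfolding ux uy up mu.simps M(1) by (simp add: algebra_simps)
  assume "(a, b, c, d) \<in> mL m (MA e)"
  then obtain i j k where ij: "a = 2 * i" "b = 2 * j" "c + (1 + int m div 2) * i + of_bool e * (int m div 2) * j = int m * k"
    by auto
  have c: "c = int m * k - (1 + int m div 2) * i - of_bool e * (int m div 2) * j" using ij(3) by simp
  have "E p 0 (a, b, c, d) = of_int i * (2 * \<iota> x) + of_int j * (2 * \<iota> y) + of_int c * p"
    unfolding ij(1,2) by (simp add: algebra_simps)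
  also have "\<dots> = of_int k * (of_int (2 * int (m div 2)) * p)"
    unfolding x y c M(1) by (subst M(2)) (cases e; simp add: algebra_simps)
  finally show "E p 0 (a, b, c, d) = 0" by (simp only: p0 mult_zero_right)
qed

lemma modelled_MA':
  assumes N: "N = 2 * m" and m: "m mod 8 = 4"
    and v: "v = \<Lambda> x (\<iota> x) - \<iota> x" and lv: "\<Lambda> x v = v + \<iota> y"
    and ly: "\<Lambda> x (\<iota> y) = \<iota> y + of_nat (m div 4) * c" and lc: "\<Lambda> x c = c" and uc: "\<Lambda> y c = - c"
    and v2: "2 * v = 0" and y2: "2 * \<iota> y = 0" and c0: "of_nat (2 * (m div 4)) * c = 0"
    and x: "2 * \<iota> x = - (of_int (MA'_coeff m e) * c)" and t: "M.f m = of_nat (m div 4) * c"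
  shows "modelled (MA' e)"
proof (rule modelledI[OF N model_MA'[OF m], of c v])
  define s where "s = of_nat (m div 4) * c"
  have s2: "s + s = 0" using c0 by (simp add: s_def algebra_simps)
  have sn: "- s = s" using s2 by (rule Groups.group_add_class.minus_unique)
  have vn: "- v = v" using v2 by (intro Groups.group_add_class.minus_unique) (simp only: mult_2)
  have yn: "- \<iota> y = \<iota> y" using y2 by (intro Groups.group_add_class.minus_unique) (simp only: mult_2)
  have l'c: "\<Lambda> (inv x) c = c" using M.l'_l[of c] by (simp only: lc)
  have l's: "\<Lambda> (inv x) s = s" by (simp add: s_def l'c)
  have lx: "\<Lambda> x (\<iota> x) = \<iota> x + v" by (simp add: v)
  have l'y: "\<Lambda> (inv x) (\<iota> y) = \<iota> y - s"
    using arg_cong[OF ly[folded s_def], of "\<Lambda> (inv x)"] by (simp add: l's algebra_simps)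
  have l'v: "\<Lambda> (inv x) v = v - (\<iota> y - s)"
  proof -
    have "v = \<Lambda> (inv x) (v + \<iota> y)" using M.l'_l[of v] by (simp only: lv)
    then have "\<Lambda> (inv x) v + (\<iota> y - s) = v"
      unfolding additive.add[OF M.l'_additive] l'y by (rule sym)
    then show ?thesis unfolding eq_diff_eq .
  qed
  have l'x: "\<Lambda> (inv x) (\<iota> x) = \<iota> x - (v - (\<iota> y - s))"
  proof -
    have "\<iota> x = \<Lambda> (inv x) (\<iota> x + v)" using M.l'_l[of "\<iota> x"] by (simp only: lx)
    then have "\<Lambda> (inv x) (\<iota> x) + (v - (\<iota> y - s)) = \<iota> x"
      unfolding additive.add[OF M.l'_additive] l'v by (rule sym)
    then show ?thesis unfolding eq_diff_eq .
  qed
  have ux: "\<Lambda> y (\<iota> x) = v + \<iota> y - \<iota> x"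
    unfolding M.u_x l'x l'y by (rule ring_cert_1[OF y2, of _ _ "- 1"]) (simp add: algebra_simps)
  have uv: "\<Lambda> y v = v + s"
  proof -
    have "\<Lambda> y v = \<Lambda> y (\<Lambda> x (\<iota> x) - \<iota> x)" by (rule arg_cong[OF v])
    also have "\<dots> = \<Lambda> y (\<Lambda> x (\<iota> x)) - \<Lambda> y (\<iota> x)" by (rule additive.diff[OF M.u_additive])
    also have "\<dots> = \<Lambda> (inv x) (v + \<iota> y - \<iota> x) - (v + \<iota> y - \<iota> x)" by (simp only: M.u_l ux)
    also have "\<dots> = v + s"
      by (rule ring_cert_1[OF y2, of _ _ "- 1"]) (simp add: l'v l'x l'y algebra_simps)
    finally show ?thesis .
  qed
  have uy: "\<Lambda> y (\<iota> y) = \<iota> y + s" unfolding M.u_y' t s_def[symmetric]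
    by (metis add.commute diff_conv_add_uminus yn)
  have h: "int m div 4 = int (m div 4)" by (simp add: zdiv_int)
  fix a b c' d :: int
  show "E c v (ml m (MA' e) (a, b, c', d)) = of_int a * \<Lambda> x (\<iota> x) + of_int b * \<Lambda> x (\<iota> y) + of_int c' * \<Lambda> x c + of_int d * \<Lambda> x v"
    unfolding lx ly lc lv ml.simps h by (simp add: algebra_simps)
  show "E c v (mu m (MA' e) (a, b, c', d)) = of_int a * \<Lambda> y (\<iota> x) + of_int b * \<Lambda> y (\<iota> y) + of_int c' * \<Lambda> y c + of_int d * \<Lambda> y v"
    unfolding ux uy uc uv mu.simps h by (simp add: s_def algebra_simps)
  assume "(a, b, c', d) \<in> mL m (MA' e)"
  then obtain i k b2 d2 where ij: "a = 2 * i" "b = 2 * b2" "d = 2 * d2" "c' - MA'_coeff m e * i = int m div 2 * k"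
    by (auto elim!: evenE)
  have "m = 8 * (m div 8) + 4" using m mod_mult_div_eq[of m 8] by simp
  then obtain r where r: "m = 8 * r + 4" by blast
  have m2: "int m div 2 = int (2 * (m div 4))" unfolding r by simp
  have c': "c' = int (2 * (m div 4)) * k + MA'_coeff m e * i" using ij(4) unfolding m2 by simp
  have "E c v (a, b, c', d) = of_int i * (2 * \<iota> x) + of_int b2 * (2 * \<iota> y) + of_int c' * c + of_int d2 * (2 * v)"
    unfolding ij(1-3) by (simp add: algebra_simps)
  also have "\<dots> = of_int k * (of_nat (2 * (m div 4)) * c)"
    unfolding x y2 v2 c' by (simp add: algebra_simps)
  finally show "E c v (a, b, c', d) = 0" by (simp only: c0 mult_zero_right)
qed

end

lemma types_mem:
  "even m \<Longrightarrow> M1 e \<in> types m" "M1 False \<in> types m" "M2 \<in> types m"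
  "4 dvd m \<Longrightarrow> M3 e \<in> types m" "even m \<Longrightarrow> MB True \<in> types m" "4 dvd m \<Longrightarrow> MB e \<in> types m"
  "even m \<Longrightarrow> odd (m div 2) \<Longrightarrow> MA e \<in> types m" "m mod 8 = 4 \<Longrightarrow> MA' e \<in> types m"
proof -
  have 1: "even m \<and> m mod 4 \<noteq> 2" if "4 dvd m" using that by presburger
  have 2: "m mod 4 = 2" if "even m" "odd (m div 2)" using that by presburger
  have 3: "even m" if "m mod 8 = 4" using that by presburger
  show "even m \<Longrightarrow> M1 e \<in> types m" "M1 False \<in> types m" "M2 \<in> types m" "even m \<Longrightarrow> MB True \<in> types m"
    by (cases e; simp add: types_def)+
  show "4 dvd m \<Longrightarrow> M3 e \<in> types m" "4 dvd m \<Longrightarrow> MB e \<in> types m"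
    using 1 by (cases e; simp add: types_def)+
  show "even m \<Longrightarrow> odd (m div 2) \<Longrightarrow> MA e \<in> types m" using 2 by (cases e) (simp_all add: types_def)
  show "m mod 8 = 4 \<Longrightarrow> MA' e \<in> types m" using 3 by (cases e) (simp_all add: types_def)
qed

section \<open>The case distinction\<close>

context quaternion_odd_part
begin

lemma rename_odd_part: "quaternion_odd_part B m x (x [^] (i::nat) \<otimes> y) N \<iota> \<Lambda> k n"
  by (intro quaternion_odd_part.intro rename_module quaternion_odd_part_axioms.intro N_eq m_eq n_odd)

lemma refl_iota: "M.f i + (\<Lambda> x ^^ i) (\<iota> y) = \<iota> (x [^] i \<otimes> y)"
  by (simp add: M_f iota_mult Lambda_pow)

abbreviation "classified \<equiv> \<exists>T\<in>types m. \<exists>Y F. modelled_brace (mL m T) (ml m T) (mu m T) mx my m B x Y F"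

lemma classifiedI: "T \<in> types m \<Longrightarrow> \<exists>F. modelled_brace (mL m T) (ml m T) (mu m T) mx my m B x Y F \<Longrightarrow> classified"
  by blast

text \<open>For odd \<open>m\<close>, \<open>x = x^m x^(m+1)\<close> with \<open>x^m\<close> acting
  trivially and \<open>x^(m+1)\<close> in \<open>Gn\<close>, so the action of \<open>x\<close> is
  trivial. The \<open>2\<close>-part \<open>h\<close> of \<open>y\<close> serves as generator:
  \<open>4 h = 0\<close>, and the rotation \<open>2 h\<close> is \<open>0\<close> or
  \<open>m x\<close>.\<close>

lemma classify_odd:
  assumes "odd m"
  shows classified
proof -
  have k: "k = 0" using assms m_eq by (cases k) auto
  have trivG: "\<Lambda> a (\<iota> b) = \<iota> b" if a: "a \<in> Gn" and b: "b \<in> carrier B" for a b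
  proof -
    obtain a' h where h: "a' \<in> Gn" "h \<in> Gp" "b = a' \<otimes> h" using decompose[OF b] .
    have "\<iota> b = \<iota> a' + \<iota> h"
      using h tors_carrier by (simp add: iota_mult odd_even_commute(1))
    then show ?thesis using Lambda_Gn_Gn[OF a h(1)] odd_even_commute(1)[OF a h(2)] by (simp add: Lambda_add)
  qed
  have lx: "\<Lambda> x (\<iota> b) = \<iota> b" if b: "b \<in> carrier B" for b
  proof -
    have "2 dvd m + 1" using assms by simp
    then obtain j where "m + 1 = 2 * j" by (rule dvdE)
    then have G: "x [^] (m + 1) \<in> Gn" unfolding rots_Gn[symmetric] k by (auto simp: rots_def)
    have "m + (m + 1) = 2 * m * 1 + 1" by simp
    then have "x [^] (m + (m + 1)) = x [^] (1::nat)" unfolding x_pow_eq_iff by (simp only: mod_mult_self4)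
    then have "x = x [^] m \<otimes> x [^] (m + 1)" by (simp only: nat_pow_mult x_closed nat_pow_eone)
    then have "\<Lambda> x (\<iota> b) = \<Lambda> (x [^] m) (\<Lambda> (x [^] (m + 1)) (\<iota> b))"
      by (metis Lambda_mult nat_pow_closed x_closed)
    then show ?thesis by (simp only: trivG[OF G b] Lambda_t[OF b])
  qed
  obtain a h where h: "a \<in> Gn" "h \<in> Gp" "y = a \<otimes> h" using decompose[OF y_closed] .
  obtain j :: nat where a: "a = x [^] (2 ^ (k + 1) * j)" using h(1) by (rule Gn_elim)
  have hB: "h \<in> carrier B" using h tors_carrier by blast
  have "h = inv a \<otimes> y" using h(3) hB by (simp add: a m_assoc[symmetric])
  then obtain i :: nat where hi: "h = x [^] i \<otimes> y" unfolding a inv_x_pow by blast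
  interpret R: quaternion_odd_part B m x h N \<iota> \<Lambda> k n unfolding hi by (rule rename_odd_part)
  have "q = 4" unfolding q_def by (simp add: k)
  then have h4: "4 * \<iota> h = 0" using tors_iota[OF h(2)] by (simp only: of_nat_numeral)
  have lpow: "(\<Lambda> x ^^ i) (\<iota> b) = \<iota> b" if "b \<in> carrier B" for i b
    by (induction i) (simp_all add: lx that)
  have f: "M.f i = of_nat i * \<iota> x" for i
    by (induction i) (simp_all add: M.f_Suc lpow algebra_simps)
  have x0: "of_nat (2 * m) * \<iota> x = 0" using M.f_eq_0_iff[of "2 * m"] by (simp only: f N_eq dvd_refl)
  have "2 * \<iota> h = 0 \<or> 2 * \<iota> h = of_nat m * \<iota> x"
  proof -
    have "2 * \<iota> h \<in> \<iota> ` carrier B" using R.M.S_numeral[OF R.M.y_S] .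
    then show ?thesis
    proof (cases rule: R.M.S_cases)
      case (refl i)
      then have "M.f i + \<iota> h = 2 * \<iota> h" by (simp add: lpow hB)
      then have "M.f i = M.f 0 + (\<Lambda> x ^^ 0) (\<iota> h)" by (simp add: algebra_simps)
      then show ?thesis using R.M.f_neq by blast
    next
      case (rot i)
      have "M.f (2 * i) = 2 * M.f i" by (simp add: f)
      also have "\<dots> = 4 * \<iota> h" by (simp flip: rot)
      finally have "N dvd 2 * i" using h4 M.f_eq_0_iff by simp
      then have "m dvd i" by (simp add: N_eq)
      then obtain r where r: "i = m * r" by (rule dvdE)
      have e: "2 * \<iota> h = of_nat r * (of_nat m * \<iota> x)" using rot by (simp add: f r)
      show ?thesis
      proof (cases "even r")
        case True
        then obtain s where "r = 2 * s" by (rule evenE)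
        then have "2 * \<iota> h = of_nat s * (of_nat (2 * m) * \<iota> x)" using e by simp
        then show ?thesis using x0 by simp
      next
        case False
        then obtain s where "r = 2 * s + 1" by (rule oddE)
        then have "2 * \<iota> h = of_nat s * (of_nat (2 * m) * \<iota> x) + of_nat m * \<iota> x" using e by (simp add: algebra_simps)
        then show ?thesis by (simp only: x0 mult_zero_right add_0 simp_thms)
      qed
    qed
  qed
  then show ?thesis
  proof
    assume h2: "2 * \<iota> h = 0"
    have "R.modelled (M1 False)"
      by (rule R.modelled_M[of False False])
         (use N_eq m_pos x0 f lx hB h2 model_exists[OF m_pos types_mem(2)] lx[of "x [^] m"] in \<open>auto simp: Lambda_of_nat mult.assoc\<close>)
    then show ?thesis by (rule classifiedI[OF types_mem(2)])
  next
    assume h2: "2 * \<iota> h = of_nat m * \<iota> x"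
    \<comment> \<open>\<open>2 j = m + 1\<close> makes twice the new generator equal to
      \<open>(2 m + 1) x = x\<close>, as \<open>M2\<close> requires.\<close>
    define j where "j = (m + 1) div 2"
    have j: "2 * j = m + 1" using assms by (simp add: j_def)
    interpret R2: quaternion_odd_part B m x "x [^] j \<otimes> h" N \<iota> \<Lambda> k n by (rule R.rename_odd_part)
    have "2 * \<iota> (x [^] j \<otimes> h) = of_nat (2 * j) * \<iota> x + of_nat m * \<iota> x"
      using h2 hB by (simp add: iota_mult Lambda_pow lpow f distrib_left mult.assoc flip: M_f)
    also have "\<dots> = of_nat (2 * m) * \<iota> x + \<iota> x" unfolding j by (simp add: algebra_simps)
    also have "\<dots> = \<iota> x" by (simp only: x0 add_0)
    finally have "R2.modelled M2"
      by (intro R2.modelled_M2) (use N_eq f lx hB in simp_all)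
    then show ?thesis by (rule classifiedI[OF types_mem(3)])
  qed
qed

text \<open>The branching is on \<open>l x - x\<close>. A reflection leads to \<open>MB\<close>. For
  a rotation the exponent modulo \<open>4\<close> decides: \<open>0\<close> leads to
  \<open>M1\<close>, \<open>M2\<close> or \<open>M3\<close>, odd residues are impossible, and
  \<open>2\<close> leads to \<open>MA\<close> or \<open>MA'\<close>.\<close>

lemma classify_even:
  assumes even: "even m"
  shows classified
proof -
  have ex: "exact_module (\<Lambda> x) (\<Lambda> (inv x)) (\<Lambda> (x [^] i \<otimes> y)) (\<iota> x) (\<iota> (x [^] i \<otimes> y)) (\<iota> ` carrier B) N m (k + 2)" for i :: nat
  proof -
    interpret R: quaternion_odd_part B m x "x [^] i \<otimes> y" N \<iota> \<Lambda> k n by (rule rename_odd_part)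
    show ?thesis by (rule R.exact[OF even])
  qed
  interpret X: exact_module "\<Lambda> x" "\<Lambda> (inv x)" "\<Lambda> y" "\<iota> x" "\<iota> y" "\<iota> ` carrier B" N m "k + 2"
    by (rule exact[OF even])
  note modl = model_exists[OF m_pos]
  \<comment> \<open>The common ending of the cases with \<open>2 y' = 0\<close>: \<open>s\<close>
    records whether \<open>l\<close> moves \<open>x\<close> by \<open>t\<close>, and
    \<open>e\<close> whether it moves \<open>y'\<close>.\<close>
  have M: "classified"
    if tx: "X.t = of_nat m * \<iota> x" and lx: "\<Lambda> x (\<iota> x) = \<iota> x + of_bool s * X.t"
      and y': "y' = M.f i + (\<Lambda> x ^^ i) (\<iota> y)" and ly: "\<Lambda> x y' = y' \<or> \<Lambda> x y' = y' + X.t" and y2: "2 * y' = 0"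
      and m4: "s \<Longrightarrow> 4 dvd m" for s i y'
  proof -
    interpret R: quaternion_module B m x "x [^] i \<otimes> y" N \<iota> \<Lambda> by (rule rename_module)
    have yi: "y' = \<iota> (x [^] i \<otimes> y)" unfolding y' by (rule refl_iota)
    obtain e where e: "\<Lambda> x y' = y' + of_bool e * X.t" using ly by (metis add_0_right mult_1 mult_zero_left of_bool_eq(1,2))
    define T where "T = (if s then M3 e else M1 e)"
    have T: "T \<in> types m" using types_mem(1)[OF even] types_mem(4)[OF m4] by (simp add: T_def)
    have "R.modelled T"
    proof (rule R.modelled_M[OF N_eq m_pos _ _ _ _ _ _ T_def modl[OF T]])
      show "2 * of_nat m * \<iota> x = 0" using X.two_t unfolding tx by (simp only: mult.assoc)
      show "R.M.f m = of_nat m * \<iota> x" unfolding tx[symmetric] by (simp add: X.t_def)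
      show "\<Lambda> x (\<iota> x) = \<iota> x + of_bool s * (of_nat m * \<iota> x)" unfolding tx[symmetric] by (rule lx)
      show "\<Lambda> x (\<iota> (x [^] i \<otimes> y)) = \<iota> (x [^] i \<otimes> y) + of_bool e * (of_nat m * \<iota> x)"
        unfolding tx[symmetric] yi[symmetric] by (rule e)
      show "\<Lambda> x (of_nat m * \<iota> x) = of_nat m * \<iota> x" unfolding tx[symmetric] by simp
      show "2 * \<iota> (x [^] i \<otimes> y) = 0" unfolding yi[symmetric] by (rule y2)
    qed
    then show ?thesis by (rule classifiedI[OF T])
  qed
  have "\<Lambda> x (\<iota> x) - \<iota> x \<in> \<iota> ` carrier B" by (intro M.S_closed)
  then show ?thesis
  proof (cases rule: M.S_cases)
    case (refl i)
    then have v: "\<Lambda> x (\<iota> x) - \<iota> x = \<iota> (x [^] i \<otimes> y)" by (simp only: refl_iota)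
    interpret R: quaternion_module B m x "x [^] i \<otimes> y" N \<iota> \<Lambda> by (rule rename_module)
    interpret Z: exact_module "\<Lambda> x" "\<Lambda> (inv x)" "\<Lambda> (x [^] i \<otimes> y)" "\<iota> x" "\<iota> (x [^] i \<otimes> y)" "\<iota> ` carrier B" N m "k + 2"
      by (rule ex)
    note III = Z.case_III[OF v]
    obtain e where e: "\<Lambda> x (\<iota> (x [^] i \<otimes> y)) = (1 + 2 * of_bool e) * \<iota> (x [^] i \<otimes> y)" "e \<or> 4 dvd m"
    proof (cases "\<Lambda> x (\<iota> (x [^] i \<otimes> y)) = \<iota> (x [^] i \<otimes> y) \<and> 4 dvd m")
      case True
      then show ?thesis using that[of False] by simp
    next
      case False
      then have "\<Lambda> x (\<iota> (x [^] i \<otimes> y)) = \<iota> (x [^] i \<otimes> y) + 2 * \<iota> (x [^] i \<otimes> y)" using III(2,3) by metis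
      then show ?thesis using that[of True] by (simp add: distrib_right)
    qed
    have T: "MB e \<in> types m" using e(2) types_mem(5)[OF even] types_mem(6) by (cases e) simp_all
    have "R.modelled (MB e)"
    proof (rule R.modelled_MB[OF N_eq even e(2) _ e(1) III(1)])
      show "\<Lambda> x (\<iota> x) = \<iota> x + \<iota> (x [^] i \<otimes> y)" using v by (simp add: diff_eq_eq add.commute)
      show "R.M.f m = 2 * \<iota> (x [^] i \<otimes> y)" using III(2) by (simp only: Z.t_def)
      show "of_nat m * \<iota> x + of_int (int (m div 2) - 2) * \<iota> (x [^] i \<otimes> y) = 0" using III(4) by (simp only: Z.M_def)
    qed
    then show ?thesis by (rule classifiedI[OF T])
  next
    case (rot i)
    show ?thesis
    proof (cases rule: X.f_cases[of i])
      case (0 a)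
      then have v: "\<Lambda> x (\<iota> x) - \<iota> x = of_nat a * X.c" using rot by simp
      note I = X.case_I[OF v]
      from I(2) show ?thesis
      proof
        assume lx: "\<Lambda> x (\<iota> x) = \<iota> x"
        obtain i y' where y': "y' = M.f i + (\<Lambda> x ^^ i) (\<iota> y)" "2 * y' = 0 \<or> 2 * y' = \<iota> x \<and> \<Lambda> x y' = y'"
          "\<Lambda> x y' = y' \<or> \<Lambda> x y' = y' + X.t" using X.case_Ia[OF lx] .
        from y'(2) show ?thesis
        proof
          assume "2 * y' = 0"
          then show ?thesis using M[of False y' i] I(3) lx y' by simp
        next
          assume y2: "2 * y' = \<iota> x \<and> \<Lambda> x y' = y'"
          interpret R: quaternion_module B m x "x [^] i \<otimes> y" N \<iota> \<Lambda> by (rule rename_module)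
          have yi: "y' = \<iota> (x [^] i \<otimes> y)" unfolding y' by (rule refl_iota)
          have "R.modelled M2"
            by (rule R.modelled_M2[OF N_eq])
               (use I(3) lx y2 in \<open>simp_all add: X.t_def flip: yi\<close>)
          then show ?thesis by (rule classifiedI[OF types_mem(3)])
        qed
      next
        assume lx: "\<Lambda> x (\<iota> x) = \<iota> x + X.t \<and> 4 dvd m"
        obtain i y' where y': "y' = M.f i + (\<Lambda> x ^^ i) (\<iota> y)" "2 * y' = 0"
          "\<Lambda> x y' = y' \<or> \<Lambda> x y' = y' + X.t" using X.case_Ib[OF conjunct1[OF lx] v] .
        show ?thesis using M[of True y' i] I(3) lx y' by simp
      qed
    next
      case (1 a)
      then show ?thesis using X.diff_not_odd[of i] rot by simp
    next
      case (3 a)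
      then have "odd i" by simp
      then show ?thesis using X.diff_not_odd[of i] rot by simp
    next
      case (2 a)
      then have v: "\<Lambda> x (\<iota> x) - \<iota> x = of_nat a * X.c + (\<iota> x + \<Lambda> x (\<iota> x))" using rot by simp
      show ?thesis
      proof (cases "odd X.M")
        case True
        define p where "p = \<iota> x + \<Lambda> x (\<iota> x)"
        obtain i y' where *: "\<Lambda> x p = p" "\<Lambda> x (\<Lambda> x (\<iota> x)) = \<iota> x" "2 * \<iota> x = of_int (1 + int X.M) * p"
          "of_int (2 * int X.M) * p = 0" "X.t = of_nat X.M * p"
          "y' = M.f i + (\<Lambda> x ^^ i) (\<iota> y)" "\<Lambda> x y' = y'" "2 * y' = 0 \<or> 2 * y' = X.t"
          using X.case_IIa[OF v True, folded p_def] .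
        interpret R: quaternion_module B m x "x [^] i \<otimes> y" N \<iota> \<Lambda> by (rule rename_module)
        have yi: "y' = \<iota> (x [^] i \<otimes> y)" unfolding * by (rule refl_iota)
        obtain e where e: "2 * y' = of_bool e * (of_nat (m div 2) * p)"
          using *(8) unfolding *(5) X.M_def by (metis mult_1 mult_zero_left of_bool_eq(1,2))
        have T: "MA e \<in> types m" using types_mem(7)[OF even] True by (simp add: X.M_def)
        have "R.modelled (MA e)"
          by (rule R.modelled_MA[OF N_eq even p_def *(1,2) *(3,4)[unfolded X.M_def]])
             (use *(5,7) e in \<open>simp_all only: X.t_def X.M_def yi\<close>)
        then show ?thesis by (rule classifiedI[OF T])
      next
        case False
        define D where "D = \<Lambda> x (\<Lambda> x (\<iota> x)) - \<iota> x"
        obtain i where *: "D = M.f i + (\<Lambda> x ^^ i) (\<iota> y)" "\<Lambda> x D = D + X.t" "2 * D = 0"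
          "of_int (1 + 2 * int a) * X.c = X.t" "X.t = of_nat (X.M div 2) * X.c"
          using X.case_IIb[OF v, folded D_def] False by auto
        note II = X.case_II[OF v]
        define h where "h = X.M div 2"
        have Mh: "X.M = 2 * h" using False by (simp add: h_def)
        have mh: "m = 4 * h" using X.m_eq Mh by simp
        have h0: "h > 0" using mh m_pos by simp
        \<comment> \<open>Both \<open>(1 + 2 a) c\<close> and \<open>h c\<close> are
          \<open>t\<close>, and \<open>c\<close> has the even order \<open>2 h\<close>; so
          \<open>1 + 2 a\<close> and \<open>h\<close> have the same parity, and \<open>h\<close> is
          odd.\<close>
        have "of_int (1 + 2 * int a - int h) * X.c = 0" using *(4,5) by (simp add: left_diff_distrib flip: h_def)
        then have dvd: "2 * int h dvd 1 + 2 * int a - int h" unfolding X.c_of_int Mh by simp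
        have "2 dvd 1 + 2 * int a - int h" using dvd by (rule dvd_mult_left)
        then have hodd: "odd h" by presburger
        then have m8: "m mod 8 = 4" using mh by presburger
        obtain r where r: "1 + 2 * int a - int h = 2 * int h * r" using dvd by (rule dvdE)
        \<comment> \<open>Here \<open>a = (h - 1) / 2 + h r\<close>. Modulo \<open>2 h\<close> only
          the parity of \<open>r\<close> matters, and it selects one of the two values of
          \<open>MA'_coeff\<close>.\<close>
        define e where "e = odd r"
        obtain w where w: "r = 2 * w + of_bool e"
        proof (cases e)
          case True then show ?thesis using that by (auto simp: e_def elim: oddE)
        next
          case False then show ?thesis using that by (auto simp: e_def elim: evenE)
        qed
        have A: "2 * MA'_coeff m e = int h - 1 + 2 * of_bool e * int h"
          using hodd by (simp add: MA'_coeff_def mh)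
        have "int a = MA'_coeff m e + 2 * int h * w" using A r unfolding w by (simp add: algebra_simps)
        then have aA: "of_nat a * X.c = of_int (MA'_coeff m e) * X.c"
        proof -
          assume a: "int a = MA'_coeff m e + 2 * int h * w"
          have "of_nat a * X.c = of_int (int a) * X.c" by simp
          also have "\<dots> = of_int (MA'_coeff m e) * X.c + of_int (2 * int h * w) * X.c"
            unfolding a by (simp only: of_int_add distrib_right)
          also have "of_int (2 * int h * w) * X.c = 0" unfolding X.c_of_int Mh by simp
          finally show ?thesis by simp
        qed
        define v' where "v' = \<Lambda> x (\<iota> x) - \<iota> x"
        have x2: "2 * \<iota> x = - (of_nat a * X.c)" by (rule II(1))
        have v2: "2 * v' = 0"
        proof -
          have "2 * v' = \<Lambda> x (2 * \<iota> x) - 2 * \<iota> x" by (simp add: v'_def algebra_simps)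
          also have "\<dots> = 0" unfolding x2 by simp
          finally show ?thesis .
        qed
        interpret R: quaternion_module B m x "x [^] i \<otimes> y" N \<iota> \<Lambda> by (rule rename_module)
        interpret Z: exact_module "\<Lambda> x" "\<Lambda> (inv x)" "\<Lambda> (x [^] i \<otimes> y)" "\<iota> x" "\<iota> (x [^] i \<otimes> y)" "\<iota> ` carrier B" N m "k + 2"
          by (rule ex)
        have Di: "D = \<iota> (x [^] i \<otimes> y)" unfolding *(1) by (rule refl_iota)
        have m4: "m div 4 = h" using mh by simp
        have "R.modelled (MA' e)"
        proof (rule R.modelled_MA'[OF N_eq m8 v'_def])
          show "\<Lambda> x v' = v' + \<iota> (x [^] i \<otimes> y)"
            unfolding Di[symmetric] by (rule ring_cert_1[OF v2, of _ _ "- 1"]) (simp add: v'_def D_def algebra_simps)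
          show "\<Lambda> x (\<iota> (x [^] i \<otimes> y)) = \<iota> (x [^] i \<otimes> y) + of_nat (m div 4) * X.c"
            unfolding Di[symmetric] m4 using *(2,5) by (simp add: h_def)
          show "\<Lambda> x X.c = X.c" by simp
          show "\<Lambda> (x [^] i \<otimes> y) X.c = - X.c" by (rule Z.u_c)
          show "2 * v' = 0" by (rule v2)
          show "2 * \<iota> (x [^] i \<otimes> y) = 0" unfolding Di[symmetric] by (rule *(3))
          show "of_nat (2 * (m div 4)) * X.c = 0" unfolding m4 using X.M_c by (simp only: Mh)
          show "2 * \<iota> x = - (of_int (MA'_coeff m e) * X.c)" unfolding x2 aA ..
          show "R.M.f m = of_nat (m div 4) * X.c" unfolding m4 using *(5) by (simp only: X.t_def h_def)
        qed
        then show ?thesis by (rule classifiedI[OF types_mem(8)[OF m8]])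
      qed
    qed
  qed
qed

end

context quaternion_brace
begin

text \<open>For the trivial ideal the embedding describes the brace itself.\<close>

theorem classification:
  "\<exists>T\<in>types m. \<exists>Y F. modelled_brace (mL m T) (ml m T) (mu m T) mx my m B x Y F"
proof -
  obtain k n where kn: "m = 2 ^ k * n" "odd n" using power_2_decompose[of m] m_pos by blast
  obtain \<iota> :: "'a \<Rightarrow> ('a \<Rightarrow> int) \<Rightarrow> zprod" and \<Lambda> where "quaternion_module B m x y (2 * m) \<iota> \<Lambda>"
    using module_exists[OF ideal_trivial] .
  then interpret Q: quaternion_module B m x y "2 * m" \<iota> \<Lambda> .
  interpret Q: quaternion_odd_part B m x y "2 * m" \<iota> \<Lambda> k n
    by unfold_locales (use kn in auto)
  show ?thesis using Q.classify_odd Q.classify_even by blast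
qed

end

section \<open>Counting\<close>

lemma quaternion_brace_transport:
  assumes W: "quaternion_brace W m X Y" and B: "brace B" and g: "g \<in> iso W B"
  shows "quaternion_brace B m (g X) (g Y)"
proof -
  interpret W: quaternion_brace W m X Y by fact
  interpret B: brace B by fact
  interpret h: group_hom W B g
    using g by unfold_locales (simp add: iso_def)
  have bij: "inj_on g (carrier W)" "carrier B = g ` carrier W" using g by (auto simp: iso_def bij_betw_def)
  have pow: "g X [^]\<^bsub>B\<^esub> i = g (X [^]\<^bsub>W\<^esub> i)" for i :: nat by (simp add: h.hom_nat_pow)
  show ?thesis
  proof (intro quaternion_brace.intro B quaternion_brace_axioms.intro)
    show "carrier B = {g X [^]\<^bsub>B\<^esub> i |i::nat. True} \<union> {g X [^]\<^bsub>B\<^esub> i \<otimes>\<^bsub>B\<^esub> g Y |i::nat. True}"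
    proof (intro equalityI subsetI)
      fix z assume "z \<in> carrier B"
      then obtain w where w: "w \<in> carrier W" "z = g w" using bij(2) by auto
      from w(1) show "z \<in> {g X [^]\<^bsub>B\<^esub> i |i::nat. True} \<union> {g X [^]\<^bsub>B\<^esub> i \<otimes>\<^bsub>B\<^esub> g Y |i::nat. True}"
      proof (cases rule: W.carrier_cases)
        case (rot i)
        then have "z = g X [^]\<^bsub>B\<^esub> i" by (simp only: w(2) pow)
        then show ?thesis by blast
      next
        case (refl i)
        then have "z = g X [^]\<^bsub>B\<^esub> i \<otimes>\<^bsub>B\<^esub> g Y" by (simp add: w(2) pow)
        then show ?thesis by blast
      qed
    next
      fix z assume "z \<in> {g X [^]\<^bsub>B\<^esub> i |i::nat. True} \<union> {g X [^]\<^bsub>B\<^esub> i \<otimes>\<^bsub>B\<^esub> g Y |i::nat. True}"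
      moreover have "g X \<in> carrier B" "g Y \<in> carrier B" by simp_all
      ultimately show "z \<in> carrier B" using B.nat_pow_closed B.m_closed by blast
    qed
    show "g X [^]\<^bsub>B\<^esub> i = \<one>\<^bsub>B\<^esub> \<longleftrightarrow> 2 * m dvd i" for i :: nat
      using inj_onD[OF bij(1), of "X [^]\<^bsub>W\<^esub> i" "\<one>\<^bsub>W\<^esub>"] unfolding pow W.x_pow_eq_1[symmetric] by auto
    show "g Y \<otimes>\<^bsub>B\<^esub> g X = inv\<^bsub>B\<^esub> (g X) \<otimes>\<^bsub>B\<^esub> g Y"
      using arg_cong[OF W.y_x, of g] by simp
    show "g Y \<otimes>\<^bsub>B\<^esub> g Y = g X [^]\<^bsub>B\<^esub> m" using arg_cong[OF W.y_y, of g] by (simp add: pow)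
    show "g Y \<noteq> g X [^]\<^bsub>B\<^esub> i" for i :: nat
      using inj_onD[OF bij(1), of Y "X [^]\<^bsub>W\<^esub> i"] W.y_neq[of i] unfolding pow by auto
  qed (use W.m_pos in auto)
qed

text \<open>The map \<open>cl\<close> from types to isomorphism classes is injective by
  \<open>type_unique\<close> and onto by \<open>classification\<close>.\<close>

lemma quaternion_brace_count_eq:
  assumes m: "m \<ge> 3"
  shows "quaternion_brace_count m = card (types m)"
proof -
  let ?G = "gen_quaternion m"
  have m0: "m > 0" using m by simp
  define W where "W T = quaternion_model.model_brace (mL m T) (ml m T) (mu m T) mx my m" for T
  have W: "\<exists>X Y F. modelled_brace (mL m T) (ml m T) (mu m T) mx my m (W T) X Y F"
    "brace (W T)" "W T \<cong> ?G" "countable (carrier (W T))" if T: "T \<in> types m" for T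
  proof -
    interpret Q: quaternion_model "mL m T" "ml m T" "mu m T" mx my m by (rule model_exists[OF m0 T])
    show "\<exists>X Y F. modelled_brace (mL m T) (ml m T) (mu m T) mx my m (W T) X Y F"
      unfolding W_def using Q.model_brace_modelled by blast
    show "brace (W T)" "W T \<cong> ?G" "countable (carrier (W T))"
      unfolding W_def by (rule Q.model_brace_brace Q.model_brace_cong Q.countable_model_brace)+
  qed
  have "\<forall>T\<in>types m. \<exists>C. C \<in> braces_over ?G \<and> brace_isomorphic (W T) C"
  proof
    fix T assume T: "T \<in> types m"
    show "\<exists>C. C \<in> braces_over ?G \<and> brace_isomorphic (W T) C"
      using brace_isomorphic_nat[OF W(2)[OF T] W(3)[OF T] W(4)[OF T]] by blast
  qed
  then obtain C where C: "\<And>T. T \<in> types m \<Longrightarrow> C T \<in> braces_over ?G"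
      "\<And>T. T \<in> types m \<Longrightarrow> brace_isomorphic (W T) (C T)"
    using bchoice[of "types m" "\<lambda>T C. C \<in> braces_over ?G \<and> brace_isomorphic (W T) C"] by blast
  note eq = equiv_brace_iso_rel[of ?G]
  define cl where "cl T = brace_iso_rel ?G `` {C T}" for T
  have inj: "inj_on cl (types m)"
  proof (rule inj_onI)
    fix T T' assume T: "T \<in> types m" "T' \<in> types m" and "cl T = cl T'"
    then have "(C T, C T') \<in> brace_iso_rel ?G"
      using eq_equiv_class[OF _ eq] C(1) by (simp add: cl_def)
    then have "brace_isomorphic (C T) (C T')" by (simp add: brace_iso_rel_def)
    then have "brace_isomorphic (W T) (C T')" by (rule brace_isomorphic_trans[OF C(2)[OF T(1)]])
    then have iso: "brace_isomorphic (W T) (W T')"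
      by (rule brace_isomorphic_trans[OF _ brace_isomorphic_sym[OF W(2)[OF T(2)] C(2)[OF T(2)]]])
    obtain X Y F X' Y' F' where "modelled_brace (mL m T) (ml m T) (mu m T) mx my m (W T) X Y F"
      "modelled_brace (mL m T') (ml m T') (mu m T') mx my m (W T') X' Y' F'" using W(1) T by blast
    then have "typed_brace m T (W T) X Y F" "typed_brace m T' (W T') X' Y' F'"
      using T m by (auto intro!: typed_brace.intro typed_brace_axioms.intro)
    then show "T = T'" using iso by (rule type_unique)
  qed
  have "cl ` types m = braces_over ?G // brace_iso_rel ?G"
  proof
    show "cl ` types m \<subseteq> braces_over ?G // brace_iso_rel ?G"
      using C(1) by (auto simp: cl_def intro: quotientI)
    show "braces_over ?G // brace_iso_rel ?G \<subseteq> cl ` types m"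
    proof
      fix K assume "K \<in> braces_over ?G // brace_iso_rel ?G"
      then obtain B where B: "B \<in> braces_over ?G" "K = brace_iso_rel ?G `` {B}" by (rule quotientE)
      then have BB: "brace B" "B \<cong> ?G" by (simp_all add: braces_over_def)
      interpret B: brace B by (rule BB)
      \<comment> \<open>\<open>M2\<close> is a type for every \<open>m\<close>; its brace carries
        the normal forms of the presented group over to \<open>B\<close>.\<close>
      have M2: "M2 \<in> types m" by (rule types_mem(3))
      obtain X Y F where "modelled_brace (mL m M2) (ml m M2) (mu m M2) mx my m (W M2) X Y F" using W(1)[OF M2] by blast
      then interpret Q: modelled_brace "mL m M2" "ml m M2" "mu m M2" mx my m "W M2" X Y F .
      have "?G \<cong> B" using B.iso_sym[OF BB(2)] .
      then have "W M2 \<cong> B" using W(3)[OF M2] by (rule iso_trans[rotated])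
      then obtain g where "g \<in> iso (W M2) B" by (auto simp: is_iso_def)
      then have qb: "quaternion_brace B m (g X) (g Y)"
        by (rule quaternion_brace_transport[OF Q.quaternion_brace_axioms BB(1)])
      obtain T where T1: "T \<in> types m" "\<exists>Y F. modelled_brace (mL m T) (ml m T) (mu m T) mx my m B (g X) Y F"
        using quaternion_brace.classification[OF qb] by (elim bexE)
      obtain Y' F' where T2: "modelled_brace (mL m T) (ml m T) (mu m T) mx my m B (g X) Y' F'"
        using T1(2) by (elim exE)
      note T = T1(1) T2
      obtain X2 Y2 F2 where "modelled_brace (mL m T) (ml m T) (mu m T) mx my m (W T) X2 Y2 F2" using W(1)[OF T(1)] by blast
      then have "brace_isomorphic (W T) B" using T(2) by (rule modelled_isomorphic)
      then have "brace_isomorphic (C T) B"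
        by (rule brace_isomorphic_trans[OF brace_isomorphic_sym[OF W(2)[OF T(1)] C(2)[OF T(1)]]])
      then have "(C T, B) \<in> brace_iso_rel ?G" using C(1)[OF T(1)] B(1) by (simp add: brace_iso_rel_def)
      then have "cl T = K" unfolding cl_def B(2) by (rule equiv_class_eq[OF eq])
      then show "K \<in> cl ` types m" using T(1) by blast
    qed
  qed
  then show ?thesis
    using card_image[OF inj] by (simp add: quaternion_brace_count_def num_braces_def)
qed

theorem theorem13p1:
  fixes m :: nat
  assumes "m \<ge> 3"
  shows "quaternion_brace_count m =
    (if odd m then 2
     else if m mod 4 = 2 then 6
     else if m mod 8 = 4 then 9
     else 7)"
  using quaternion_brace_count_eq[OF assms] card_types by simp

end
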